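(* Let $G$ be a $2$-cell embedding of a connected graph with at least one edge, with gem $M$, and let $D\subseteq E(G)$. Then the partial dual $G^D$ corresponds to the gem $M^D$ obtained by swapping the colours red and blue on each red-blue bigon of $M$ corresponding to an edge in $D$.
   Context: Graphs are finite and may have loops and multiple edges. A surface is a connected compact $2$-manifold without boundary; an embedding is $2$-cell if every face is an open disk. Embeddings related by a homeomorphism of surfaces are regarded as equivalent. Gem (graph-encoded map): the barycentric subdivision $S$ of the embedding $G$ is the triangulation obtained by subdividing each edge $e$ with a new vertex $u_e$, and adding a new vertex $u_f$ in each face $f$ joined to all vertices (including the $u_e$) along the boundary of $f$. Let $U_0=V(G)$, $U_1=\{u_e\}$, $U_2=\{u_f\}$, and let $E_{jk}$ be the set of edges of $S$ between $U_j$ and $U_k$. Each triangle of $S$ has one vertex in each of $U_0,U_1,U_2$. The dual embedded graph $S^*$ is cubic (its vertices are the triangles of $S$). Colour the edges of $S^*$ dual to $E_{01}$ red, those dual to $E_{02}$ yellow, and those dual to $E_{12}$ blue; this is a proper $3$-edge-colouring. The gem $M$ of $G$ is the abstract $3$-edge-coloured cubic graph underlying $S^*$. A bigon is a cycle whose edges alternate between two colours. Red-yellow bigons of $M$ correspond to vertices of $G$, red-blue bigons (all of them $4$-cycles) to edges of $G$, and blue-yellow bigons to faces of $G$. The embedding is recovered from $M$ by gluing a disk onto each bigon; any connected properly $3$-edge-coloured cubic graph (colours red, yellow, blue) whose red-blue bigons are $4$-cycles is the gem of some embedding. Partial dual $G^D$: represent $G$ by a ribbon graph $O$, i.e. a union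 of closed disks $\overline{c_v}$, $v\in V(G)$ ($0$-bands, fattened vertices) and $\overline{q_e}$, $e\in E(G)$ ($1$-bands, fattened edges, each attached to the $0$-bands along two opposite boundary arcs), from which the embedding is recovered by gluing a disk along each boundary component. Let $\Delta$ be the ribbon subgraph consisting of all $\overline{c_v}$, $v\in V(G)$, and $\overline{q_e}$, $e\in D$, with boundary components $C'_1,\dots,C'_k$. Add to $O$ a new $0$-band $\overline{c'_i}$ with boundary $C'_i$ for each $i$, and then remove every old $0$-band interior $c_v$. The result is a ribbon graph with $0$-bands $\overline{c'_i}$ and $1$-bands $\overline{q_e}$; the embedding it represents is $G^D$. Its edges are in natural bijection with $E(G)$. *)

theory Defs
  imports "HOL-Analysis.Analysis"
begin

section \<open>Graphs embedded in surfaces\<close>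

definition surface :: "'a topology \<Rightarrow> bool" where
  "surface X \<longleftrightarrow>
     Hausdorff_space X \<and> compact_space X \<and> connected_space X \<and>
     (\<forall>x\<in>topspace X. \<exists>U. openin X U \<and> x \<in> U \<and>
        subtopology X U homeomorphic_space top_of_set (ball (0::complex) 1))"

text \<open>Vertices are points of the surface. Edges carry labels (so parallel edges
  and loops are allowed); the edge labelled \<open>e\<close> is the image of the path \<open>curve G e\<close>
  on the unit interval, and its orientation plays no role.\<close>

record ('a, 'e) embedded_graph =
  surf :: "'a topology"
  vertices :: "'a set"
  edges :: "'e set"
  curve :: "'e \<Rightarrow> real \<Rightarrow> 'a"

definition edge_set :: "('a, 'e) embedded_graph \<Rightarrow> 'e \<Rightarrow> 'a set" where
  "edge_set G e = curve G e ` {0..1}"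

definition faces :: "('a, 'e) embedded_graph \<Rightarrow> 'a set set" where
  "faces G = connected_components_of
     (subtopology (surf G) (topspace (surf G) - (vertices G \<union> (\<Union>e\<in>edges G. edge_set G e))))"

definition graph_embedding :: "('a, 'e) embedded_graph \<Rightarrow> bool" where
  "graph_embedding G \<longleftrightarrow>
     surface (surf G) \<and>
     finite (vertices G) \<and> vertices G \<subseteq> topspace (surf G) \<and> finite (edges G) \<and>
     (\<forall>e\<in>edges G.
        pathin (surf G) (curve G e) \<and> inj_on (curve G e) {0<..<1} \<and>
        curve G e 0 \<in> vertices G \<and> curve G e 1 \<in> vertices G \<and>
        curve G e ` {0<..<1} \<inter> vertices G = {}) \<and>
     (\<forall>e\<in>edges G. \<forall>e'\<in>edges G. e \<noteq> e' \<longrightarrow>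
        curve G e ` {0<..<1} \<inter> curve G e' ` {0<..<1} = {})"

definition two_cell_embedding :: "('a, 'e) embedded_graph \<Rightarrow> bool" where
  "two_cell_embedding G \<longleftrightarrow> graph_embedding G \<and>
     (\<forall>f\<in>faces G. subtopology (surf G) f homeomorphic_space top_of_set (ball (0::complex) 1))"

definition connected_graph :: "('a, 'e) embedded_graph \<Rightarrow> bool" where
  "connected_graph G \<longleftrightarrow>
     (\<forall>u\<in>vertices G. \<forall>v\<in>vertices G.
        (u, v) \<in> (\<Union>e\<in>edges G. {(curve G e 0, curve G e 1), (curve G e 1, curve G e 0)})\<^sup>*)"


section \<open>Edge-coloured graphs\<close>

datatype colour = Red | Yellow | Blue

text \<open>An edge of an edge-coloured graph is given by its colour and its set of ends. In a
  properly coloured graph parallel edges have different colours, so this loses nothing.\<close>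

record 'm coloured_graph =
  nodes :: "'m set"
  links :: "colour \<Rightarrow> 'm set set"

definition coloured_iso ::
    "('m \<Rightarrow> 'n) \<Rightarrow> 'm coloured_graph \<Rightarrow> 'n coloured_graph \<Rightarrow> bool" where
  "coloured_iso f M N \<longleftrightarrow>
     bij_betw f (nodes M) (nodes N) \<and> (\<forall>k. links N k = (\<lambda>d. f ` d) ` links M k)"

text \<open>\<open>B\<close> is the node set of a cycle whose edges alternate between the colours \<open>j\<close> and \<open>k\<close>;
  two parallel edges form such a cycle of length two.\<close>

definition bigon :: "'m coloured_graph \<Rightarrow> colour \<Rightarrow> colour \<Rightarrow> 'm set \<Rightarrow> bool" where
  "bigon M j k B \<longleftrightarrow>
     (\<exists>xs. xs \<noteq> [] \<and> even (length xs) \<and> distinct xs \<and> set xs = B \<and> B \<subseteq> nodes M \<and>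
        (\<forall>i<length xs. {xs ! i, xs ! (Suc i mod length xs)} \<in> links M (if even i then j else k)))"

text \<open>A bigon of a properly edge-coloured cubic graph contains every edge of its two colours
  that has an end in it. Hence the red and blue edges on a red-blue bigon with node set \<open>B\<close>
  are the red and blue edges whose ends lie in \<open>B\<close>.\<close>

definition swap_red_blue :: "'m coloured_graph \<Rightarrow> 'm set set \<Rightarrow> 'm coloured_graph" where
  "swap_red_blue M \<B> =
     (let on_bigon = (\<lambda>d. \<exists>B\<in>\<B>. d \<subseteq> B) in
      M\<lparr>links := (\<lambda>k. case k of
          Red \<Rightarrow> {d \<in> links M Red. \<not> on_bigon d} \<union> {d \<in> links M Blue. on_bigon d}
        | Blue \<Rightarrow> {d \<in> links M Blue. \<not> on_bigon d} \<union> {d \<in> links M Red. on_bigon d}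
        | Yellow \<Rightarrow> links M Yellow)\<rparr>)"


section \<open>Barycentric subdivisions and gems\<close>

text \<open>Triangles of the subdivision are parametrised by the triangle with corners \<open>0\<close>, \<open>1\<close>
  and \<open>\<i>\<close>, which go to a vertex, to the new vertex on an edge, and to the new vertex in a
  face, respectively. Its sides are thus of the types 01, 02 and 12.\<close>

definition std_triangle :: "complex set" where
  "std_triangle = convex hull {0, 1, \<i>}"

fun side :: "colour \<Rightarrow> complex set" where
  "side Red = closed_segment 0 1"
| "side Yellow = closed_segment 0 \<i>"
| "side Blue = closed_segment 1 \<i>"

text \<open>The edge \<open>e\<close> is subdivided at the point with parameter \<open>s e\<close>, the new vertex in the
  face \<open>f\<close> is \<open>p f\<close>, and \<open>T\<close> is the set of triangles. The clauses on triangles say, in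
  order: the corner \<open>1\<close> is some \<open>u\<^sub>e\<close> and the side 01 is one of the two halves of \<open>e\<close>;
  the corner \<open>\<i>\<close> is some \<open>u\<^sub>f\<close> and all of the triangle off the side 01 lies in \<open>f\<close>;
  distinct triangles meet only in common corners and common sides; the triangles
  cover the surface.\<close>

definition barycentric_subdivision ::
    "('a, 'e) embedded_graph \<Rightarrow> ('e \<Rightarrow> real) \<Rightarrow> ('a set \<Rightarrow> 'a) \<Rightarrow> (complex \<Rightarrow> 'a) set \<Rightarrow> bool" where
  "barycentric_subdivision G s p T \<longleftrightarrow>
     (\<forall>e\<in>edges G. 0 < s e \<and> s e < 1) \<and>
     (\<forall>f\<in>faces G. p f \<in> f) \<and>
     finite T \<and>
     (\<forall>t\<in>T. embedding_map (top_of_set std_triangle) (surf G) t \<and>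
        t 0 \<in> vertices G \<and>
        (\<exists>e\<in>edges G. t 1 = curve G e (s e) \<and>
           (t ` side Red = curve G e ` {0..s e} \<or> t ` side Red = curve G e ` {s e..1})) \<and>
        (\<exists>f\<in>faces G. t \<i> = p f \<and> t ` (std_triangle - side Red) \<subseteq> f)) \<and>
     (\<forall>t\<in>T. \<forall>t'\<in>T. t \<noteq> t' \<longrightarrow>
        (\<forall>x\<in>std_triangle. \<forall>y\<in>std_triangle. t x = t' y \<longrightarrow>
           (\<exists>K. K face_of std_triangle \<and> K \<noteq> std_triangle \<and>
              x \<in> K \<and> y \<in> K \<and> t ` K = t' ` K))) \<and>
     (\<Union>t\<in>T. t ` std_triangle) = topspace (surf G)"

definition dual_coloured_graph :: "(complex \<Rightarrow> 'a) set \<Rightarrow> (complex \<Rightarrow> 'a) coloured_graph" where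
  "dual_coloured_graph T =
     \<lparr>nodes = T,
      links = (\<lambda>k. {{t, t'} | t t'. t \<in> T \<and> t' \<in> T \<and> t \<noteq> t' \<and> t ` side k = t' ` side k})\<rparr>"

text \<open>\<open>M\<close> is (up to isomorphism) the gem of \<open>G\<close>, and \<open>\<beta> e\<close> is the node set of the
  red-blue bigon of \<open>M\<close> corresponding to the edge \<open>e\<close>, that is, the dual of \<open>u\<^sub>e\<close>.\<close>

definition is_gem ::
    "('a, 'e) embedded_graph \<Rightarrow> 'm coloured_graph \<Rightarrow> ('e \<Rightarrow> 'm set) \<Rightarrow> bool" where
  "is_gem G M \<beta> \<longleftrightarrow>
     (\<exists>s p T g. barycentric_subdivision G s p T \<and>
        coloured_iso g (dual_coloured_graph T) M \<and>
        (\<forall>e\<in>edges G. bigon M Red Blue (\<beta> e) \<and>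
           \<beta> e = g ` {t \<in> T. t 1 = curve G e (s e)}))"


section \<open>Ribbon graphs and partial duals\<close>

text \<open>The 0-band of \<open>v\<close> is the image of the closed unit disc under \<open>c v\<close>, and the 1-band of
  \<open>e\<close> is the image of the square below under \<open>q e\<close>; a 1-band is attached along the images
  of the two vertical sides.\<close>

definition square :: "(real \<times> real) set" where
  "square = {-1..1} \<times> {-1..1}"

definition band_union ::
    "'a set \<Rightarrow> 'e set \<Rightarrow> ('a \<Rightarrow> complex \<Rightarrow> 'a) \<Rightarrow> ('e \<Rightarrow> real \<times> real \<Rightarrow> 'a) \<Rightarrow> 'a set" where
  "band_union V D c q = (\<Union>v\<in>V. c v ` cball 0 1) \<union> (\<Union>e\<in>D. q e ` square)"

text \<open>For a union of bands in a closed surface, the boundary in the sense of manifolds is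
  the frontier in the surface.\<close>

definition boundary_components :: "'a topology \<Rightarrow> 'a set \<Rightarrow> 'a set set" where
  "boundary_components X A = connected_components_of (subtopology X (X frontier_of A))"

text \<open>The bands are taken inside the surface that is recovered by gluing a disc along each
  boundary component of their union. The vertices of \<open>G\<close> are the centres of the 0-bands,
  and the edge \<open>e\<close> consists of the core of its 1-band and the radii leading to the two ends
  of that core.\<close>

definition ribbon_representation ::
    "('a, 'e) embedded_graph \<Rightarrow> ('a \<Rightarrow> complex \<Rightarrow> 'a) \<Rightarrow> ('e \<Rightarrow> real \<times> real \<Rightarrow> 'a) \<Rightarrow> bool" where
  "ribbon_representation G c q \<longleftrightarrow>
     (\<forall>v\<in>vertices G. embedding_map (top_of_set (cball 0 1)) (surf G) (c v) \<and> c v 0 = v) \<and>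
     (\<forall>e\<in>edges G. embedding_map (top_of_set square) (surf G) (q e)) \<and>
     disjoint_family_on (\<lambda>v. c v ` cball 0 1) (vertices G) \<and>
     disjoint_family_on (\<lambda>e. q e ` square) (edges G) \<and>
     (\<forall>e\<in>edges G. \<forall>a\<in>{-1, 1}. \<exists>v\<in>vertices G. q e ` ({a} \<times> {-1..1}) \<subseteq> c v ` sphere 0 1) \<and>
     (\<forall>e\<in>edges G. \<forall>v\<in>vertices G.
        q e ` square \<inter> c v ` cball 0 1 \<subseteq> q e ` ({-1, 1} \<times> {-1..1})) \<and>
     (\<forall>e\<in>edges G. edge_set G e =
        q e ` ({-1..1} \<times> {0}) \<union>
        (\<Union>v\<in>vertices G. \<Union>z\<in>{z \<in> sphere 0 1. c v z \<in> q e ` ({-1, 1} \<times> {0})}.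
           c v ` closed_segment 0 z)) \<and>
     (let R = band_union (vertices G) (edges G) c q;
          \<C> = boundary_components (surf G) R
      in \<exists>d :: 'a set \<Rightarrow> complex \<Rightarrow> 'a.
          (\<forall>C\<in>\<C>. embedding_map (top_of_set (cball 0 1)) (surf G) (d C) \<and>
             d C ` sphere 0 1 = C \<and> d C ` ball 0 1 \<inter> R = {}) \<and>
          disjoint_family_on (\<lambda>C. d C ` ball 0 1) \<C> \<and>
          topspace (surf G) = R \<union> (\<Union>C\<in>\<C>. d C ` cball 0 1))"

text \<open>What remains of a ribbon graph when the interiors of its 0-bands are removed.\<close>

definition without_0_bands ::
    "('a, 'e) embedded_graph \<Rightarrow> ('a \<Rightarrow> complex \<Rightarrow> 'a) \<Rightarrow> ('e \<Rightarrow> real \<times> real \<Rightarrow> 'a) \<Rightarrow> 'a set" where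
  "without_0_bands G c q =
     band_union (vertices G) (edges G) c q - (\<Union>v\<in>vertices G. c v ` ball 0 1)"

text \<open>The ribbon graph of \<open>G'\<close> arises from that of \<open>G\<close> by gluing a disc onto each boundary
  component of \<open>\<Delta>\<close> and removing the interiors of the old 0-bands. Since the boundaries of
  the old and of the new 0-bands survive, this means that removing the interiors of the old
  0-bands from the old ribbon graph and of the new 0-bands from the new one leaves the same
  space (identified by \<open>h\<close>), with the same 1-bands, in which the boundaries of the new
  0-bands are the boundary components of \<open>\<Delta>\<close>. The bijection between the edges of
  \<open>G\<close> and those of \<open>G'\<close> is rendered by the two graphs having the same edge labels.\<close>

definition is_partial_dual ::
    "('a, 'e) embedded_graph \<Rightarrow> 'e set \<Rightarrow> ('b, 'e) embedded_graph \<Rightarrow> bool" where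
  "is_partial_dual G D G' \<longleftrightarrow>
     two_cell_embedding G' \<and> edges G' = edges G \<and>
     (\<exists>c q c' q' h.
        ribbon_representation G c q \<and> ribbon_representation G' c' q' \<and>
        homeomorphic_map (subtopology (surf G) (without_0_bands G c q))
          (subtopology (surf G') (without_0_bands G' c' q')) h \<and>
        (\<forall>e\<in>edges G. h ` q e ` square = q' e ` square) \<and>
        (let \<Delta> = band_union (vertices G) D c q
         in (\<lambda>C. h ` C) ` boundary_components (surf G) \<Delta> =
            (\<lambda>v. c' v ` sphere 0 1) ` vertices G'))"

end

theory Submission imports Defs begin

text \<open>A gem is determined by its embedding: at an interior point of an edge the surface has
  exactly two germs of sides, and each half-edge together with one of its sides lies in exactly
  one triangle of any barycentric subdivision. Following the wedges between consecutive
  half-edges at a vertex shows that sending a triangle to the triangle with the same half-edge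
  and the same side germ respects all three colours. Hence any gem of \<open>G\<close> may be replaced by
  that of one particular subdivision.

  A ribbon graph yields such a subdivision with four triangles \<open>(e, a, b)\<close>, \<open>a, b = \<plusminus>1\<close>, for every
  1-band \<open>e\<close>, one for each corner of the square: red adjacency changes \<open>b\<close>, blue adjacency
  changes \<open>a\<close>, and yellow adjacency joins the corners at the two ends of a gap between
  consecutive 1-bands on the boundary of a 0-band.

  The homeomorphism \<open>h\<close> between the ribbon graphs without their 0-bands maps gaps to gaps and
  corners to corners. It maps the vertical sides of the 1-band of \<open>e\<close>, along which it is attached,
  to vertical sides if \<open>e \<notin> D\<close> and exchanges them with the horizontal sides if \<open>e \<in> D\<close>, because
  the boundary of \<open>\<Delta>\<close> contains the vertical or the horizontal sides accordingly. So it
  preserves yellow and swaps red and blue exactly over \<open>D\<close>.\<close>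

text \<open>\<open>is_gem\<close> hands over an arbitrary subdivision of \<open>G\<close>, with its
  own split points and face centres and with triangles of unknown shape, whereas for
  \<open>G'\<close> a subdivision may be exhibited. So the given subdivision of \<open>G\<close> is
  compared with a reference one whose combinatorics is known. The rigidity behind the comparison:
  near a point of the graph, the complement of the graph breaks up into finitely many connected
  germs, and such a decomposition is unique. Germs are taken off the graph because neighbouring
  triangles overlap in it. The map \<open>h\<close> says nothing about the interiors of 0-bands and
  faces, and it need not respect parametrisations or midpoints. What it preserves is topological:
  the bands and the connected pieces of the circles outside the bands. Therefore a yellow side is
  encoded by the gap that it crosses, and gaps are compared through connectedness. Invariance of
  domain enters wherever a boundary, of a union of bands or of a square, has to be recognised from
  the topology alone.\<close>

section \<open>Connected sets and embeddings of compact sets\<close>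

text \<open>The other closed sets are finitely many, so their union is closed and would separate
  \<open>S\<close> from the chosen one. This is the recurring tool for confining a connected set to
  one germ, one face or one gap.\<close>

lemma connectedin_in_one_closed:
  assumes S: "connectedin X S" "S \<noteq> {}" and fin: "finite I"
    and cl: "\<And>i. i \<in> I \<Longrightarrow> closedin X (A i)"
    and cover: "S \<subseteq> (\<Union>i\<in>I. A i)"
    and disj: "\<And>i j. i \<in> I \<Longrightarrow> j \<in> I \<Longrightarrow> i \<noteq> j \<Longrightarrow> A i \<inter> A j \<inter> S = {}"
  obtains i where "i \<in> I" "S \<subseteq> A i"
proof -
  obtain x i where x: "x \<in> S" "i \<in> I" "x \<in> A i" using assms by blast
  have "closedin X (\<Union>j\<in>I-{i}. A j)" using fin cl by (auto intro!: closedin_Union)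
  moreover have "A i \<inter> (\<Union>j\<in>I-{i}. A j) \<inter> S = {}" using disj x(2) by blast
  moreover have "S \<subseteq> A i \<union> (\<Union>j\<in>I-{i}. A j)" using cover by blast
  ultimately have "(\<Union>j\<in>I-{i}. A j) \<inter> S = {}"
    using S(1) cl[OF x(2)] x unfolding connectedin_closedin by blast
  then have "S \<subseteq> A i" using cover by blast
  then show thesis using that x by blast
qed

text \<open>The points with value \<open>i0\<close> and those with any other value form two open
  sets that are disjoint on \<open>S\<close>; openness allows arbitrarily many values. It serves to
  carry the side of an edge along a whole open half-edge.\<close>

lemma connectedin_constant:
  assumes "connectedin X S" and "x0 \<in> S" "R x0 i0"
    and op: "\<And>i. openin X {x \<in> topspace X. R x i}"
    and tot: "\<And>x. x \<in> S \<Longrightarrow> \<exists>i. R x i"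
    and uniq: "\<And>x i j. x \<in> S \<Longrightarrow> R x i \<Longrightarrow> R x j \<Longrightarrow> i = j"
    and "x \<in> S"
  shows "R x i0"
proof -
  have sub: "S \<subseteq> topspace X" using assms(1) connectedin_subset_topspace by blast
  let ?A = "{x \<in> topspace X. R x i0}" and ?B = "\<Union>i\<in>-{i0}. {x \<in> topspace X. R x i}"
  have "openin X ?B" using op by blast
  moreover have "S \<subseteq> ?A \<union> ?B"
  proof
    fix y assume y: "y \<in> S"
    then obtain i where "R y i" using tot by blast
    then show "y \<in> ?A \<union> ?B" using y sub by (cases "i = i0") auto
  qed
  moreover have "?A \<inter> ?B \<inter> S = {}"
  proof -
    have False if "y \<in> S" "R y i0" "R y i" "i \<noteq> i0" for y i using uniq[OF that(1-3)] that(4) by simp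
    then show ?thesis by auto
  qed
  moreover have "?A \<inter> S \<noteq> {}" using assms(2,3) sub by auto
  moreover have "openin X ?A" using op .
  ultimately have B: "?B \<inter> S = {}" using connectedinD[OF assms(1), of ?A ?B] by blast
  obtain i where i: "R x i" using tot[OF \<open>x \<in> S\<close>] by blast
  have "i = i0" using B i \<open>x \<in> S\<close> sub by auto
  then show ?thesis using i by simp
qed

lemma connectedin_Union_meeting:
  assumes "connectedin X S" and "\<And>i. i \<in> I \<Longrightarrow> connectedin X (A i)"
    and "\<And>i. i \<in> I \<Longrightarrow> S \<inter> A i \<noteq> {}" and "S \<noteq> {}"
  shows "connectedin X (S \<union> (\<Union>i\<in>I. A i))"
proof -
  have "connectedin X (\<Union> (insert S ((\<lambda>i. S \<union> A i) ` I)))"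
    by (rule connectedin_Union) (use assms in \<open>auto intro!: connectedin_Un\<close>)
  moreover have "\<Union> (insert S ((\<lambda>i. S \<union> A i) ` I)) = S \<union> (\<Union>i\<in>I. A i)" by auto
  ultimately show ?thesis by simp
qed

text \<open>Compactness of \<open>S\<close> makes images of closed subsets closed. A neighbourhood
  of \<open>f z\<close> that meets the image only near \<open>z\<close> then arises by discarding
  the image of \<open>S - ball z e\<close>; in this way points of the surface are localised inside
  triangles and bands.\<close>

lemma
  assumes emb: "embedding_map (top_of_set S) X f" and X: "Hausdorff_space X" and S: "compact S"
  shows embedding_closedin: "\<And>A. compact A \<Longrightarrow> A \<subseteq> S \<Longrightarrow> closedin X (f ` A)"
    and embedding_inj_on: "inj_on f S"
    and embedding_connectedin: "\<And>A. connected A \<Longrightarrow> A \<subseteq> S \<Longrightarrow> connectedin X (f ` A)"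
    and embedding_continuous_map: "continuous_map (top_of_set S) X f"
    and embedding_nbhd: "\<And>z e. z \<in> S \<Longrightarrow> 0 < e \<Longrightarrow>
          \<exists>V. openin X V \<and> f z \<in> V \<and> V \<inter> f ` S \<subseteq> f ` (S \<inter> ball z e)"
    and embedding_ball: "\<And>z U. z \<in> S \<Longrightarrow> openin X U \<Longrightarrow> f z \<in> U \<Longrightarrow>
          \<exists>e>0. f ` (S \<inter> ball z e) \<subseteq> U"
proof -
  show cm: "continuous_map (top_of_set S) X f"
    using emb homeomorphic_imp_continuous_map continuous_map_in_subtopology
    unfolding embedding_map_def by blast
  show inj: "inj_on f S" using emb homeomorphic_imp_injective_map unfolding embedding_map_def by fastforce
  show cl: "closedin X (f ` A)" if "compact A" "A \<subseteq> S" for A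
  proof -
    have "compactin (top_of_set S) A" using that by (simp add: compactin_subtopology)
    then show ?thesis using image_compactin[OF _ cm] compactin_imp_closedin X by blast
  qed
  show "connectedin X (f ` A)" if "connected A" "A \<subseteq> S" for A
    using connectedin_continuous_map_image[OF cm] that by (simp add: connectedin_subtopology)
  show "\<exists>V. openin X V \<and> f z \<in> V \<and> V \<inter> f ` S \<subseteq> f ` (S \<inter> ball z e)" if "z \<in> S" "0 < e" for z e
  proof (intro exI conjI)
    have "compact (S - ball z e)" using S by (simp add: compact_diff)
    then show "openin X (topspace X - f ` (S - ball z e))" using cl by blast
    have "f z \<in> topspace X" using cm that by (metis continuous_map_image_subset_topspace image_subset_iff topspace_euclidean_subtopology)
    then show "f z \<in> topspace X - f ` (S - ball z e)" using inj that by (auto simp: inj_on_def)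
    show "(topspace X - f ` (S - ball z e)) \<inter> f ` S \<subseteq> f ` (S \<inter> ball z e)" by blast
  qed
  show "\<exists>e>0. f ` (S \<inter> ball z e) \<subseteq> U" if "z \<in> S" "openin X U" "f z \<in> U" for z U
  proof -
    have "openin (top_of_set S) {x \<in> S. f x \<in> U}"
      using openin_continuous_map_preimage[OF cm that(2)] by simp
    moreover have "z \<in> {x \<in> S. f x \<in> U}" using that by simp
    ultimately obtain e where "e > 0" "ball z e \<inter> S \<subseteq> {x \<in> S. f x \<in> U}"
      unfolding openin_contains_ball by blast
    then show ?thesis by blast
  qed
qed

section \<open>Germs at the points of the graph\<close>

text \<open>Equality near \<open>x\<close> outside \<open>E\<close>. In the application
  \<open>E\<close> is the graph: removing it makes the sectors on the two sides of an edge disjoint,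
  although as closed sets they share the edge.\<close>

definition germ_eq :: "'a topology \<Rightarrow> 'a set \<Rightarrow> 'a \<Rightarrow> 'a set \<Rightarrow> 'a set \<Rightarrow> bool" where
  "germ_eq X E x A B \<longleftrightarrow> (\<exists>U. openin X U \<and> x \<in> U \<and> U \<inter> A - E = U \<inter> B - E)"

text \<open>An axiomatic form of the local components at \<open>x\<close> of the complement of
  \<open>E\<close>, represented by closed sets. The last clause but one is connectedness of a germ:
  inside any \<open>U\<close> there is a connected part of \<open>A - E\<close> that swallows all of
  \<open>A - E\<close> close enough to \<open>x\<close>.\<close>

definition germ_family :: "'a topology \<Rightarrow> 'a set \<Rightarrow> 'a \<Rightarrow> 'a set set \<Rightarrow> bool" where
  "germ_family X E x \<A> \<longleftrightarrow>
     finite \<A> \<and> (\<forall>A\<in>\<A>. closedin X A) \<and>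
     (\<exists>U. openin X U \<and> x \<in> U \<and> U - E \<subseteq> \<Union>\<A>) \<and>
     (\<forall>A\<in>\<A>. \<forall>B\<in>\<A>. A \<noteq> B \<longrightarrow> (\<exists>U. openin X U \<and> x \<in> U \<and> U \<inter> A \<inter> B \<subseteq> E)) \<and>
     (\<forall>A\<in>\<A>. \<forall>U. openin X U \<and> x \<in> U \<longrightarrow>
        (\<exists>P V. connectedin X P \<and> P \<subseteq> A \<inter> U - E \<and> openin X V \<and> x \<in> V \<and> A \<inter> V - E \<subseteq> P)) \<and>
     (\<forall>A\<in>\<A>. \<forall>U. openin X U \<and> x \<in> U \<longrightarrow> A \<inter> U - E \<noteq> {})"

lemma
  assumes "germ_family X E x \<A>"
  shows germ_family_finite: "finite \<A>"
    and germ_family_closedin: "\<And>A. A \<in> \<A> \<Longrightarrow> closedin X A"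
    and germ_family_cover: "\<exists>U. openin X U \<and> x \<in> U \<and> U - E \<subseteq> \<Union>\<A>"
    and germ_family_disj: "\<And>A B. A \<in> \<A> \<Longrightarrow> B \<in> \<A> \<Longrightarrow> A \<noteq> B \<Longrightarrow> \<exists>U. openin X U \<and> x \<in> U \<and> U \<inter> A \<inter> B \<subseteq> E"
    and germ_family_connected: "\<And>A U. A \<in> \<A> \<Longrightarrow> openin X U \<Longrightarrow> x \<in> U \<Longrightarrow>
        \<exists>P V. connectedin X P \<and> P \<subseteq> A \<inter> U - E \<and> openin X V \<and> x \<in> V \<and> A \<inter> V - E \<subseteq> P"
    and germ_family_nonempty: "\<And>A U. A \<in> \<A> \<Longrightarrow> openin X U \<Longrightarrow> x \<in> U \<Longrightarrow> A \<inter> U - E \<noteq> {}"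
  using assms unfolding germ_family_def by simp_all

lemma germ_eq_sym: "germ_eq X E x A B \<Longrightarrow> germ_eq X E x B A"
  unfolding germ_eq_def by metis

lemma germ_eq_trans: "germ_eq X E x A B \<Longrightarrow> germ_eq X E x B C \<Longrightarrow> germ_eq X E x A C"
  unfolding germ_eq_def
proof (elim exE conjE)
  fix U V assume "openin X U" "x \<in> U" "U \<inter> A - E = U \<inter> B - E" "openin X V" "x \<in> V" "V \<inter> B - E = V \<inter> C - E"
  then show "\<exists>U. openin X U \<and> x \<in> U \<and> U \<inter> A - E = U \<inter> C - E"
    by (intro exI[of _ "U \<inter> V"] conjI openin_Int IntI) (assumption | blast)+
qed

lemma germ_eq_open: "openin X {x \<in> topspace X. germ_eq X E x A B}"
proof (subst openin_subopen, safe)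
  fix x assume "x \<in> topspace X" "germ_eq X E x A B"
  then obtain U where "openin X U" "x \<in> U" "U \<inter> A - E = U \<inter> B - E" unfolding germ_eq_def by blast
  then show "\<exists>T. openin X T \<and> x \<in> T \<and> T \<subseteq> {x \<in> topspace X. germ_eq X E x A B}"
    by (intro exI[of _ U]) (auto simp: germ_eq_def dest: openin_subset)
qed

lemma finite_nbhds:
  assumes "finite I" and "x \<in> topspace X" and "\<And>i. i \<in> I \<Longrightarrow> \<exists>U. openin X U \<and> x \<in> U \<and> Q i U"
    and mono: "\<And>i U V. i \<in> I \<Longrightarrow> Q i U \<Longrightarrow> openin X V \<Longrightarrow> V \<subseteq> U \<Longrightarrow> Q i V"
  shows "\<exists>U. openin X U \<and> x \<in> U \<and> (\<forall>i\<in>I. Q i U)"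
proof -
  obtain W where W: "\<And>i. i \<in> I \<Longrightarrow> openin X (W i) \<and> x \<in> W i \<and> Q i (W i)" using assms(3) by metis
  \<comment> \<open>The factor \<open>topspace X\<close> keeps the set open when \<open>I\<close> is
    empty.\<close>
  let ?U = "topspace X \<inter> (\<Inter>i\<in>I. W i)"
  have op: "openin X ?U"
  proof (cases "I = {}")
    case False
    then have "openin X (\<Inter>i\<in>I. W i)" using W assms(1) by (intro openin_INT2) auto
    then show ?thesis by blast
  qed simp
  show ?thesis
  proof (intro exI[of _ ?U] conjI ballI op)
    show "x \<in> ?U" using W assms(2) by auto
    show "Q i ?U" if "i \<in> I" for i
      by (rule mono[OF that _ op, of "W i"]) (use W[OF that] that in auto)
  qed
qed

lemma germ_family_disjoint:
  assumes A: "germ_family X E x \<A>" and x: "x \<in> topspace X"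
  obtains U where "openin X U" "x \<in> U" "\<And>A B. A \<in> \<A> \<Longrightarrow> B \<in> \<A> \<Longrightarrow> A \<noteq> B \<Longrightarrow> U \<inter> A \<inter> B \<subseteq> E"
proof -
  let ?I = "{p \<in> \<A> \<times> \<A>. fst p \<noteq> snd p}"
  have fin: "finite ?I" using germ_family_finite[OF A] by simp
  have ex: "\<exists>U. openin X U \<and> x \<in> U \<and> U \<inter> fst p \<inter> snd p \<subseteq> E" if "p \<in> ?I" for p
    using germ_family_disj[OF A, of "fst p" "snd p"] that by auto
  have "\<exists>U. openin X U \<and> x \<in> U \<and> (\<forall>p\<in>?I. U \<inter> fst p \<inter> snd p \<subseteq> E)"
  proof (rule finite_nbhds[OF fin x ex])
    fix i U V assume "U \<inter> fst i \<inter> snd i \<subseteq> E" "V \<subseteq> U"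
    then show "V \<inter> fst i \<inter> snd i \<subseteq> E" by blast
  qed
  then obtain U where U: "openin X U" "x \<in> U" "\<And>p. p \<in> ?I \<Longrightarrow> U \<inter> fst p \<inter> snd p \<subseteq> E" by auto
  show thesis
  proof (rule that[OF U(1,2)])
    show "U \<inter> B \<inter> C \<subseteq> E" if "B \<in> \<A>" "C \<in> \<A>" "B \<noteq> C" for B C
      using U(3)[of "(B, C)"] that by simp
  qed
qed

lemma germ_family_unique:
  assumes A: "germ_family X E x \<A>" "x \<in> topspace X" "A \<in> \<A>" "B \<in> \<A>"
    and meet: "\<And>U. openin X U \<Longrightarrow> x \<in> U \<Longrightarrow> U \<inter> A \<inter> B - E \<noteq> {}"
  shows "A = B"
proof (rule ccontr)
  assume "A \<noteq> B"
  then obtain U where "openin X U" "x \<in> U" "U \<inter> A \<inter> B \<subseteq> E"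
    using germ_family_disj[OF A(1,3,4)] by auto
  then show False using meet[of U] by auto
qed

lemma germ_eq_family_imp_eq:
  assumes A: "germ_family X E x \<A>" "x \<in> topspace X" "A \<in> \<A>" "B \<in> \<A>" and eq: "germ_eq X E x A B"
  shows "A = B"
proof (rule germ_family_unique[OF A])
  fix U assume U: "openin X U" "x \<in> U"
  obtain V where V: "openin X V" "x \<in> V" "V \<inter> A - E = V \<inter> B - E" using eq unfolding germ_eq_def by blast
  have "openin X (U \<inter> V)" "x \<in> U \<inter> V" using U V by auto
  then have "A \<inter> (U \<inter> V) - E \<noteq> {}" using germ_family_nonempty[OF A(1,3)] by blast
  then show "U \<inter> A \<inter> B - E \<noteq> {}" using V by blast
qed

text \<open>Near \<open>x\<close> the germ of \<open>A\<close> is connected and is covered by the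
  closed members of \<open>\<B>\<close>, which are disjoint off \<open>E\<close>; so it falls into a
  single one of them.\<close>

lemma germ_family_sub:
  assumes A: "germ_family X E x \<A>" and B: "germ_family X E x \<B>" and x: "x \<in> topspace X" "A \<in> \<A>"
  obtains B V where "B \<in> \<B>" "openin X V" "x \<in> V" "A \<inter> V - E \<subseteq> B"
proof -
  obtain U0 where U0: "openin X U0" "x \<in> U0" "U0 - E \<subseteq> \<Union>\<B>" using germ_family_cover[OF B] by auto
  obtain U1 where U1: "openin X U1" "x \<in> U1"
      "\<And>A B. A \<in> \<B> \<Longrightarrow> B \<in> \<B> \<Longrightarrow> A \<noteq> B \<Longrightarrow> U1 \<inter> A \<inter> B \<subseteq> E"
    using germ_family_disjoint[OF B x(1)] by metis
  have U: "openin X (U0 \<inter> U1)" "x \<in> U0 \<inter> U1" using U0 U1 by auto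
  obtain P V where P: "connectedin X P" "P \<subseteq> A \<inter> (U0 \<inter> U1) - E" "openin X V" "x \<in> V" "A \<inter> V - E \<subseteq> P"
    using germ_family_connected[OF A x(2) U] by auto
  have "A \<inter> V - E \<noteq> {}" using germ_family_nonempty[OF A x(2) P(3,4)] .
  then have "P \<noteq> {}" using P(5) by auto
  moreover have "finite \<B>" "\<And>B. B \<in> \<B> \<Longrightarrow> closedin X B" using germ_family_finite[OF B] germ_family_closedin[OF B] by auto
  moreover have "P \<subseteq> (\<Union>B\<in>\<B>. B)" using P(2) U0 by blast
  moreover have "B \<inter> C \<inter> P = {}" if "B \<in> \<B>" "C \<in> \<B>" "B \<noteq> C" for B C using U1(3)[OF that] P(2) by auto
  ultimately obtain B where "B \<in> \<B>" "P \<subseteq> B" using connectedin_in_one_closed[OF P(1), of \<B> "\<lambda>B. B"] by metis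
  then show thesis using that P by blast
qed

text \<open>Uniqueness of the local decomposition: going from \<open>A\<close> into some
  \<open>B\<close> and back into some \<open>A'\<close> gives \<open>A' = A\<close>, because
  \<open>A\<close> and \<open>A'\<close> share points arbitrarily close to \<open>x\<close>. The two
  inclusions then make the germs equal.\<close>

lemma germ_family_match:
  assumes A: "germ_family X E x \<A>" and B: "germ_family X E x \<B>" and x: "x \<in> topspace X" "A \<in> \<A>"
  obtains B where "B \<in> \<B>" "germ_eq X E x A B"
proof -
  obtain B V where BV: "B \<in> \<B>" "openin X V" "x \<in> V" "A \<inter> V - E \<subseteq> B" using germ_family_sub[OF A B x] .
  obtain A' V' where A': "A' \<in> \<A>" "openin X V'" "x \<in> V'" "B \<inter> V' - E \<subseteq> A'"
    using germ_family_sub[OF B A x(1) BV(1)] .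
  have "A = A'"
  proof (rule germ_family_unique[OF A x A'(1)])
    fix U assume "openin X U" "x \<in> U"
    then have "openin X (U \<inter> V \<inter> V')" "x \<in> U \<inter> V \<inter> V'" using BV A' by auto
    then have "A \<inter> (U \<inter> V \<inter> V') - E \<noteq> {}" using germ_family_nonempty[OF A x(2)] by blast
    then show "U \<inter> A \<inter> A' - E \<noteq> {}" using BV A' by blast
  qed
  then have "V \<inter> V' \<inter> A - E = V \<inter> V' \<inter> B - E" using BV(4) A'(4) by blast
  then have "germ_eq X E x A B" unfolding germ_eq_def
    by (intro exI[of _ "V \<inter> V'"]) (use BV A' in auto)
  then show thesis using that BV by blast
qed

text \<open>Allows the members to be enlarged away from \<open>x\<close>, so that one set can
  represent the same side at all points of an edge.\<close>

lemma germ_family_cong: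
  assumes A: "germ_family X E x \<A>" and x: "x \<in> topspace X"
    and eq: "\<And>A. A \<in> \<A> \<Longrightarrow> closedin X (\<phi> A) \<and> germ_eq X E x A (\<phi> A)"
  shows "germ_family X E x (\<phi> ` \<A>)"
proof -
  have fin: "finite \<A>" using germ_family_finite[OF A] .
  have ex: "\<exists>U. openin X U \<and> x \<in> U \<and> U \<inter> A - E = U \<inter> \<phi> A - E" if "A \<in> \<A>" for A
    using eq[OF that] unfolding germ_eq_def by blast
  have "\<exists>W. openin X W \<and> x \<in> W \<and> (\<forall>A\<in>\<A>. W \<inter> A - E = W \<inter> \<phi> A - E)"
  proof (rule finite_nbhds[OF fin x ex])
    fix A U V assume "U \<inter> A - E = U \<inter> \<phi> A - E" "V \<subseteq> U"
    then show "V \<inter> A - E = V \<inter> \<phi> A - E" by blast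
  qed
  then obtain W where W: "openin X W" "x \<in> W" "\<And>A. A \<in> \<A> \<Longrightarrow> W \<inter> A - E = W \<inter> \<phi> A - E" by auto
  show ?thesis
    unfolding germ_family_def
  proof (intro conjI ballI allI impI)
    show "finite (\<phi> ` \<A>)" using fin by simp
    show "closedin X B" if "B \<in> \<phi> ` \<A>" for B using that eq by blast
    obtain U where "openin X U" "x \<in> U" "U - E \<subseteq> \<Union>\<A>" using germ_family_cover[OF A] by auto
    moreover have "U \<inter> W - E \<subseteq> \<Union>(\<phi> ` \<A>)"
    proof
      fix y assume y: "y \<in> U \<inter> W - E"
      then obtain A' where "A' \<in> \<A>" "y \<in> A'" using \<open>U - E \<subseteq> \<Union>\<A>\<close> by blast
      then show "y \<in> \<Union>(\<phi> ` \<A>)" using W(3)[of A'] y by blast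
    qed
    ultimately have "openin X (U \<inter> W) \<and> x \<in> U \<inter> W \<and> U \<inter> W - E \<subseteq> \<Union>(\<phi> ` \<A>)" using W(1,2) by (simp add: openin_Int)
    then show "\<exists>U. openin X U \<and> x \<in> U \<and> U - E \<subseteq> \<Union>(\<phi> ` \<A>)" by blast
  next
    fix B C assume "B \<in> \<phi> ` \<A>" "C \<in> \<phi> ` \<A>" "B \<noteq> C"
    then obtain A' A'' where *: "A' \<in> \<A>" "A'' \<in> \<A>" "A' \<noteq> A''" "B = \<phi> A'" "C = \<phi> A''" by blast
    then obtain U where "openin X U" "x \<in> U" "U \<inter> A' \<inter> A'' \<subseteq> E" using germ_family_disj[OF A *(1-3)] by auto
    moreover have "U \<inter> W \<inter> B \<inter> C \<subseteq> E" using W(3)[OF *(1)] W(3)[OF *(2)] \<open>U \<inter> A' \<inter> A'' \<subseteq> E\<close> *(4,5) by blast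
    ultimately have "openin X (U \<inter> W) \<and> x \<in> U \<inter> W \<and> U \<inter> W \<inter> B \<inter> C \<subseteq> E" using W(1,2) by (simp add: openin_Int)
    then show "\<exists>U. openin X U \<and> x \<in> U \<and> U \<inter> B \<inter> C \<subseteq> E" by blast
  next
    fix B U assume B: "B \<in> \<phi> ` \<A>" and U: "openin X U \<and> x \<in> U"
    then obtain A' where A': "A' \<in> \<A>" "B = \<phi> A'" by blast
    have UW: "openin X (U \<inter> W) \<and> x \<in> U \<inter> W" using U W(1,2) by auto
    then obtain P V where PV: "connectedin X P" "P \<subseteq> A' \<inter> (U \<inter> W) - E" "openin X V" "x \<in> V" "A' \<inter> V - E \<subseteq> P"
      using germ_family_connected[OF A A'(1), of "U \<inter> W"] by auto
    moreover have "P \<subseteq> B \<inter> U - E" "B \<inter> (V \<inter> W) - E \<subseteq> P" using W(3)[OF A'(1)] A'(2) PV(2,5) by blast+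
    ultimately have "connectedin X P \<and> P \<subseteq> B \<inter> U - E \<and> openin X (V \<inter> W) \<and> x \<in> V \<inter> W \<and> B \<inter> (V \<inter> W) - E \<subseteq> P"
      using W(1,2) by auto
    then show "\<exists>P V. connectedin X P \<and> P \<subseteq> B \<inter> U - E \<and> openin X V \<and> x \<in> V \<and> B \<inter> V - E \<subseteq> P" by blast
    have "A' \<inter> (U \<inter> W) - E \<noteq> {}" using germ_family_nonempty[OF A A'(1)] UW by blast
    then show "B \<inter> U - E \<noteq> {}" using W(3)[OF A'(1)] A'(2) by blast
  qed
qed

section \<open>The standard triangle\<close>

lemma std_triangle_eq: "std_triangle = {z. 0 \<le> Re z \<and> 0 \<le> Im z \<and> Re z + Im z \<le> 1}"
proof (intro set_eqI iffI)
  fix z :: complex assume "z \<in> {z. 0 \<le> Re z \<and> 0 \<le> Im z \<and> Re z + Im z \<le> 1}"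
  then show "z \<in> std_triangle" unfolding std_triangle_def convex_hull_3 mem_Collect_eq
    by (intro exI[of _ "1 - Re z - Im z"] exI[of _ "Re z"] exI[of _ "Im z"]) (auto simp: complex_eq_iff)
qed (auto simp: std_triangle_def convex_hull_3)

lemma side_eq:
  "side Red = {z. 0 \<le> Re z \<and> Im z = 0 \<and> Re z \<le> 1}"
  "side Yellow = {z. Re z = 0 \<and> 0 \<le> Im z \<and> Im z \<le> 1}"
  "side Blue = {z. 0 \<le> Re z \<and> 0 \<le> Im z \<and> Re z + Im z = 1}"
proof -
  show "side Red = {z. 0 \<le> Re z \<and> Im z = 0 \<and> Re z \<le> 1}"
    by (auto simp: side.simps closed_segment_def complex_eq_iff)
  show "side Yellow = {z. Re z = 0 \<and> 0 \<le> Im z \<and> Im z \<le> 1}"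
    by (auto simp: side.simps closed_segment_def complex_eq_iff)
  show "side Blue = {z. 0 \<le> Re z \<and> 0 \<le> Im z \<and> Re z + Im z = 1}"
    by (auto simp: side.simps closed_segment_def complex_eq_iff intro!: exI[of _ "Im _"])
qed

declare side.simps [simp del]

lemma side_subset: "side k \<subseteq> std_triangle"
  by (cases k) (auto simp: side_eq std_triangle_eq)

lemma compact_std_triangle: "compact std_triangle"
  unfolding std_triangle_def by (simp add: finite_imp_compact_convex_hull)

lemma convex_std_triangle: "convex std_triangle"
  unfolding std_triangle_def by simp

lemma compact_side: "compact (side k)"
  by (cases k) (auto simp: side.simps)

lemma not_affine_dependent_triangle: "\<not> affine_dependent {0, 1, \<i>}"
proof -
  have "independent {1, \<i>}"
  proof (rule independent_insertI)
    show "1 \<notin> span {\<i>}" by (auto simp: span_singleton complex_eq_iff)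
    show "independent {\<i>}" by simp
  qed
  then show ?thesis by (subst affine_dependent_iff_dependent) (auto simp: insert_Diff_if)
qed

lemma face_of_std_triangle: "K face_of std_triangle \<longleftrightarrow> (\<exists>c\<subseteq>{0,1,\<i>}. K = convex hull c)"
  unfolding std_triangle_def using face_of_convex_hull_affine_independent[OF not_affine_dependent_triangle] .

lemma side_face: "side k face_of std_triangle" "side k \<noteq> std_triangle"
proof -
  show "side k face_of std_triangle"
    unfolding face_of_std_triangle
    by (cases k) (auto simp: side.simps segment_convex_hull intro: exI[of _ "{0,1}"] exI[of _ "{0,\<i>}"] exI[of _ "{1,\<i>}"])
  show "side k \<noteq> std_triangle"
  proof
    assume "side k = std_triangle"
    then have "Complex (1/4) (1/4) \<in> side k" by (simp add: std_triangle_eq)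
    then show False by (cases k) (simp_all only: side_eq, auto)
  qed
qed

lemma corner_face: "z \<in> {0,1,\<i>} \<Longrightarrow> {z} face_of std_triangle" "{z} \<noteq> std_triangle"
proof -
  show "z \<in> {0,1,\<i>} \<Longrightarrow> {z} face_of std_triangle"
    unfolding face_of_std_triangle by (intro exI[of _ "{z}"]) auto
  show "{z} \<noteq> std_triangle"
  proof
    assume "{z} = std_triangle"
    moreover have "0 \<in> std_triangle" "1 \<in> std_triangle" by (auto simp: std_triangle_eq)
    ultimately have "0 = z" "1 = z" by blast+
    then show False by simp
  qed
qed

text \<open>Sorts the possible contacts of two triangles: within the graph (first case), or off the
  graph along a yellow or blue side or at the apex.\<close>

lemma proper_face_cases:
  assumes "K face_of std_triangle" "K \<noteq> std_triangle"
  obtains "K \<subseteq> side Red" | "K = side Yellow" | "K = side Blue" | "K = {\<i>}"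
proof -
  obtain c where c: "c \<subseteq> {0,1,\<i>}" "K = convex hull c" using assms(1) face_of_std_triangle by blast
  have n: "(0::complex) \<noteq> 1" "(0::complex) \<noteq> \<i>" "1 \<noteq> \<i>" by (auto simp: complex_eq_iff)
  have ne: "c \<noteq> {0,1,\<i>}" using assms(2) c(2) std_triangle_def by blast
  consider "c \<subseteq> {0,1}" | "c = {0,\<i>}" | "c = {1,\<i>}" | "c = {\<i>}"
    using c(1) ne by blast
  then show thesis
  proof cases
    case 1
    then have "K \<subseteq> side Red" unfolding c(2) by (simp add: side.simps segment_convex_hull hull_mono)
    then show thesis using that by blast
  qed (use that c(2) in \<open>auto simp: side.simps segment_convex_hull\<close>)
qed

section \<open>Local structure of a barycentric subdivision\<close>

definition graph_set :: "('a, 'e) embedded_graph \<Rightarrow> 'a set" where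
  "graph_set G = vertices G \<union> (\<Union>e\<in>edges G. edge_set G e)"

text \<open>The two halves of an edge are told apart by a Boolean, which is true for the half
  containing the point with parameter 0.\<close>

definition half_interval :: "real \<Rightarrow> bool \<Rightarrow> real set" where
  "half_interval r a = (if a then {0<..<r} else {r<..<1})"

locale subdivision =
  fixes G :: "('a, 'e) embedded_graph" and s p T
  assumes embedding: "graph_embedding G" and subdivided: "barycentric_subdivision G s p T"
begin

abbreviation "X \<equiv> surf G"
abbreviation "E \<equiv> graph_set G"

definition half :: "'e \<Rightarrow> bool \<Rightarrow> 'a set" where
  "half e a = curve G e ` (if a then {0..s e} else {s e..1})"

text \<open>The edge and the end of it that carry the red side. The choice is determined, since
  distinct half-edges have distinct images, even the two halves of a loop
  (\<open>half_eq_iff\<close>).\<close>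

definition edge_end :: "(complex \<Rightarrow> 'a) \<Rightarrow> 'e \<times> bool" where
  "edge_end t = (SOME (e, a). e \<in> edges G \<and> t 1 = curve G e (s e) \<and> t ` side Red = half e a)"

definition triangles_at :: "'a \<Rightarrow> (complex \<Rightarrow> 'a) set" where
  "triangles_at x = {t \<in> T. x \<in> t ` std_triangle}"

text \<open>Red sides are excluded because they lie in the graph and hence separate sectors. At
  points of the graph the relation is an equivalence as it stands, see
  \<open>adjacent_at_trans\<close>.\<close>

definition adjacent_at :: "'a \<Rightarrow> (complex \<Rightarrow> 'a) \<Rightarrow> (complex \<Rightarrow> 'a) \<Rightarrow> bool" where
  "adjacent_at x t u \<longleftrightarrow> t = u \<or> (\<exists>k\<in>{Yellow, Blue}. x \<in> t ` side k \<and> t ` side k = u ` side k)"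

text \<open>The closed sector at \<open>x\<close> to which \<open>t\<close> belongs. Only its germ
  at \<open>x\<close> matters; away from \<open>x\<close> it depends on the triangles.\<close>

definition wedge :: "'a \<Rightarrow> (complex \<Rightarrow> 'a) \<Rightarrow> 'a set" where
  "wedge x t = (\<Union>u\<in>{u \<in> T. adjacent_at x t u}. u ` std_triangle)"

lemma hausdorff: "Hausdorff_space X"
  using embedding by (simp add: graph_embedding_def surface_def)

lemma finite_T: "finite T"
  using subdivided by (simp add: barycentric_subdivision_def)

lemma embedding_T: "t \<in> T \<Longrightarrow> embedding_map (top_of_set std_triangle) X t"
  using subdivided by (simp add: barycentric_subdivision_def)

lemmas T_closedin = embedding_closedin[OF embedding_T hausdorff compact_std_triangle]
lemmas T_inj_on = embedding_inj_on[OF embedding_T hausdorff compact_std_triangle]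
lemmas T_connectedin = embedding_connectedin[OF embedding_T hausdorff compact_std_triangle]
lemmas T_nbhd = embedding_nbhd[OF embedding_T hausdorff compact_std_triangle]
lemmas T_ball = embedding_ball[OF embedding_T hausdorff compact_std_triangle]

lemma split_inside: "e \<in> edges G \<Longrightarrow> 0 < s e \<and> s e < 1"
  using subdivided by (simp add: barycentric_subdivision_def)

lemma T_zero: "t \<in> T \<Longrightarrow> t 0 \<in> vertices G"
  using subdivided by (simp add: barycentric_subdivision_def)

lemma T_cover: "(\<Union>t\<in>T. t ` std_triangle) = topspace X"
  using subdivided by (simp add: barycentric_subdivision_def)

lemma T_meet:
  assumes "t \<in> T" "u \<in> T" "t \<noteq> u" "y \<in> std_triangle" "z \<in> std_triangle" "t y = u z"
  obtains K where "K face_of std_triangle" "K \<noteq> std_triangle" "y \<in> K" "z \<in> K" "t ` K = u ` K"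
  using subdivided assms unfolding barycentric_subdivision_def by meson

lemma curve_inj: "e \<in> edges G \<Longrightarrow> inj_on (curve G e) {0<..<1}"
  using embedding by (simp add: graph_embedding_def)

lemma curve_notin_vertices: "e \<in> edges G \<Longrightarrow> r \<in> {0<..<1} \<Longrightarrow> curve G e r \<notin> vertices G"
  using embedding unfolding graph_embedding_def by blast

lemma curve_ends: "e \<in> edges G \<Longrightarrow> curve G e 0 \<in> vertices G \<and> curve G e 1 \<in> vertices G"
  using embedding unfolding graph_embedding_def by blast

text \<open>Only \<open>r\<close> has to be an inner parameter: an end parameter \<open>r'\<close>
  would put the common point into the vertex set.\<close>

lemma curve_eq_imp:
  assumes "e \<in> edges G" "e' \<in> edges G" "r \<in> {0<..<1}" "r' \<in> {0..1}" "curve G e r = curve G e' r'"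
  shows "e = e' \<and> r = r'"
proof -
  have "curve G e' r' \<notin> vertices G" using curve_notin_vertices assms by metis
  then have "r' \<noteq> 0" "r' \<noteq> 1" using curve_ends assms(2) by auto
  then have r': "r' \<in> {0<..<1}" using assms(4) by auto
  then have "curve G e ` {0<..<1} \<inter> curve G e' ` {0<..<1} \<noteq> {}" using assms by blast
  then have "e = e'" using embedding assms(1,2) unfolding graph_embedding_def by blast
  then show ?thesis using inj_onD[OF curve_inj[OF assms(1)]] assms(3,5) r' by auto
qed

lemma graph_subset_topspace: "E \<subseteq> topspace X"
proof -
  have "curve G e ` {0..1} \<subseteq> topspace X" if "e \<in> edges G" for e
  proof -
    have "continuous_map (top_of_set {0..1}) X (curve G e)"
      using embedding that unfolding graph_embedding_def pathin_def by blast
    then show ?thesis by (metis continuous_map_image_subset_topspace topspace_euclidean_subtopology)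
  qed
  moreover have "vertices G \<subseteq> topspace X" using embedding by (simp add: graph_embedding_def)
  ultimately show ?thesis unfolding graph_set_def edge_set_def by blast
qed

lemma curve_in_graph: "e \<in> edges G \<Longrightarrow> r \<in> {0..1} \<Longrightarrow> curve G e r \<in> E"
  unfolding graph_set_def edge_set_def by blast

lemma T_in_graph_iff:
  assumes t: "t \<in> T" and z: "z \<in> std_triangle"
  shows "t z \<in> E \<longleftrightarrow> z \<in> side Red"
proof
  assume "z \<in> side Red"
  moreover obtain e where e: "e \<in> edges G" "t ` side Red = curve G e ` {0..s e} \<or> t ` side Red = curve G e ` {s e..1}"
    using subdivided t unfolding barycentric_subdivision_def by meson
  moreover have "curve G e ` {0..s e} \<subseteq> E" "curve G e ` {s e..1} \<subseteq> E"
    using split_inside[OF e(1)] curve_in_graph[OF e(1)] by auto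
  ultimately show "t z \<in> E" by blast
next
  assume tz: "t z \<in> E"
  show "z \<in> side Red"
  proof (rule ccontr)
    assume "z \<notin> side Red"
    moreover obtain f where f: "f \<in> faces G" "t ` (std_triangle - side Red) \<subseteq> f"
      using subdivided t unfolding barycentric_subdivision_def by meson
    moreover have "f \<subseteq> topspace X - E"
      using connected_components_of_subset[OF f(1)[unfolded faces_def]] by (auto simp: graph_set_def)
    ultimately show False using z tz by blast
  qed
qed

lemma edge_end_exists:
  assumes "t \<in> T"
  shows "\<exists>e a. e \<in> edges G \<and> t 1 = curve G e (s e) \<and> t ` side Red = half e a"
proof -
  obtain e where "e \<in> edges G" "t 1 = curve G e (s e)"
      "t ` side Red = curve G e ` {0..s e} \<or> t ` side Red = curve G e ` {s e..1}"
    using subdivided assms unfolding barycentric_subdivision_def by meson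
  then show ?thesis unfolding half_def
    by (metis (full_types))
qed

lemma edge_end:
  assumes "t \<in> T" "edge_end t = (e, a)"
  shows "e \<in> edges G" "t 1 = curve G e (s e)" "t ` side Red = half e a"
proof -
  have "\<exists>x. case x of (e, a) \<Rightarrow> e \<in> edges G \<and> t 1 = curve G e (s e) \<and> t ` side Red = half e a"
    using edge_end_exists[OF assms(1)] by auto
  from someI_ex[OF this] have "case edge_end t of (e, a) \<Rightarrow> e \<in> edges G \<and> t 1 = curve G e (s e) \<and> t ` side Red = half e a"
    unfolding edge_end_def .
  then show "e \<in> edges G" "t 1 = curve G e (s e)" "t ` side Red = half e a" using assms(2) by auto
qed

lemma half_interval_subset: "e \<in> edges G \<Longrightarrow> half_interval (s e) a \<subseteq> {0<..<1}"
  using split_inside[of e] by (auto simp: half_interval_def)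

lemma curve_in_half_iff:
  assumes "e \<in> edges G" "e' \<in> edges G" "r \<in> {0<..<1}"
  shows "curve G e r \<in> half e' a \<longleftrightarrow> e = e' \<and> r \<in> insert (s e) (half_interval (s e) a)"
proof
  have *: "(if a then {0..s e'} else {s e'..1}) \<subseteq> {0..1}" using split_inside[OF assms(2)] by auto
  assume "curve G e r \<in> half e' a"
  then obtain r' where r': "r' \<in> (if a then {0..s e'} else {s e'..1})" "curve G e r = curve G e' r'"
    unfolding half_def by blast
  then have "e = e'" "r = r'" using curve_eq_imp[OF assms(1,2,3) _ r'(2)] * by auto
  then show "e = e' \<and> r \<in> insert (s e) (half_interval (s e) a)"
    using r'(1) assms(3) by (auto simp: half_interval_def split: if_splits)
next
  assume "e = e' \<and> r \<in> insert (s e) (half_interval (s e) a)"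
  then show "curve G e r \<in> half e' a" using split_inside[OF assms(1)]
    by (auto simp: half_def half_interval_def split: if_splits)
qed

lemma half_eq_iff:
  assumes "e \<in> edges G" "e' \<in> edges G"
  shows "half e a = half e' a' \<longleftrightarrow> e = e' \<and> a = a'"
proof
  assume eq: "half e a = half e' a'"
  \<comment> \<open>The parameter halfway along the open half; it lies in no other half.\<close>
  define r where "r = (if a then s e / 2 else (1 + s e) / 2)"
  have r: "r \<in> {0<..<1}" "r \<in> half_interval (s e) a" "r \<notin> insert (s e) (half_interval (s e) (\<not> a))"
    using split_inside[OF assms(1)] by (auto simp: r_def half_interval_def)
  have "curve G e r \<in> half e' a'" using curve_in_half_iff[OF assms(1,1) r(1), of a] r(2) eq by simp
  then have "e = e'" "r \<in> insert (s e) (half_interval (s e) a')" using curve_in_half_iff[OF assms r(1)] by auto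
  then show "e = e' \<and> a = a'" using r(3) by (cases "a = a'") (auto simp: )
qed auto

lemma edge_end_eq_iff_red:
  assumes "t \<in> T" "u \<in> T"
  shows "edge_end t = edge_end u \<longleftrightarrow> t ` side Red = u ` side Red"
proof -
  obtain e a e' a' where ea: "edge_end t = (e, a)" "edge_end u = (e', a')" by fastforce
  show ?thesis
    using edge_end[OF assms(1) ea(1)] edge_end[OF assms(2) ea(2)] half_eq_iff[of e e' a a'] ea by simp
qed

lemma edge_iff:
  assumes "t \<in> T" "e \<in> edges G"
  shows "fst (edge_end t) = e \<longleftrightarrow> t 1 = curve G e (s e)"
proof -
  obtain e' a where ea: "edge_end t = (e', a)" by fastforce
  note ee = edge_end[OF assms(1) ea]
  show ?thesis
  proof
    assume "t 1 = curve G e (s e)"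
    then have "curve G e' (s e') = curve G e (s e)" using ee by simp
    then show "fst (edge_end t) = e"
      using curve_eq_imp[OF ee(1) assms(2), of "s e'" "s e"] split_inside[OF ee(1)] split_inside[OF assms(2)] ea by simp
  qed (use ee ea in auto)
qed

lemma corners_in_triangle: "0 \<in> std_triangle" "1 \<in> std_triangle" "\<i> \<in> std_triangle"
  by (auto simp: std_triangle_eq)

text \<open>The corner is a vertex, so its parameter is not an inner one, and each half contains
  just one end parameter.\<close>

lemma edge_end_zero:
  assumes "t \<in> T" "edge_end t = (e, a)"
  shows "t 0 = curve G e (if a then 0 else 1)"
proof -
  note ee = edge_end[OF assms]
  have "t 0 \<in> half e a" using ee(3) by (auto simp: side_eq)
  then obtain r where r: "r \<in> (if a then {0..s e} else {s e..1})" "t 0 = curve G e r" unfolding half_def by blast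
  have "r \<notin> {0<..<1}" using curve_notin_vertices[OF ee(1)] T_zero[OF assms(1)] r(2) by auto
  then show ?thesis using r split_inside[OF ee(1)] by (auto split: if_splits)
qed

lemma edge_end_open:
  assumes t: "t \<in> T" and ea: "edge_end t = (e, a)"
  shows "t ` (side Red - {0, 1}) = curve G e ` half_interval (s e) a"
proof -
  note ee = edge_end[OF t ea]
  have sp: "0 < s e" "s e < 1" using split_inside[OF ee(1)] by auto
  have "t ` (side Red - {0, 1}) = t ` side Red - {t 0, t 1}"
    using inj_on_image_set_diff[OF T_inj_on[OF t], of "side Red" "{0,1}"] side_subset[of Red] corners_in_triangle by auto
  also have "\<dots> = half e a - {curve G e (if a then 0 else 1), curve G e (s e)}"
    using ee edge_end_zero[OF t ea] by simp
  also have "\<dots> = curve G e ` half_interval (s e) a"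
  proof
    show "half e a - {curve G e (if a then 0 else 1), curve G e (s e)} \<subseteq> curve G e ` half_interval (s e) a"
      by (auto simp: half_def half_interval_def less_eq_real_def)
    show "curve G e ` half_interval (s e) a \<subseteq> half e a - {curve G e (if a then 0 else 1), curve G e (s e)}"
    proof
      fix x assume "x \<in> curve G e ` half_interval (s e) a"
      then obtain r where r: "r \<in> half_interval (s e) a" "x = curve G e r" by blast
      have r1: "r \<in> {0<..<1}" using r(1) half_interval_subset[OF ee(1)] by blast
      have "x \<in> half e a" using curve_in_half_iff[OF ee(1,1) r1] r by blast
      moreover have "x \<noteq> curve G e (if a then 0 else 1)"
        using curve_notin_vertices[OF ee(1) r1] curve_ends[OF ee(1)] r(2) by auto
      moreover have "x \<noteq> curve G e (s e)"
        using curve_eq_imp[OF ee(1,1) r1, of "s e"] sp r by (auto simp: half_interval_def split: if_splits)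
      ultimately show "x \<in> half e a - {curve G e (if a then 0 else 1), curve G e (s e)}" by blast
    qed
  qed
  finally show ?thesis .
qed

lemma side_Int:
  "side Red \<inter> side Yellow = {0}" "side Red \<inter> side Blue = {1}" "side Yellow \<inter> side Blue = {\<i>}"
  by (auto simp: side_eq complex_eq_iff)

lemma side_Int_graph: "t \<in> T \<Longrightarrow> t ` side k \<inter> E = t ` (side Red \<inter> side k)"
proof (intro set_eqI iffI)
  fix y assume t: "t \<in> T"
  { assume "y \<in> t ` side k \<inter> E"
    then obtain z where z: "z \<in> side k" "y = t z" "t z \<in> E" by blast
    have "z \<in> std_triangle" using z(1) side_subset by blast
    then show "y \<in> t ` (side Red \<inter> side k)" using T_in_graph_iff[OF t] z by blast }
  { assume "y \<in> t ` (side Red \<inter> side k)"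
    then obtain z where z: "z \<in> side Red" "z \<in> side k" "y = t z" by blast
    have "z \<in> std_triangle" using z(1) side_subset by blast
    then show "y \<in> t ` side k \<inter> E" using T_in_graph_iff[OF t] z by blast }
qed

lemma yellow_Int_graph: "t \<in> T \<Longrightarrow> t ` side Yellow \<inter> E = {t 0}"
  using side_Int_graph[of t Yellow] side_Int(1) by simp

lemma blue_Int_graph: "t \<in> T \<Longrightarrow> t ` side Blue \<inter> E = {t 1}"
  using side_Int_graph[of t Blue] side_Int(2) by simp

lemma apex_notin_graph: "t \<in> T \<Longrightarrow> t \<i> \<notin> E"
  using T_in_graph_iff[of t \<i>] corners_in_triangle by (simp add: side_eq)

text \<open>Moving a point of the red side slightly towards the apex leaves the graph at once and
  stays in the convex set \<open>C\<close>. The generality in \<open>C\<close> covers the whole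
  triangle as well as a yellow or blue side.\<close>

lemma triangle_meets_nbhd:
  assumes t: "t \<in> T" and C: "convex C" "C \<subseteq> std_triangle" "\<i> \<in> C" and z: "z \<in> C" "t z \<in> E"
    and V: "openin X V" "t z \<in> V"
  shows "t ` C \<inter> V - E \<noteq> {}"
proof -
  have zR: "z \<in> side Red" using T_in_graph_iff[OF t] z C by blast
  obtain d where d: "d > 0" "t ` (std_triangle \<inter> ball z d) \<subseteq> V" using T_ball[OF t _ V] z C by blast
  \<comment> \<open>The displacement is \<open>b\<close> times
    \<open>norm (\<i> - z) \<le> 2\<close>, so \<open>d / 4\<close> keeps it below \<open>d\<close>;
    the bound \<open>1/2\<close> keeps the combination convex.\<close>
  define b where "b = min (1/2) (d / 4)"
  define w where "w = (1 - b) *\<^sub>R z + b *\<^sub>R \<i>"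
  have b: "0 < b" "b < 1" "2 * b < d" using d by (auto simp: b_def)
  have wC: "w \<in> C" unfolding w_def by (rule convexD[OF C(1) z(1) C(3)]) (use b in auto)
  have "w - z = b *\<^sub>R (\<i> - z)" unfolding w_def by (simp add: algebra_simps)
  moreover have "norm (\<i> - z) \<le> 2"
  proof -
    have "norm z \<le> 1" using zR by (auto simp: side_eq cmod_def)
    then show ?thesis using norm_triangle_ineq4[of \<i> z] by simp
  qed
  ultimately have "dist z w < d" using b
    by (simp add: dist_norm norm_minus_commute) (metis b(3) dual_order.strict_trans2 mult.commute mult_le_cancel_left_pos)
  then have "w \<in> std_triangle \<inter> ball z d" using wC C(2) by auto
  then have "t w \<in> V" using d(2) by blast
  moreover have "t w \<notin> E"
  proof -
    have "Im w > 0" using b zR by (simp add: w_def side_eq)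
    then show ?thesis using T_in_graph_iff[OF t, of w] wC C(2) by (auto simp: side_eq)
  qed
  ultimately show ?thesis using wC by blast
qed

lemma triangle_meets_nbhd':
  assumes "t \<in> T" "x \<in> t ` std_triangle" "x \<in> E" "openin X V" "x \<in> V"
  shows "t ` std_triangle \<inter> V - E \<noteq> {}"
  using triangle_meets_nbhd[OF assms(1) convex_std_triangle order_refl corners_in_triangle(3)] assms by blast

text \<open>In the coordinates of the triangle, the graph is removed by the condition
  \<open>0 < Im w\<close>; cut down by a ball this leaves a convex set, whose image serves as
  \<open>P\<close>.\<close>

lemma triangle_germ_connected:
  assumes t: "t \<in> T" and x: "x \<in> t ` std_triangle" and U: "openin X U" "x \<in> U"
  shows "\<exists>P V. connectedin X P \<and> P \<subseteq> t ` std_triangle \<inter> U - E \<and> openin X V \<and> x \<in> V \<and> t ` std_triangle \<inter> V - E \<subseteq> P"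
proof -
  obtain z where z: "z \<in> std_triangle" "x = t z" using x by blast
  obtain d where d: "d > 0" "t ` (std_triangle \<inter> ball z d) \<subseteq> U" using T_ball[OF t z(1) U(1)] U(2) z(2) by blast
  let ?C = "std_triangle \<inter> ball z d \<inter> {w. 0 < Im w}"
  obtain V where V: "openin X V" "x \<in> V" "V \<inter> t ` std_triangle \<subseteq> t ` (std_triangle \<inter> ball z d)"
    using T_nbhd[OF t z(1) d(1)] z(2) by blast
  have "convex ?C" by (intro convex_Int convex_std_triangle convex_ball convex_halfspace_Im_gt)
  then have conn: "connectedin X (t ` ?C)" by (intro T_connectedin[OF t] convex_connected) auto
  have notE: "t w \<notin> E \<longleftrightarrow> 0 < Im w" if "w \<in> std_triangle" for w
    using T_in_graph_iff[OF t that] that by (auto simp: side_eq std_triangle_eq)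
  have "t ` ?C \<subseteq> t ` std_triangle \<inter> U - E"
  proof (clarify, intro DiffI IntI)
    fix w assume w: "w \<in> std_triangle" "w \<in> ball z d" "0 < Im w"
    show "t w \<in> U" using d(2) w by blast
    show "t w \<notin> E" using notE w by blast
  qed auto
  moreover have "t ` std_triangle \<inter> V - E \<subseteq> t ` ?C"
  proof
    fix y assume y: "y \<in> t ` std_triangle \<inter> V - E"
    then obtain w where "w \<in> std_triangle \<inter> ball z d" "y = t w" using V(3) by blast
    then show "y \<in> t ` ?C" using notE y by blast
  qed
  ultimately show ?thesis using conn V by blast
qed

lemma adjacent_at_sym: "adjacent_at x t u \<Longrightarrow> adjacent_at x u t"
  unfolding adjacent_at_def by auto

text \<open>At a point of the graph at most one of the two sides Yellow and Blue of a triangle can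
  pass through: they meet only in the apex, which is off the graph. So consecutive adjacencies use
  the same side.\<close>

lemma adjacent_at_trans:
  assumes tT: "u \<in> T" and x: "x \<in> E" and 1: "adjacent_at x t u" and 2: "adjacent_at x u w"
  shows "adjacent_at x t w"
proof (cases "t = u \<or> u = w")
  case False
  obtain k where k: "k \<in> {Yellow, Blue}" "x \<in> t ` side k" "t ` side k = u ` side k"
    using 1 False unfolding adjacent_at_def by blast
  obtain l where l: "l \<in> {Yellow, Blue}" "x \<in> u ` side l" "u ` side l = w ` side l"
    using 2 False unfolding adjacent_at_def by blast
  have "k = l"
  proof (rule ccontr)
    assume "k \<noteq> l"
    then have "side k \<inter> side l = {\<i>}" using k(1) l(1) side_Int(3) by auto
    moreover have "x \<in> u ` side k \<inter> u ` side l" using k l by blast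
    then have "x \<in> u ` (side k \<inter> side l)"
      using inj_on_image_Int[OF T_inj_on[OF tT] side_subset side_subset] by blast
    ultimately have "x = u \<i>" by auto
    then show False using apex_notin_graph[OF tT] x by simp
  qed
  then show ?thesis using k l unfolding adjacent_at_def by auto
qed (use 1 2 in auto)

lemma adjacent_at_triangles_at: "t \<in> triangles_at x \<Longrightarrow> u \<in> T \<Longrightarrow> adjacent_at x t u \<Longrightarrow> u \<in> triangles_at x"
  unfolding adjacent_at_def triangles_at_def using side_subset by blast

text \<open>Triangles meet off the graph only in a common yellow or blue side or in the apex. Such a
  common side avoids \<open>x\<close>, as otherwise the triangles would be adjacent at
  \<open>x\<close>; hence deleting from the surface the sides and the apex that avoid
  \<open>x\<close> removes every contact off the graph.\<close>

lemma nonadjacent_disjoint: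
  assumes t: "t \<in> T" "u \<in> T" and x: "x \<in> E" and nadj: "\<not> adjacent_at x t u"
  shows "\<exists>U. openin X U \<and> x \<in> U \<and> U \<inter> t ` std_triangle \<inter> u ` std_triangle \<subseteq> E"
proof -
  define \<K> where "\<K> = {K \<in> {side Yellow, side Blue, {\<i>}}. x \<notin> t ` K}"
  have sub: "K \<in> \<K> \<Longrightarrow> compact K \<and> K \<subseteq> std_triangle" for K
    using compact_side side_subset corners_in_triangle by (auto simp: \<K>_def)
  let ?U = "topspace X - (\<Union>K\<in>\<K>. t ` K)"
  have "finite \<K>" unfolding \<K>_def by simp
  then have "closedin X (\<Union>K\<in>\<K>. t ` K)" using T_closedin[OF t(1)] sub by (auto intro!: closedin_Union)
  then have "openin X ?U" by blast
  moreover have "x \<in> ?U" using x graph_subset_topspace by (auto simp: \<K>_def)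
  moreover have "?U \<inter> t ` std_triangle \<inter> u ` std_triangle \<subseteq> E"
  proof
    fix y assume y: "y \<in> ?U \<inter> t ` std_triangle \<inter> u ` std_triangle"
    then obtain z w where zw: "z \<in> std_triangle" "w \<in> std_triangle" "y = t z" "y = u w" by blast
    have "t \<noteq> u" using nadj unfolding adjacent_at_def by blast
    then obtain K where K: "K face_of std_triangle" "K \<noteq> std_triangle" "z \<in> K" "w \<in> K" "t ` K = u ` K"
      using T_meet[OF t _ zw(1,2)] zw by metis
    from K(1,2) show "y \<in> E"
    proof (cases rule: proper_face_cases)
      case 1
      then show ?thesis using T_in_graph_iff[OF t(1) zw(1)] zw(3) K(3) by blast
    next
      case 2
      then have "x \<notin> t ` K" using nadj K(5) unfolding adjacent_at_def by blast
      then show ?thesis using y K(3) zw(3) 2 unfolding \<K>_def by blast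
    next
      case 3
      then have "x \<notin> t ` K" using nadj K(5) unfolding adjacent_at_def by blast
      then show ?thesis using y K(3) zw(3) 3 unfolding \<K>_def by blast
    next
      case 4
      then have "x \<notin> t ` K" using apex_notin_graph[OF t(1)] x by auto
      then show ?thesis using y K(3) zw(3) 4 unfolding \<K>_def by blast
    qed
  qed
  ultimately show ?thesis by blast
qed

lemma wedge_cong: "t \<in> T \<Longrightarrow> u \<in> T \<Longrightarrow> x \<in> E \<Longrightarrow> adjacent_at x t u \<Longrightarrow> wedge x t = wedge x u"
  unfolding wedge_def using adjacent_at_trans adjacent_at_sym by (metis (no_types, lifting))

lemma triangle_subset_wedge: "t \<in> T \<Longrightarrow> t ` std_triangle \<subseteq> wedge x t"
  unfolding wedge_def adjacent_at_def by blast

lemma wedge_disjoint: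
  assumes t: "t \<in> T" "u \<in> T" and x: "x \<in> E" and nadj: "\<not> adjacent_at x t u"
  shows "\<exists>U. openin X U \<and> x \<in> U \<and> U \<inter> wedge x t \<inter> wedge x u \<subseteq> E"
proof -
  let ?I = "{t' \<in> T. adjacent_at x t t'} \<times> {u' \<in> T. adjacent_at x u u'}"
  have "\<exists>U. openin X U \<and> x \<in> U \<and> (\<forall>i\<in>?I. U \<inter> fst i ` std_triangle \<inter> snd i ` std_triangle \<subseteq> E)"
  proof (rule finite_nbhds)
    show "finite ?I" using finite_T by simp
    show "x \<in> topspace X" using x graph_subset_topspace by blast
    fix i assume i: "i \<in> ?I"
    have "\<not> adjacent_at x (fst i) (snd i)"
    proof
      assume a: "adjacent_at x (fst i) (snd i)"
      have "adjacent_at x t (snd i)" using adjacent_at_trans[OF _ x _ a, of t] i by auto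
      then have "adjacent_at x t u" using adjacent_at_trans[OF _ x, of "snd i" t u] i adjacent_at_sym by auto
      then show False using nadj by simp
    qed
    then show "\<exists>U. openin X U \<and> x \<in> U \<and> U \<inter> fst i ` std_triangle \<inter> snd i ` std_triangle \<subseteq> E"
      using nonadjacent_disjoint[OF _ _ x] i by auto
  next
    fix i U V assume "U \<inter> fst i ` std_triangle \<inter> snd i ` std_triangle \<subseteq> E" "V \<subseteq> U"
    then show "V \<inter> fst i ` std_triangle \<inter> snd i ` std_triangle \<subseteq> E" by blast
  qed
  then obtain U where U: "openin X U" "x \<in> U" "\<forall>i\<in>?I. U \<inter> fst i ` std_triangle \<inter> snd i ` std_triangle \<subseteq> E" by blast
  have "U \<inter> wedge x t \<inter> wedge x u \<subseteq> E"
  proof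
    fix y assume "y \<in> U \<inter> wedge x t \<inter> wedge x u"
    then obtain t' u' where "(t', u') \<in> ?I" "y \<in> t' ` std_triangle" "y \<in> u' ` std_triangle" "y \<in> U"
      unfolding wedge_def by blast
    moreover from this(1) have "U \<inter> t' ` std_triangle \<inter> u' ` std_triangle \<subseteq> E"
      using bspec[OF U(3), of "(t', u')"] by simp
    ultimately show "y \<in> E" by blast
  qed
  then show ?thesis using U(1,2) by blast
qed

text \<open>Turns coincidence of sectors into the combinatorial adjacency; at the corners it becomes
  equality of blue or of yellow sides.\<close>

lemma wedge_eq_iff:
  assumes t: "t \<in> triangles_at x" "u \<in> triangles_at x" and x: "x \<in> E"
  shows "wedge x t = wedge x u \<longleftrightarrow> adjacent_at x t u"
proof
  have T: "t \<in> T" "u \<in> T" "x \<in> t ` std_triangle" using t unfolding triangles_at_def by auto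
  show "wedge x t = wedge x u" if "adjacent_at x t u" using wedge_cong[OF T(1,2) x that] .
  assume eq: "wedge x t = wedge x u"
  show "adjacent_at x t u"
  proof (rule ccontr)
    assume "\<not> adjacent_at x t u"
    then obtain U where U: "openin X U" "x \<in> U" "U \<inter> wedge x t \<inter> wedge x u \<subseteq> E"
      using wedge_disjoint[OF T(1,2) x] by blast
    then have "t ` std_triangle \<inter> U - E = {}" using eq triangle_subset_wedge[OF T(1), of x] by blast
    then show False using triangle_meets_nbhd'[OF T(1,3) x U(1,2)] by blast
  qed
qed

lemma wedge_closedin: "closedin X (wedge x t)"
  unfolding wedge_def using finite_T T_closedin[OF _ compact_std_triangle order_refl]
  by (auto intro!: closedin_Union)

text \<open>Each triangle of the sector contributes a connected piece. All of them meet the piece of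
  \<open>t\<close>: the common side runs into \<open>x\<close>, so it contains points off the graph
  that are as close to \<open>x\<close> as required.\<close>

lemma wedge_germ_connected:
  assumes t: "t \<in> triangles_at x" and x: "x \<in> E" and U: "openin X U" "x \<in> U"
  shows "\<exists>P V. connectedin X P \<and> P \<subseteq> wedge x t \<inter> U - E \<and> openin X V \<and> x \<in> V \<and> wedge x t \<inter> V - E \<subseteq> P"
proof -
  let ?C = "{u \<in> T. adjacent_at x t u}"
  have tT: "t \<in> T" "x \<in> t ` std_triangle" using t unfolding triangles_at_def by auto
  have tC: "t \<in> ?C" using tT by (simp add: adjacent_at_def)
  have C: "u \<in> T \<and> x \<in> u ` std_triangle" if "u \<in> ?C" for u
    using adjacent_at_triangles_at[OF t] that unfolding triangles_at_def by blast
  have "\<forall>u\<in>?C. \<exists>P V. connectedin X P \<and> P \<subseteq> u ` std_triangle \<inter> U - E \<and> openin X V \<and> x \<in> V \<and> u ` std_triangle \<inter> V - E \<subseteq> P"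
    using triangle_germ_connected[OF _ _ U] C by blast
  then obtain P V where PV: "\<And>u. u \<in> ?C \<Longrightarrow> connectedin X (P u) \<and> P u \<subseteq> u ` std_triangle \<inter> U - E
      \<and> openin X (V u) \<and> x \<in> V u \<and> u ` std_triangle \<inter> V u - E \<subseteq> P u" by metis
  let ?V = "\<Inter>u\<in>?C. V u"
  have opV: "openin X ?V" using PV finite_T tC by (intro openin_INT2) auto
  have meet: "P t \<inter> P u \<noteq> {}" if u: "u \<in> ?C" for u
  proof -
    have op: "openin X (V t \<inter> V u)" "x \<in> V t \<inter> V u" using PV tC u by auto
    consider "t = u" | k where "k \<in> {Yellow, Blue}" "x \<in> t ` side k" "t ` side k = u ` side k"
      using u unfolding adjacent_at_def by blast
    then have "\<exists>y. y \<in> t ` std_triangle \<inter> u ` std_triangle \<inter> (V t \<inter> V u) - E"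
    proof cases
      case 1
      then show ?thesis using triangle_meets_nbhd'[OF tT x op] by blast
    next
      case 2
      then obtain z where z: "z \<in> side k" "x = t z" by blast
      have "convex (side k)" "\<i> \<in> side k" using 2(1) by (auto simp: side.simps)
      from triangle_meets_nbhd[OF tT(1) this(1) side_subset this(2) z(1), of "V t \<inter> V u"]
      have "t ` side k \<inter> (V t \<inter> V u) - E \<noteq> {}" using x op z(2) by blast
      then obtain y where y: "y \<in> t ` side k" "y \<in> V t \<inter> V u" "y \<notin> E" by blast
      have "y \<in> t ` std_triangle" using y(1) side_subset by blast
      moreover have "y \<in> u ` std_triangle" using y(1) 2(3) side_subset by blast
      ultimately show ?thesis using y by blast
    qed
    then obtain y where y: "y \<in> t ` std_triangle" "y \<in> u ` std_triangle" "y \<in> V t" "y \<in> V u" "y \<notin> E" by blast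
    have "y \<in> P t" using PV[OF tC] y by blast
    moreover have "y \<in> P u" using PV[OF u] y by blast
    ultimately show ?thesis by blast
  qed
  have "connectedin X (P t \<union> (\<Union>u\<in>?C. P u))"
    using connectedin_Union_meeting[of X "P t" ?C P] PV tC meet by blast
  moreover have "P t \<union> (\<Union>u\<in>?C. P u) = (\<Union>u\<in>?C. P u)" using tC by blast
  ultimately have conn: "connectedin X (\<Union>u\<in>?C. P u)" by simp
  have sub: "(\<Union>u\<in>?C. P u) \<subseteq> wedge x t \<inter> U - E"
  proof
    fix y assume "y \<in> (\<Union>u\<in>?C. P u)"
    then obtain u where u: "u \<in> ?C" "y \<in> P u" by blast
    then have "y \<in> u ` std_triangle \<inter> U - E" using PV[OF u(1)] by blast
    then show "y \<in> wedge x t \<inter> U - E" using u(1) unfolding wedge_def by blast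
  qed
  have sub2: "wedge x t \<inter> ?V - E \<subseteq> (\<Union>u\<in>?C. P u)"
  proof
    fix y assume y: "y \<in> wedge x t \<inter> ?V - E"
    then obtain u where u: "u \<in> ?C" "y \<in> u ` std_triangle" unfolding wedge_def by blast
    then have "y \<in> P u" using PV[OF u(1)] y by blast
    then show "y \<in> (\<Union>u\<in>?C. P u)" using u(1) by blast
  qed
  have "x \<in> ?V" using PV by blast
  then show ?thesis using conn sub sub2 opV by blast
qed

text \<open>The local structure theorem: at any point of the graph the sectors of a barycentric
  subdivision are the local components of the complement. By \<open>germ_family_match\<close> they
  depend on the embedding only.\<close>

lemma wedge_germ_family:
  assumes x: "x \<in> E"
  shows "germ_family X E x (wedge x ` triangles_at x)"
  unfolding germ_family_def
proof (intro conjI ballI allI impI)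
  show "finite (wedge x ` triangles_at x)" using finite_T unfolding triangles_at_def by simp
  show "closedin X A" if "A \<in> wedge x ` triangles_at x" for A using that wedge_closedin by blast
  let ?U = "topspace X - (\<Union>t\<in>T - triangles_at x. t ` std_triangle)"
  have "closedin X (\<Union>t\<in>T - triangles_at x. t ` std_triangle)"
    using finite_T T_closedin[OF _ compact_std_triangle order_refl] by (auto intro!: closedin_Union)
  then have "openin X ?U" by blast
  moreover have "x \<in> ?U" using x graph_subset_topspace unfolding triangles_at_def by blast
  moreover have "?U - E \<subseteq> \<Union> (wedge x ` triangles_at x)"
  proof
    fix y assume y: "y \<in> ?U - E"
    then have "y \<in> (\<Union>t\<in>T. t ` std_triangle)" using T_cover by simp
    then obtain t where t: "t \<in> T" "y \<in> t ` std_triangle" by blast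
    then have "t \<in> triangles_at x" using y by auto
    then show "y \<in> \<Union> (wedge x ` triangles_at x)" using triangle_subset_wedge[OF t(1)] t(2) by blast
  qed
  ultimately show "\<exists>U. openin X U \<and> x \<in> U \<and> U - E \<subseteq> \<Union> (wedge x ` triangles_at x)" by blast
next
  fix A B assume "A \<in> wedge x ` triangles_at x" "B \<in> wedge x ` triangles_at x" "A \<noteq> B"
  then obtain t u where tu: "t \<in> triangles_at x" "u \<in> triangles_at x" "A = wedge x t" "B = wedge x u" by blast
  then have "\<not> adjacent_at x t u" using wedge_eq_iff[OF tu(1,2) x] \<open>A \<noteq> B\<close> by blast
  moreover have "t \<in> T" "u \<in> T" using tu(1,2) unfolding triangles_at_def by auto
  ultimately show "\<exists>U. openin X U \<and> x \<in> U \<and> U \<inter> A \<inter> B \<subseteq> E"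
    using wedge_disjoint[of t u, OF _ _ x] tu(3,4) by simp
next
  fix A U assume A: "A \<in> wedge x ` triangles_at x" and U: "openin X U \<and> x \<in> U"
  then obtain t where t: "t \<in> triangles_at x" "A = wedge x t" by blast
  show "\<exists>P V. connectedin X P \<and> P \<subseteq> A \<inter> U - E \<and> openin X V \<and> x \<in> V \<and> A \<inter> V - E \<subseteq> P"
    using wedge_germ_connected[OF t(1) x] U t(2) by simp
  have tT: "t \<in> T" "x \<in> t ` std_triangle" using t(1) unfolding triangles_at_def by auto
  have "t ` std_triangle \<inter> U - E \<noteq> {}" using triangle_meets_nbhd'[OF tT x] U by blast
  then show "A \<inter> U - E \<noteq> {}" using triangle_subset_wedge[OF tT(1), of x] t(2) by blast
qed

text \<open>Yellow and blue sides touch the graph only at vertices and split points. At all other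
  points of an edge each sector therefore consists of one triangle.\<close>

lemma triangles_at_open_edge:
  assumes e: "e \<in> edges G" and r: "r \<in> half_interval (s e) a"
  shows "triangles_at (curve G e r) = {t \<in> T. edge_end t = (e, a)}"
    and "t \<in> triangles_at (curve G e r) \<Longrightarrow> adjacent_at (curve G e r) t u \<longleftrightarrow> t = u"
    and "t \<in> triangles_at (curve G e r) \<Longrightarrow> wedge (curve G e r) t = t ` std_triangle"
proof -
  let ?x = "curve G e r"
  have r1: "r \<in> {0<..<1}" using r half_interval_subset[OF e] by blast
  have x: "?x \<in> E" using curve_in_graph[OF e] r1 by simp
  have rn: "r \<noteq> s e" "r \<notin> half_interval (s e) (\<not> a)" using r by (auto simp: half_interval_def split: if_splits)
  show 1: "triangles_at ?x = {t \<in> T. edge_end t = (e, a)}"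
  proof (intro set_eqI iffI)
    fix t assume "t \<in> triangles_at ?x"
    then obtain z where tz: "t \<in> T" "z \<in> std_triangle" "?x = t z" unfolding triangles_at_def by blast
    then have zR: "z \<in> side Red" using T_in_graph_iff x by metis
    obtain e' a' where ea: "edge_end t = (e', a')" by fastforce
    note ee = edge_end[OF tz(1) ea]
    have "?x \<in> half e' a'" using ee(3) zR tz(3) by blast
    then have "e = e' \<and> r \<in> insert (s e) (half_interval (s e) a')" using curve_in_half_iff[OF e ee(1) r1] by blast
    then have "e = e'" "a = a'" using rn by (cases "a = a'"; auto)+
    then show "t \<in> {t \<in> T. edge_end t = (e, a)}" using tz ea by simp
  next
    fix t assume "t \<in> {t \<in> T. edge_end t = (e, a)}"
    then have t: "t \<in> T" "edge_end t = (e, a)" by auto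
    have "?x \<in> t ` side Red" using edge_end_open[OF t] r by blast
    then show "t \<in> triangles_at ?x" using t side_subset unfolding triangles_at_def by blast
  qed
  show 2: "adjacent_at ?x t u \<longleftrightarrow> t = u" if t: "t \<in> triangles_at ?x" for t u
  proof
    have tT: "t \<in> T" "edge_end t = (e, a)" using t 1 by auto
    have "?x \<notin> t ` side k" if k: "k \<in> {Yellow, Blue}" for k
    proof
      assume "?x \<in> t ` side k"
      then have "?x = t 0 \<or> ?x = t 1" using yellow_Int_graph[OF tT(1)] blue_Int_graph[OF tT(1)] x k by blast
      moreover have "?x \<noteq> t 0" using T_zero[OF tT(1)] curve_notin_vertices[OF e r1] by metis
      moreover have "?x \<noteq> t 1"
        using edge_end(2)[OF tT] curve_eq_imp[OF e e r1, of "s e"] split_inside[OF e] rn by auto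
      ultimately show False by blast
    qed
    then show "t = u" if "adjacent_at ?x t u" using that unfolding adjacent_at_def by blast
  qed (simp add: adjacent_at_def)
  show "wedge ?x t = t ` std_triangle" if t: "t \<in> triangles_at ?x"
    using 2[OF t] t unfolding wedge_def triangles_at_def by auto
qed

lemma edge_of_eq_iff:
  assumes "t \<in> T" "u \<in> T" shows "fst (edge_end t) = fst (edge_end u) \<longleftrightarrow> t 1 = u 1"
proof -
  obtain e a where ea: "edge_end u = (e, a)" by fastforce
  show ?thesis using edge_iff[OF assms(1), of e] edge_end[OF assms(2) ea] ea by simp
qed

lemma blue_imp_edge: "t \<in> T \<Longrightarrow> u \<in> T \<Longrightarrow> t ` side Blue = u ` side Blue \<Longrightarrow> t 1 = u 1"
  using blue_Int_graph by (metis singleton_inject)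

lemma yellow_imp_zero: "t \<in> T \<Longrightarrow> u \<in> T \<Longrightarrow> t ` side Yellow = u ` side Yellow \<Longrightarrow> t 0 = u 0"
  using yellow_Int_graph by (metis singleton_inject)

lemma one_in_graph: "t \<in> T \<Longrightarrow> t 1 \<in> E" and zero_in_graph: "t \<in> T \<Longrightarrow> t 0 \<in> E"
  using T_in_graph_iff corners_in_triangle by (auto simp: side_eq)

text \<open>The yellow side meets the graph only in the corner \<open>0\<close>, so it cannot
  contain the corner \<open>1\<close>; sectors at a split point correspond to blue sides.\<close>

lemma adjacent_at_one:
  assumes "t \<in> T" "u \<in> T"
  shows "adjacent_at (t 1) t u \<longleftrightarrow> t ` side Blue = u ` side Blue"
proof
  have "t 1 \<notin> t ` side Yellow"
  proof
    assume "t 1 \<in> t ` side Yellow"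
    then have "t 1 = t 0" using yellow_Int_graph[OF assms(1)] one_in_graph[OF assms(1)] by blast
    then show False using inj_onD[OF T_inj_on[OF assms(1)], of 1 0] corners_in_triangle by simp
  qed
  then show "t ` side Blue = u ` side Blue" if "adjacent_at (t 1) t u" using that unfolding adjacent_at_def by blast
  show "adjacent_at (t 1) t u" if "t ` side Blue = u ` side Blue"
    using that unfolding adjacent_at_def by (auto simp: side_eq)
qed

lemma adjacent_at_zero:
  assumes "t \<in> T" "u \<in> T"
  shows "adjacent_at (t 0) t u \<longleftrightarrow> t ` side Yellow = u ` side Yellow"
proof
  have "t 0 \<notin> t ` side Blue"
  proof
    assume "t 0 \<in> t ` side Blue"
    then have "t 0 = t 1" using blue_Int_graph[OF assms(1)] zero_in_graph[OF assms(1)] by blast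
    then show False using inj_onD[OF T_inj_on[OF assms(1)], of 0 1] corners_in_triangle by simp
  qed
  then show "t ` side Yellow = u ` side Yellow" if "adjacent_at (t 0) t u" using that unfolding adjacent_at_def by blast
  show "adjacent_at (t 0) t u" if "t ` side Yellow = u ` side Yellow"
    using that unfolding adjacent_at_def by (auto simp: side_eq)
qed

lemma triangles_at_split:
  assumes e: "e \<in> edges G"
  shows "triangles_at (curve G e (s e)) = {t \<in> T. fst (edge_end t) = e}"
proof (intro set_eqI iffI)
  let ?x = "curve G e (s e)"
  have s1: "s e \<in> {0<..<1}" using split_inside[OF e] by simp
  have x: "?x \<in> E" using curve_in_graph[OF e] s1 by simp
  fix t 
  { assume "t \<in> triangles_at ?x"
    then obtain z where tz: "t \<in> T" "z \<in> std_triangle" "?x = t z" unfolding triangles_at_def by blast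
    then have zR: "z \<in> side Red" using T_in_graph_iff x by metis
    obtain e' a' where ea: "edge_end t = (e', a')" by fastforce
    note ee = edge_end[OF tz(1) ea]
    have "?x \<in> half e' a'" using ee(3) zR tz(3) by blast
    then have "e = e'" using curve_in_half_iff[OF e ee(1) s1] by blast
    then show "t \<in> {t \<in> T. fst (edge_end t) = e}" using tz ea by simp }
  { assume "t \<in> {t \<in> T. fst (edge_end t) = e}"
    then have "t \<in> T" "t 1 = ?x" using edge_iff[OF _ e] by auto
    then show "t \<in> triangles_at ?x" using corners_in_triangle unfolding triangles_at_def by force }
qed

lemma triangles_at_zero: "t \<in> T \<Longrightarrow> t \<in> triangles_at (t 0)"
  and triangles_at_one: "t \<in> T \<Longrightarrow> t \<in> triangles_at (t 1)"
  using corners_in_triangle unfolding triangles_at_def by auto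

end

section \<open>Uniqueness of the gem\<close>

text \<open>Makes both ends of an open half-edge limits of its points, so that germs known along the
  half-edge can be carried to the vertex and to the split point.\<close>

lemma (in subdivision) open_edge_accumulates:
  assumes t: "t \<in> T" and z: "z \<in> {0, 1}" and U: "openin X U" "t z \<in> U"
  shows "t ` (side Red - {0, 1}) \<inter> U \<noteq> {}"
proof -
  have zt: "z \<in> std_triangle" using z corners_in_triangle by auto
  obtain d where d: "d > 0" "t ` (std_triangle \<inter> ball z d) \<subseteq> U" using T_ball[OF t zt U] by blast
  define b where "b = min (1/4) (d / 2)"
  define w where "w = Complex (if z = 0 then b else 1 - b) 0"
  have b: "0 < b" "b < d" "b < 1/2" using d by (auto simp: b_def)
  have "dist z w = b" using z b by (auto simp: w_def dist_norm cmod_def)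
  moreover have wR: "w \<in> side Red - {0, 1}" using b by (auto simp: w_def side_eq complex_eq_iff)
  ultimately have "w \<in> std_triangle \<inter> ball z d" using side_subset[of Red] b by auto
  then have "t w \<in> U" using d(2) by blast
  then show ?thesis using wR by blast
qed

text \<open>The reference subdivision \<open>T'\<close> has known combinatorics: half-edge and blue
  side determine a triangle, and every blue side is shared by triangles on both halves of the edge.
  About \<open>T\<close> nothing of the kind is known beforehand; it is obtained through the
  matching with \<open>T'\<close>.\<close>

locale subdivision_pair = subdivision G s p T + other: subdivision G s' p' T'
  for G :: "('a, 'e) embedded_graph" and s p T s' p' T' +
  assumes regular: "\<And>t u. t \<in> T' \<Longrightarrow> u \<in> T' \<Longrightarrow> t ` side Red = u ` side Red \<Longrightarrow> t ` side Blue = u ` side Blue \<Longrightarrow> t = u"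
    and partner: "\<And>t. t \<in> T' \<Longrightarrow> \<exists>u\<in>T'. u ` side Blue = t ` side Blue \<and> u ` side Red \<noteq> t ` side Red"
begin

text \<open>The reference triangles on both halves of an edge that lie on the same side of it. As
  one set it represents this side at every inner point of the edge, the split point
  included.\<close>

definition edge_side :: "(complex \<Rightarrow> 'a) \<Rightarrow> 'a set" where
  "edge_side t = (\<Union>u\<in>{u \<in> T'. t ` side Blue = u ` side Blue}. u ` std_triangle)"

lemma other_edge_side_wedge: "t \<in> T' \<Longrightarrow> other.wedge (t 1) t = edge_side t"
  unfolding edge_side_def other.wedge_def using other.adjacent_at_one[of t]
  by (intro arg_cong[of _ _ "\<lambda>S. \<Union>u\<in>S. u ` std_triangle"]) auto

lemma edge_side_eq_iff:
  assumes "t \<in> T'" "u \<in> T'" "fst (other.edge_end t) = fst (other.edge_end u)"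
  shows "edge_side t = edge_side u \<longleftrightarrow> t ` side Blue = u ` side Blue"
proof -
  have 1: "t 1 = u 1" using other.edge_of_eq_iff[OF assms(1,2)] assms(3) by simp
  have "other.wedge (t 1) t = other.wedge (t 1) u \<longleftrightarrow> other.adjacent_at (t 1) t u"
    using other.wedge_eq_iff[of t "t 1" u] other.triangles_at_one[OF assms(1)] other.triangles_at_one[OF assms(2)]
      other.one_in_graph[OF assms(1)] 1 by simp
  then show ?thesis
    using other_edge_side_wedge[OF assms(1)] other_edge_side_wedge[OF assms(2)] other.adjacent_at_one[OF assms(1,2)] 1 by simp
qed

lemma partner_end:
  assumes t: "t \<in> T'" "other.edge_end t = (e, a)"
  obtains u where "u \<in> T'" "other.edge_end u = (e, b)" "u ` side Blue = t ` side Blue"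
proof (cases "a = b")
  case False
  obtain u where u: "u \<in> T'" "u ` side Blue = t ` side Blue" "u ` side Red \<noteq> t ` side Red"
    using partner[OF t(1)] by blast
  have "fst (other.edge_end u) = e"
    using other.edge_of_eq_iff[OF u(1) t(1)] other.blue_imp_edge[OF u(1) t(1) u(2)] t(2) by simp
  moreover have "other.edge_end u \<noteq> (e, a)" using other.edge_end_eq_iff_red[OF u(1) t(1)] u(3) t(2) by simp
  ultimately have "other.edge_end u = (e, b)" using False by (cases "other.edge_end u") auto
  then show thesis using that u by blast
qed (use that t in blast)

lemma edge_side_closedin: "closedin X (edge_side t)"
  unfolding edge_side_def using other.finite_T other.T_closedin[OF _ compact_std_triangle order_refl]
  by (auto intro!: closedin_Union)

text \<open>By \<open>regular\<close>, any other triangle of the edge side lies on the other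
  half-edge and so misses the point.\<close>

lemma germ_eq_edge_side:
  assumes e: "e \<in> edges G" and r: "r \<in> half_interval (s' e) a" and t: "t \<in> T'" "other.edge_end t = (e, a)"
  shows "germ_eq X E (curve G e r) (t ` std_triangle) (edge_side t)"
proof -
  let ?x = "curve G e r"
  let ?I = "{u \<in> T'. u \<noteq> t \<and> t ` side Blue = u ` side Blue}"
  let ?U = "topspace X - (\<Union>u\<in>?I. u ` std_triangle)"
  have at: "other.triangles_at ?x = {t \<in> T'. other.edge_end t = (e, a)}" using other.triangles_at_open_edge(1)[OF e r] .
  have "closedin X (\<Union>u\<in>?I. u ` std_triangle)"
    using other.finite_T other.T_closedin[OF _ compact_std_triangle order_refl] by (auto intro!: closedin_Union)
  then have "openin X ?U" by blast
  moreover have "?x \<in> ?U"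
  proof -
    have "?x \<in> topspace X" using curve_in_graph[OF e] other.half_interval_subset[OF e, of a] r graph_subset_topspace by fastforce
    moreover have "?x \<notin> u ` std_triangle" if u: "u \<in> ?I" for u
    proof
      assume "?x \<in> u ` std_triangle"
      then have "other.edge_end u = (e, a)" using at u unfolding other.triangles_at_def by blast
      then have "u ` side Red = t ` side Red" using other.edge_end_eq_iff_red[of u t] u t by auto
      then show False using regular[of u t] u t(1) by auto
    qed
    ultimately show ?thesis by blast
  qed
  moreover have "?U \<inter> t ` std_triangle - E = ?U \<inter> edge_side t - E"
    using t(1) unfolding edge_side_def by blast
  ultimately show ?thesis unfolding germ_eq_def by blast
qed

text \<open>At the split point of \<open>T'\<close> the edge sides are the sectors themselves.
  Elsewhere the sectors are single triangles, which may be enlarged to edge sides; by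
  \<open>partner\<close> every edge side arises already from the given half.\<close>

lemma edge_side_germ_family:
  assumes e: "e \<in> edges G" and r: "r \<in> {0<..<1}"
  shows "germ_family X E (curve G e r) (edge_side ` {t \<in> T'. fst (other.edge_end t) = e})"
proof -
  let ?x = "curve G e r"
  have x: "?x \<in> E" using curve_in_graph[OF e] r by simp
  note fam = other.wedge_germ_family[OF x]
  consider "r = s' e" | a where "r \<in> half_interval (s' e) a"
    using r unfolding half_interval_def by (cases "r < s' e"; cases "r = s' e") force+
  then show ?thesis
  proof cases
    case 1
    have "other.triangles_at ?x = {t \<in> T'. fst (other.edge_end t) = e}"
      using other.triangles_at_split[OF e] 1 by simp
    moreover have "other.wedge ?x t = edge_side t" if "t \<in> T'" "fst (other.edge_end t) = e" for t
      using other_edge_side_wedge[OF that(1)] other.edge_iff[OF that(1) e] that(2) 1 by simp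
    ultimately have "other.wedge ?x ` other.triangles_at ?x = edge_side ` {t \<in> T'. fst (other.edge_end t) = e}" by auto
    then show ?thesis using fam by simp
  next
    case 2
    let ?I = "{t \<in> T'. other.edge_end t = (e, a)}"
    note oe = other.triangles_at_open_edge[OF e 2]
    \<comment> \<open>\<open>germ_family_cong\<close> asks for a map on sets, so the triangle has to
      be recovered from its image; this is possible because different triangles have different germs
      at the point.\<close>
    define \<phi> where "\<phi> = (\<lambda>A. edge_side (inv_into ?I (\<lambda>t. t ` std_triangle) A))"
    have w: "other.wedge ?x ` other.triangles_at ?x = (\<lambda>t. t ` std_triangle) ` ?I" using oe(1,3) by auto
    have inj: "inj_on (\<lambda>t. t ` std_triangle) ?I"
    proof (rule inj_onI)
      fix t u assume tu: "t \<in> ?I" "u \<in> ?I" "t ` std_triangle = u ` std_triangle"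
      then have "other.wedge ?x t = other.wedge ?x u" using oe(1) oe(3)[of t] oe(3)[of u] by simp
      then show "t = u" using other.wedge_eq_iff[of t ?x u] tu oe(1) oe(2)[of t u] x by auto
    qed
    have \<phi>: "\<phi> (t ` std_triangle) = edge_side t" if "t \<in> ?I" for t
      unfolding \<phi>_def using inv_into_f_f[OF inj that] by simp
    have "germ_family X E ?x (\<phi> ` (\<lambda>t. t ` std_triangle) ` ?I)"
    proof (rule germ_family_cong)
      show "germ_family X E ?x ((\<lambda>t. t ` std_triangle) ` ?I)" using fam w by simp
      show "?x \<in> topspace X" using x graph_subset_topspace by blast
      fix A assume "A \<in> (\<lambda>t. t ` std_triangle) ` ?I"
      then obtain t where t: "t \<in> ?I" "A = t ` std_triangle" by blast
      then show "closedin X (\<phi> A) \<and> germ_eq X E ?x A (\<phi> A)"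
        using \<phi>[OF t(1)] edge_side_closedin germ_eq_edge_side[OF e 2, of t] by simp
    qed
    moreover have "\<phi> ` (\<lambda>t. t ` std_triangle) ` ?I = edge_side ` ?I" unfolding image_image by (rule image_cong[OF refl \<phi>])
    moreover have "edge_side ` ?I = edge_side ` {t \<in> T'. fst (other.edge_end t) = e}"
    proof
      show "edge_side ` {t \<in> T'. fst (other.edge_end t) = e} \<subseteq> edge_side ` ?I"
      proof
        fix B assume "B \<in> edge_side ` {t \<in> T'. fst (other.edge_end t) = e}"
        then obtain t where t': "t \<in> T'" "fst (other.edge_end t) = e" "B = edge_side t" by blast
        then obtain b where t: "t \<in> T'" "other.edge_end t = (e, b)" "B = edge_side t" by (metis prod.collapse)
        obtain u where u: "u \<in> T'" "other.edge_end u = (e, a)" "u ` side Blue = t ` side Blue"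
          using partner_end[OF t(1,2)] .
        then have "edge_side u = B" using t(3) unfolding edge_side_def by simp
        then show "B \<in> edge_side ` ?I" using u by blast
      qed
    qed auto
    ultimately show ?thesis by simp
  qed
qed

abbreviation "edge_sides e \<equiv> edge_side ` {t \<in> T'. fst (other.edge_end t) = e}"

text \<open>Passes germs to a limit: if along \<open>S\<close> the triangle \<open>t\<close> looks
  like \<open>D\<close>, then arbitrarily close to the limit point \<open>y\<close> of
  \<open>S\<close> there are points off the graph in both \<open>C\<close> and \<open>D'\<close>,
  which forces these two members of the family to agree.\<close>

lemma germ_extends:
  assumes y: "y \<in> topspace X" and fam: "germ_family X E y \<C>" and CD: "C \<in> \<C>" "D' \<in> \<C>" "D \<subseteq> D'"
    and W: "germ_eq X E y W C" "t ` std_triangle \<subseteq> W" and t: "t \<in> T"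
    and S: "\<And>U. openin X U \<Longrightarrow> y \<in> U \<Longrightarrow> S \<inter> U \<noteq> {}"
    and eq: "\<And>x. x \<in> S \<Longrightarrow> x \<in> E \<and> x \<in> t ` std_triangle \<and> germ_eq X E x (t ` std_triangle) D"
  shows "C = D'"
proof (rule germ_family_unique[OF fam y CD(1,2)])
  fix U assume U: "openin X U" "y \<in> U"
  obtain U1 where U1: "openin X U1" "y \<in> U1" "U1 \<inter> W - E = U1 \<inter> C - E" using W(1) unfolding germ_eq_def by blast
  have "S \<inter> (U \<inter> U1) \<noteq> {}" using S[of "U \<inter> U1"] U U1 by (simp add: openin_Int)
  then obtain x where x: "x \<in> S" "x \<in> U" "x \<in> U1" by blast
  obtain V where V: "openin X V" "x \<in> V" "V \<inter> t ` std_triangle - E = V \<inter> D - E"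
    using eq[OF x(1)] unfolding germ_eq_def by blast
  have "openin X (V \<inter> (U \<inter> U1))" "x \<in> V \<inter> (U \<inter> U1)" using V U U1 x by auto
  from triangle_meets_nbhd'[OF t _ _ this] eq[OF x(1)]
  obtain z where "z \<in> t ` std_triangle" "z \<in> V \<inter> (U \<inter> U1)" "z \<notin> E" by blast
  then show "U \<inter> C \<inter> D' - E \<noteq> {}" using V(3) U1(3) W(2) CD(3) by blast
qed

section \<open>Sides of an arbitrary subdivision and the matching with the reference\<close>

text \<open>At each point of the open half-edge, uniqueness of germs picks one side for
  \<open>t\<close>. Equality of germs is an open condition and the half-edge is connected, so the
  side is the same all along.\<close>

lemma side_of_triangle:
  assumes t: "t \<in> T" "edge_end t = (e, a)"
  shows "\<exists>!B. B \<in> edge_sides e \<and> (\<forall>x\<in>curve G e ` half_interval (s e) a. germ_eq X E x (t ` std_triangle) B)"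
proof -
  note ee = edge_end[OF t]
  let ?S = "curve G e ` half_interval (s e) a"
  define R where "R x B \<longleftrightarrow> B \<in> edge_sides e \<and> germ_eq X E x (t ` std_triangle) B" for x B
  have S: "?S = t ` (side Red - {0, 1})" using edge_end_open[OF t] by simp
  have pts: "x \<in> topspace X \<and> (\<exists>r. r \<in> half_interval (s e) a \<and> r \<in> {0<..<1} \<and> x = curve G e r)" if x: "x \<in> ?S" for x
  proof -
    obtain r where r: "r \<in> half_interval (s e) a" "x = curve G e r" using x by blast
    then have "r \<in> {0<..<1}" using half_interval_subset[OF ee(1)] by blast
    then show ?thesis using r curve_in_graph[OF ee(1), of r] graph_subset_topspace by auto
  qed
  have ex: "\<exists>B. R x B" and un: "\<And>B C. R x B \<Longrightarrow> R x C \<Longrightarrow> B = C" if x: "x \<in> ?S" for x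
  proof -
    obtain r where r: "r \<in> half_interval (s e) a" "r \<in> {0<..<1}" "x = curve G e r" using pts[OF x] by blast
    have xE: "x \<in> E" using curve_in_graph[OF ee(1)] r by simp
    have fam: "germ_family X E x (edge_sides e)" using edge_side_germ_family[OF ee(1) r(2)] r(3) by simp
    have tx: "t \<in> triangles_at x" using triangles_at_open_edge(1)[OF ee(1) r(1)] r(3) t by simp
    have "t ` std_triangle = wedge x t" using triangles_at_open_edge(3)[OF ee(1) r(1)] tx r(3) by simp
    then have "t ` std_triangle \<in> wedge x ` triangles_at x" using tx by blast
    from germ_family_match[OF wedge_germ_family[OF xE] fam _ this] pts[OF x] show "\<exists>B. R x B"
      unfolding R_def by blast
    show "B = C" if "R x B" "R x C" for B C
    proof (rule germ_eq_family_imp_eq[OF fam])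
      show "x \<in> topspace X" using pts[OF x] by blast
      show "B \<in> edge_sides e" "C \<in> edge_sides e" using that unfolding R_def by simp_all
      have "germ_eq X E x B (t ` std_triangle)" using that(1) germ_eq_sym unfolding R_def by metis
      then show "germ_eq X E x B C" using that(2) germ_eq_trans unfolding R_def by metis
    qed
  qed
  have op: "openin X {x \<in> topspace X. R x B}" for B
    using germ_eq_open[of X E "t ` std_triangle" B] unfolding R_def by (cases "B \<in> edge_sides e") auto
  have conn: "connectedin X ?S"
    unfolding S
  proof (rule T_connectedin[OF t(1)])
    have "side Red - {0, 1} = open_segment 0 1" by (auto simp: side.simps open_segment_def)
    then show "connected (side Red - {0, 1})" by (simp add: convex_connected)
    show "side Red - {0, 1} \<subseteq> std_triangle" using side_subset by blast
  qed
  have ne: "?S \<noteq> {}" using split_inside[OF ee(1)] unfolding half_interval_def by auto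
  then obtain x0 where x0: "x0 \<in> ?S" by blast
  then obtain B0 where B0: "R x0 B0" using ex by blast
  have all: "R x B0" if "x \<in> ?S" for x
    by (rule connectedin_constant[OF conn x0, of R]) (use B0 op ex un that in auto)
  show ?thesis
  proof (rule ex1I[of _ B0])
    show "B0 \<in> edge_sides e \<and> (\<forall>x\<in>?S. germ_eq X E x (t ` std_triangle) B0)" using all x0 unfolding R_def by blast
    fix B assume "B \<in> edge_sides e \<and> (\<forall>x\<in>?S. germ_eq X E x (t ` std_triangle) B)"
    then have "R x0 B" using x0 unfolding R_def by blast
    then show "B = B0" using un[OF x0] B0 by blast
  qed
qed

definition side_of :: "(complex \<Rightarrow> 'a) \<Rightarrow> 'a set" where
  "side_of t = (THE B. B \<in> edge_sides (fst (edge_end t)) \<and>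
     (\<forall>x\<in>curve G (fst (edge_end t)) ` half_interval (s (fst (edge_end t))) (snd (edge_end t)). germ_eq X E x (t ` std_triangle) B))"

lemma side_of:
  assumes t: "t \<in> T" "edge_end t = (e, a)"
  shows "side_of t \<in> edge_sides e"
    and "\<And>r. r \<in> half_interval (s e) a \<Longrightarrow> germ_eq X E (curve G e r) (t ` std_triangle) (side_of t)"
  using theI'[OF side_of_triangle[OF t]] unfolding side_of_def by (auto simp: t(2))

text \<open>The limit of the preceding result at the split point of \<open>T\<close>, where the
  triangle has to be replaced by its whole sector.\<close>

lemma side_of_at_split:
  assumes t: "t \<in> T"
  shows "germ_eq X E (t 1) (wedge (t 1) t) (side_of t)"
proof -
  obtain e a where ea: "edge_end t = (e, a)" by fastforce
  note ee = edge_end[OF t ea]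
  have r: "s e \<in> {0<..<1}" using split_inside[OF ee(1)] by simp
  have E1: "t 1 \<in> E" using one_in_graph[OF t] .
  then have top: "t 1 \<in> topspace X" using graph_subset_topspace by blast
  have fam: "germ_family X E (t 1) (edge_sides e)" using edge_side_germ_family[OF ee(1) r] ee(2) by simp
  have mem: "wedge (t 1) t \<in> wedge (t 1) ` triangles_at (t 1)" using triangles_at_one[OF t] by blast
  obtain C where C: "C \<in> edge_sides e" "germ_eq X E (t 1) (wedge (t 1) t) C"
    using germ_family_match[OF wedge_germ_family[OF E1] fam top mem] .
  have "C = side_of t"
  proof (rule germ_extends[OF top fam C(1) side_of(1)[OF t ea] order_refl C(2) triangle_subset_wedge[OF t] t])
    fix U assume "openin X U" "t 1 \<in> U"
    then show "curve G e ` half_interval (s e) a \<inter> U \<noteq> {}"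
      using open_edge_accumulates[OF t, of 1 U] edge_end_open[OF t ea] by simp
  next
    fix x assume "x \<in> curve G e ` half_interval (s e) a"
    then obtain r where r: "r \<in> half_interval (s e) a" "x = curve G e r" by blast
    then show "x \<in> E \<and> x \<in> t ` std_triangle \<and> germ_eq X E x (t ` std_triangle) (side_of t)"
      using side_of(2)[OF t ea r(1)] half_interval_subset[OF ee(1), of a] curve_in_graph[OF ee(1), of r]
        triangles_at_open_edge(1)[OF ee(1) r(1)] t ea unfolding triangles_at_def by fastforce
  qed
  then show ?thesis using C(2) by simp
qed

text \<open>Both conditions say that the sectors at the split point coincide: for blue sides by
  \<open>adjacent_at_one\<close>, for sides of the edge by the germs found in
  \<open>side_of_at_split\<close>.\<close>

lemma blue_iff_side_of:
  assumes t: "t \<in> T" "u \<in> T" "fst (edge_end t) = fst (edge_end u)"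
  shows "t ` side Blue = u ` side Blue \<longleftrightarrow> side_of t = side_of u"
proof -
  obtain e a b where ea: "edge_end t = (e, a)" "edge_end u = (e, b)" using t(3) by (metis prod.collapse)
  have 1: "t 1 = u 1" using edge_of_eq_iff[OF t(1,2)] t(3) by simp
  have E1: "t 1 \<in> E" using one_in_graph[OF t(1)] .
  then have top: "t 1 \<in> topspace X" using graph_subset_topspace by blast
  have r: "s e \<in> {0<..<1}" using split_inside[of e] edge_end(1)[OF t(1) ea(1)] by simp
  have fam: "germ_family X E (t 1) (edge_sides e)"
    using edge_side_germ_family[OF edge_end(1)[OF t(1) ea(1)] r] edge_end(2)[OF t(1) ea(1)] by simp
  have mem: "t \<in> triangles_at (t 1)" "u \<in> triangles_at (t 1)"
    using triangles_at_one[OF t(1)] triangles_at_one[OF t(2)] 1 by auto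
  have gt: "germ_eq X E (t 1) (wedge (t 1) t) (side_of t)" using side_of_at_split[OF t(1)] .
  have gu: "germ_eq X E (t 1) (wedge (t 1) u) (side_of u)" using side_of_at_split[OF t(2)] 1 by simp
  have "wedge (t 1) t = wedge (t 1) u \<longleftrightarrow> side_of t = side_of u"
  proof
    assume "wedge (t 1) t = wedge (t 1) u"
    then have "germ_eq X E (t 1) (side_of t) (side_of u)" using gt gu germ_eq_sym germ_eq_trans by metis
    then show "side_of t = side_of u"
      using germ_eq_family_imp_eq[OF fam top side_of(1)[OF t(1) ea(1)] side_of(1)[OF t(2) ea(2)]] by simp
  next
    assume "side_of t = side_of u"
    then have "germ_eq X E (t 1) (wedge (t 1) t) (wedge (t 1) u)" using gt gu germ_eq_sym germ_eq_trans by metis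
    then show "wedge (t 1) t = wedge (t 1) u"
      using germ_eq_family_imp_eq[OF wedge_germ_family[OF E1] top] mem by simp
  qed
  then show ?thesis using wedge_eq_iff[OF mem E1] adjacent_at_one[OF t(1,2)] by simp
qed

text \<open>Some reference triangle lies on the required side of the edge; \<open>partner\<close>
  moves it to the required half, and \<open>regular\<close> makes it unique.\<close>

lemma match_exists:
  assumes t: "t \<in> T"
  shows "\<exists>!t'. t' \<in> T' \<and> other.edge_end t' = edge_end t \<and> edge_side t' = side_of t"
proof -
  obtain e a where ea: "edge_end t = (e, a)" by fastforce
  obtain t0 b where t0: "t0 \<in> T'" "other.edge_end t0 = (e, b)" "side_of t = edge_side t0"
  proof -
    obtain t0 where "t0 \<in> T'" "fst (other.edge_end t0) = e" "side_of t = edge_side t0" using side_of(1)[OF t ea] by blast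
    then show thesis using that[of t0 "snd (other.edge_end t0)"] by (metis prod.collapse)
  qed
  obtain t' where t': "t' \<in> T'" "other.edge_end t' = (e, a)" "t' ` side Blue = t0 ` side Blue"
    using partner_end[OF t0(1,2)] .
  show ?thesis
  proof (rule ex1I[of _ t'])
    show "t' \<in> T' \<and> other.edge_end t' = edge_end t \<and> edge_side t' = side_of t"
      using t' t0 ea edge_side_eq_iff[OF t'(1) t0(1)] by simp
    fix u assume u: "u \<in> T' \<and> other.edge_end u = edge_end t \<and> edge_side u = side_of t"
    then have "u ` side Blue = t' ` side Blue"
      using edge_side_eq_iff[of u t0] t0 t' ea by simp
    moreover have "u ` side Red = t' ` side Red" using other.edge_end_eq_iff_red[of u t'] u t' ea by simp
    ultimately show "u = t'" using regular u t' by blast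
  qed
qed

definition match :: "(complex \<Rightarrow> 'a) \<Rightarrow> complex \<Rightarrow> 'a" where
  "match t = (THE t'. t' \<in> T' \<and> other.edge_end t' = edge_end t \<and> edge_side t' = side_of t)"

lemma match: "t \<in> T \<Longrightarrow> match t \<in> T'" "t \<in> T \<Longrightarrow> other.edge_end (match t) = edge_end t"
  "t \<in> T \<Longrightarrow> edge_side (match t) = side_of t"
  using theI'[OF match_exists] unfolding match_def by blast+

lemma match_germ:
  assumes t: "t \<in> T" "edge_end t = (e, a)" and r: "r \<in> half_interval (s e) a" "r \<in> half_interval (s' e) a"
  shows "germ_eq X E (curve G e r) (t ` std_triangle) (match t ` std_triangle)"
proof -
  have "germ_eq X E (curve G e r) (match t ` std_triangle) (edge_side (match t))"
    by (rule germ_eq_edge_side[OF edge_end(1)[OF t] r(2)]) (use match t in auto)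
  then show ?thesis using side_of(2)[OF t r(1)] match(3)[OF t(1)] germ_eq_sym germ_eq_trans by metis
qed

text \<open>The two subdivisions may split the edge at different points. A parameter closer to the
  end than both of them belongs to both halves.\<close>

lemma common_point:
  assumes "e \<in> edges G"
  obtains r where "r \<in> half_interval (s e) a" "r \<in> half_interval (s' e) a"
proof (cases a)
  case True
  show ?thesis by (rule that[of "min (s e) (s' e) / 2"])
      (use True split_inside[OF assms] other.split_inside[OF assms] in \<open>auto simp: half_interval_def min_def\<close>)
next
  case False
  show ?thesis by (rule that[of "(max (s e) (s' e) + 1) / 2"])
      (use False split_inside[OF assms] other.split_inside[OF assms] in \<open>auto simp: half_interval_def max_def\<close>)
qed

text \<open>At a point common to both halves a triangle is recovered from its germ, which it shares
  with its match. This gives injectivity, and matching the germ of a reference side backwards gives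
  surjectivity.\<close>

lemma match_bij: "bij_betw match T T'"
proof (rule bij_betwI')
  fix t u assume tu: "t \<in> T" "u \<in> T"
  show "match t = match u \<longleftrightarrow> t = u"
  proof
    assume eq: "match t = match u"
    obtain e a where ea: "edge_end t = (e, a)" by fastforce
    then have ea': "edge_end u = (e, a)" using match(2)[OF tu(1)] match(2)[OF tu(2)] eq by simp
    note e = edge_end(1)[OF tu(1) ea]
    obtain r where r: "r \<in> half_interval (s e) a" "r \<in> half_interval (s' e) a" using common_point[OF e] .
    let ?x = "curve G e r"
    have x: "?x \<in> E" using half_interval_subset[OF e] r(1) curve_in_graph[OF e] by fastforce
    have at: "t \<in> triangles_at ?x" "u \<in> triangles_at ?x" using triangles_at_open_edge(1)[OF e r(1)] tu ea ea' by auto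
    have "germ_eq X E ?x (t ` std_triangle) (u ` std_triangle)"
      using match_germ[OF tu(1) ea r] match_germ[OF tu(2) ea' r] eq germ_eq_sym germ_eq_trans by metis
    then have "germ_eq X E ?x (wedge ?x t) (wedge ?x u)" using triangles_at_open_edge(3)[OF e r(1)] at by simp
    then have "wedge ?x t = wedge ?x u"
      using germ_eq_family_imp_eq[OF wedge_germ_family[OF x]] at x graph_subset_topspace by blast
    then show "t = u" using wedge_eq_iff[OF at x] triangles_at_open_edge(2)[OF e r(1) at(1)] by simp
  qed simp
next
  fix t assume "t \<in> T" then show "match t \<in> T'" using match by blast
next
  fix t' assume t': "t' \<in> T'"
  obtain e a where ea: "other.edge_end t' = (e, a)" by fastforce
  note e = other.edge_end(1)[OF t' ea]
  obtain r where r: "r \<in> half_interval (s e) a" "r \<in> half_interval (s' e) a" using common_point[OF e] .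
  let ?x = "curve G e r"
  have r1: "r \<in> {0<..<1}" using half_interval_subset[OF e] r(1) by blast
  have x: "?x \<in> E" using r1 curve_in_graph[OF e] by simp
  then have top: "?x \<in> topspace X" using graph_subset_topspace by blast
  have mem: "edge_side t' \<in> edge_sides e" using t' ea by auto
  note fam = edge_side_germ_family[OF e r1]
  obtain A where A: "A \<in> wedge ?x ` triangles_at ?x" "germ_eq X E ?x (edge_side t') A"
    using germ_family_match[OF fam wedge_germ_family[OF x] top mem] .
  then obtain t where t: "t \<in> triangles_at ?x" "A = wedge ?x t" by blast
  then have tT: "t \<in> T" "edge_end t = (e, a)" using triangles_at_open_edge(1)[OF e r(1)] by auto
  have "germ_eq X E ?x (t ` std_triangle) (side_of t)" using side_of(2)[OF tT r(1)] .
  moreover have "germ_eq X E ?x (edge_side t') (t ` std_triangle)"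
    using A(2) t(2) triangles_at_open_edge(3)[OF e r(1) t(1)] by simp
  ultimately have "germ_eq X E ?x (edge_side t') (side_of t)" using germ_eq_trans by metis
  then have "edge_side t' = side_of t"
    using germ_eq_family_imp_eq[OF fam top mem side_of(1)[OF tT]] by simp
  then have "match t = t'" using match_exists[OF tT(1)] match[OF tT(1)] t' ea tT(2) by metis
  then show "\<exists>t\<in>T. t' = match t" using tT by blast
qed

lemma match_zero: "t \<in> T \<Longrightarrow> match t 0 = t 0"
  using edge_end_zero[of t] other.edge_end_zero[of "match t"] match by (metis prod.collapse)

text \<open>A triangle and its match have the same germ along the half-edge near the vertex; in the
  limit their sectors at the vertex agree. This is what makes yellow adjacency an invariant of the
  embedding.\<close>

lemma match_wedge:
  assumes t: "t \<in> T"
  shows "germ_eq X E (t 0) (wedge (t 0) t) (other.wedge (t 0) (match t))"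
proof -
  obtain e a where ea: "edge_end t = (e, a)" by fastforce
  note ee = edge_end[OF t ea]
  have E0: "t 0 \<in> E" using zero_in_graph[OF t] .
  then have top: "t 0 \<in> topspace X" using graph_subset_topspace by blast
  have mem: "wedge (t 0) t \<in> wedge (t 0) ` triangles_at (t 0)" using triangles_at_zero[OF t] by blast
  have mem': "other.wedge (t 0) (match t) \<in> other.wedge (t 0) ` other.triangles_at (t 0)"
    using other.triangles_at_zero[OF match(1)[OF t]] match_zero[OF t] by simp
  obtain C where C: "C \<in> other.wedge (t 0) ` other.triangles_at (t 0)" "germ_eq X E (t 0) (wedge (t 0) t) C"
    using germ_family_match[OF wedge_germ_family[OF E0] other.wedge_germ_family[OF E0] top mem] .
  let ?S = "curve G e ` (half_interval (s e) a \<inter> half_interval (s' e) a)"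
  have "C = other.wedge (t 0) (match t)"
  proof (rule germ_extends[OF top other.wedge_germ_family[OF E0] C(1) mem'
        other.triangle_subset_wedge[OF match(1)[OF t]] C(2) triangle_subset_wedge[OF t] t, where S = ?S])
    fix x assume "x \<in> ?S"
    then obtain r where r: "r \<in> half_interval (s e) a" "r \<in> half_interval (s' e) a" "x = curve G e r" by blast
    then show "x \<in> E \<and> x \<in> t ` std_triangle \<and> germ_eq X E x (t ` std_triangle) (match t ` std_triangle)"
      using match_germ[OF t ea r(1,2)] half_interval_subset[OF ee(1), of a] curve_in_graph[OF ee(1), of r]
        triangles_at_open_edge(1)[OF ee(1) r(1)] t ea unfolding triangles_at_def by fastforce
  next
    fix U assume U: "openin X U" "t 0 \<in> U"
    have t': "match t \<in> T'" "other.edge_end (match t) = (e, a)" using match t ea by auto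
    \<comment> \<open>the two open halves are intervals with the same end, so one of them is the smaller\<close>
    have "half_interval (s e) a \<subseteq> half_interval (s' e) a \<or> half_interval (s' e) a \<subseteq> half_interval (s e) a"
      by (auto simp: half_interval_def)
    then consider "half_interval (s e) a \<inter> half_interval (s' e) a = half_interval (s e) a"
      | "half_interval (s e) a \<inter> half_interval (s' e) a = half_interval (s' e) a" by blast
    then show "?S \<inter> U \<noteq> {}"
    proof cases
      case 1
      show ?thesis using open_edge_accumulates[OF t, of 0 U] U edge_end_open[OF t ea] unfolding 1 by simp
    next
      case 2
      show ?thesis
        using other.open_edge_accumulates[OF t'(1), of 0 U] U other.edge_end_open[OF t'] match_zero[OF t] unfolding 2 by simp
    qed
  qed
  then show ?thesis using C(2) by simp
qed

lemma match_yellow: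
  assumes t: "t \<in> T" "u \<in> T"
  shows "t ` side Yellow = u ` side Yellow \<longleftrightarrow> match t ` side Yellow = match u ` side Yellow"
proof (cases "t 0 = u 0")
  case False
  then show ?thesis
    using yellow_imp_zero[OF t] other.yellow_imp_zero[of "match t" "match u"] match match_zero t by metis
next
  case True
  have E0: "t 0 \<in> E" using zero_in_graph[OF t(1)] .
  then have top: "t 0 \<in> topspace X" using graph_subset_topspace by blast
  have mem: "t \<in> triangles_at (t 0)" "u \<in> triangles_at (t 0)"
    using triangles_at_zero[OF t(1)] triangles_at_zero[OF t(2)] True by auto
  have mem': "match t \<in> other.triangles_at (t 0)" "match u \<in> other.triangles_at (t 0)"
    using other.triangles_at_zero match t match_zero True by metis+
  have g: "germ_eq X E (t 0) (wedge (t 0) t) (other.wedge (t 0) (match t))"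
    "germ_eq X E (t 0) (wedge (t 0) u) (other.wedge (t 0) (match u))"
    using match_wedge[OF t(1)] match_wedge[OF t(2)] True by auto
  have "wedge (t 0) t = wedge (t 0) u \<longleftrightarrow> other.wedge (t 0) (match t) = other.wedge (t 0) (match u)"
  proof
    assume "wedge (t 0) t = wedge (t 0) u"
    then have "germ_eq X E (t 0) (other.wedge (t 0) (match t)) (other.wedge (t 0) (match u))"
      using g germ_eq_sym germ_eq_trans by metis
    then show "other.wedge (t 0) (match t) = other.wedge (t 0) (match u)"
      using germ_eq_family_imp_eq[OF other.wedge_germ_family[OF E0] top] mem' by simp
  next
    assume "other.wedge (t 0) (match t) = other.wedge (t 0) (match u)"
    then have "germ_eq X E (t 0) (wedge (t 0) t) (wedge (t 0) u)" using g germ_eq_sym germ_eq_trans by metis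
    then show "wedge (t 0) t = wedge (t 0) u"
      using germ_eq_family_imp_eq[OF wedge_germ_family[OF E0] top] mem by simp
  qed
  moreover have "other.adjacent_at (t 0) (match t) (match u) \<longleftrightarrow> match t ` side Yellow = match u ` side Yellow"
    using other.adjacent_at_zero[OF match(1)[OF t(1)] match(1)[OF t(2)]] match_zero[OF t(1)] by simp
  ultimately show ?thesis
    using wedge_eq_iff[OF mem E0] other.wedge_eq_iff[OF mem' E0] adjacent_at_zero[OF t] by simp
qed

lemma match_red:
  assumes t: "t \<in> T" "u \<in> T"
  shows "t ` side Red = u ` side Red \<longleftrightarrow> match t ` side Red = match u ` side Red"
  using edge_end_eq_iff_red[OF t] other.edge_end_eq_iff_red[OF match(1)[OF t(1)] match(1)[OF t(2)]]
    match(2)[OF t(1)] match(2)[OF t(2)] by simp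

lemma match_blue:
  assumes t: "t \<in> T" "u \<in> T"
  shows "t ` side Blue = u ` side Blue \<longleftrightarrow> match t ` side Blue = match u ` side Blue"
proof (cases "fst (edge_end t) = fst (edge_end u)")
  case True
  then show ?thesis
    using blue_iff_side_of[OF t True] edge_side_eq_iff[OF match(1)[OF t(1)] match(1)[OF t(2)]]
      match(2,3)[OF t(1)] match(2,3)[OF t(2)] by simp
next
  case False
  have "match t ` side Blue \<noteq> match u ` side Blue"
    using False other.blue_imp_edge[OF match(1)[OF t(1)] match(1)[OF t(2)]]
      other.edge_of_eq_iff[OF match(1)[OF t(1)] match(1)[OF t(2)]] match(2)[OF t(1)] match(2)[OF t(2)] by auto
  moreover have "t ` side Blue \<noteq> u ` side Blue" using False blue_imp_edge[OF t] edge_of_eq_iff[OF t] by auto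
  ultimately show ?thesis by simp
qed

theorem match_iso:
  shows "bij_betw match T T'"
    and "\<And>t u k. t \<in> T \<Longrightarrow> u \<in> T \<Longrightarrow> t ` side k = u ` side k \<longleftrightarrow> match t ` side k = match u ` side k"
    and "\<And>t e. t \<in> T \<Longrightarrow> e \<in> edges G \<Longrightarrow> t 1 = curve G e (s e) \<longleftrightarrow> match t 1 = curve G e (s' e)"
proof -
  show "bij_betw match T T'" by (rule match_bij)
  show "t ` side k = u ` side k \<longleftrightarrow> match t ` side k = match u ` side k" if "t \<in> T" "u \<in> T" for t u k
    using match_red[OF that] match_blue[OF that] match_yellow[OF that] by (cases k) auto
  show "t 1 = curve G e (s e) \<longleftrightarrow> match t 1 = curve G e (s' e)" if "t \<in> T" "e \<in> edges G" for t e
    using edge_iff[OF that] other.edge_iff[OF match(1)[OF that(1)] that(2)] match(2)[OF that(1)] by simp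
qed

end

section \<open>Gaps between disjoint arcs in the circle\<close>

lemma cis_eq_cis_iff: "cis x = cis y \<longleftrightarrow> (\<exists>k::int. x = y + 2 * pi * k)"
  using sin_cos_eq_iff[of x y] by (auto simp: complex_eq_iff)

lemma cis_shift [simp]: "cis (x + 2 * pi * of_int k) = cis x"
  using cis_eq_cis_iff by blast

text \<open>A continuous logarithm lifts the arc to an angle function, which is injective and hence
  monotone. The sign \<open>r\<close> reverses the arc where needed so that the angle
  increases.\<close>

lemma circle_path_lift:
  assumes cont: "continuous_on {-1..1} p" and inj: "inj_on p {-1..1::real}" and sph: "p ` {-1..1} \<subseteq> sphere 0 1"
  obtains \<alpha> \<beta> r and \<psi> :: "real \<Rightarrow> real" where "\<alpha> < \<beta>" "\<beta> < \<alpha> + 2 * pi" "r \<in> {1, -1}"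
    "\<psi> (-1) = \<alpha>" "\<psi> 1 = \<beta>" "\<psi> ` {-1..1} = {\<alpha>..\<beta>}" "\<psi> ` {-1<..<1} \<subseteq> {\<alpha><..<\<beta>}"
    "\<And>y. y \<in> {-1..1} \<Longrightarrow> cis (\<psi> y) = p (r * y)"
proof -
  have "contractible {-1..1::real}" by (simp add: convex_imp_contractible)
  moreover have "p y \<noteq> 0" if "y \<in> {-1..1}" for y using sph that by force
  ultimately obtain g where g: "continuous_on {-1..1} g" "\<And>y. y \<in> {-1..1} \<Longrightarrow> p y = exp (g y)"
    using continuous_logarithm_on_contractible[OF cont] by metis
  define \<phi> where "\<phi> y = Im (g y)" for y
  have \<phi>c: "continuous_on {-1..1} \<phi>" unfolding \<phi>_def using g(1) by (intro continuous_intros)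
  have \<phi>: "p y = cis (\<phi> y)" if "y \<in> {-1..1}" for y
  proof -
    have "p y \<in> sphere 0 1" using sph that by blast
    then have "norm (p y) = 1" by simp
    then have "Re (g y) = 0" using g(2)[OF that] by simp
    then show ?thesis using g(2)[OF that] by (simp add: \<phi>_def exp_eq_polar)
  qed
  have \<phi>inj: "inj_on \<phi> {-1..1}"
    using \<phi> inj by (auto simp: inj_on_def)
  \<comment> \<open>The orientation in which the arc runs counterclockwise.\<close>
  define r where "r = (if \<phi> (-1) < \<phi> 1 then 1 else -1::real)"
  have r: "r \<in> {1, -1}" by (simp add: r_def)
  define \<psi> where "\<psi> y = \<phi> (r * y)" for y
  have ry: "r * y \<in> {-1..1}" if "y \<in> {-1..1}" for y using that r by auto
  have \<psi>c: "continuous_on {-1..1} \<psi>" unfolding \<psi>_def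
    by (rule continuous_on_compose2[OF \<phi>c]) (use ry in \<open>auto intro!: continuous_intros\<close>)
  have \<psi>inj: "inj_on \<psi> {-1..1}"
  proof (rule inj_onI)
    fix x y assume xy: "x \<in> {-1..1}" "y \<in> {-1..1}" "\<psi> x = \<psi> y"
    then have "r * x = r * y" using inj_onD[OF \<phi>inj _ ry ry, of x y] unfolding \<psi>_def by blast
    then show "x = y" using r by auto
  qed
  have "\<phi> (-1) \<noteq> \<phi> 1" using inj_onD[OF \<phi>inj, of "-1" 1] by auto
  then have lt: "\<psi> (-1) < \<psi> 1" unfolding \<psi>_def r_def by auto
  have mid: "\<psi> (-1) < \<psi> y \<and> \<psi> y < \<psi> 1" if "y \<in> {-1<..<1}" for y
    using continuous_inj_imp_mono[of "-1" y 1, OF _ _ \<psi>c \<psi>inj] that lt by auto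
  have img: "\<psi> ` {-1..1} = {\<psi> (-1)..\<psi> 1}"
  proof
    show "\<psi> ` {-1..1} \<subseteq> {\<psi> (-1)..\<psi> 1}"
    proof
      fix z assume "z \<in> \<psi> ` {-1..1}"
      then obtain y where "y \<in> {-1..1}" "z = \<psi> y" by blast
      then show "z \<in> {\<psi> (-1)..\<psi> 1}" using mid[of y] lt by (cases "y = -1"; cases "y = 1") auto
    qed
    show "{\<psi> (-1)..\<psi> 1} \<subseteq> \<psi> ` {-1..1}"
    proof
      fix z assume "z \<in> {\<psi> (-1)..\<psi> 1}"
      then obtain y where "-1 \<le> y" "y \<le> 1" "\<psi> y = z" using IVT'[of \<psi> "-1" z 1] \<psi>c by auto
      then show "z \<in> \<psi> ` {-1..1}" by auto
    qed
  qed
  have cis\<psi>: "cis (\<psi> y) = p (r * y)" if "y \<in> {-1..1}" for y using \<phi>[OF ry[OF that]] unfolding \<psi>_def by simp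
  \<comment> \<open>Otherwise the angle of the starting point is reached again after a full turn,
    against injectivity.\<close>
  have "\<psi> 1 < \<psi> (-1) + 2 * pi"
  proof (rule ccontr)
    assume "\<not> ?thesis"
    then have "\<psi> (-1) + 2 * pi \<in> {\<psi> (-1)..\<psi> 1}" by auto
    then obtain y where y: "y \<in> {-1..1}" "\<psi> y = \<psi> (-1) + 2 * pi" using img by (metis imageE)
    then have "cis (\<psi> y) = cis (\<psi> (-1))" using cis_shift[of "\<psi> (-1)" 1] by simp
    then have "p (r * y) = p (r * (-1))" using cis\<psi>[OF y(1)] cis\<psi>[of "-1"] by simp
    then have "r * y = r * (-1)" using inj_onD[OF inj _ ry[OF y(1)] ry[of "-1"]] by simp
    then have "y = -1" using r by auto
    then show False using y(2) by simp
  qed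
  moreover have "\<psi> ` {-1<..<1} \<subseteq> {\<psi> (-1)<..<\<psi> 1}"
    using mid by (intro image_subsetI) simp
  ultimately show thesis using that[OF lt _ r refl refl img _ cis\<psi>] by blast
qed

lemma least_positive_element:
  assumes "closed S" and "x0 > 0" "x0 \<in> S" and "d > 0" and free: "\<And>x::real. 0 < x \<Longrightarrow> x < d \<Longrightarrow> x \<notin> S"
  obtains l where "l > 0" "l \<in> S" "\<And>x. 0 < x \<Longrightarrow> x < l \<Longrightarrow> x \<notin> S"
proof -
  let ?A = "S \<inter> {d..}"
  have "\<not> x0 < d" using assms(2,3) free[of x0] by blast
  then have "x0 \<in> ?A" using assms(3) by simp
  then have ne: "?A \<noteq> {}" by blast
  have cl: "closed ?A" using assms(1) by auto
  have bdd: "bdd_below ?A" by auto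
  have "Inf ?A \<in> ?A" using closed_contains_Inf[OF ne bdd cl] .
  moreover have "x \<notin> S" if "0 < x" "x < Inf ?A" for x
  proof
    assume "x \<in> S"
    then have "x \<in> ?A" using free[OF that(1)] by force
    then show False using cInf_lower[OF _ bdd, of x] that by simp
  qed
  ultimately show thesis using that[of "Inf ?A"] assms(4) by auto
qed

text \<open>From each end of each arc one walks away from that arc, up to the midpoint of the gap
  before the next arc. The two walks into one gap thus meet exactly at time 1, and equality of the
  values at time 1 says that two arc ends bound the same gap. With a single arc its two ends bound
  one gap.\<close>

lemma circle_gaps:
  fixes P :: "'i \<Rightarrow> real \<Rightarrow> complex"
  assumes fin: "finite I" and ne: "I \<noteq> {}"
    and cont: "\<And>i. i \<in> I \<Longrightarrow> continuous_on {-1..1} (P i)"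
    and inj: "\<And>i. i \<in> I \<Longrightarrow> inj_on (P i) {-1..1}"
    and sph: "\<And>i. i \<in> I \<Longrightarrow> P i ` {-1..1} \<subseteq> sphere 0 1"
    and disj: "\<And>i j. i \<in> I \<Longrightarrow> j \<in> I \<Longrightarrow> i \<noteq> j \<Longrightarrow> P i ` {-1..1} \<inter> P j ` {-1..1} = {}"
  shows "\<exists>\<gamma> :: 'i \<Rightarrow> real \<Rightarrow> real \<Rightarrow> complex.
     (\<forall>i\<in>I. \<forall>b\<in>{-1,1}. continuous_on {0..1} (\<gamma> i b) \<and> \<gamma> i b ` {0..1} \<subseteq> sphere 0 1 \<and> \<gamma> i b 0 = P i b) \<and>
     (\<forall>i\<in>I. \<forall>b\<in>{-1,1}. \<forall>\<tau>\<in>{0<..1}. \<gamma> i b \<tau> \<notin> (\<Union>j\<in>I. P j ` {-1..1})) \<and>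
     (\<forall>i\<in>I. \<forall>b\<in>{-1,1}. \<forall>j\<in>I. \<forall>c\<in>{-1,1}. \<forall>\<tau>\<in>{0..1}. \<forall>\<tau>'\<in>{0..1}. \<gamma> i b \<tau> = \<gamma> j c \<tau>' \<longrightarrow>
        \<tau> = \<tau>' \<and> (i = j \<and> b = c \<or> \<tau> = 1)) \<and>
     sphere 0 1 \<subseteq> (\<Union>i\<in>I. P i ` {-1..1}) \<union> (\<Union>i\<in>I. \<Union>b\<in>{-1,1}. \<gamma> i b ` {0..1})"
proof -
  \<comment> \<open>The angles covered by the arcs, a closed set of period 2 pi. Gaps of the circle
    become gaps of this subset of the line.\<close>
  define B where "B = {x. cis x \<in> (\<Union>i\<in>I. P i ` {-1..1})}"
  have B_cis: "x \<in> B \<longleftrightarrow> y \<in> B" if "cis x = cis y" for x y using that unfolding B_def by simp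
  have clP: "closed (P i ` {-1..1})" if "i \<in> I" for i
    using compact_continuous_image[OF cont[OF that]] by (simp add: compact_imp_closed)
  have cl_vimage: "closed {x. cis x \<in> C}" if "closed C" for C
  proof -
    have "closed (cis -` C)" by (rule closed_vimage[OF that]) (auto intro!: continuous_intros)
    then show ?thesis by (simp add: vimage_def)
  qed
  have clB: "closed B" unfolding B_def using clP fin by (intro cl_vimage closed_UN) auto
  have free_nbhd: "\<exists>d>0. \<forall>x. \<bar>x\<bar> < d \<longrightarrow> \<xi> + x \<notin> S" if "closed S" "\<xi> \<notin> S" for \<xi> and S :: "real set"
  proof -
    have "open (- S)" "\<xi> \<in> - S" using that by auto
    then obtain d where "d > 0" "ball \<xi> d \<subseteq> - S" using openE by blast
    then show ?thesis by (intro exI[of _ d]) (auto simp: dist_real_def subset_iff)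
  qed
  have inner: "\<exists>d>0. \<forall>x. \<bar>x\<bar> < d \<longrightarrow> \<theta> + x \<in> B"
    if i: "i \<in> I" and y: "y \<in> {-1<..<1}" and \<theta>: "cis \<theta> = P i y" for i y \<theta>
  proof -
    obtain \<alpha> \<beta> r and \<psi> :: "real \<Rightarrow> real" where \<psi>: "r \<in> {1, -1}" "\<psi> ` {-1..1} = {\<alpha>..\<beta>}" "\<psi> ` {-1<..<1} \<subseteq> {\<alpha><..<\<beta>}"
      "\<And>y. y \<in> {-1..1} \<Longrightarrow> cis (\<psi> y) = P i (r * y)"
      using circle_path_lift[OF cont[OF i] inj[OF i] sph[OF i]] by metis
    have ry: "r * y \<in> {-1<..<1}" using \<psi>(1) y by auto
    have eq: "cis (\<psi> (r * y)) = cis \<theta>" using \<psi>(4)[of "r * y"] ry \<psi>(1) \<theta> by auto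
    have in_ab: "\<psi> (r * y) \<in> {\<alpha><..<\<beta>}" using \<psi>(3) ry by blast
    show ?thesis
    proof (intro exI[of _ "min (\<psi> (r * y) - \<alpha>) (\<beta> - \<psi> (r * y))"] conjI allI impI)
      fix x assume "\<bar>x\<bar> < min (\<psi> (r * y) - \<alpha>) (\<beta> - \<psi> (r * y))"
      then have "\<psi> (r * y) + x \<in> {\<alpha>..\<beta>}" by (auto simp: abs_if split: if_splits)
      then obtain w where w: "w \<in> {-1..1}" "\<psi> w = \<psi> (r * y) + x" using \<psi>(2) by (metis imageE)
      have "cis (\<theta> + x) = cis (\<psi> w)" using eq w(2) by (simp flip: cis_mult)
      moreover have "r * w \<in> {-1..1}" using w(1) \<psi>(1) by auto
      moreover have "cis (\<psi> w) \<in> P i ` {-1..1}" using \<psi>(4)[OF w(1)] \<open>r * w \<in> {-1..1}\<close> by blast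
      ultimately show "\<theta> + x \<in> B" using i unfolding B_def by auto
    qed (use in_ab in auto)
  qed
  have corner: "\<exists>\<theta> \<sigma>. cis \<theta> = P i b \<and> \<sigma> \<in> {1,-1} \<and> (\<exists>d>0. \<forall>x. 0 < x \<and> x < d \<longrightarrow> \<theta> + \<sigma> * x \<notin> B \<and> \<theta> - \<sigma> * x \<in> B)"
    if i: "i \<in> I" and b: "b \<in> {-1, 1}" for i b
  proof -
    obtain \<alpha> \<beta> r and \<psi> :: "real \<Rightarrow> real" where ab: "\<alpha> < \<beta>" "\<beta> < \<alpha> + 2 * pi" and r: "r \<in> {1, -1}"
      and ends: "\<psi> (-1) = \<alpha>" "\<psi> 1 = \<beta>" and img: "\<psi> ` {-1..1} = {\<alpha>..\<beta>}"
      and \<psi>: "\<And>y. y \<in> {-1..1} \<Longrightarrow> cis (\<psi> y) = P i (r * y)"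
      using circle_path_lift[OF cont[OF i] inj[OF i] sph[OF i]] by metis
    define \<sigma> where "\<sigma> = r * b"
    have \<sigma>: "\<sigma> \<in> {1, -1}" "r * \<sigma> = b" using r b by (auto simp: \<sigma>_def)
    define \<theta> where "\<theta> = \<psi> \<sigma>"
    have \<theta>: "cis \<theta> = P i b" using \<psi>[of \<sigma>] \<sigma> by (auto simp: \<theta>_def)
    have inP: "cis x \<in> P i ` {-1..1} \<longleftrightarrow> (\<exists>\<xi>\<in>{\<alpha>..\<beta>}. cis x = cis \<xi>)" for x
    proof
      assume "cis x \<in> P i ` {-1..1}"
      then obtain y where y: "y \<in> {-1..1}" "cis x = P i y" by blast
      have ry: "r * y \<in> {-1..1}" "r * (r * y) = y" using r y by auto
      have "cis x = cis (\<psi> (r * y))" using \<psi>[OF ry(1)] y(2) ry(2) by metis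
      moreover have "\<psi> (r * y) \<in> {\<alpha>..\<beta>}" using ry(1) img by blast
      ultimately have "cis x = cis (\<psi> (r * y))" "\<psi> (r * y) \<in> {\<alpha>..\<beta>}" by blast+
      then show "\<exists>\<xi>\<in>{\<alpha>..\<beta>}. cis x = cis \<xi>" by blast
    next
      assume "\<exists>\<xi>\<in>{\<alpha>..\<beta>}. cis x = cis \<xi>"
      then obtain y where y: "y \<in> {-1..1}" "cis x = cis (\<psi> y)" using img by (metis imageE)
      have "r * y \<in> {-1..1}" using r y by auto
      then show "cis x \<in> P i ` {-1..1}" using \<psi>[OF y(1)] y(2) by (metis image_eqI)
    qed
    let ?C = "\<Union>j\<in>I - {i}. P j ` {-1..1}"
    have "P i b \<in> P i ` {-1..1}" using b by auto
    then have "P i b \<notin> ?C" using disj[OF i] by blast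
    then have n: "\<theta> \<notin> {x. cis x \<in> ?C}" using \<theta> by simp
    have "closed {x. cis x \<in> ?C}" using clP fin by (intro cl_vimage closed_UN) auto
    then obtain d where d: "d > 0" "\<And>x. \<bar>x\<bar> < d \<Longrightarrow> cis (\<theta> + x) \<notin> ?C" using free_nbhd[OF _ n] by auto
    \<comment> \<open>The three bounds keep the walk off the other arcs, keep the backward walk
      inside the own arc, and prevent the forward walk from reaching the own arc around the
      circle.\<close>
    define d' where "d' = min d (min (\<beta> - \<alpha>) (\<alpha> + 2 * pi - \<beta>))"
    have d': "d' > 0" using d ab by (auto simp: d'_def)
    have "\<theta> + \<sigma> * x \<notin> B \<and> \<theta> - \<sigma> * x \<in> B" if x: "0 < x" "x < d'" for x
    proof
      have "\<theta> - \<sigma> * x \<in> {\<alpha>..\<beta>}" using x \<sigma>(1) ends ab by (auto simp: \<theta>_def d'_def)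
      then show "\<theta> - \<sigma> * x \<in> B" using inP[of "\<theta> - \<sigma> * x"] i unfolding B_def by blast
      have "cis (\<theta> + \<sigma> * x) \<notin> ?C" 
      proof (rule d(2))
        show "\<bar>\<sigma> * x\<bar> < d" using x \<sigma>(1) by (auto simp: d'_def abs_mult)
      qed
      moreover have "cis (\<theta> + \<sigma> * x) \<notin> P i ` {-1..1}"
      proof
        assume "cis (\<theta> + \<sigma> * x) \<in> P i ` {-1..1}"
        then obtain \<xi> where \<xi>: "\<xi> \<in> {\<alpha>..\<beta>}" "cis (\<theta> + \<sigma> * x) = cis \<xi>" using inP by blast
        then obtain k :: int where k: "\<theta> + \<sigma> * x = \<xi> + 2 * pi * k" using cis_eq_cis_iff by blast
        have "0 < \<sigma> * (\<theta> + \<sigma> * x - \<xi>)" "\<sigma> * (\<theta> + \<sigma> * x - \<xi>) < 2 * pi"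
          using \<sigma>(1) x \<xi>(1) ends ab by (auto simp: \<theta>_def d'_def)
        moreover have "\<sigma> * (\<theta> + \<sigma> * x - \<xi>) = 2 * pi * (\<sigma> * k)" using k by (simp add: algebra_simps)
        ultimately have "0 < \<sigma> * real_of_int k" "\<sigma> * real_of_int k < 1" by (auto simp: zero_less_mult_iff)
        then show False using \<sigma>(1) by (auto simp flip: of_int_minus)
      qed
      moreover have "(\<Union>j\<in>I. P j ` {-1..1}) = P i ` {-1..1} \<union> ?C" using i by blast
      ultimately show "\<theta> + \<sigma> * x \<notin> B" unfolding B_def by blast
    qed
    then show ?thesis using \<theta> \<sigma>(1) d' by blast
  qed
  have cl_line: "closed {x. \<theta> + \<sigma> * x \<in> B}" for \<theta> \<sigma>
  proof -
    have "closed ((\<lambda>x. \<theta> + \<sigma> * x) -` B)" by (rule closed_vimage[OF clB]) (auto intro!: continuous_intros)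
    then show ?thesis by (simp add: vimage_def)
  qed
  \<comment> \<open>The end \<open>b\<close> of arc \<open>i\<close> has angle \<theta>, the gap
    lies in direction \<sigma> and has length \<open>l\<close>. The last clause, that the arc lies
    behind, fixes the direction and is used when a free point is assigned to its gap.\<close>
  define Q where "Q i b \<theta> \<sigma> l \<longleftrightarrow> cis \<theta> = P i b \<and> \<sigma> \<in> {1,-1} \<and> l > 0 \<and> \<theta> + \<sigma> * l \<in> B
      \<and> (\<forall>x. 0 < x \<and> x < l \<longrightarrow> \<theta> + \<sigma> * x \<notin> B) \<and> (\<exists>d>0. \<forall>x. 0 < x \<and> x < d \<longrightarrow> \<theta> - \<sigma> * x \<in> B)"
    for i b \<theta> \<sigma> l
  have "\<exists>\<theta> \<sigma> l. Q i b \<theta> \<sigma> l" if i: "i \<in> I" and b: "b \<in> {-1, 1}" for i b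
  proof -
    obtain \<theta> \<sigma> d where c: "cis \<theta> = P i b" "\<sigma> \<in> {1,-1}" "d > 0"
      "\<And>x. 0 < x \<Longrightarrow> x < d \<Longrightarrow> \<theta> + \<sigma> * x \<notin> B \<and> \<theta> - \<sigma> * x \<in> B" using corner[OF i b] by blast
    have "P i b \<in> P i ` {-1..1}" using b by auto
    then have "\<theta> \<in> B" using c(1) i unfolding B_def by auto
    moreover have "cis (\<theta> + \<sigma> * (2 * pi)) = cis \<theta>"
      using c(2) cis_shift[of \<theta> 1] cis_shift[of \<theta> "-1"] by auto
    \<comment> \<open>After a full turn the walk is back at its start, so a first point of
      \<open>B\<close> exists.\<close>
    ultimately have "2 * pi \<in> {x. \<theta> + \<sigma> * x \<in> B}" using B_cis by blast
    then obtain l where "l > 0" "l \<in> {x. \<theta> + \<sigma> * x \<in> B}" "\<And>x. 0 < x \<Longrightarrow> x < l \<Longrightarrow> x \<notin> {x. \<theta> + \<sigma> * x \<in> B}"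
      using least_positive_element[OF cl_line, of "2 * pi" \<theta> \<sigma> d] c(3,4) by auto
    then have "Q i b \<theta> \<sigma> l" using c unfolding Q_def by blast
    then show ?thesis by blast
  qed
  then obtain \<theta> \<sigma> l where Q: "\<And>i b. i \<in> I \<Longrightarrow> b \<in> {-1, 1} \<Longrightarrow> Q i b (\<theta> i b) (\<sigma> i b) (l i b)" by metis
  \<comment> \<open>The division by 2 stops the walk at the midpoint of the gap at time 1.\<close>
  define \<gamma> where "\<gamma> i b \<tau> = cis (\<theta> i b + \<sigma> i b * (\<tau> * l i b / 2))" for i b \<tau>
  have \<theta>B: "\<theta> i b \<in> B" if "i \<in> I" "b \<in> {-1, 1}" for i b
  proof -
    have "P i b \<in> P i ` {-1..1}" "cis (\<theta> i b) = P i b" using Q[OF that] that(2) unfolding Q_def by auto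
    then show ?thesis using that(1) unfolding B_def by auto
  qed
  have G1: "continuous_on {0..1} (\<gamma> i b)" "\<gamma> i b ` {0..1} \<subseteq> sphere 0 1" for i b
    unfolding \<gamma>_def by (auto intro!: continuous_intros)
  have G2: "\<gamma> i b 0 = P i b" if "i \<in> I" "b \<in> {-1, 1}" for i b
    using Q[OF that] unfolding Q_def \<gamma>_def by simp
  have G3: "\<gamma> i b \<tau> \<notin> (\<Union>j\<in>I. P j ` {-1..1})" if ib: "i \<in> I" "b \<in> {-1, 1}" and t: "\<tau> \<in> {0<..1}" for i b \<tau>
  proof -
    have "l i b > 0" using Q[OF ib] unfolding Q_def by blast
    moreover from this have "\<tau> * l i b \<le> l i b" using t by (simp add: mult_left_le_one_le)
    ultimately have "0 < \<tau> * l i b / 2" "\<tau> * l i b / 2 < l i b" using t by auto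
    then have "\<theta> i b + \<sigma> i b * (\<tau> * l i b / 2) \<notin> B" using Q[OF ib] unfolding Q_def by blast
    then show ?thesis unfolding B_def \<gamma>_def by blast
  qed
  have ends_inj: "i = j \<and> b = c" if "i \<in> I" "b \<in> {-1, 1}" "j \<in> I" "c \<in> {-1, 1}" "P i b = P j c" for i j b c
  proof -
    have bc: "b \<in> {-1..1}" "c \<in> {-1..1}" using that by auto
    then have "i = j" using disj[OF that(1,3)] that(5) by blast
    then show ?thesis using inj_onD[OF inj[OF that(1)] _ bc] that(5) by simp
  qed
  have G4: "\<tau> = \<tau>' \<and> (i = j \<and> b = c \<or> \<tau> = 1)"
    if ib: "i \<in> I" "b \<in> {-1, 1}" and jc: "j \<in> I" "c \<in> {-1, 1}" and t: "\<tau> \<in> {0..1}" "\<tau>' \<in> {0..1}"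
      and eq: "\<gamma> i b \<tau> = \<gamma> j c \<tau>'" for i b j c \<tau> \<tau>'
  proof -
    define x x' where "x = \<tau> * l i b / 2" "x' = \<tau>' * l j c / 2"
    note q = Q[OF ib, unfolded Q_def] and q' = Q[OF jc, unfolded Q_def]
    have l: "l i b > 0" "l j c > 0" using q q' by auto
    have x: "0 \<le> x" "x \<le> l i b / 2" "0 \<le> x'" "x' \<le> l j c / 2"
      unfolding x_x'_def using t l by (auto simp: mult_left_le_one_le)
    obtain k :: int where k: "\<theta> i b + \<sigma> i b * x = \<theta> j c + \<sigma> j c * x' + 2 * pi * k"
      using eq unfolding \<gamma>_def x_x'_def[symmetric] cis_eq_cis_iff by blast
    define t' where "t' = \<theta> j c + 2 * pi * k"
    have t': "\<theta> i b + \<sigma> i b * x = t' + \<sigma> j c * x'" "cis t' = cis (\<theta> j c)" using k unfolding t'_def by auto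
    have t'B: "t' \<in> B" "\<theta> i b \<in> B" using \<theta>B[OF ib] \<theta>B[OF jc] B_cis[OF t'(2)] by auto
    have free_i: "\<theta> i b + \<sigma> i b * w \<notin> B" if "0 < w" "w < l i b" for w using q that by blast
    have free_j: "t' + \<sigma> j c * w \<notin> B" if w: "0 < w" "w < l j c" for w
    proof -
      have "cis (t' + \<sigma> j c * w) = cis (\<theta> j c + \<sigma> j c * w)" using t'(2) by (simp flip: cis_mult)
      then show ?thesis using B_cis q' w by blast
    qed
    have same: ?thesis if "\<theta> i b = t'" "x = x'"
    proof -
      have "P i b = P j c" using q q' t'(2) that(1) by simp
      then have "i = j \<and> b = c" using ends_inj ib jc by blast
      then show ?thesis using that(2) l unfolding x_x'_def by auto
    qed
    show ?thesis
    \<comment> \<open>Walks in the same direction that meet must start together, as otherwise one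
      start, an angle in \<open>B\<close>, would lie strictly inside the gap of the other. Walks in
      opposite directions start at the two ends of one gap or at one common point.\<close>
    proof (cases "\<sigma> i b = \<sigma> j c")
      case True
      consider "x = x'" | "x > x'" | "x < x'" by linarith
      then show ?thesis
      proof cases
        case 1
        then have "\<theta> i b = t'" using t'(1) True by simp
        from same[OF this 1] show ?thesis .
      next
        case 2
        have "t' = \<theta> i b + \<sigma> i b * (x - x')" using t'(1) True by (simp add: algebra_simps)
        then show ?thesis using free_i[of "x - x'"] 2 x t'B l by auto
      next
        case 3
        have "\<theta> i b = t' + \<sigma> j c * (x' - x)" using t'(1) True by (simp add: algebra_simps)
        then show ?thesis using free_j[of "x' - x"] 3 x t'B l by auto
      qed
    next
      case False
      then have \<sigma>: "\<sigma> j c = - \<sigma> i b" using q q' by auto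
      \<comment> \<open>The starts lie \<open>x + x'\<close> apart. Unless this is 0, it is at least
        each of the two gap lengths, whereas \<open>x\<close> and \<open>x'\<close> are at most half
        of them; so both walks are at the midpoint.\<close>
      have e1: "t' = \<theta> i b + \<sigma> i b * (x + x')" using t'(1) \<sigma> by (simp add: algebra_simps)
      have e2: "\<theta> i b = t' + \<sigma> j c * (x + x')" using e1 \<sigma> by (simp add: algebra_simps)
      show ?thesis
      proof (cases "x + x' = 0")
        case True
        then have "x = 0" "x' = 0" using x by auto
        then have "\<theta> i b = t'" "x = x'" using e1 by auto
        from same[OF this] show ?thesis .
      next
        case False
        then have pos: "x + x' > 0" using x by auto
        have "x + x' \<ge> l i b" using free_i[of "x + x'"] e1 t'B pos by force
        moreover have "x + x' \<ge> l j c" using free_j[of "x + x'"] e2 t'B pos by force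
        ultimately have "x = l i b / 2" "x' = l j c / 2" using x by auto
        then show ?thesis using l unfolding x_x'_def by auto
      qed
    qed
  qed
  have G5: "z \<in> (\<Union>i\<in>I. P i ` {-1..1}) \<union> (\<Union>i\<in>I. \<Union>b\<in>{-1,1}. \<gamma> i b ` {0..1})" if z: "z \<in> sphere 0 1" for z
  proof (cases "z \<in> (\<Union>i\<in>I. P i ` {-1..1})")
    case False
    have "norm z = 1" using z by simp
    then obtain \<xi> where \<xi>: "z = cis \<xi>" by (metis cis_Arg norm_zero sgn_div_norm zero_neq_one div_by_1 scaleR_one inverse_1)
    have \<xi>B: "\<xi> \<notin> B" using False \<xi> unfolding B_def by blast
    obtain i0 where i0: "i0 \<in> I" using ne by blast
    have \<theta>0: "\<theta> i0 1 \<in> B" using \<theta>B[OF i0] by simp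
    have far: "\<exists>x>0. \<xi> + s * x \<in> B" if s: "s \<in> {1, -1}" for s
    proof -
      obtain k :: nat where k: "\<bar>\<xi> - \<theta> i0 1\<bar> < of_nat k * (2 * pi)" using reals_Archimedean3[of "2 * pi"] by fastforce
      define x where "x = s * (\<theta> i0 1 - \<xi>) + 2 * pi * k"
      have "x > 0" using k s unfolding x_def by (auto simp: abs_if mult.commute split: if_splits)
      have "\<xi> + s * x = \<theta> i0 1 + 2 * pi * of_int (if s = 1 then int k else - int k)"
        using s unfolding x_def by (auto simp: algebra_simps)
      then have "cis (\<xi> + s * x) = cis (\<theta> i0 1)" using cis_shift by presburger
      then have "\<xi> + s * x \<in> B" using \<theta>0 B_cis by blast
      then show ?thesis using \<open>x > 0\<close> by blast
    qed
    obtain d where d: "d > 0" "\<And>x. \<bar>x\<bar> < d \<Longrightarrow> \<xi> + x \<notin> B" using free_nbhd[OF clB \<xi>B] by blast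
    have "\<exists>x>0. \<xi> + s * x \<in> B \<and> (\<forall>w. 0 < w \<and> w < x \<longrightarrow> \<xi> + s * w \<notin> B)" if s: "s \<in> {1, -1}" for s
    proof -
      obtain x0 where x0: "x0 > 0" "x0 \<in> {x. \<xi> + s * x \<in> B}" using far[OF s] by blast
      have "w \<notin> {x. \<xi> + s * x \<in> B}" if "0 < w" "w < d" for w using d(2)[of "s * w"] that s by auto
      from least_positive_element[OF cl_line x0 d(1) this] show ?thesis by (metis mem_Collect_eq)
    qed
    then obtain x where x: "\<And>s. s \<in> {1, -1} \<Longrightarrow> x s > 0 \<and> \<xi> + s * x s \<in> B \<and> (\<forall>w. 0 < w \<and> w < x s \<longrightarrow> \<xi> + s * w \<notin> B)"
      by metis
    \<comment> \<open>The direction of the nearer arc. The point where that arc begins is an arc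
      end, and the walk starting there comes back over the given point.\<close>
    obtain s where s: "s \<in> {1, -1}" "x s \<le> x (-s)" by (cases "x 1 \<le> x (-1)") (use that in force)+
    define \<zeta> where "\<zeta> = \<xi> + s * x s"
    have s': "-s \<in> {1, -1}" using s(1) by auto
    have ss: "s * s = 1" using s(1) by auto
    obtain j y where y: "j \<in> I" "y \<in> {-1..1}" "cis \<zeta> = P j y" using x[OF s(1)] unfolding \<zeta>_def B_def by blast
    have freeD: "\<exists>w. 0 < w \<and> w < e \<and> \<zeta> - s * w \<notin> B" if "e > 0" for e
    proof (intro exI conjI)
      let ?w = "min (e / 2) (x s / 2)"
      show "0 < ?w" "?w < e" using that x[OF s(1)] by auto
      have "\<zeta> - s * ?w = \<xi> + s * (x s - ?w)" unfolding \<zeta>_def by (simp add: algebra_simps)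
      moreover have "0 < x s - ?w" "x s - ?w < x s" using that x[OF s(1)] by (auto simp: min_def)
      ultimately show "\<zeta> - s * ?w \<notin> B" using x[OF s(1)] by auto
    qed
    have "y \<notin> {-1<..<1}"
    proof
      assume "y \<in> {-1<..<1}"
      then obtain e where e: "e > 0" "\<And>w. \<bar>w\<bar> < e \<Longrightarrow> \<zeta> + w \<in> B" using inner[OF y(1) _ y(3)] by blast
      obtain w where "0 < w" "w < e" "\<zeta> - s * w \<notin> B" using freeD[OF e(1)] by blast
      then show False using e(2)[of "- (s * w)"] s(1) by auto
    qed
    then have yb: "y \<in> {-1, 1}" using y(2) by auto
    note q = Q[OF y(1) yb, unfolded Q_def]
    let ?\<theta> = "\<theta> j y" and ?\<sigma> = "\<sigma> j y" and ?l = "l j y"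
    have c: "cis (\<zeta> + w) = cis (?\<theta> + w)" for w using q y(3) by (simp flip: cis_mult)
    have \<sigma>: "?\<sigma> = - s"
    proof (rule ccontr)
      assume "?\<sigma> \<noteq> - s"
      then have "?\<sigma> = s" using q s(1) by auto
      then obtain e where e: "e > 0" "\<And>w. 0 < w \<Longrightarrow> w < e \<Longrightarrow> ?\<theta> - s * w \<in> B" using q by blast
      obtain w where w: "0 < w" "w < e" "\<zeta> - s * w \<notin> B" using freeD[OF e(1)] by blast
      then show False using e(2)[OF w(1,2)] B_cis[OF c[of "- (s * w)"]] by simp
    qed
    have lB: "\<zeta> - s * ?l \<in> B" using q B_cis[OF c[of "- (s * ?l)"]] \<sigma> by simp
    \<comment> \<open>The gap contains the stretch of length \<open>x s\<close> already known to be
      free, and on the far side another one of length \<open>x (-s)\<close>, which is no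
      shorter.\<close>
    have "?l \<ge> 2 * x s"
    proof -
      have e: "\<zeta> - s * ?l = \<xi> + s * (x s - ?l)" "\<zeta> - s * ?l = \<xi> + (- s) * (?l - x s)"
        unfolding \<zeta>_def by (auto simp: algebra_simps)
      have lpos: "?l > 0" using q by blast
      consider "?l < x s" | "?l = x s" | "?l > x s" by linarith
      then show ?thesis
      proof cases
        case 1
        then have "\<xi> + s * (x s - ?l) \<notin> B" using x[OF s(1)] lpos by simp
        then show ?thesis using lB e by simp
      next
        case 2 then show ?thesis using lB e \<xi>B by simp
      next
        case 3
        then have "?l - x s \<ge> x (- s)" using x[OF s'] lB e(2) by (metis diff_gt_0_iff_gt not_le)
        then show ?thesis using s(2) by linarith
      qed
    qed
    then have "2 * x s / ?l \<in> {0..1}" using x[OF s(1)] by (auto simp: divide_le_eq)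
    moreover have "\<gamma> j y (2 * x s / ?l) = z"
    proof -
      have "?l \<noteq> 0" using q by auto
      then have "\<gamma> j y (2 * x s / ?l) = cis (?\<theta> + - (s * x s))" unfolding \<gamma>_def \<sigma> by simp
      also have "\<dots> = cis (\<zeta> + - (s * x s))" using c[of "- (s * x s)"] by simp
      also have "\<dots> = z" unfolding \<zeta>_def \<xi> by simp
      finally show ?thesis .
    qed
    ultimately show ?thesis using y(1) yb by blast
  qed simp
  show ?thesis
  proof (intro exI[of _ \<gamma>] conjI ballI impI)
    show "sphere 0 1 \<subseteq> (\<Union>i\<in>I. P i ` {-1..1}) \<union> (\<Union>i\<in>I. \<Union>b\<in>{-1,1}. \<gamma> i b ` {0..1})"
      using G5 by (rule subsetI)
    fix i b j c \<tau> \<tau>'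
    assume a: "i \<in> I" "b \<in> {-1, 1::real}" "j \<in> I" "c \<in> {-1, 1::real}" "\<tau> \<in> {0..1}" "\<tau>' \<in> {0..1}" "\<gamma> i b \<tau> = \<gamma> j c \<tau>'"
    from G4[OF this] show "\<tau> = \<tau>'" "i = j \<and> b = c \<or> \<tau> = 1" by blast+
  qed (rule G1 G2 G3; assumption?)+
qed

section \<open>Embeddings into surfaces\<close>

lemma surface_chart:
  assumes X: "surface X" and x: "x \<in> topspace X"
  obtains U \<phi> \<psi> where "openin X U" "x \<in> U"
    "homeomorphic_maps (subtopology X U) (top_of_set (ball (0::complex) 1)) \<phi> \<psi>"
  using X x unfolding surface_def homeomorphic_space_def by blast

text \<open>Invariance of domain in the plane, applied in a chart around each point of the
  image.\<close>

lemma surface_invariance_of_domain: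
  fixes f :: "'n::euclidean_space \<Rightarrow> 'a"
  assumes X: "surface X" and S: "open S" and dim: "DIM('n) = 2"
    and cont: "continuous_map (top_of_set S) X f" and inj: "inj_on f S"
  shows "openin X (f ` S)"
proof (subst openin_subopen, clarify)
  fix x assume x: "x \<in> S"
  have "f x \<in> topspace X" using continuous_map_image_subset_topspace[OF cont] x by auto
  then obtain U \<phi> \<psi> where U: "openin X U" "f x \<in> U"
    and h: "homeomorphic_maps (subtopology X U) (top_of_set (ball (0::complex) 1)) \<phi> \<psi>"
    using surface_chart[OF X] by blast
  have Usub: "U \<subseteq> topspace X" using U(1) openin_subset by blast
  have \<phi>: "continuous_map (subtopology X U) (top_of_set (ball 0 1)) \<phi>" and \<psi>: "continuous_map (top_of_set (ball 0 1)) (subtopology X U) \<psi>"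
    and \<psi>\<phi>: "\<And>y. y \<in> U \<Longrightarrow> \<psi> (\<phi> y) = y"
    using h Usub unfolding homeomorphic_maps_def by auto
  define S' where "S' = {y \<in> S. f y \<in> U}"
  have "openin (top_of_set S) S'" unfolding S'_def using openin_continuous_map_preimage[OF cont U(1)] by simp
  then have S': "open S'" using S openin_open_trans by blast
  have "continuous_map (top_of_set S') (subtopology X U) f"
    using cont unfolding S'_def by (auto simp: continuous_map_in_subtopology intro: continuous_map_from_subtopology_mono)
  then have "continuous_map (top_of_set S') (top_of_set (ball 0 1)) (\<phi> \<circ> f)" using \<phi> continuous_map_compose by blast
  then have c: "continuous_on S' (\<phi> \<circ> f)" and im: "(\<phi> \<circ> f) ` S' \<subseteq> ball 0 1" by auto
  have "inj_on (\<phi> \<circ> f) S'"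
  proof (rule inj_onI)
    fix y z assume yz: "y \<in> S'" "z \<in> S'" "(\<phi> \<circ> f) y = (\<phi> \<circ> f) z"
    have "f y = \<psi> (\<phi> (f y))" "f z = \<psi> (\<phi> (f z))" using yz(1,2) \<psi>\<phi> unfolding S'_def by simp_all
    then have "f y = f z" using yz(3) by (metis comp_apply)
    then show "y = z" using inj yz unfolding S'_def inj_on_def by blast
  qed
  then have op: "open ((\<phi> \<circ> f) ` S')" using invariance_of_domain_gen[OF S' c] dim by simp
  have hm: "homeomorphic_map (top_of_set (ball 0 1)) (subtopology X U) \<psi>"
    using h homeomorphic_maps_map homeomorphic_maps_sym by blast
  have "openin (top_of_set (ball 0 1)) ((\<phi> \<circ> f) ` S')" using op im open_subset by blast
  then have "openin (subtopology X U) (\<psi> ` (\<phi> \<circ> f) ` S')"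
    using hm homeomorphic_imp_open_map open_map_def by metis
  moreover have "\<psi> ` (\<phi> \<circ> f) ` S' = f ` S'" using \<psi>\<phi> unfolding S'_def by (force simp: image_image)
  ultimately have "openin X (f ` S')" using U(1) openin_trans_full by metis
  moreover have "f x \<in> f ` S'" using x U(2) unfolding S'_def by blast
  moreover have "f ` S' \<subseteq> f ` S" unfolding S'_def by blast
  ultimately show "\<exists>T. openin X T \<and> f x \<in> T \<and> T \<subseteq> f ` S" by blast
qed

lemma embedding_inverse:
  assumes "embedding_map (top_of_set S) X f"
  obtains g where "continuous_map (subtopology X (f ` S)) (top_of_set S) g" "\<And>x. x \<in> S \<Longrightarrow> g (f x) = x"
proof -
  have "homeomorphic_map (top_of_set S) (subtopology X (f ` S)) f" using assms unfolding embedding_map_def by simp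
  then obtain g where "homeomorphic_maps (top_of_set S) (subtopology X (f ` S)) f g" using homeomorphic_map_maps by blast
  then show thesis using that[of g] unfolding homeomorphic_maps_def by simp
qed

text \<open>The converse tool: the inverse of a chart followed by the inverse of \<open>f\<close>
  maps a planar open set injectively and continuously into \<open>S\<close>, so it reaches only
  interior points. It shows that boundary points of a disc or square cannot become interior in the
  surface.\<close>

lemma surface_interior_preimage:
  fixes f :: "'n::euclidean_space \<Rightarrow> 'a"
  assumes X: "surface X" and dim: "DIM('n) = 2" and emb: "embedding_map (top_of_set S) X f"
    and W: "openin X W" "W \<subseteq> f ` S" and x: "x \<in> S" "f x \<in> W"
  shows "x \<in> interior S"
proof -
  have "f x \<in> topspace X" using W x openin_subset by blast
  then obtain U \<phi> \<psi> where U: "openin X U" "f x \<in> U"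
    and h: "homeomorphic_maps (subtopology X U) (top_of_set (ball (0::complex) 1)) \<phi> \<psi>"
    using surface_chart[OF X] by blast
  have Usub: "U \<subseteq> topspace X" using U(1) openin_subset by blast
  have \<psi>: "continuous_map (top_of_set (ball 0 1)) (subtopology X U) \<psi>"
    and \<psi>\<phi>: "\<And>y. y \<in> U \<Longrightarrow> \<psi> (\<phi> y) = y" and \<phi>\<psi>: "\<And>y. y \<in> ball 0 1 \<Longrightarrow> \<phi> (\<psi> y) = y"
    using h Usub unfolding homeomorphic_maps_def by auto
  obtain g where g: "continuous_map (subtopology X (f ` S)) (top_of_set S) g" "\<And>x. x \<in> S \<Longrightarrow> g (f x) = x"
    using embedding_inverse[OF emb] by blast
  have hm: "homeomorphic_map (subtopology X U) (top_of_set (ball 0 1)) \<phi>" using h homeomorphic_maps_map by blast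
  have "openin (subtopology X U) (W \<inter> U)" using W(1) U(1) openin_subtopology by blast
  then have "openin (top_of_set (ball 0 1)) (\<phi> ` (W \<inter> U))"
    using hm homeomorphic_imp_open_map open_map_def by metis
  then have opV: "open (\<phi> ` (W \<inter> U))" and Vb: "\<phi> ` (W \<inter> U) \<subseteq> ball 0 1"
    using openin_open_trans open_ball openin_subset by (blast, fastforce dest: openin_subset)
  let ?V = "\<phi> ` (W \<inter> U)"
  have \<psi>V: "\<psi> y \<in> W \<inter> U" if "y \<in> ?V" for y using that \<psi>\<phi> by auto
  have "continuous_map (top_of_set ?V) X \<psi>"
    using continuous_map_from_subtopology_mono[OF _ Vb] \<psi> unfolding continuous_map_in_subtopology by blast
  moreover have "\<psi> ` ?V \<subseteq> f ` S" using \<psi>V W(2) by blast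
  ultimately have "continuous_map (top_of_set ?V) (subtopology X (f ` S)) \<psi>"
    by (simp add: continuous_map_in_subtopology image_subset_iff_funcset)
  then have "continuous_map (top_of_set ?V) (top_of_set S) (g \<circ> \<psi>)" using g(1) continuous_map_compose by blast
  then have c: "continuous_on ?V (g \<circ> \<psi>)" and im: "(g \<circ> \<psi>) ` ?V \<subseteq> S" by auto
  have "inj_on (g \<circ> \<psi>) ?V"
  proof (rule inj_onI)
    fix y z assume yz: "y \<in> ?V" "z \<in> ?V" "(g \<circ> \<psi>) y = (g \<circ> \<psi>) z"
    obtain a b where ab: "a \<in> S" "b \<in> S" "\<psi> y = f a" "\<psi> z = f b" using \<psi>V yz W(2) by blast
    then have "\<psi> y = \<psi> z" using g(2) yz(3) by simp
    then show "y = z" using \<phi>\<psi> Vb yz by (metis subsetD)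
  qed
  then have "open ((g \<circ> \<psi>) ` ?V)" using invariance_of_domain_gen[OF opV c] dim by simp
  moreover have "x \<in> (g \<circ> \<psi>) ` ?V"
    by (rule image_eqI[of _ _ "\<phi> (f x)"]) (use \<psi>\<phi> U(2) g(2) x in auto)
  ultimately show ?thesis using im interiorI by blast
qed

lemma embedding_lift_path:
  assumes emb: "embedding_map (top_of_set S) X f" and p: "continuous_map (top_of_set A) X p" "p ` A \<subseteq> f ` S"
  obtains r where "continuous_on A r" "r ` A \<subseteq> S" "\<And>y. y \<in> A \<Longrightarrow> f (r y) = p y"
proof -
  obtain g where g: "continuous_map (subtopology X (f ` S)) (top_of_set S) g" "\<And>x. x \<in> S \<Longrightarrow> g (f x) = x"
    using embedding_inverse[OF emb] by blast
  have "continuous_map (top_of_set A) (subtopology X (f ` S)) p"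
    using p by (simp add: continuous_map_in_subtopology image_subset_iff_funcset)
  then have cm: "continuous_map (top_of_set A) (top_of_set S) (g \<circ> p)" using g(1) continuous_map_compose by blast
  show thesis
  proof (rule that)
    show "continuous_on A (g \<circ> p)" using cm by simp
    show "(g \<circ> p) ` A \<subseteq> S" using cm by (auto simp: Pi_iff)
    show "f ((g \<circ> p) y) = p y" if "y \<in> A" for y using p(2) that g(2) by force
  qed
qed

section \<open>Ribbon graphs\<close>

text \<open>The triangles will be indexed by the corners of the bands; a 0-band without an attached
  1-band would receive none and stay uncovered. For \<open>G\<close> the last assumption comes from
  connectedness, for \<open>G'\<close> from the boundary components of \<Delta>.\<close>

locale ribbon_graph =
  fixes G :: "('a, 'e) embedded_graph" and c q
  assumes embedding: "graph_embedding G" and ribbon: "ribbon_representation G c q"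
    and no_isolated: "\<And>v. v \<in> vertices G \<Longrightarrow> \<exists>e\<in>edges G. \<exists>a\<in>{-1, 1}. q e ` ({a} \<times> {-1..1}) \<subseteq> c v ` sphere 0 1"
begin

abbreviation "X \<equiv> surf G"
abbreviation "band e \<equiv> q e ` square"
abbreviation "circle v \<equiv> c v ` sphere 0 1"
abbreviation "disc v \<equiv> c v ` ball 0 1"
abbreviation "vside e a \<equiv> q e ` ({a} \<times> {-1..1})"
abbreviation "hside e b \<equiv> q e ` ({-1..1} \<times> {b})"

lemma surface_X: "surface X"
  using embedding by (simp add: graph_embedding_def)

lemma hausdorff: "Hausdorff_space X"
  using surface_X by (simp add: surface_def)

lemma finite_edges: "finite (edges G)" and finite_vertices: "finite (vertices G)"
  using embedding by (simp_all add: graph_embedding_def)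

lemma c_embedding: "v \<in> vertices G \<Longrightarrow> embedding_map (top_of_set (cball 0 1)) X (c v)"
  and c_zero: "v \<in> vertices G \<Longrightarrow> c v 0 = v"
  and q_embedding: "e \<in> edges G \<Longrightarrow> embedding_map (top_of_set square) X (q e)"
  using ribbon by (simp_all add: ribbon_representation_def)

lemma compact_square: "compact square"
  unfolding square_def by (intro compact_Times) auto

lemmas c_inj_on = embedding_inj_on[OF c_embedding hausdorff compact_cball]
lemmas q_inj_on = embedding_inj_on[OF q_embedding hausdorff compact_square]
lemmas c_continuous = embedding_continuous_map[OF c_embedding hausdorff compact_cball]
lemmas q_continuous = embedding_continuous_map[OF q_embedding hausdorff compact_square]
lemmas c_closedin = embedding_closedin[OF c_embedding hausdorff compact_cball]
lemmas q_closedin = embedding_closedin[OF q_embedding hausdorff compact_square]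

lemma c_eq_imp:
  assumes "v \<in> vertices G" "w \<in> vertices G" "x \<in> cball 0 1" "y \<in> cball 0 1" "c v x = c w y"
  shows "v = w \<and> x = y"
proof -
  have "disjoint_family_on (\<lambda>v. c v ` cball 0 1) (vertices G)" using ribbon by (simp add: ribbon_representation_def)
  then have "v = w" using assms unfolding disjoint_family_on_def by blast
  then show ?thesis using assms inj_onD[OF c_inj_on[OF assms(1)] _ assms(3,4)] by simp
qed

lemma q_eq_imp:
  assumes "e \<in> edges G" "e' \<in> edges G" "x \<in> square" "y \<in> square" "q e x = q e' y"
  shows "e = e' \<and> x = y"
proof -
  have "disjoint_family_on (\<lambda>e. q e ` square) (edges G)" using ribbon by (simp add: ribbon_representation_def)
  then have "e = e'" using assms unfolding disjoint_family_on_def by blast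
  then show ?thesis using assms inj_onD[OF q_inj_on[OF assms(1)] _ assms(3,4)] by simp
qed

lemma ribbon_attached: "\<forall>e\<in>edges G. \<forall>a\<in>{-1, 1}. \<exists>v\<in>vertices G. vside e a \<subseteq> circle v"
  using ribbon unfolding ribbon_representation_def by (elim conjE) assumption

lemma ribbon_meet: "\<forall>e\<in>edges G. \<forall>v\<in>vertices G. band e \<inter> c v ` cball 0 1 \<subseteq> q e ` ({-1, 1} \<times> {-1..1})"
  using ribbon unfolding ribbon_representation_def by (elim conjE) assumption

lemma attached:
  assumes "e \<in> edges G" "a \<in> {-1, 1}"
  shows "\<exists>!v. v \<in> vertices G \<and> vside e a \<subseteq> circle v"
proof -
  obtain v where v: "v \<in> vertices G" "vside e a \<subseteq> circle v"
    using ribbon_attached assms by blast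
  have "w = v" if w: "w \<in> vertices G \<and> vside e a \<subseteq> circle w" for w
  proof -
    have "q e (a, 0) \<in> vside e a" by auto
    then have "q e (a, 0) \<in> circle v" "q e (a, 0) \<in> circle w" using v(2) w by blast+
    then obtain x y where xy: "x \<in> sphere 0 1" "y \<in> sphere 0 1" "c w x = c v y" by (metis imageE)
    have "x \<in> cball 0 1" "y \<in> cball 0 1" using xy(1,2) by simp_all
    then show ?thesis using c_eq_imp[of w v x y] v(1) w xy(3) by blast
  qed
  then show ?thesis by (intro ex1I[of _ v] conjI v)
qed

definition att :: "'e \<Rightarrow> real \<Rightarrow> 'a" where
  "att e a = (THE v. v \<in> vertices G \<and> vside e a \<subseteq> circle v)"

lemma att:
  assumes "e \<in> edges G" "a \<in> {-1, 1}" shows "att e a \<in> vertices G" "vside e a \<subseteq> circle (att e a)"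
  using theI'[OF attached[OF assms]] unfolding att_def by blast+

lemma att_unique:
  assumes "e \<in> edges G" "a \<in> {-1, 1}" "v \<in> vertices G" "vside e a \<subseteq> circle v" shows "att e a = v"
  using attached[OF assms(1,2)] att[OF assms(1,2)] assms(3,4) by blast

lemma band_Int_cball:
  assumes e: "e \<in> edges G" and v: "v \<in> vertices G" and x: "x \<in> square" and z: "z \<in> cball 0 1" and eq: "q e x = c v z"
  shows "fst x \<in> {-1, 1} \<and> att e (fst x) = v \<and> z \<in> sphere 0 1"
proof -
  have "q e x \<in> band e \<inter> c v ` cball 0 1" using x z eq by blast
  then have "q e x \<in> q e ` ({-1, 1} \<times> {-1..1})" using ribbon_meet e v by blast
  then obtain y where y: "y \<in> {-1, 1} \<times> {-1..1}" "q e x = q e y" by blast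
  have "y \<in> square" using y(1) by (auto simp: square_def)
  then have "x = y" using q_eq_imp[OF e e x] y(2) by blast
  then have 1: "fst x \<in> {-1, 1}" "x \<in> {fst x} \<times> {-1..1}" using y(1) by auto
  have "q e x \<in> vside e (fst x)" by (rule imageI[OF 1(2)])
  then have "q e x \<in> circle (att e (fst x))" using att(2)[OF e 1(1)] by (rule subsetD[rotated])
  then obtain z' where z': "z' \<in> sphere 0 1" "q e x = c (att e (fst x)) z'" by blast
  have "z' \<in> cball 0 1" "c (att e (fst x)) z' = c v z" using z' eq by simp_all
  from c_eq_imp[OF att(1)[OF e 1(1)] v this(1) z this(2)] have "att e (fst x) = v \<and> z' = z" .
  then show ?thesis using 1 z' by blast
qed

lemma hside_subset_band: "b \<in> {-1, 1} \<Longrightarrow> hside e b \<subseteq> band e"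
  by (auto simp: square_def)

lemma disc_Int_band: "v \<in> vertices G \<Longrightarrow> e \<in> edges G \<Longrightarrow> disc v \<inter> band e = {}"
proof (rule ccontr)
  assume v: "v \<in> vertices G" and e: "e \<in> edges G" and "disc v \<inter> band e \<noteq> {}"
  then obtain y where y: "y \<in> disc v" "y \<in> band e" by blast
  obtain z where z1: "z \<in> ball 0 1" "y = c v z" using y(1) by (rule imageE)
  obtain x where x1: "x \<in> square" "y = q e x" using y(2) by (rule imageE)
  have z: "z \<in> ball 0 1" "x \<in> square" "q e x = c v z" using z1 x1 by simp_all
  then have "z \<in> cball 0 1" by simp
  then show False using band_Int_cball[OF e v z(2) _ z(3)] z(1) by simp
qed

lemma disc_Int_circle: "v \<in> vertices G \<Longrightarrow> w \<in> vertices G \<Longrightarrow> disc v \<inter> circle w = {}"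
proof (rule ccontr)
  assume v: "v \<in> vertices G" and w: "w \<in> vertices G" and "disc v \<inter> circle w \<noteq> {}"
  then obtain y where y: "y \<in> disc v" "y \<in> circle w" by blast
  obtain z where z1: "z \<in> ball 0 1" "y = c v z" using y(1) by (rule imageE)
  obtain x where x1: "x \<in> sphere 0 1" "y = c w x" using y(2) by (rule imageE)
  have z: "z \<in> ball 0 1" "x \<in> sphere 0 1" "c v z = c w x" using z1 x1 by simp_all
  then have "z \<in> cball 0 1" "x \<in> cball 0 1" by simp_all
  then show False using c_eq_imp[OF v w _ _ z(3)] z(1,2) by simp
qed

lemma continuous_vpath:
  assumes "e \<in> edges G" "a \<in> {-1, 1}" shows "continuous_map (top_of_set {-1..1}) X (\<lambda>y. q e (a, y))"
proof -
  have "continuous_map (top_of_set {-1..1}) (top_of_set square) (\<lambda>y. (a, y))"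
    using assms by (auto simp: square_def intro!: continuous_intros)
  from continuous_map_compose[OF this q_continuous[OF assms(1)]] show ?thesis by (simp add: o_def)
qed

lemma continuous_hpath:
  assumes "e \<in> edges G" "b \<in> {-1, 1}" shows "continuous_map (top_of_set {-1..1}) X (\<lambda>x. q e (x, b))"
proof -
  have "continuous_map (top_of_set {-1..1}) (top_of_set square) (\<lambda>x. (x, b))"
    using assms by (auto simp: square_def intro!: continuous_intros)
  from continuous_map_compose[OF this q_continuous[OF assms(1)]] show ?thesis by (simp add: o_def)
qed

text \<open>The attaching arc, read in the coordinates of the 0-band. In this form the arcs at a
  vertex are disjoint arcs of the unit circle.\<close>

lemma vpath_exists:
  assumes e: "e \<in> edges G" and a: "a \<in> {-1, 1}"
  shows "\<exists>r. continuous_on {-1..1} r \<and> r ` {-1..1} \<subseteq> sphere 0 1 \<and> inj_on r {-1..1} \<and>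
    (\<forall>y\<in>{-1..1}. c (att e a) (r y) = q e (a, y))"
proof -
  let ?v = "att e a"
  note v = att[OF e a]
  have "vside e a \<subseteq> c ?v ` cball 0 1" using v(2) sphere_cball by blast
  then have "(\<lambda>y. q e (a, y)) ` {-1..1} \<subseteq> c ?v ` cball 0 1" by auto
  then obtain r where r: "continuous_on {-1..1} r" "r ` {-1..1} \<subseteq> cball 0 1" "\<And>y. y \<in> {-1..1} \<Longrightarrow> c ?v (r y) = q e (a, y)"
    using embedding_lift_path[OF c_embedding[OF v(1)] continuous_vpath[OF e a]] by blast
  have sq: "(a, y) \<in> square" if "y \<in> {-1..1}" for y using that a by (auto simp: square_def)
  have "r y \<in> sphere 0 1" if y: "y \<in> {-1..1}" for y
    using band_Int_cball[OF e v(1) sq[OF y], of "r y"] r y by force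
  moreover have "inj_on r {-1..1}"
  proof (rule inj_onI)
    fix x y assume "x \<in> {-1..1}" "y \<in> {-1..1}" "r x = r y"
    then show "x = y" using r(3) q_eq_imp[OF e e sq sq] by (metis snd_conv)
  qed
  ultimately show ?thesis using r by blast
qed

definition vpath :: "'e \<Rightarrow> real \<Rightarrow> real \<Rightarrow> complex" where
  "vpath e a = (SOME r. continuous_on {-1..1} r \<and> r ` {-1..1} \<subseteq> sphere 0 1 \<and> inj_on r {-1..1} \<and>
    (\<forall>y\<in>{-1..1}. c (att e a) (r y) = q e (a, y)))"

lemma vpath:
  assumes "e \<in> edges G" "a \<in> {-1, 1}"
  shows "continuous_on {-1..1} (vpath e a)" "vpath e a ` {-1..1} \<subseteq> sphere 0 1" "inj_on (vpath e a) {-1..1}"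
    "\<And>y. y \<in> {-1..1} \<Longrightarrow> c (att e a) (vpath e a y) = q e (a, y)"
  using someI_ex[OF vpath_exists[OF assms]] unfolding vpath_def by blast+

section \<open>The boundary of a union of bands\<close>

text \<open>The frontier of \<Delta> in explicit form: the circles without the open attaching arcs
  of the bands in \<open>D\<close>, together with the horizontal sides of these bands. The corners
  stay in.\<close>

definition outline :: "'e set \<Rightarrow> 'a set" where
  "outline D = ((\<Union>v\<in>vertices G. circle v) - (\<Union>e\<in>D. \<Union>a\<in>{-1,1}. q e ` ({a} \<times> {-1<..<1})))
     \<union> (\<Union>e\<in>D. \<Union>b\<in>{-1,1}. hside e b)"

lemma disc_openin: "v \<in> vertices G \<Longrightarrow> openin X (disc v)"
  by (rule surface_invariance_of_domain[OF surface_X open_ball])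
    (auto intro: inj_on_subset[OF c_inj_on] continuous_map_from_subtopology_mono[OF c_continuous])

lemma open_band_openin:
  assumes "e \<in> edges G" shows "openin X (q e ` ({-1<..<1} \<times> {-1<..<1}))"
proof (rule surface_invariance_of_domain[OF surface_X])
  have sub: "{-1<..<1} \<times> {-1<..<1} \<subseteq> square" by (auto simp: square_def)
  show "open ({-1<..<1::real} \<times> {-1<..<1::real})" by (intro open_Times) auto
  show "continuous_map (top_of_set ({-1<..<1} \<times> {-1<..<1})) X (q e)"
    using continuous_map_from_subtopology_mono[OF q_continuous[OF assms] sub] .
  show "inj_on (q e) ({-1<..<1} \<times> {-1<..<1})" using inj_on_subset[OF q_inj_on[OF assms] sub] .
qed simp

text \<open>Across an attaching arc, half of the band and the radial part of the 0-band fit together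
  to an injective image of an open rectangle, which is open in the surface.\<close>

lemma open_vside_nbhd:
  assumes e: "e \<in> edges G" and a: "a \<in> {-1, 1}" and y: "y \<in> {-1<..<1}"
  shows "\<exists>W. openin X W \<and> q e (a, y) \<in> W \<and> W \<subseteq> c (att e a) ` cball 0 1 \<union> band e"
proof -
  let ?v = "att e a"
  note v = att[OF e a] and vp = vpath[OF e a]
  \<comment> \<open>The first coordinate runs from the middle of the band (0) through the attaching
    arc (1) towards the centre of the 0-band (2).\<close>
  define F where "F z = (if fst z \<le> 1 then q e (a * fst z, snd z) else c ?v ((2 - fst z) *\<^sub>R vpath e a (snd z)))" for z
  let ?S = "{0<..<2::real} \<times> {-1<..<1::real}"
  have F1: "F z = q e (a * fst z, snd z)" "(a * fst z, snd z) \<in> square" if "z \<in> ?S" "fst z \<le> 1" for z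
    using that a by (auto simp: F_def square_def)
  have nv: "norm (vpath e a (snd z)) = 1" if "z \<in> ?S" for z
  proof -
    have "snd z \<in> {-1..1}" using that by auto
    then have "vpath e a (snd z) \<in> sphere 0 1" using vp(2) by blast
    then show ?thesis by simp
  qed
  have F2: "F z = c ?v ((2 - fst z) *\<^sub>R vpath e a (snd z))" "(2 - fst z) *\<^sub>R vpath e a (snd z) \<in> cball 0 1"
    if z: "z \<in> ?S" "fst z \<ge> 1" for z
  proof -
    show "(2 - fst z) *\<^sub>R vpath e a (snd z) \<in> cball 0 1" using z nv[OF z(1)] by auto
    have "q e (a, snd z) = c ?v (vpath e a (snd z))" using vp(4)[of "snd z"] z by auto
    then show "F z = c ?v ((2 - fst z) *\<^sub>R vpath e a (snd z))" using z by (cases "fst z = 1") (auto simp: F_def)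
  qed
  have cont: "continuous_map (top_of_set ?S) X F"
  proof (rule pasting_lemma_closed[of "{True, False}" _ "\<lambda>b. if b then {z \<in> ?S. fst z \<le> 1} else {z \<in> ?S. fst z \<ge> 1}" _ "\<lambda>_. F"])
    fix i :: bool
    have "closedin (top_of_set ?S) {z \<in> ?S. fst z \<in> {..1}}" "closedin (top_of_set ?S) {z \<in> ?S. fst z \<in> {1..}}"
      by (intro continuous_closedin_preimage[unfolded vimage_def Int_def mem_Collect_eq] continuous_intros; simp)+
    then show "closedin (top_of_set ?S) (if i then {z \<in> ?S. fst z \<le> 1} else {z \<in> ?S. fst z \<ge> 1})" by auto
    show "continuous_map (subtopology (top_of_set ?S) (if i then {z \<in> ?S. fst z \<le> 1} else {z \<in> ?S. fst z \<ge> 1})) X F"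
    proof (cases i)
      case True
      have "continuous_map (top_of_set {z \<in> ?S. fst z \<le> 1}) (top_of_set square) (\<lambda>z. (a * fst z, snd z))"
        using a by (auto simp: square_def intro!: continuous_intros)
      from continuous_map_compose[OF this q_continuous[OF e]]
      have "continuous_map (top_of_set {z \<in> ?S. fst z \<le> 1}) X F"
        by (rule continuous_map_eq) (use F1 in auto)
      then show ?thesis using True by (simp add: subtopology_subtopology Int_absorb1 subset_iff)
    next
      case False
      have "continuous_on {z \<in> ?S. fst z \<ge> 1} (\<lambda>z. vpath e a (snd z))"
        by (rule continuous_on_compose2[OF vp(1)]) (auto intro!: continuous_intros)
      then have "continuous_map (top_of_set {z \<in> ?S. fst z \<ge> 1}) (top_of_set (cball 0 1)) (\<lambda>z. (2 - fst z) *\<^sub>R vpath e a (snd z))"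
        using F2(2) by (auto intro!: continuous_intros)
      from continuous_map_compose[OF this c_continuous[OF v(1)]]
      have "continuous_map (top_of_set {z \<in> ?S. fst z \<ge> 1}) X F"
        by (rule continuous_map_eq) (use F2 in auto)
      then show ?thesis using False by (simp add: subtopology_subtopology Int_absorb1 subset_iff)
    qed
  next
    fix x assume "x \<in> topspace (top_of_set ?S)"
    then show "\<exists>j. j \<in> {True, False} \<and> x \<in> (if j then {z \<in> ?S. fst z \<le> 1} else {z \<in> ?S. fst z \<ge> 1}) \<and> F x = F x"
      by (intro exI[of _ "fst x \<le> 1"]) auto
  qed simp_all
  have inj: "inj_on F ?S"
  proof (rule inj_onI)
    fix z w assume z: "z \<in> ?S" and w: "w \<in> ?S" and eq: "F z = F w"
    have mixed: False if "z \<in> ?S" "w \<in> ?S" "fst z \<le> 1" "fst w > 1" "F z = F w" for z w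
    proof -
      have ge: "fst w \<ge> 1" using that(4) by simp
      have "q e (a * fst z, snd z) = c ?v ((2 - fst w) *\<^sub>R vpath e a (snd w))"
        using F1(1)[OF that(1,3)] F2(1)[OF that(2) ge] that(5) by metis
      from band_Int_cball[OF e v(1) F1(2)[OF that(1,3)] F2(2)[OF that(2) ge] this]
      have "norm ((2 - fst w) *\<^sub>R vpath e a (snd w)) = 1" by simp
      then show False using nv[OF that(2)] that(2,4) by auto
    qed
    consider "fst z \<le> 1" "fst w \<le> 1" | "fst z > 1" "fst w > 1" using mixed[OF z w] mixed[OF w z] eq by force
    then show "z = w"
    proof cases
      case 1
      then show ?thesis using q_eq_imp[OF e e F1(2)[OF z 1(1)] F1(2)[OF w 1(2)]] F1(1)[OF z 1(1)] F1(1)[OF w 1(2)] eq a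
        by (auto simp: prod_eq_iff)
    next
      case 2
      then have ge: "fst z \<ge> 1" "fst w \<ge> 1" by auto
      have e1: "(2 - fst z) *\<^sub>R vpath e a (snd z) = (2 - fst w) *\<^sub>R vpath e a (snd w)"
        using c_eq_imp[OF v(1) v(1) F2(2)[OF z ge(1)] F2(2)[OF w ge(2)]] F2(1)[OF z ge(1)] F2(1)[OF w ge(2)] eq by simp
      then have "norm ((2 - fst z) *\<^sub>R vpath e a (snd z)) = norm ((2 - fst w) *\<^sub>R vpath e a (snd w))" by simp
      then have f: "fst z = fst w" using nv[OF z] nv[OF w] z w by auto
      then have "vpath e a (snd z) = vpath e a (snd w)" using e1 z w by auto
      then show ?thesis using inj_onD[OF vp(3), of "snd z" "snd w"] z w f by (auto simp: prod_eq_iff)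
    qed
  qed
  have "open ?S" by (intro open_Times) auto
  then have "openin X (F ` ?S)" using surface_invariance_of_domain[OF surface_X _ _ cont inj] by simp
  moreover have "q e (a, y) \<in> F ` ?S" by (rule image_eqI[of _ _ "(1, y)"]) (use y in \<open>auto simp: F_def\<close>)
  moreover have "F ` ?S \<subseteq> c ?v ` cball 0 1 \<union> band e"
  proof
    fix x assume "x \<in> F ` ?S"
    then obtain z where z: "z \<in> ?S" "x = F z" by blast
    show "x \<in> c ?v ` cball 0 1 \<union> band e"
      using F1[OF z(1)] F2[OF z(1)] z(2) by (cases "fst z \<le> 1") force+
  qed
  ultimately show ?thesis by blast
qed

text \<open>Points off the outline have open neighbourhoods within the union: open discs, open
  bands, or the rectangles across attaching arcs. Conversely, after removing the other closed bands
  a point of the outline would be an interior point of a disc or a square, although it lies on its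
  boundary.\<close>

lemma frontier_band_union:
  assumes D: "D \<subseteq> edges G"
  shows "X frontier_of (band_union (vertices G) D c q) = outline D"
proof -
  let ?\<Delta> = "band_union (vertices G) D c q"
  let ?I = "X interior_of ?\<Delta>"
  have finD: "finite D" using finite_subset[OF D finite_edges] .
  have De: "e \<in> edges G" if "e \<in> D" for e using that D by blast
  have clc: "closedin X (c v ` cball 0 1)" if "v \<in> vertices G" for v using c_closedin[OF that compact_cball order_refl] .
  have clq: "closedin X (band e)" if "e \<in> edges G" for e using q_closedin[OF that compact_square order_refl] .
  have "closedin X ?\<Delta>" unfolding band_union_def using finD finite_vertices clc clq De
    by (intro closedin_Un closedin_Union) auto
  then have fr: "X frontier_of ?\<Delta> = ?\<Delta> - ?I" unfolding frontier_of_def by (simp add: closure_of_closedin)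
  have intI: "x \<in> ?I" if "openin X W" "x \<in> W" "W \<subseteq> ?\<Delta>" for x W
    using that interior_of_maximal by blast
  have "?\<Delta> - ?I \<subseteq> outline D"
  proof
    fix x assume x: "x \<in> ?\<Delta> - ?I"
    have notdisc: "x \<notin> disc v" if v: "v \<in> vertices G" for v
    proof
      have "disc v \<subseteq> c v ` cball 0 1" by (intro image_mono ball_subset_cball)
      then have "disc v \<subseteq> ?\<Delta>" using v unfolding band_union_def by auto
      moreover assume "x \<in> disc v"
      ultimately have "x \<in> ?I" using intI[OF disc_openin[OF v]] by simp
      then show False using x by simp
    qed
    have notopen: "x \<notin> q e ` ({-1<..<1} \<times> {-1<..<1})" if "e \<in> D" for e
    proof
      assume "x \<in> q e ` ({-1<..<1} \<times> {-1<..<1})"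
      moreover have "q e ` ({-1<..<1} \<times> {-1<..<1}) \<subseteq> ?\<Delta>" using that unfolding band_union_def square_def by force
      ultimately show False using intI[OF open_band_openin[OF De[OF that]], of x] x by blast
    qed
    have notv: "x \<notin> q e ` ({a} \<times> {-1<..<1})" if e: "e \<in> D" and a: "a \<in> {-1, 1}" for e a
    proof
      assume "x \<in> q e ` ({a} \<times> {-1<..<1})"
      then obtain y where y: "y \<in> {-1<..<1}" "x = q e (a, y)" by blast
      obtain W where "openin X W" "q e (a, y) \<in> W" "W \<subseteq> c (att e a) ` cball 0 1 \<union> band e"
        using open_vside_nbhd[OF De[OF e] a y(1)] by blast
      moreover have "c (att e a) ` cball 0 1 \<union> band e \<subseteq> ?\<Delta>"
        using att(1)[OF De[OF e] a] e unfolding band_union_def by blast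
      ultimately show False using intI[of W x] x y(2) by blast
    qed
    consider v where "v \<in> vertices G" "x \<in> c v ` cball 0 1" | e where "e \<in> D" "x \<in> band e"
      using x unfolding band_union_def by blast
    then show "x \<in> outline D"
    proof cases
      case 1
      then obtain z where z: "z \<in> cball 0 1" "x = c v z" by blast
      then have "z \<in> sphere 0 1" using notdisc[OF 1(1)] by force
      then have "x \<in> circle v" using z by blast
      then show ?thesis using 1(1) notv unfolding outline_def by blast
    next
      case 2
      then obtain y z where yz: "(y, z) \<in> square" "x = q e (y, z)" by auto
      show ?thesis
      proof (cases "z \<in> {-1, 1}")
        case True
        then have "x \<in> hside e z" using yz by (auto simp: square_def)
        then show ?thesis using True 2(1) unfolding outline_def by blast
      next
        case False
        then have z: "z \<in> {-1<..<1}" using yz by (auto simp: square_def)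
        have "y \<in> {-1, 1} \<or> y \<in> {-1<..<1}" using yz by (auto simp: square_def)
        then show ?thesis using notv[OF 2(1)] notopen[OF 2(1)] z yz by blast
      qed
    qed
  qed
  moreover have "outline D \<subseteq> ?\<Delta> - ?I"
  proof
    fix x assume x: "x \<in> outline D"
    have "circle v \<subseteq> c v ` cball 0 1" for v by (intro image_mono sphere_cball)
    then have "(\<Union>v\<in>vertices G. circle v) \<subseteq> ?\<Delta>" unfolding band_union_def by auto
    moreover have "(\<Union>e\<in>D. \<Union>b\<in>{-1,1}. hside e b) \<subseteq> ?\<Delta>"
      unfolding band_union_def using hside_subset_band by (intro UN_least le_supI2) (auto simp: square_def)
    ultimately have sub: "x \<in> ?\<Delta>" using x unfolding outline_def by (elim UnE DiffE) (rule subsetD; assumption)+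
    \<comment> \<open>For points of a circle that lie on no band of \<open>D\<close>: nearby only
      the one disc is left.\<close>
    have isolate: False if W: "openin X W" "x \<in> W" "W \<subseteq> ?\<Delta>" and v: "v \<in> vertices G" and xv: "x \<in> circle v"
      and nb: "\<And>e. e \<in> D \<Longrightarrow> x \<notin> band e" for x W v
    proof -
      let ?C = "(\<Union>w\<in>vertices G - {v}. c w ` cball 0 1) \<union> (\<Union>e\<in>D. band e)"
      have "closedin X ?C" using finD finite_vertices clc clq De by (intro closedin_Un closedin_Union) auto
      then have op: "openin X (W - ?C)" using W(1) by blast
      obtain z where z: "z \<in> sphere 0 1" "x = c v z" using xv by blast
      have "x \<notin> c w ` cball 0 1" if "w \<in> vertices G - {v}" for w
        using c_eq_imp[OF v, of w z] that z by force
      then have "x \<in> W - ?C" using W(2) nb by blast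
      moreover have "?\<Delta> - ?C \<subseteq> c v ` cball 0 1" unfolding band_union_def by auto
      then have "W - ?C \<subseteq> c v ` cball 0 1" using W(3) by (meson Diff_mono order_refl order_trans)
      ultimately have "z \<in> interior (cball 0 1)"
        using surface_interior_preimage[OF surface_X _ c_embedding[OF v] op, of z] z by auto
      then show False using z(1) by simp
    qed
    \<comment> \<open>For inner points of a horizontal side. Corners are excluded here because there
      the 0-band is present as well.\<close>
    have hopen: False if W: "openin X W" "q e (y, b) \<in> W" "W \<subseteq> ?\<Delta>" and e: "e \<in> D" and b: "b \<in> {-1, 1}" and y: "y \<in> {-1<..<1}"
      for W e y b
    proof -
      let ?C = "(\<Union>w\<in>vertices G. c w ` cball 0 1) \<union> (\<Union>e'\<in>D - {e}. band e')"
      have sq: "(y, b) \<in> square" using b y by (auto simp: square_def)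
      have "closedin X ?C" using finD finite_vertices clc clq De by (intro closedin_Un closedin_Union) auto
      then have op: "openin X (W - ?C)" using W(1) by blast
      have "q e (y, b) \<notin> c w ` cball 0 1" if "w \<in> vertices G" for w
        using band_Int_cball[OF De[OF e] that sq] y by force
      moreover have "q e (y, b) \<notin> band e'" if "e' \<in> D - {e}" for e'
        using q_eq_imp[OF De[OF e] _ sq, of e'] that De by blast
      ultimately have "q e (y, b) \<in> W - ?C" using W(2) by blast
      moreover have "?\<Delta> - ?C \<subseteq> band e" unfolding band_union_def by auto
      then have "W - ?C \<subseteq> band e" using W(3) by (meson Diff_mono order_refl order_trans)
      ultimately have "(y, b) \<in> interior square"
        using surface_interior_preimage[OF surface_X _ q_embedding[OF De[OF e]] op, of "(y, b)"] sq by auto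
      then show False using b unfolding square_def by (auto simp: interior_Times)
    qed
    have "x \<notin> ?I"
    proof
      assume xI: "x \<in> ?I"
      have IW: "openin X ?I" "?I \<subseteq> ?\<Delta>" by (auto simp: interior_of_subset)
      define H where "H = (\<Union>e\<in>D. \<Union>b\<in>{-1,1}. hside e b)"
      define B where "B = (\<Union>e\<in>D. \<Union>a\<in>{-1,1}. q e ` ({a} \<times> {-1<..<1}))"
      have xHB: "x \<in> (\<Union>v\<in>vertices G. circle v) - B \<union> H" using x unfolding outline_def H_def B_def .
      consider e b where "e \<in> D" "b \<in> {-1, 1}" "x \<in> hside e b" | v where "v \<in> vertices G" "x \<in> circle v" "x \<notin> B" "x \<notin> H"
      proof (cases "x \<in> H")
        case True
        then obtain e where e: "e \<in> D" "x \<in> (\<Union>b\<in>{-1,1}. hside e b)" unfolding H_def by (rule UN_E)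
        from e(2) obtain b where "b \<in> {-1,1}" "x \<in> hside e b" by (rule UN_E)
        then show thesis using that(1) e(1) by blast
      next
        case False
        then have "x \<in> (\<Union>v\<in>vertices G. circle v)" "x \<notin> B" using xHB by simp_all
        then show thesis using that(2) False by (elim UN_E)
      qed
      then show False
      proof cases
        case 1
        then obtain y where y: "y \<in> {-1..1}" "x = q e (y, b)" by blast
        have sq: "(y, b) \<in> square" using 1 y by (auto simp: square_def)
        obtain d where d: "d > 0" "q e ` (square \<inter> ball (y, b) d) \<subseteq> ?I"
          using embedding_ball[OF q_embedding[OF De[OF 1(1)]] hausdorff compact_square sq IW(1)] xI y(2) by blast
        \<comment> \<open>A corner is replaced by a nearby inner point of the horizontal side, since
          an open set around the corner contains such points. The shift is at most
          \<open>m < d\<close>.\<close>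
        define m where "m = min (1/2) (d / 4)"
        define y' where "y' = (1 - m) * y"
        have m: "0 < m" "m < 1" "m < d" using d(1) by (auto simp: m_def)
        have "\<bar>y'\<bar> = (1 - m) * \<bar>y\<bar>" using m unfolding y'_def by (simp add: abs_mult)
        also have "\<dots> \<le> (1 - m) * 1" using y(1) m by (intro mult_left_mono) auto
        finally have "\<bar>y'\<bar> < 1" using m by simp
        then have y': "y' \<in> {-1<..<1}" by auto
        have "y - y' = m * y" unfolding y'_def by (simp add: algebra_simps)
        then have "dist (y, b) (y', b) = m * \<bar>y\<bar>"
          using m unfolding dist_Pair_Pair by (simp add: dist_real_def abs_mult)
        also have "\<dots> \<le> m * 1" using y(1) m by (intro mult_left_mono) auto
        also have "\<dots> < d" using m by simp
        finally have "(y', b) \<in> square \<inter> ball (y, b) d" using y' 1(2) by (auto simp: square_def)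
        then have "q e (y', b) \<in> ?I" using d(2) by blast
        then show False using hopen[OF IW(1) _ IW(2) 1(1,2) y'] by blast
      next
        case 2
        have "x \<notin> band e" if e: "e \<in> D" for e
        proof
          assume "x \<in> band e"
          then obtain y where y: "y \<in> square" "x = q e y" by blast
          obtain z where z: "z \<in> sphere 0 1" "x = c v z" using 2(2) by blast
          have "fst y \<in> {-1, 1}" using band_Int_cball[OF De[OF e] 2(1) y(1), of z] y(2) z by auto
          moreover have "snd y \<in> {-1<..<1} \<or> snd y \<in> {-1, 1}" using y(1) by (auto simp: square_def)
          ultimately have "(y \<in> {fst y} \<times> {-1<..<1} \<and> fst y \<in> {-1,1}) \<or> (y \<in> {-1..1} \<times> {snd y} \<and> snd y \<in> {-1,1})"
            using y(1) by (auto simp: square_def mem_Times_iff)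
          then have "x \<in> B \<or> x \<in> H"
          proof (elim disjE conjE)
            assume "y \<in> {fst y} \<times> {-1<..<1}" "fst y \<in> {-1,1}"
            then have "x \<in> q e ` ({fst y} \<times> {-1<..<1})" unfolding y(2) by (intro imageI)
            then show ?thesis using e \<open>fst y \<in> {-1,1}\<close> unfolding B_def by (intro disjI1 UN_I)
          next
            assume "y \<in> {-1..1} \<times> {snd y}" "snd y \<in> {-1,1}"
            then have "x \<in> hside e (snd y)" unfolding y(2) by (intro imageI)
            then show ?thesis using e \<open>snd y \<in> {-1,1}\<close> unfolding H_def by (intro disjI2 UN_I)
          qed
          then show False using 2(3,4) by blast
        qed
        then show False using isolate[OF IW(1) xI IW(2) 2(1,2)] by blast
      qed
    qed
    then show "x \<in> ?\<Delta> - ?I" using sub by blast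
  qed
  ultimately show ?thesis using fr by blast
qed

end

section \<open>Cones and the dissection of the standard triangle\<close>

text \<open>At the tip the direction \<open>u (T z)\<close> has no limit, but it is bounded and
  multiplied by \<open>N z\<close>, which tends to 0.\<close>

lemma continuous_on_cone:
  fixes u :: "real \<Rightarrow> complex" and S :: "complex set"
  assumes N: "continuous_on S N" and T: "continuous_on {z \<in> S. N z \<noteq> 0} T" "\<And>z. z \<in> S \<Longrightarrow> N z \<noteq> 0 \<Longrightarrow> T z \<in> A"
    and u: "continuous_on A u" "u ` A \<subseteq> sphere 0 1"
  shows "continuous_on S (\<lambda>z. N z *\<^sub>R (if N z = 0 then 0 else u (T z)))"
  unfolding continuous_on_def
proof
  let ?g = "\<lambda>z. N z *\<^sub>R (if N z = 0 then 0 else u (T z))"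
  fix z assume z: "z \<in> S"
  show "(?g \<longlongrightarrow> ?g z) (at z within S)"
  proof (cases "N z = 0")
    case True
    have "(N \<longlongrightarrow> 0) (at z within S)" using N z True unfolding continuous_on_def by force
    moreover have "\<forall>\<^sub>F w in at z within S. norm (?g w) \<le> norm (N w) * 1"
    proof (rule eventually_at_filter[THEN iffD2], rule always_eventually, intro allI impI)
      fix w assume "w \<noteq> z" "w \<in> S"
      show "norm (?g w) \<le> norm (N w) * 1"
      proof (cases "N w = 0")
        case False
        then have "norm (u (T w)) = 1" using T(2)[OF \<open>w \<in> S\<close> False] u(2) by (metis dist_0_norm imageI mem_sphere subsetD)
        then show ?thesis by simp
      qed simp
    qed
    moreover from calculation(1) have "((\<lambda>w. norm (N w) * 1) \<longlongrightarrow> 0) (at z within S)"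
      by (simp add: tendsto_norm_zero_iff flip: real_norm_def)
    ultimately have "(?g \<longlongrightarrow> 0) (at z within S)" by (rule_tac Lim_null_comparison)
    then show ?thesis using True by simp
  next
    case False
    let ?S' = "{w \<in> S. N w \<noteq> 0}"
    have "openin (top_of_set S) {w \<in> S. N w \<in> - {0}}"
      using continuous_openin_preimage[OF N, of UNIV "- {0}"] by (simp add: vimage_def Int_def open_Compl)
    then obtain O' where O': "open O'" "?S' = S \<inter> O'" unfolding openin_open by auto
    have at: "at z within S = at z within ?S'"
      by (rule at_within_nhd[of z O']) (use O' z False in auto)
    have "continuous_on ?S' (\<lambda>w. N w *\<^sub>R u (T w))"
      by (intro continuous_intros continuous_on_subset[OF N] continuous_on_compose2[OF u(1) T(1)]) (use T(2) in auto)
    then have "((\<lambda>w. N w *\<^sub>R u (T w)) \<longlongrightarrow> N z *\<^sub>R u (T z)) (at z within ?S')"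
      using z False unfolding continuous_on_def by blast
    moreover have "\<forall>\<^sub>F w in at z within ?S'. N w *\<^sub>R u (T w) = ?g w"
      by (auto simp: eventually_at_filter)
    ultimately have "(?g \<longlongrightarrow> N z *\<^sub>R u (T z)) (at z within ?S')" by (rule Lim_transform_eventually)
    then show ?thesis using at False by simp
  qed
qed

text \<open>The standard triangle is cut into a kite at each corner. The kites at \<open>0\<close> and \<open>\<i>\<close> are
  cones over paths parametrised by \<open>{0..2}\<close>, with radial coordinates \<open>n\<close> and \<open>\<tau>\<close>; the kite at
  \<open>1\<close> is a parallelogram. They meet in the point with coordinates 1/3 and 1/3.\<close>

definition pt0 :: "real \<Rightarrow> real \<Rightarrow> complex" where
  "pt0 n \<tau> = Complex (n * (2 - \<tau>) / 3) (n * \<tau> / 3)"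

definition pt1 :: "real \<Rightarrow> real \<Rightarrow> complex" where
  "pt1 \<alpha> \<beta> = Complex (1 - \<alpha> / 3 - \<beta> / 3) (\<beta> / 3)"

text \<open>The outer boundary of this kite has a bend at the point with coordinates 1/3 and 1/3: it
  follows \<open>Im z = 1/3\<close> for \<tau> \<le> 1 and \<open>Re z + Im z = 2/3\<close>
  afterwards. The maximum here, and the one in \<open>rad2\<close>, come from this bend.\<close>

definition pt2 :: "real \<Rightarrow> real \<Rightarrow> complex" where
  "pt2 n \<tau> = Complex (n * (2 - \<tau>) / 3) (1 - n * (3 - max 1 \<tau>) / 3)"

definition rad0 :: "complex \<Rightarrow> real" where "rad0 z = 3 / 2 * (Re z + Im z)"
definition ang0 :: "complex \<Rightarrow> real" where "ang0 z = 3 * Im z / rad0 z"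
definition rad2 :: "complex \<Rightarrow> real" where "rad2 z = max (3 / 2 * (1 - Im z)) (3 * (1 - Im z - Re z))"
definition ang2 :: "complex \<Rightarrow> real" where "ang2 z = 2 - 3 * Re z / rad2 z"

definition kite0 :: "complex set" where "kite0 = {z \<in> std_triangle. Re z + Im z \<le> 2/3}"
definition kite1 :: "complex set" where "kite1 = {z \<in> std_triangle. Im z \<le> 1/3 \<and> 2/3 \<le> Re z + Im z}"
definition kite2 :: "complex set" where "kite2 = {z \<in> std_triangle. 1/3 \<le> Im z \<and> 2/3 \<le> Re z + Im z}"

lemma kites_cover: "z \<in> std_triangle \<Longrightarrow> z \<in> kite0 \<or> z \<in> kite1 \<or> z \<in> kite2"
  by (auto simp: kite0_def kite1_def kite2_def)

lemma kite0_param: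
  assumes "z \<in> kite0"
  shows "rad0 z \<in> {0..1}" "rad0 z \<noteq> 0 \<Longrightarrow> ang0 z \<in> {0..2}" "rad0 z \<noteq> 0 \<Longrightarrow> z = pt0 (rad0 z) (ang0 z)" "rad0 z = 0 \<longleftrightarrow> z = 0"
proof -
  have z: "0 \<le> Re z" "0 \<le> Im z" "Re z + Im z \<le> 2/3" using assms by (auto simp: kite0_def std_triangle_eq)
  show "rad0 z \<in> {0..1}" using z by (auto simp: rad0_def)
  show "rad0 z = 0 \<longleftrightarrow> z = 0" using z by (auto simp: rad0_def complex_eq_iff)
  assume nz: "rad0 z \<noteq> 0"
  then have p: "rad0 z > 0" using z by (auto simp: rad0_def)
  show "ang0 z \<in> {0..2}" using z p by (auto simp: ang0_def divide_le_eq) (auto simp: rad0_def)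
  have "rad0 z * ang0 z = 3 * Im z" using p by (simp add: ang0_def)
  moreover from this have "Re z = rad0 z * (2 - ang0 z) / 3"
    unfolding right_diff_distrib rad0_def[of z] by (simp add: field_simps)
  ultimately show "z = pt0 (rad0 z) (ang0 z)" by (simp add: pt0_def complex_eq_iff)
qed

lemma pt0_kite0:
  assumes "n \<in> {0..1}" "\<tau> \<in> {0..2}"
  shows "pt0 n \<tau> \<in> kite0" "rad0 (pt0 n \<tau>) = n" "n \<noteq> 0 \<Longrightarrow> ang0 (pt0 n \<tau>) = \<tau>"
proof -
  have s: "Re (pt0 n \<tau>) + Im (pt0 n \<tau>) = 2 * n / 3" by (simp add: pt0_def field_simps)
  then show r: "rad0 (pt0 n \<tau>) = n" by (simp add: rad0_def)
  show "n \<noteq> 0 \<Longrightarrow> ang0 (pt0 n \<tau>) = \<tau>" unfolding ang0_def r by (simp add: pt0_def)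
  show "pt0 n \<tau> \<in> kite0" using assms s by (auto simp: kite0_def std_triangle_eq pt0_def)
qed

lemma kite2_param:
  assumes "z \<in> kite2"
  shows "rad2 z \<in> {0..1}" "rad2 z \<noteq> 0 \<Longrightarrow> ang2 z \<in> {0..2}" "rad2 z \<noteq> 0 \<Longrightarrow> z = pt2 (rad2 z) (ang2 z)" "rad2 z = 0 \<longleftrightarrow> z = \<i>"
proof -
  have z: "0 \<le> Re z" "Re z + Im z \<le> 1" "1/3 \<le> Im z" "2/3 \<le> Re z + Im z" using assms by (auto simp: kite2_def std_triangle_eq)
  show "rad2 z \<in> {0..1}" using z by (auto simp: rad2_def)
  show "rad2 z = 0 \<longleftrightarrow> z = \<i>" using z by (auto simp: rad2_def complex_eq_iff max_def split: if_splits)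
  assume nz: "rad2 z \<noteq> 0"
  then have p: "rad2 z > 0" using z by (auto simp: rad2_def)
  have le: "3 * Re z \<le> 2 * rad2 z" using z by (auto simp: rad2_def max_def)
  then show "ang2 z \<in> {0..2}" using z p by (auto simp: ang2_def divide_le_eq)
  have ra: "rad2 z * ang2 z = 2 * rad2 z - 3 * Re z" using p by (simp add: ang2_def right_diff_distrib)
  have "Im z = 1 - rad2 z * (3 - max 1 (ang2 z)) / 3"
  proof (cases "ang2 z \<le> 1")
    case True
    then have "rad2 z * ang2 z \<le> rad2 z * 1" using p by (intro mult_left_mono) auto
    then have "rad2 z \<le> 3 * Re z" using ra by simp
    then have "rad2 z = 3 / 2 * (1 - Im z)" by (auto simp: rad2_def max_def split: if_splits)
    moreover have "max 1 (ang2 z) = 1" using True by simp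
    ultimately show ?thesis by (simp add: field_simps)
  next
    case False
    then have "rad2 z * 1 < rad2 z * ang2 z" using p by (intro mult_strict_left_mono) auto
    then have "3 * Re z < rad2 z" using ra by simp
    then have "rad2 z = 3 * (1 - Im z - Re z)" using z by (auto simp: rad2_def max_def split: if_splits)
    moreover have "max 1 (ang2 z) = ang2 z" using False by simp
    moreover have "rad2 z * (3 - ang2 z) = 3 * rad2 z - (2 * rad2 z - 3 * Re z)" using ra by (simp add: right_diff_distrib)
    ultimately show ?thesis by (simp add: field_simps)
  qed
  then show "z = pt2 (rad2 z) (ang2 z)" using ra by (auto simp: pt2_def complex_eq_iff right_diff_distrib)
qed

lemma pt2_kite2:
  assumes "n \<in> {0..1}" "\<tau> \<in> {0..2}"
  shows "pt2 n \<tau> \<in> kite2" "rad2 (pt2 n \<tau>) = n" "n \<noteq> 0 \<Longrightarrow> ang2 (pt2 n \<tau>) = \<tau>"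
proof -
  have n: "0 \<le> n" "n \<le> 1" and t: "0 \<le> \<tau>" "\<tau> \<le> 2" using assms by auto
  have nt: "0 \<le> n * \<tau>" "n * \<tau> \<le> n * 2" using n t by (auto intro: mult_left_mono)
  have c1: "n * \<tau> \<le> n" if "\<tau> \<le> 1" using mult_left_mono[OF that n(1)] by simp
  have c2: "n \<le> n * \<tau>" if "1 \<le> \<tau>" using mult_left_mono[OF that n(1)] by simp
  have im: "Im (pt2 n \<tau>) = 1 - n + n * max 1 \<tau> / 3" and re: "Re (pt2 n \<tau>) = 2 * n / 3 - n * \<tau> / 3"
    by (auto simp: pt2_def field_simps)
  show r: "rad2 (pt2 n \<tau>) = n"
    using c1 c2 unfolding rad2_def im re by (auto simp: max_def field_simps)
  show "n \<noteq> 0 \<Longrightarrow> ang2 (pt2 n \<tau>) = \<tau>" unfolding ang2_def r re by (simp add: field_simps)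
  show "pt2 n \<tau> \<in> kite2" using c1 c2 nt n t unfolding kite2_def std_triangle_eq
    by (simp add: im re) (auto simp: max_def field_simps)
qed

lemma kite1_param:
  assumes "z \<in> kite1"
  obtains \<alpha> \<beta> where "\<alpha> \<in> {0..1}" "\<beta> \<in> {0..1}" "z = pt1 \<alpha> \<beta>"
proof (rule that)
  have z: "0 \<le> Im z" "Re z + Im z \<le> 1" "Im z \<le> 1/3" "2/3 \<le> Re z + Im z" using assms by (auto simp: kite1_def std_triangle_eq)
  show "3 * (1 - Re z - Im z) \<in> {0..1}" "3 * Im z \<in> {0..1}" using z by auto
  show "z = pt1 (3 * (1 - Re z - Im z)) (3 * Im z)" by (simp add: pt1_def complex_eq_iff field_simps)
qed

lemma pt1_kite1: "\<alpha> \<in> {0..1} \<Longrightarrow> \<beta> \<in> {0..1} \<Longrightarrow> pt1 \<alpha> \<beta> \<in> kite1"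
  by (auto simp: pt1_def kite1_def std_triangle_eq)

lemma pt_sides:
  assumes "n \<in> {0..1}" "\<alpha> \<in> {0..1}"
  shows "pt0 n 0 \<in> side Red" "pt0 n 2 \<in> side Yellow" "pt1 \<alpha> 0 \<in> side Red" "pt1 0 \<alpha> \<in> side Blue" "pt2 n 0 \<in> side Blue" "pt2 n 2 \<in> side Yellow"
  using assms by (auto simp: pt0_def pt1_def pt2_def side_eq complex_eq_iff max_def field_simps)

lemma kite_edges:
  assumes "z \<in> std_triangle" "Re z + Im z = 2/3"
  shows "z = pt0 1 (3 * Im z)" "3 * Im z \<in> {0..2}" "Im z \<ge> 1/3 \<Longrightarrow> z = pt2 1 (3 * Im z)"
  using assms by (auto simp: pt0_def pt2_def complex_eq_iff std_triangle_eq max_def field_simps)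

lemma pt_corners [simp]: "pt0 0 \<tau> = 0" "pt1 0 0 = 1" "pt2 0 \<tau> = \<i>"
  by (auto simp: pt0_def pt1_def pt2_def complex_eq_iff)

context ribbon_graph
begin

section \<open>Gaps and face discs\<close>

definition flags :: "('e \<times> real \<times> real) set" where
  "flags = edges G \<times> {-1, 1} \<times> {-1, 1}"

definition arcs_at :: "'a \<Rightarrow> ('e \<times> real) set" where
  "arcs_at v = {(e, a). e \<in> edges G \<and> a \<in> {-1, 1} \<and> att e a = v}"

abbreviation "arc_path i \<equiv> vpath (fst i) (snd i)"

text \<open>The conclusion of \<open>circle_gaps\<close> for the attaching arcs at \<open>v\<close>,
  named so that one family of gap paths can be chosen per vertex.\<close>

definition is_gap :: "'a \<Rightarrow> ('e \<times> real \<Rightarrow> real \<Rightarrow> real \<Rightarrow> complex) \<Rightarrow> bool" where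
  "is_gap v \<gamma> \<longleftrightarrow>
     (\<forall>i\<in>arcs_at v. \<forall>b\<in>{-1,1}. continuous_on {0..1} (\<gamma> i b) \<and> \<gamma> i b ` {0..1} \<subseteq> sphere 0 1 \<and> \<gamma> i b 0 = arc_path i b) \<and>
     (\<forall>i\<in>arcs_at v. \<forall>b\<in>{-1,1}. \<forall>\<tau>\<in>{0<..1}. \<gamma> i b \<tau> \<notin> (\<Union>j\<in>arcs_at v. arc_path j ` {-1..1})) \<and>
     (\<forall>i\<in>arcs_at v. \<forall>b\<in>{-1,1}. \<forall>j\<in>arcs_at v. \<forall>c\<in>{-1,1}. \<forall>\<tau>\<in>{0..1}. \<forall>\<tau>'\<in>{0..1}. \<gamma> i b \<tau> = \<gamma> j c \<tau>' \<longrightarrow>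
        \<tau> = \<tau>' \<and> (i = j \<and> b = c \<or> \<tau> = 1)) \<and>
     sphere 0 1 \<subseteq> (\<Union>i\<in>arcs_at v. arc_path i ` {-1..1}) \<union> (\<Union>i\<in>arcs_at v. \<Union>b\<in>{-1,1}. \<gamma> i b ` {0..1})"

lemma gap_exists:
  assumes v: "v \<in> vertices G" shows "\<exists>\<gamma>. is_gap v \<gamma>"
  unfolding is_gap_def
proof (rule circle_gaps)
  show "finite (arcs_at v)"
    by (rule finite_subset[of _ "edges G \<times> {-1, 1}"]) (use finite_edges in \<open>auto simp: arcs_at_def\<close>)
  obtain e a where ea: "e \<in> edges G" "a \<in> {-1, 1}" "vside e a \<subseteq> circle v" using no_isolated[OF v] by blast
  then have "(e, a) \<in> arcs_at v" using att_unique[OF ea(1,2) v ea(3)] by (simp add: arcs_at_def)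
  then show "arcs_at v \<noteq> {}" by blast
next
  fix i assume i: "i \<in> arcs_at v"
  then have i': "fst i \<in> edges G" "snd i \<in> {-1, 1}" "att (fst i) (snd i) = v" by (auto simp: arcs_at_def)
  show "continuous_on {-1..1} (arc_path i)" "inj_on (arc_path i) {-1..1}" "arc_path i ` {-1..1} \<subseteq> sphere 0 1"
    using vpath(1-3)[OF i'(1,2)] by simp_all
  fix j assume j: "j \<in> arcs_at v" "i \<noteq> j"
  then have j': "fst j \<in> edges G" "snd j \<in> {-1, 1}" "att (fst j) (snd j) = v" by (auto simp: arcs_at_def)
  show "arc_path i ` {-1..1} \<inter> arc_path j ` {-1..1} = {}"
  proof (rule ccontr)
    assume "arc_path i ` {-1..1} \<inter> arc_path j ` {-1..1} \<noteq> {}"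
    then obtain z where z: "z \<in> arc_path i ` {-1..1}" "z \<in> arc_path j ` {-1..1}" by blast
    obtain x where x: "x \<in> {-1..1}" "z = arc_path i x" using z(1) by (rule imageE)
    obtain y where y: "y \<in> {-1..1}" "z = arc_path j y" using z(2) by (rule imageE)
    have "q (fst i) (snd i, x) = q (fst j) (snd j, y)"
      using vpath(4)[OF i'(1,2) x(1)] vpath(4)[OF j'(1,2) y(1)] x(2) y(2) i'(3) j'(3) by metis
    moreover have "(snd i, x) \<in> square" "(snd j, y) \<in> square" using i' j' x y by (auto simp: square_def)
    ultimately have "fst i = fst j" "snd i = snd j" using q_eq_imp[OF i'(1) j'(1)] by blast+
    then show False using j(2) by (simp add: prod_eq_iff)
  qed
qed

definition gap_at :: "'a \<Rightarrow> 'e \<times> real \<Rightarrow> real \<Rightarrow> real \<Rightarrow> complex" where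
  "gap_at v = (SOME \<gamma>. is_gap v \<gamma>)"

lemma gap_at: "v \<in> vertices G \<Longrightarrow> is_gap v (gap_at v)"
  unfolding gap_at_def using gap_exists by (rule someI_ex)

definition gap :: "'e \<Rightarrow> real \<Rightarrow> real \<Rightarrow> real \<Rightarrow> complex" where
  "gap e a b = gap_at (att e a) (e, a) b"

definition gapX :: "'e \<Rightarrow> real \<Rightarrow> real \<Rightarrow> real \<Rightarrow> 'a" where
  "gapX e a b \<tau> = c (att e a) (gap e a b \<tau>)"

lemma flagsD: "(e, a, b) \<in> flags \<Longrightarrow> e \<in> edges G" "(e, a, b) \<in> flags \<Longrightarrow> a \<in> {-1, 1}" "(e, a, b) \<in> flags \<Longrightarrow> b \<in> {-1, 1}"
  by (auto simp: flags_def)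

lemma
  assumes f: "(e, a, b) \<in> flags"
  shows gap_continuous: "continuous_on {0..1} (gap e a b)"
    and gap_sphere: "\<tau> \<in> {0..1} \<Longrightarrow> gap e a b \<tau> \<in> sphere 0 1"
    and gap_zero: "gap e a b 0 = vpath e a b"
    and gapX_notin_band: "\<tau> \<in> {0<..1} \<Longrightarrow> e' \<in> edges G \<Longrightarrow> gapX e a b \<tau> \<notin> band e'"
proof -
  note fD = flagsD[OF f] and v = att[OF flagsD(1)[OF f] flagsD(2)[OF f]]
  have i: "(e, a) \<in> arcs_at (att e a)" using fD by (simp add: arcs_at_def)
  note g = gap_at[OF v(1), unfolded is_gap_def]
  have 1: "continuous_on {0..1} (gap e a b) \<and> gap e a b ` {0..1} \<subseteq> sphere 0 1 \<and> gap e a b 0 = vpath e a b"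
    using bspec[OF bspec[OF conjunct1[OF g] i] fD(3)] unfolding gap_def by simp
  then show "continuous_on {0..1} (gap e a b)" "gap e a b 0 = vpath e a b" by simp_all
  show s: "gap e a b \<tau> \<in> sphere 0 1" if "\<tau> \<in> {0..1}" for \<tau> using 1 that by blast
  assume t: "\<tau> \<in> {0<..1}" and e': "e' \<in> edges G"
  have off: "gap e a b \<tau> \<notin> (\<Union>j\<in>arcs_at (att e a). arc_path j ` {-1..1})"
    using bspec[OF bspec[OF bspec[OF conjunct1[OF conjunct2[OF g]] i] fD(3)] t] unfolding gap_def by simp
  show "gapX e a b \<tau> \<notin> band e'"
  proof
    assume "gapX e a b \<tau> \<in> band e'"
    then obtain x where x: "x \<in> square" "q e' x = c (att e a) (gap e a b \<tau>)" unfolding gapX_def by force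
    have gs: "gap e a b \<tau> \<in> sphere 0 1" using s t by simp
    then have gc: "gap e a b \<tau> \<in> cball 0 1" by simp
    have bx: "fst x \<in> {-1, 1}" "att e' (fst x) = att e a" using band_Int_cball[OF e' v(1) x(1) gc x(2)] by simp_all
    have sx: "snd x \<in> {-1..1}" using x(1) by (auto simp: square_def)
    have vp: "vpath e' (fst x) (snd x) \<in> sphere 0 1" using vpath(2)[OF e' bx(1)] sx by blast
    then have "vpath e' (fst x) (snd x) \<in> cball 0 1" by simp
    moreover have "c (att e a) (vpath e' (fst x) (snd x)) = c (att e a) (gap e a b \<tau>)"
      using vpath(4)[OF e' bx(1) sx] bx(2) x(2) by simp
    ultimately have "vpath e' (fst x) (snd x) = gap e a b \<tau>" using c_eq_imp[OF v(1) v(1) _ gc] by blast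
    moreover have "(e', fst x) \<in> arcs_at (att e a)" using bx e' by (simp add: arcs_at_def)
    ultimately have "gap e a b \<tau> \<in> (\<Union>j\<in>arcs_at (att e a). arc_path j ` {-1..1})"
      using sx by (intro UN_I[of "(e', fst x)"] image_eqI[of _ _ "snd x"]) simp_all
    then show False using off by blast
  qed
qed

text \<open>The disjointness of gap paths, carried from the circles to the surface; different
  vertices have disjoint 0-bands.\<close>

lemma gapX_eq_imp:
  assumes f: "(e, a, b) \<in> flags" "(e', a', b') \<in> flags" and t: "\<tau> \<in> {0..1}" "\<tau>' \<in> {0..1}"
    and eq: "gapX e a b \<tau> = gapX e' a' b' \<tau>'"
  shows "att e a = att e' a' \<and> \<tau> = \<tau>' \<and> ((e, a, b) = (e', a', b') \<or> \<tau> = 1)"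
proof -
  note fD = flagsD[OF f(1)] and fD' = flagsD[OF f(2)]
  note v = att(1)[OF fD(1,2)] and v' = att(1)[OF fD'(1,2)]
  have "gap e a b \<tau> \<in> cball 0 1" "gap e' a' b' \<tau>' \<in> cball 0 1"
    using gap_sphere[OF f(1) t(1)] gap_sphere[OF f(2) t(2)] by simp_all
  from c_eq_imp[OF v v' this] eq have 1: "att e a = att e' a'" "gap e a b \<tau> = gap e' a' b' \<tau>'"
    unfolding gapX_def by blast+
  have i: "(e, a) \<in> arcs_at (att e a)" "(e', a') \<in> arcs_at (att e a)" using fD fD' 1(1) by (simp_all add: arcs_at_def)
  note g = gap_at[OF v, unfolded is_gap_def]
  have "\<tau> = \<tau>' \<and> ((e, a) = (e', a') \<and> b = b' \<or> \<tau> = 1)"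
  proof (rule g[THEN conjunct2, THEN conjunct2, THEN conjunct1, rule_format, OF i(1) fD(3) i(2) fD'(3) t])
    show "gap_at (att e a) (e, a) b \<tau> = gap_at (att e a) (e', a') b' \<tau>'" using 1 unfolding gap_def by simp
  qed
  then show ?thesis using 1 by auto
qed

lemma circle_cover:
  assumes v: "v \<in> vertices G" and x: "x \<in> circle v"
  obtains e a y where "e \<in> edges G" "a \<in> {-1, 1}" "y \<in> {-1..1}" "att e a = v" "x = q e (a, y)"
    | e a b \<tau> where "(e, a, b) \<in> flags" "\<tau> \<in> {0<..1}" "att e a = v" "x = gapX e a b \<tau>"
proof -
  obtain z where z: "z \<in> sphere 0 1" "x = c v z" using x by (rule imageE)
  have "z \<in> (\<Union>i\<in>arcs_at v. arc_path i ` {-1..1}) \<union> (\<Union>i\<in>arcs_at v. \<Union>b\<in>{-1,1}. gap_at v i b ` {0..1})"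
    using gap_at[OF v, unfolded is_gap_def] z(1) by (elim conjE) (rule subsetD)
  then consider i y where "i \<in> arcs_at v" "y \<in> {-1..1}" "z = arc_path i y"
    | i b \<tau> where "i \<in> arcs_at v" "b \<in> {-1, 1}" "\<tau> \<in> {0..1}" "z = gap_at v i b \<tau>" by blast
  then show thesis
  proof cases
    case 1
    then have i: "fst i \<in> edges G" "snd i \<in> {-1, 1}" "att (fst i) (snd i) = v" by (auto simp: arcs_at_def)
    show ?thesis by (rule that(1)[OF i(1,2) 1(2) i(3)]) (use vpath(4)[OF i(1,2) 1(2)] 1(3) i(3) z(2) in simp)
  next
    case 2
    then have i: "fst i \<in> edges G" "snd i \<in> {-1, 1}" "att (fst i) (snd i) = v" by (auto simp: arcs_at_def)
    have f: "(fst i, snd i, b) \<in> flags" using i 2(2) by (auto simp: flags_def)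
    have x': "x = gapX (fst i) (snd i) b \<tau>" using 2(4) z(2) i(3) by (simp add: gapX_def gap_def)
    show ?thesis
    \<comment> \<open>At time 0 the gap path is at a corner of a band, which counts as a point of
      the attaching arc.\<close>
    proof (cases "\<tau> = 0")
      case True
      have b: "b \<in> {-1..1}" using 2(2) by auto
      show ?thesis
        by (rule that(1)[OF i(1,2) b i(3)]) (use x' True gap_zero[OF f] vpath(4)[OF i(1,2) b] in \<open>simp add: gapX_def\<close>)
    next
      case False
      then have "\<tau> \<in> {0<..1}" using 2(3) by auto
      then show ?thesis using that(2)[OF f _ i(3) x'] by blast
    qed
  qed
qed

lemma gapX_continuous: "(e, a, b) \<in> flags \<Longrightarrow> continuous_map (top_of_set {0..1}) X (gapX e a b)"
proof -
  assume f: "(e, a, b) \<in> flags"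
  have "continuous_map (top_of_set {0..1}) (top_of_set (cball 0 1)) (gap e a b)"
    using gap_continuous[OF f] gap_sphere[OF f] by (auto simp: Pi_iff)
  from continuous_map_compose[OF this c_continuous[OF att(1)[OF flagsD(1)[OF f] flagsD(2)[OF f]]]]
  show ?thesis by (simp add: o_def gapX_def[abs_def])
qed

lemma gapX_zero:
  assumes f: "(e, a, b) \<in> flags" shows "gapX e a b 0 = q e (a, b)"
proof -
  have "b \<in> {-1..1}" using flagsD(3)[OF f] by auto
  then show ?thesis using gap_zero[OF f] vpath(4)[OF flagsD(1)[OF f] flagsD(2)[OF f]] by (simp add: gapX_def)
qed

lemma gapX_in_circle: "(e, a, b) \<in> flags \<Longrightarrow> \<tau> \<in> {0..1} \<Longrightarrow> gapX e a b \<tau> \<in> circle (att e a)"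
  unfolding gapX_def using gap_sphere by blast

text \<open>The outer arc of the sector of a 0-band that belongs to a flag: from the middle of the
  attaching arc (time 0) over the corner of the band (time 1) to the midpoint of the gap (time
  2).\<close>

definition spoke :: "'e \<times> real \<times> real \<Rightarrow> real \<Rightarrow> complex" where
  "spoke = (\<lambda>(e, a, b) \<tau>. if \<tau> \<le> 1 then vpath e a (b * \<tau>) else gap e a b (\<tau> - 1))"

text \<open>The part of a face boundary that belongs to a flag: from the middle of a horizontal side
  (time 0) over the corner (time 1) to the midpoint of the gap (time 2). From time 1 on it follows
  the spoke.\<close>

definition rim :: "'e \<times> real \<times> real \<Rightarrow> real \<Rightarrow> 'a" where
  "rim = (\<lambda>(e, a, b) \<tau>. if \<tau> \<le> 1 then q e (a * \<tau>, b) else gapX e a b (\<tau> - 1))"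

abbreviation "att' \<phi> \<equiv> att (fst \<phi>) (fst (snd \<phi>))"
abbreviation "mid \<phi> \<equiv> gapX (fst \<phi>) (fst (snd \<phi>)) (snd (snd \<phi>)) 1"

lemma spoke_continuous:
  assumes f: "\<phi> \<in> flags" shows "continuous_on {0..2} (spoke \<phi>)" "spoke \<phi> ` {0..2} \<subseteq> sphere 0 1"
proof -
  obtain e a b where [simp]: "\<phi> = (e, a, b)" by (metis prod_cases3)
  have f': "(e, a, b) \<in> flags" using f by simp
  note fD = flagsD[OF f']
  have "continuous_on ({0..1} \<union> {1..2}) (\<lambda>\<tau>. if \<tau> \<le> 1 then vpath e a (b * \<tau>) else gap e a b (\<tau> - 1))"
  proof (rule continuous_on_cases)
    show "continuous_on {0..1} (\<lambda>\<tau>. vpath e a (b * \<tau>))"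
      by (rule continuous_on_compose2[OF vpath(1)[OF fD(1,2)]]) (use fD in \<open>auto intro!: continuous_intros\<close>)
    show "continuous_on {1..2} (\<lambda>\<tau>. gap e a b (\<tau> - 1))"
      by (rule continuous_on_compose2[OF gap_continuous[OF f']]) (auto intro!: continuous_intros)
    show "\<forall>x. x \<in> {0..1} \<and> \<not> x \<le> 1 \<or> x \<in> {1..2} \<and> x \<le> 1 \<longrightarrow> vpath e a (b * x) = gap e a b (x - 1)"
      using gap_zero[OF f'] by auto
  qed auto
  moreover have "{0..1} \<union> {1..2} = {0..2::real}" by auto
  ultimately show "continuous_on {0..2} (spoke \<phi>)" by (simp add: spoke_def)
  show "spoke \<phi> ` {0..2} \<subseteq> sphere 0 1"
  proof
    fix z assume "z \<in> spoke \<phi> ` {0..2}"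
    then obtain \<tau> where t: "\<tau> \<in> {0..2}" "z = spoke \<phi> \<tau>" by (rule imageE)
    show "z \<in> sphere 0 1"
    proof (cases "\<tau> \<le> 1")
      case True
      have "b * \<tau> \<in> {-1..1}" using fD(3) t(1) True by auto
      then have "vpath e a (b * \<tau>) \<in> sphere 0 1" using vpath(2)[OF fD(1,2)] by blast
      then show ?thesis using t(2) True by (simp add: spoke_def)
    next
      case False
      then show ?thesis using gap_sphere[OF f', of "\<tau> - 1"] t by (auto simp: spoke_def)
    qed
  qed
qed

lemma spoke_image:
  assumes f: "(e, a, b) \<in> flags" and t: "\<tau> \<in> {0..2}"
  shows "c (att e a) (spoke (e, a, b) \<tau>) = (if \<tau> \<le> 1 then q e (a, b * \<tau>) else gapX e a b (\<tau> - 1))"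
proof -
  have "b * \<tau> \<in> {-1..1}" if "\<tau> \<le> 1" using flagsD(3)[OF f] t that by auto
  then show ?thesis using vpath(4)[OF flagsD(1)[OF f] flagsD(2)[OF f]] by (auto simp: spoke_def gapX_def)
qed

lemma rim_continuous:
  assumes f: "\<phi> \<in> flags" shows "continuous_map (top_of_set {0..2}) X (rim \<phi>)"
proof -
  obtain e a b where [simp]: "\<phi> = (e, a, b)" by (metis prod_cases3)
  have f': "(e, a, b) \<in> flags" using f by simp
  note fD = flagsD[OF f']
  show ?thesis
  proof (rule pasting_lemma_closed[of "{True, False}" _ "\<lambda>b. if b then {0..1} else {1..2}" _ "\<lambda>_. rim \<phi>"])
    fix i :: bool
    show "closedin (top_of_set {0..2}) (if i then {0..1} else {1..2::real})"
      by (auto intro!: closed_subset)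
    have 1: "continuous_map (top_of_set {0..1}) (top_of_set {-1..1}) (\<lambda>\<tau>. a * \<tau>)"
      using fD by (auto intro!: continuous_intros)
    have "continuous_map (top_of_set {0..1}) X (rim \<phi>)"
      by (rule continuous_map_eq[OF continuous_map_compose[OF 1 continuous_hpath[OF fD(1,3)]]]) (auto simp: rim_def)
    moreover have 2: "continuous_map (top_of_set {1..2}) (top_of_set {0..1}) (\<lambda>\<tau>::real. \<tau> - 1)"
      by (auto intro!: continuous_intros)
    have "continuous_map (top_of_set {1..2}) X (rim \<phi>)"
    proof (rule continuous_map_eq[OF continuous_map_compose[OF 2 gapX_continuous[OF f']]])
      fix x :: real assume "x \<in> topspace (top_of_set {1..2})"
      then show "(gapX e a b \<circ> (\<lambda>\<tau>. \<tau> - 1)) x = rim \<phi> x"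
        using gapX_zero[OF f'] by (cases "x = 1") (auto simp: rim_def)
    qed
    ultimately show "continuous_map (subtopology (top_of_set {0..2}) (if i then {0..1} else {1..2})) X (rim \<phi>)"
      by (cases i) (simp_all add: subtopology_subtopology Int_absorb1)
  next
    fix x :: real assume "x \<in> topspace (top_of_set {0..2})"
    then show "\<exists>j. j \<in> {True, False} \<and> x \<in> (if j then {0..1} else {1..2}) \<and> rim \<phi> x = rim \<phi> x"
      by (intro exI[of _ "x \<le> 1"]) auto
  qed simp_all
qed

lemma spoke_eq_imp:
  assumes f: "(e, a, b) \<in> flags" "(e', a', b') \<in> flags" and t: "\<tau> \<in> {0..2}" "\<tau>' \<in> {0..2}"
    and eq: "c (att e a) (spoke (e, a, b) \<tau>) = c (att e' a') (spoke (e', a', b') \<tau>')"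
  shows "\<tau> = \<tau>' \<and> ((e, a, b) = (e', a', b') \<or> \<tau> = 0 \<and> e = e' \<and> a = a' \<or> \<tau> = 2 \<and> mid (e, a, b) = mid (e', a', b'))"
proof -
  note fD = flagsD[OF f(1)] and fD' = flagsD[OF f(2)]
  have mixed: False if "(e, a, b) \<in> flags" "(e', a', b') \<in> flags" "\<tau> \<in> {0..2}" "\<tau>' \<in> {0..2}" "\<tau> \<le> 1" "\<not> \<tau>' \<le> 1"
    "c (att e a) (spoke (e, a, b) \<tau>) = c (att e' a') (spoke (e', a', b') \<tau>')" for e a b e' a' b' \<tau> \<tau>'
  proof -
    have "(a, b * \<tau>) \<in> square" using flagsD[OF that(1)] that(3,5) by (auto simp: square_def)
    moreover have "gapX e' a' b' (\<tau>' - 1) = q e (a, b * \<tau>)"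
      using spoke_image[OF that(1,3)] spoke_image[OF that(2,4)] that(5-7) by simp
    ultimately show False using gapX_notin_band[OF that(2), of "\<tau>' - 1" e] flagsD(1)[OF that(1)] that(4,6) by auto
  qed
  consider "\<tau> \<le> 1" "\<tau>' \<le> 1" | "\<not> \<tau> \<le> 1" "\<not> \<tau>' \<le> 1"
    using mixed[OF f t _ _ eq] mixed[OF f(2,1) t(2,1) _ _ eq[symmetric]] by blast
  then show ?thesis
  proof cases
    case 1
    have "(a, b * \<tau>) \<in> square" "(a', b' * \<tau>') \<in> square" using fD fD' t 1 by (auto simp: square_def)
    moreover have "q e (a, b * \<tau>) = q e' (a', b' * \<tau>')"
      using spoke_image[OF f(1) t(1)] spoke_image[OF f(2) t(2)] 1 eq by simp
    ultimately have "e = e'" "a = a'" "b * \<tau> = b' * \<tau>'" using q_eq_imp[OF fD(1) fD'(1)] by blast+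
    then show ?thesis using fD(3) fD'(3) t by auto
  next
    case 2
    have "gapX e a b (\<tau> - 1) = gapX e' a' b' (\<tau>' - 1)"
      using spoke_image[OF f(1) t(1)] spoke_image[OF f(2) t(2)] 2 eq by simp
    moreover have "\<tau> - 1 \<in> {0..1}" "\<tau>' - 1 \<in> {0..1}" using 2 t by auto
    ultimately have "\<tau> - 1 = \<tau>' - 1" "(e, a, b) = (e', a', b') \<or> \<tau> - 1 = 1"
      "gapX e a b (\<tau> - 1) = gapX e' a' b' (\<tau>' - 1)"
      using gapX_eq_imp[OF f, of "\<tau> - 1" "\<tau>' - 1"] by auto
    then show ?thesis by auto
  qed
qed

lemma rim_eq_imp:
  assumes f: "(e, a, b) \<in> flags" "(e', a', b') \<in> flags" and t: "\<tau> \<in> {0..2}" "\<tau>' \<in> {0..2}"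
    and eq: "rim (e, a, b) \<tau> = rim (e', a', b') \<tau>'"
  shows "\<tau> = \<tau>' \<and> ((e, a, b) = (e', a', b') \<or> \<tau> = 0 \<and> e = e' \<and> b = b' \<or> \<tau> = 2 \<and> mid (e, a, b) = mid (e', a', b'))"
proof -
  note fD = flagsD[OF f(1)] and fD' = flagsD[OF f(2)]
  have mixed: False if "(e, a, b) \<in> flags" "(e', a', b') \<in> flags" "\<tau> \<in> {0..2}" "\<tau>' \<in> {0..2}" "\<tau> \<le> 1" "\<not> \<tau>' \<le> 1"
    "rim (e, a, b) \<tau> = rim (e', a', b') \<tau>'" for e a b e' a' b' \<tau> \<tau>'
  proof -
    have "(a * \<tau>, b) \<in> square" using flagsD[OF that(1)] that(3,5) by (auto simp: square_def)
    moreover have "gapX e' a' b' (\<tau>' - 1) = q e (a * \<tau>, b)" using that(5-7) by (simp add: rim_def)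
    ultimately show False using gapX_notin_band[OF that(2), of "\<tau>' - 1" e] flagsD(1)[OF that(1)] that(4,6) by auto
  qed
  consider "\<tau> \<le> 1" "\<tau>' \<le> 1" | "\<not> \<tau> \<le> 1" "\<not> \<tau>' \<le> 1"
    using mixed[OF f t _ _ eq] mixed[OF f(2,1) t(2,1) _ _ eq[symmetric]] by blast
  then show ?thesis
  proof cases
    case 1
    have "(a * \<tau>, b) \<in> square" "(a' * \<tau>', b') \<in> square" using fD fD' t 1 by (auto simp: square_def)
    moreover have "q e (a * \<tau>, b) = q e' (a' * \<tau>', b')" using 1 eq by (simp add: rim_def)
    ultimately have "e = e'" "b = b'" "a * \<tau> = a' * \<tau>'" using q_eq_imp[OF fD(1) fD'(1)] by blast+
    then show ?thesis using fD(2) fD'(2) t by auto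
  next
    case 2
    have "gapX e a b (\<tau> - 1) = gapX e' a' b' (\<tau>' - 1)" using 2 eq by (simp add: rim_def)
    moreover have "\<tau> - 1 \<in> {0..1}" "\<tau>' - 1 \<in> {0..1}" using 2 t by auto
    ultimately have "\<tau> - 1 = \<tau>' - 1" "(e, a, b) = (e', a', b') \<or> \<tau> - 1 = 1"
      "gapX e a b (\<tau> - 1) = gapX e' a' b' (\<tau>' - 1)"
      using gapX_eq_imp[OF f, of "\<tau> - 1" "\<tau>' - 1"] by auto
    then show ?thesis by auto
  qed
qed

abbreviation "ribbon_surface \<equiv> band_union (vertices G) (edges G) c q"
abbreviation "boundaries \<equiv> boundary_components X ribbon_surface"

lemma boundaries_eq: "boundaries = connected_components_of (subtopology X (outline (edges G)))"
  unfolding boundary_components_def frontier_band_union[OF order_refl] ..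

lemma outline_subset_topspace: "D \<subseteq> edges G \<Longrightarrow> outline D \<subseteq> topspace X"
  using frontier_of_subset_topspace frontier_band_union by metis

lemma gapX_in_outline:
  assumes f: "(e, a, b) \<in> flags" and t: "\<tau> \<in> {0..1}" and D: "D \<subseteq> edges G"
  shows "gapX e a b \<tau> \<in> outline D"
proof -
  note fD = flagsD[OF f]
  have 1: "gapX e a b \<tau> \<in> (\<Union>v\<in>vertices G. circle v)" using gapX_in_circle[OF f t] att(1)[OF fD(1,2)] by blast
  have "gapX e a b \<tau> \<notin> q e' ` ({a'} \<times> {-1<..<1})" if e': "e' \<in> D" and a': "a' \<in> {-1, 1}" for e' a'
  proof
    assume "gapX e a b \<tau> \<in> q e' ` ({a'} \<times> {-1<..<1})"
    then obtain y where y: "y \<in> {-1<..<1}" "gapX e a b \<tau> = q e' (a', y)" by blast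
    have sq: "(a', y) \<in> square" using y(1) a' by (auto simp: square_def)
    have e'E: "e' \<in> edges G" using e' D by blast
    show False
    proof (cases "\<tau> = 0")
      case True
      have "(a, b) \<in> square" using fD by (auto simp: square_def)
      then have "(a', y) = (a, b)" using q_eq_imp[OF e'E fD(1) sq] gapX_zero[OF f] y(2) True by metis
      then show False using y(1) fD(3) by auto
    next
      case False
      then have "\<tau> \<in> {0<..1}" using t by auto
      then show False using gapX_notin_band[OF f _ e'E] y(2) sq by blast
    qed
  qed
  then have "gapX e a b \<tau> \<notin> (\<Union>e\<in>D. \<Union>a\<in>{-1,1}. q e ` ({a} \<times> {-1<..<1}))" by blast
  then show ?thesis using 1 unfolding outline_def by (intro UnI1 DiffI)
qed

lemma rim_in_outline:
  assumes f: "\<phi> \<in> flags" and t: "\<tau> \<in> {0..2}" shows "rim \<phi> \<tau> \<in> outline (edges G)"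
proof -
  obtain e a b where [simp]: "\<phi> = (e, a, b)" by (metis prod_cases3)
  have f': "(e, a, b) \<in> flags" using f by simp
  note fD = flagsD[OF f']
  show ?thesis
  proof (cases "\<tau> \<le> 1")
    case True
    have "a * \<tau> \<in> {-1..1}" using fD t True by auto
    then have "rim \<phi> \<tau> \<in> hside e b" using True by (auto simp: rim_def)
    then have "rim \<phi> \<tau> \<in> (\<Union>e\<in>edges G. \<Union>b\<in>{-1,1}. hside e b)" by (rule UN_I[OF fD(1) UN_I[OF fD(3)]])
    then show ?thesis unfolding outline_def by (rule UnI2)
  next
    case False
    then show ?thesis using gapX_in_outline[OF f', of "\<tau> - 1" "edges G"] t by (auto simp: rim_def)
  qed
qed

text \<open>The boundary component through the corner of the band. It contains the entire rim, as
  that is connected.\<close>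

definition boundary_of :: "'e \<times> real \<times> real \<Rightarrow> 'a set" where
  "boundary_of \<phi> = connected_component_of_set (subtopology X (outline (edges G))) (rim \<phi> 1)"

lemma boundary_of: "\<phi> \<in> flags \<Longrightarrow> boundary_of \<phi> \<in> boundaries"
  and rim_in_boundary: "\<phi> \<in> flags \<Longrightarrow> \<tau> \<in> {0..2} \<Longrightarrow> rim \<phi> \<tau> \<in> boundary_of \<phi>"
proof -
  assume f: "\<phi> \<in> flags"
  have top: "topspace (subtopology X (outline (edges G))) = outline (edges G)"
    using outline_subset_topspace[OF order_refl] by auto
  show "boundary_of \<phi> \<in> boundaries"
    unfolding boundaries_eq boundary_of_def using rim_in_outline[OF f, of 1] top
    by (simp add: connected_component_in_connected_components_of)
  have "connectedin X (rim \<phi> ` {0..2})"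
    by (rule connectedin_continuous_map_image[OF rim_continuous[OF f]]) (simp add: connectedin_subtopology)
  then have "connectedin (subtopology X (outline (edges G))) (rim \<phi> ` {0..2})"
    using rim_in_outline[OF f] by (auto simp: connectedin_subtopology)
  moreover have "rim \<phi> 1 \<in> rim \<phi> ` {0..2}" by auto
  ultimately have "rim \<phi> ` {0..2} \<subseteq> boundary_of \<phi>"
    unfolding boundary_of_def by (rule connected_component_of_maximal)
  then show "rim \<phi> \<tau> \<in> boundary_of \<phi>" if "\<tau> \<in> {0..2}" for \<tau> using that by blast
qed

lemma boundary_of_eqI:
  assumes "\<phi> \<in> flags" "C \<in> boundaries" "\<tau> \<in> {0..2}" "rim \<phi> \<tau> \<in> C" shows "boundary_of \<phi> = C"
proof (rule ccontr)
  assume ne: "boundary_of \<phi> \<noteq> C"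
  have "disjnt (boundary_of \<phi>) C"
    using pairwiseD[OF pairwise_disjoint_connected_components_of] boundary_of[OF assms(1)] assms(2) ne
    unfolding boundaries_eq by blast
  then show False using rim_in_boundary[OF assms(1,3)] assms(4) by (auto simp: disjnt_def)
qed

definition is_face_discs :: "('a set \<Rightarrow> complex \<Rightarrow> 'a) \<Rightarrow> bool" where
  "is_face_discs d \<longleftrightarrow>
     (\<forall>C\<in>boundaries. embedding_map (top_of_set (cball 0 1)) X (d C) \<and> d C ` sphere 0 1 = C \<and>
        d C ` ball 0 1 \<inter> ribbon_surface = {}) \<and>
     disjoint_family_on (\<lambda>C. d C ` ball 0 1) boundaries \<and>
     topspace X = ribbon_surface \<union> (\<Union>C\<in>boundaries. d C ` cball 0 1)"

definition face_disc :: "'a set \<Rightarrow> complex \<Rightarrow> 'a" where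
  "face_disc = (SOME d. is_face_discs d)"

lemma face_disc: "is_face_discs face_disc"
proof -
  have "\<exists>d. is_face_discs d"
    using ribbon unfolding ribbon_representation_def Let_def is_face_discs_def by (elim conjE) assumption
  then show ?thesis unfolding face_disc_def by (rule someI_ex)
qed

lemma
  assumes C: "C \<in> boundaries"
  shows fd_embedding: "embedding_map (top_of_set (cball 0 1)) X (face_disc C)"
    and fd_sphere: "face_disc C ` sphere 0 1 = C"
    and fd_ball: "face_disc C ` ball 0 1 \<inter> ribbon_surface = {}"
  using bspec[OF conjunct1[OF face_disc[unfolded is_face_discs_def]] C] by simp_all

lemma fd_disjoint: "C \<in> boundaries \<Longrightarrow> C' \<in> boundaries \<Longrightarrow> C \<noteq> C' \<Longrightarrow> face_disc C ` ball 0 1 \<inter> face_disc C' ` ball 0 1 = {}"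
  using conjunct1[OF conjunct2[OF face_disc[unfolded is_face_discs_def]]] by (simp add: disjoint_family_on_def)

lemma fd_cover: "topspace X = ribbon_surface \<union> (\<Union>C\<in>boundaries. face_disc C ` cball 0 1)"
  using face_disc unfolding is_face_discs_def by blast

lemmas fd_inj_on = embedding_inj_on[OF fd_embedding hausdorff compact_cball]
lemmas fd_continuous = embedding_continuous_map[OF fd_embedding hausdorff compact_cball]

lemma rim_lift_exists:
  assumes f: "\<phi> \<in> flags"
  shows "\<exists>r. continuous_on {0..2} r \<and> r ` {0..2} \<subseteq> sphere 0 1 \<and> (\<forall>\<tau>\<in>{0..2}. face_disc (boundary_of \<phi>) (r \<tau>) = rim \<phi> \<tau>)"
proof -
  let ?d = "face_disc (boundary_of \<phi>)"
  note C = boundary_of[OF f]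
  have im: "rim \<phi> \<tau> \<in> ?d ` sphere 0 1" if "\<tau> \<in> {0..2}" for \<tau> using rim_in_boundary[OF f that] fd_sphere[OF C] by simp
  have "?d ` sphere 0 1 \<subseteq> ?d ` cball 0 1" by (intro image_mono sphere_cball)
  then have "rim \<phi> ` {0..2} \<subseteq> ?d ` cball 0 1" using im by blast
  then obtain r where r: "continuous_on {0..2} r" "r ` {0..2} \<subseteq> cball 0 1" "\<And>\<tau>. \<tau> \<in> {0..2} \<Longrightarrow> ?d (r \<tau>) = rim \<phi> \<tau>"
    using embedding_lift_path[OF fd_embedding[OF C] rim_continuous[OF f]] by metis
  have "r \<tau> \<in> sphere 0 1" if t: "\<tau> \<in> {0..2}" for \<tau>
  proof -
    obtain z where z: "z \<in> sphere 0 1" "rim \<phi> \<tau> = ?d z" using im[OF t] by (rule imageE)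
    have "r \<tau> \<in> cball 0 1" using r(2) t by blast
    moreover have "z \<in> cball 0 1" using z(1) by simp
    ultimately have "z \<in> cball 0 1" "r \<tau> \<in> cball 0 1" by blast+
    then have "r \<tau> = z" using inj_onD[OF fd_inj_on[OF C]] r(3)[OF t] z(2) by simp
    then show ?thesis using z(1) by simp
  qed
  then show ?thesis using r by blast
qed

definition rim_lift :: "'e \<times> real \<times> real \<Rightarrow> real \<Rightarrow> complex" where
  "rim_lift \<phi> = (SOME r. continuous_on {0..2} r \<and> r ` {0..2} \<subseteq> sphere 0 1 \<and>
     (\<forall>\<tau>\<in>{0..2}. face_disc (boundary_of \<phi>) (r \<tau>) = rim \<phi> \<tau>))"

lemma rim_lift:
  assumes "\<phi> \<in> flags"
  shows "continuous_on {0..2} (rim_lift \<phi>)" "rim_lift \<phi> ` {0..2} \<subseteq> sphere 0 1"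
    "\<And>\<tau>. \<tau> \<in> {0..2} \<Longrightarrow> face_disc (boundary_of \<phi>) (rim_lift \<phi> \<tau>) = rim \<phi> \<tau>"
  using someI_ex[OF rim_lift_exists[OF assms]] unfolding rim_lift_def by blast+

section \<open>The triangles of the flags\<close>

definition cone0 :: "'e \<times> real \<times> real \<Rightarrow> complex \<Rightarrow> complex" where
  "cone0 \<phi> z = rad0 z *\<^sub>R (if rad0 z = 0 then 0 else spoke \<phi> (ang0 z))"

definition cone2 :: "'e \<times> real \<times> real \<Rightarrow> complex \<Rightarrow> complex" where
  "cone2 \<phi> z = rad2 z *\<^sub>R (if rad2 z = 0 then 0 else rim_lift \<phi> (ang2 z))"

text \<open>The triangle is assembled from a sector of the 0-band, a quarter of the 1-band and a
  sector of the face disc, one on each kite. Overlaps of the kites are resolved by the order of the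
  tests; that the other formulas agree there is \<open>tri_kite1\<close> and
  \<open>tri_kite2\<close>.\<close>

definition tri :: "'e \<times> real \<times> real \<Rightarrow> complex \<Rightarrow> 'a" where
  "tri \<phi> z = (if Re z + Im z \<le> 2/3 then c (att' \<phi>) (cone0 \<phi> z)
     else if Im z \<le> 1/3 then q (fst \<phi>) (fst (snd \<phi>) * (3 * (1 - Re z - Im z)), snd (snd \<phi>) * (3 * Im z))
     else face_disc (boundary_of \<phi>) (cone2 \<phi> z))"

lemma cone0_pt0: "n \<in> {0..1} \<Longrightarrow> \<tau> \<in> {0..2} \<Longrightarrow> cone0 \<phi> (pt0 n \<tau>) = n *\<^sub>R spoke \<phi> \<tau>"
  using pt0_kite0[of n \<tau>] by (simp add: cone0_def)

lemma cone2_pt2: "n \<in> {0..1} \<Longrightarrow> \<tau> \<in> {0..2} \<Longrightarrow> cone2 \<phi> (pt2 n \<tau>) = n *\<^sub>R rim_lift \<phi> \<tau>"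
  using pt2_kite2[of n \<tau>] by (simp add: cone2_def)

lemma tri_kite0: "z \<in> kite0 \<Longrightarrow> tri \<phi> z = c (att' \<phi>) (cone0 \<phi> z)"
  by (simp add: tri_def kite0_def)

text \<open>Where the kite borders on that of the vertex, the spoke up to time 1 is the attaching
  arc.\<close>

lemma tri_kite1:
  assumes f: "(e, a, b) \<in> flags" and z: "z \<in> kite1"
  shows "tri (e, a, b) z = q e (a * (3 * (1 - Re z - Im z)), b * (3 * Im z))"
proof (cases "Re z + Im z = 2/3")
  case True
  have zs: "z \<in> std_triangle" "Im z \<le> 1/3" using z by (auto simp: kite1_def)
  note ke = kite_edges[OF zs(1) True]
  have "z \<in> kite0" using zs True by (simp add: kite0_def)
  then have "tri (e, a, b) z = c (att e a) (cone0 (e, a, b) z)" by (simp add: tri_kite0)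
  also have "cone0 (e, a, b) z = spoke (e, a, b) (3 * Im z)" using cone0_pt0[of 1 "3 * Im z" "(e, a, b)"] ke by simp
  also have "c (att e a) (spoke (e, a, b) (3 * Im z)) = q e (a, b * (3 * Im z))"
    using spoke_image[OF f ke(2)] zs(2) by simp
  also have "\<dots> = q e (a * (3 * (1 - Re z - Im z)), b * (3 * Im z))"
  proof -
    have "3 * (1 - Re z - Im z) = 1" using True by simp
    then show ?thesis by (metis mult.right_neutral)
  qed
  finally show ?thesis .
qed (use z in \<open>auto simp: tri_def kite1_def\<close>)

text \<open>On the border the rim is compared with the spoke, both following the gap, and with the
  horizontal side of the band, which is the rim up to time 1.\<close>

lemma tri_kite2:
  assumes f: "(e, a, b) \<in> flags" and z: "z \<in> kite2"
  shows "tri (e, a, b) z = face_disc (boundary_of (e, a, b)) (cone2 (e, a, b) z)"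
proof -
  have zs: "z \<in> std_triangle" "Im z \<ge> 1/3" "2/3 \<le> Re z + Im z" using z by (auto simp: kite2_def)
  consider "Re z + Im z = 2/3" | "Re z + Im z > 2/3" "Im z = 1/3" | "Re z + Im z > 2/3" "Im z > 1/3" using zs by linarith
  then show ?thesis
  proof cases
    case 1
    note ke = kite_edges[OF zs(1) 1]
    have "z \<in> kite0" using zs 1 by (simp add: kite0_def)
    then have "tri (e, a, b) z = c (att e a) (cone0 (e, a, b) z)" by (simp add: tri_kite0)
    also have "cone0 (e, a, b) z = spoke (e, a, b) (3 * Im z)" using cone0_pt0[of 1 "3 * Im z" "(e, a, b)"] ke(1,2) by simp
    also have "c (att e a) (spoke (e, a, b) (3 * Im z)) = rim (e, a, b) (3 * Im z)"
    proof (cases "Im z = 1/3")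
      case True
      then have "3 * Im z = 1" by simp
      then show ?thesis using spoke_image[OF f, of 1] by (simp only:) (simp add: rim_def)
    next
      case False
      then show ?thesis using spoke_image[OF f ke(2)] zs(2) by (simp add: rim_def)
    qed
    also have "\<dots> = face_disc (boundary_of (e, a, b)) (rim_lift (e, a, b) (3 * Im z))" using rim_lift(3)[OF f ke(2)] by simp
    also have "rim_lift (e, a, b) (3 * Im z) = cone2 (e, a, b) z"
      using cone2_pt2[of 1 "3 * Im z" "(e, a, b)"] ke(2) ke(3)[OF zs(2)] by simp
    finally show ?thesis .
  next
    case 2
    have "Re z \<le> 2/3" using zs(1) 2(2) by (auto simp: std_triangle_eq)
    then have t: "2 - 3 * Re z \<in> {0..2}" "2 - 3 * Re z \<le> 1" using 2 by auto
    \<comment> \<open>The border with the kite of the band. The rim time \<open>2 - 3 * Re z\<close>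
      is 0 on the blue side and 1 at the bend.\<close>
    have pt: "z = pt2 1 (2 - 3 * Re z)" using 2 t by (auto simp: pt2_def complex_eq_iff max_def)
    have "tri (e, a, b) z = q e (a * (2 - 3 * Re z), b)" using 2 by (simp add: tri_def algebra_simps)
    also have "\<dots> = rim (e, a, b) (2 - 3 * Re z)" using t by (simp add: rim_def)
    also have "\<dots> = face_disc (boundary_of (e, a, b)) (rim_lift (e, a, b) (2 - 3 * Re z))" using rim_lift(3)[OF f t(1)] by simp
    also have "rim_lift (e, a, b) (2 - 3 * Re z) = cone2 (e, a, b) z"
      using cone2_pt2[of 1 "2 - 3 * Re z" "(e, a, b)"] t(1) pt by simp
    finally show ?thesis .
  qed (simp add: tri_def)
qed

lemma tri_pt0: "n \<in> {0..1} \<Longrightarrow> \<tau> \<in> {0..2} \<Longrightarrow> tri \<phi> (pt0 n \<tau>) = c (att' \<phi>) (n *\<^sub>R spoke \<phi> \<tau>)"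
  using tri_kite0 pt0_kite0(1) cone0_pt0 by metis

lemma tri_pt1: "(e, a, b) \<in> flags \<Longrightarrow> \<alpha> \<in> {0..1} \<Longrightarrow> \<beta> \<in> {0..1} \<Longrightarrow> tri (e, a, b) (pt1 \<alpha> \<beta>) = q e (a * \<alpha>, b * \<beta>)"
  using tri_kite1[OF _ pt1_kite1, of e a b \<alpha> \<beta>] by (simp add: pt1_def)

lemma tri_pt2: "(e, a, b) \<in> flags \<Longrightarrow> n \<in> {0..1} \<Longrightarrow> \<tau> \<in> {0..2} \<Longrightarrow>
    tri (e, a, b) (pt2 n \<tau>) = face_disc (boundary_of (e, a, b)) (n *\<^sub>R rim_lift (e, a, b) \<tau>)"
  using tri_kite2 pt2_kite2(1) cone2_pt2 by metis

lemma tri_continuous: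
  assumes f: "\<phi> \<in> flags" shows "continuous_map (top_of_set std_triangle) X (tri \<phi>)"
proof -
  obtain e a b where [simp]: "\<phi> = (e, a, b)" by (metis prod_cases3)
  have f': "(e, a, b) \<in> flags" using f by simp
  note fD = flagsD[OF f']
  define K :: "nat \<Rightarrow> complex set" where "K i = (if i = 0 then kite0 else if i = 1 then kite1 else kite2)" for i
  have Ksub: "K i \<subseteq> std_triangle" for i by (auto simp: K_def kite0_def kite1_def kite2_def)
  have cl: "closed (K i)" for i
  proof -
    have k: "kite0 = std_triangle \<inter> {z. Re z + Im z \<le> 2/3}"
      "kite1 = std_triangle \<inter> ({z. Im z \<le> 1/3} \<inter> {z. 2/3 \<le> Re z + Im z})"
      "kite2 = std_triangle \<inter> ({z. 1/3 \<le> Im z} \<inter> {z. 2/3 \<le> Re z + Im z})"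
      by (auto simp: kite0_def kite1_def kite2_def)
    have "closed std_triangle" using compact_std_triangle compact_imp_closed by blast
    then have "closed kite0" "closed kite1" "closed kite2"
      unfolding k by (intro closed_Int closed_Collect_le continuous_intros; simp)+
    then show ?thesis unfolding K_def by simp
  qed
  have c0: "continuous_map (top_of_set kite0) X (tri \<phi>)"
  proof -
    have "continuous_on kite0 (cone0 \<phi>)"
      unfolding cone0_def[abs_def]
    proof (rule continuous_on_cone[where A = "{0..2}"])
      show "continuous_on kite0 rad0" unfolding rad0_def[abs_def] by (intro continuous_intros)
      show "continuous_on {z \<in> kite0. rad0 z \<noteq> 0} ang0"
        unfolding ang0_def[abs_def] rad0_def[abs_def] by (intro continuous_intros) auto
    qed (use kite0_param(2) spoke_continuous[OF f] in auto)
    moreover have "cone0 \<phi> z \<in> cball 0 1" if z: "z \<in> kite0" for z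
    proof (cases "rad0 z = 0")
      case False
      have "spoke \<phi> (ang0 z) \<in> sphere 0 1" using spoke_continuous(2)[OF f] kite0_param(2)[OF z False] by blast
      then show ?thesis using kite0_param(1)[OF z] by (simp add: cone0_def)
    qed (simp add: cone0_def)
    ultimately have 1: "continuous_map (top_of_set kite0) (top_of_set (cball 0 1)) (cone0 \<phi>)" by (simp add: Pi_iff)
    show ?thesis
      by (rule continuous_map_eq[OF continuous_map_compose[OF 1 c_continuous[OF att(1)[OF fD(1,2)]]]])
        (simp add: tri_kite0)
  qed
  have c1: "continuous_map (top_of_set kite1) X (tri \<phi>)"
  proof -
    have sq: "(a * (3 * (1 - Re z - Im z)), b * (3 * Im z)) \<in> square" if z: "z \<in> kite1" for z
    proof -
      have "3 * (1 - Re z - Im z) \<in> {0..1}" "3 * Im z \<in> {0..1}" using z by (auto simp: kite1_def std_triangle_eq)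
      then show ?thesis using fD by (auto simp: square_def)
    qed
    have "continuous_on kite1 (\<lambda>z. (a * (3 * (1 - Re z - Im z)), b * (3 * Im z)))" by (intro continuous_intros)
    then have 1: "continuous_map (top_of_set kite1) (top_of_set square) (\<lambda>z. (a * (3 * (1 - Re z - Im z)), b * (3 * Im z)))"
      using sq by (simp add: Pi_iff)
    show ?thesis
      by (rule continuous_map_eq[OF continuous_map_compose[OF 1 q_continuous[OF fD(1)]]])
        (simp add: tri_kite1[OF f'])
  qed
  have c2: "continuous_map (top_of_set kite2) X (tri \<phi>)"
  proof -
    have "continuous_on kite2 (cone2 \<phi>)"
      unfolding cone2_def[abs_def]
    proof (rule continuous_on_cone[where A = "{0..2}"])
      show "continuous_on kite2 rad2" unfolding rad2_def[abs_def] by (intro continuous_intros)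
      then have "continuous_on {z \<in> kite2. rad2 z \<noteq> 0} rad2" by (rule continuous_on_subset) auto
      then show "continuous_on {z \<in> kite2. rad2 z \<noteq> 0} ang2"
        unfolding ang2_def[abs_def] by (intro continuous_intros) auto
    qed (use kite2_param(2) rim_lift(1,2)[OF f] in auto)
    moreover have "cone2 \<phi> z \<in> cball 0 1" if z: "z \<in> kite2" for z
    proof (cases "rad2 z = 0")
      case False
      have "rim_lift \<phi> (ang2 z) \<in> sphere 0 1" using rim_lift(2)[OF f] kite2_param(2)[OF z False] by blast
      then show ?thesis using kite2_param(1)[OF z] by (simp add: cone2_def)
    qed (simp add: cone2_def)
    ultimately have 1: "continuous_map (top_of_set kite2) (top_of_set (cball 0 1)) (cone2 \<phi>)" by (simp add: Pi_iff)
    show ?thesis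
      by (rule continuous_map_eq[OF continuous_map_compose[OF 1 fd_continuous[OF boundary_of[OF f]]]])
        (simp add: tri_kite2[OF f'])
  qed
  show ?thesis
  proof (rule pasting_lemma_closed[of "{0, 1, 2}" _ K _ "\<lambda>_. tri \<phi>"])
    fix i :: nat
    show "closedin (top_of_set std_triangle) (K i)" using closed_subset[OF Ksub cl] .
    have "subtopology (top_of_set std_triangle) (K i) = top_of_set (K i)"
      using Ksub by (simp add: subtopology_subtopology Int_absorb1)
    then show "continuous_map (subtopology (top_of_set std_triangle) (K i)) X (tri \<phi>)"
      using c0 c1 c2 by (simp add: K_def)
  next
    fix z assume "z \<in> topspace (top_of_set std_triangle)"
    then have "z \<in> kite0 \<or> z \<in> kite1 \<or> z \<in> kite2" using kites_cover by simp
    then have "z \<in> K 0 \<or> z \<in> K 1 \<or> z \<in> K 2" by (simp add: K_def)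
    then show "\<exists>j. j \<in> {0, 1, 2} \<and> z \<in> K j \<and> tri \<phi> z = tri \<phi> z" by blast
  qed simp_all
qed

end

section \<open>How the triangles of two flags can meet\<close>

text \<open>The ranges are half-open so that the four kinds of points have images in disjoint parts
  of the surface: open 0-bands, gaps, closed 1-bands, open face discs.\<close>

lemma triangle_cases:
  assumes z: "z \<in> std_triangle"
  obtains (disc) n \<tau> where "n \<in> {0..<1}" "\<tau> \<in> {0..2}" "z = pt0 n \<tau>"
    | (gap) \<tau> where "\<tau> \<in> {1<..2}" "z = pt0 1 \<tau>"
    | (band) \<alpha> \<beta> where "\<alpha> \<in> {0..1}" "\<beta> \<in> {0..1}" "z = pt1 \<alpha> \<beta>"
    | (face) n \<tau> where "n \<in> {0..<1}" "\<tau> \<in> {0..2}" "z = pt2 n \<tau>"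
proof -
  have zz: "0 \<le> Re z" "0 \<le> Im z" "Re z + Im z \<le> 1" using z by (auto simp: std_triangle_eq)
  consider "Re z + Im z < 2/3" | "Re z + Im z \<ge> 2/3" "Im z \<le> 1/3" | "Re z + Im z = 2/3" "Im z > 1/3" | "Re z + Im z > 2/3" "Im z > 1/3"
    by linarith
  then show thesis
  proof cases
    case 1
    then have k: "z \<in> kite0" using z by (simp add: kite0_def)
    have "rad0 z \<in> {0..<1}" using 1 zz by (auto simp: rad0_def)
    moreover have "z = pt0 0 0" if "rad0 z = 0" using that kite0_param(4)[OF k] by (simp add: pt0_def complex_eq_iff)
    ultimately show ?thesis using disc[of "rad0 z" "ang0 z"] disc[of 0 0] kite0_param[OF k] by (cases "rad0 z = 0") auto
  next
    case 2
    then have "z \<in> kite1" using z by (simp add: kite1_def)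
    then show ?thesis by (rule kite1_param) (rule band)
  next
    case 3
    then show ?thesis using gap[of "3 * Im z"] kite_edges[OF z 3(1)] by auto
  next
    case 4
    then have k: "z \<in> kite2" using z by (simp add: kite2_def)
    have "rad2 z \<in> {0..<1}" using 4 zz kite2_param(1)[OF k] by (auto simp: rad2_def max_def)
    moreover have "z = pt2 0 0" if "rad2 z = 0" using that kite2_param(4)[OF k] by (simp add: pt2_def complex_eq_iff)
    ultimately show ?thesis using face[of "rad2 z" "ang2 z"] face[of 0 0] kite2_param[OF k] by (cases "rad2 z = 0") auto
  qed
qed

context ribbon_graph
begin

text \<open>Tells these four parts apart. Bands are tested before circles, so attaching arcs count
  as band points, in accordance with \<open>triangle_cases\<close>.\<close>

definition region :: "'a \<Rightarrow> nat" where
  "region x = (if x \<in> (\<Union>v\<in>vertices G. disc v) then 0 else if x \<in> (\<Union>e\<in>edges G. band e) then 1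
     else if x \<in> (\<Union>v\<in>vertices G. circle v) then 2 else 3)"

lemma spoke_norm: "\<phi> \<in> flags \<Longrightarrow> \<tau> \<in> {0..2} \<Longrightarrow> norm (spoke \<phi> \<tau>) = 1"
  and rim_lift_norm: "\<phi> \<in> flags \<Longrightarrow> \<tau> \<in> {0..2} \<Longrightarrow> norm (rim_lift \<phi> \<tau>) = 1"
proof -
  assume f: "\<phi> \<in> flags" and t: "\<tau> \<in> {0..2}"
  have "spoke \<phi> \<tau> \<in> sphere 0 1" using spoke_continuous(2)[OF f] t by blast
  then show "norm (spoke \<phi> \<tau>) = 1" by simp
  have "rim_lift \<phi> \<tau> \<in> sphere 0 1" using rim_lift(2)[OF f] t by blast
  then show "norm (rim_lift \<phi> \<tau>) = 1" by simp
qed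

lemma att_flag: "\<phi> \<in> flags \<Longrightarrow> att' \<phi> \<in> vertices G"
  using att(1) by (auto simp: flags_def)

lemma region_disc:
  assumes f: "\<phi> \<in> flags" and n: "n \<in> {0..<1}" and t: "\<tau> \<in> {0..2}"
  shows "region (tri \<phi> (pt0 n \<tau>)) = 0"
proof -
  have "n *\<^sub>R spoke \<phi> \<tau> \<in> ball 0 1" using spoke_norm[OF f t] n by simp
  then have "tri \<phi> (pt0 n \<tau>) \<in> disc (att' \<phi>)" using tri_pt0[of n \<tau> \<phi>] n t by simp
  then show ?thesis using att_flag[OF f] unfolding region_def by auto
qed

lemma tri_gap:
  assumes f: "(e, a, b) \<in> flags" and t: "\<tau> \<in> {1<..2}"
  shows "tri (e, a, b) (pt0 1 \<tau>) = gapX e a b (\<tau> - 1)"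
  using tri_pt0[of 1 \<tau> "(e, a, b)"] spoke_image[OF f, of \<tau>] t by auto

lemma region_gap:
  assumes f: "\<phi> \<in> flags" and t: "\<tau> \<in> {1<..2}"
  shows "region (tri \<phi> (pt0 1 \<tau>)) = 2"
proof -
  obtain e a b where [simp]: "\<phi> = (e, a, b)" by (metis prod_cases3)
  have f': "(e, a, b) \<in> flags" using f by simp
  let ?x = "gapX e a b (\<tau> - 1)"
  have v: "att e a \<in> vertices G" using att_flag[OF f'] by simp
  have circ: "?x \<in> circle (att e a)" using gapX_in_circle[OF f', of "\<tau> - 1"] t by auto
  have "?x \<notin> disc w" if w: "w \<in> vertices G" for w using disc_Int_circle[OF w v] circ by blast
  moreover have "?x \<notin> band e'" if "e' \<in> edges G" for e' using gapX_notin_band[OF f' _ that, of "\<tau> - 1"] t by auto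
  ultimately show ?thesis using circ v tri_gap[OF f' t] unfolding region_def by auto
qed

lemma region_band:
  assumes f: "\<phi> \<in> flags" and a: "\<alpha> \<in> {0..1}" "\<beta> \<in> {0..1}"
  shows "region (tri \<phi> (pt1 \<alpha> \<beta>)) = 1"
proof -
  obtain e a b where [simp]: "\<phi> = (e, a, b)" by (metis prod_cases3)
  have f': "(e, a, b) \<in> flags" using f by simp
  note fD = flagsD[OF f']
  have "(a * \<alpha>, b * \<beta>) \<in> square" using fD a by (auto simp: square_def)
  then have B: "tri \<phi> (pt1 \<alpha> \<beta>) \<in> band e" using tri_pt1[OF f' a] by auto
  have "tri \<phi> (pt1 \<alpha> \<beta>) \<notin> disc w" if "w \<in> vertices G" for w using disc_Int_band[OF that fD(1)] B by blast
  then show ?thesis using B fD(1) unfolding region_def by auto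
qed

lemma band_union_regions: "x \<in> disc v \<Longrightarrow> v \<in> vertices G \<Longrightarrow> x \<in> ribbon_surface"
  "x \<in> circle v \<Longrightarrow> v \<in> vertices G \<Longrightarrow> x \<in> ribbon_surface" "x \<in> band e \<Longrightarrow> e \<in> edges G \<Longrightarrow> x \<in> ribbon_surface"
proof -
  have *: "disc v \<subseteq> c v ` cball 0 1" "circle v \<subseteq> c v ` cball 0 1"
    by (intro image_mono ball_subset_cball sphere_cball)+
  show "x \<in> ribbon_surface" if "x \<in> disc v" "v \<in> vertices G"
    unfolding band_union_def by (rule UnI1, rule UN_I[OF that(2)], rule subsetD[OF *(1) that(1)])
  show "x \<in> ribbon_surface" if "x \<in> circle v" "v \<in> vertices G"
    unfolding band_union_def by (rule UnI1, rule UN_I[OF that(2)], rule subsetD[OF *(2) that(1)])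
  show "x \<in> band e \<Longrightarrow> e \<in> edges G \<Longrightarrow> x \<in> ribbon_surface" unfolding band_union_def by auto
qed

lemma region_face:
  assumes f: "\<phi> \<in> flags" and n: "n \<in> {0..<1}" and t: "\<tau> \<in> {0..2}"
  shows "region (tri \<phi> (pt2 n \<tau>)) = 3" "tri \<phi> (pt2 n \<tau>) \<in> face_disc (boundary_of \<phi>) ` ball 0 1"
proof -
  obtain e a b where [simp]: "\<phi> = (e, a, b)" by (metis prod_cases3)
  have f': "(e, a, b) \<in> flags" using f by simp
  have "n *\<^sub>R rim_lift \<phi> \<tau> \<in> ball 0 1" using rim_lift_norm[OF f t] n by simp
  then show F: "tri \<phi> (pt2 n \<tau>) \<in> face_disc (boundary_of \<phi>) ` ball 0 1" using tri_pt2[OF f', of n \<tau>] n t by simp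
  then have "tri \<phi> (pt2 n \<tau>) \<notin> ribbon_surface" using fd_ball[OF boundary_of[OF f]] by blast
  then have "tri \<phi> (pt2 n \<tau>) \<notin> (\<Union>v\<in>vertices G. disc v)" "tri \<phi> (pt2 n \<tau>) \<notin> (\<Union>e\<in>edges G. band e)"
    "tri \<phi> (pt2 n \<tau>) \<notin> (\<Union>v\<in>vertices G. circle v)" using band_union_regions by blast+
  then show "region (tri \<phi> (pt2 n \<tau>)) = 3" unfolding region_def by (simp only: if_False)
qed

lemma scaleR_sphere_eq:
  fixes x y :: complex
  assumes "n *\<^sub>R x = m *\<^sub>R y" "norm x = 1" "norm y = 1" "0 \<le> n" "0 \<le> m"
  shows "n = m \<and> (n = 0 \<or> x = y)"
proof -
  have "norm (n *\<^sub>R x) = norm (m *\<^sub>R y)" using assms(1) by simp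
  then have "n = m" using assms(2-5) by (simp add: norm_scaleR)
  then show ?thesis using assms(1) by auto
qed

text \<open>By \<open>region\<close> both points are of the same kind, and within one kind
  injectivity of the disc, band or gap determines the coordinates. What remains free are the signs
  at coordinate 0 and the two approaches to the midpoint of a gap; these give the common
  sides.\<close>

lemma tri_eq_imp:
  assumes f: "(e, a, b) \<in> flags" "(e', a', b') \<in> flags" and z: "z \<in> std_triangle" "z' \<in> std_triangle"
    and eq: "tri (e, a, b) z = tri (e', a', b') z'"
  shows "z = z' \<and> ((e, a, b) = (e', a', b') \<or> (z \<in> side Red \<and> e = e' \<and> a = a') \<or> (z \<in> side Blue \<and> e = e' \<and> b = b') \<or>
     (z \<in> side Yellow \<and> mid (e, a, b) = mid (e', a', b')) \<or> (z = 0 \<and> att e a = att e' a') \<or> (z = 1 \<and> e = e') \<or>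
     (z = \<i> \<and> boundary_of (e, a, b) = boundary_of (e', a', b')))"
proof -
  note fD = flagsD[OF f(1)] and fD' = flagsD[OF f(2)]
  have reg: "region (tri (e, a, b) z) = region (tri (e', a', b') z')" using eq by simp
  have v: "att e a \<in> vertices G" "att e' a' \<in> vertices G" using att_flag[OF f(1)] att_flag[OF f(2)] by simp_all
  from z(1) show ?thesis
  proof (cases rule: triangle_cases)
    case (disc n \<tau>)
    from z(2) obtain n' \<tau>' where d': "n' \<in> {0..<1}" "\<tau>' \<in> {0..2}" "z' = pt0 n' \<tau>'"
      by (cases rule: triangle_cases) (use reg disc region_disc[OF f(1)] region_gap[OF f(2)] region_band[OF f(2)] region_face(1)[OF f(2)] in auto)
    have nn: "norm (spoke (e, a, b) \<tau>) = 1" "norm (spoke (e', a', b') \<tau>') = 1" using spoke_norm f disc d' by blast+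
    have "c (att e a) (n *\<^sub>R spoke (e, a, b) \<tau>) = c (att e' a') (n' *\<^sub>R spoke (e', a', b') \<tau>')"
      using eq disc d' tri_pt0[of n \<tau>] tri_pt0[of n' \<tau>'] by simp
    moreover have "n *\<^sub>R spoke (e, a, b) \<tau> \<in> cball 0 1" "n' *\<^sub>R spoke (e', a', b') \<tau>' \<in> cball 0 1" using nn disc d' by simp_all
    ultimately have cc: "att e a = att e' a'" "n *\<^sub>R spoke (e, a, b) \<tau> = n' *\<^sub>R spoke (e', a', b') \<tau>'"
      using c_eq_imp[OF v] by blast+
    have n: "n = n'" "n = 0 \<or> spoke (e, a, b) \<tau> = spoke (e', a', b') \<tau>'"
    proof -
      have "0 \<le> n" "0 \<le> n'" using disc d' by simp_all
      from scaleR_sphere_eq[OF cc(2) nn this] show "n = n'" "n = 0 \<or> spoke (e, a, b) \<tau> = spoke (e', a', b') \<tau>'" by blast+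
    qed
    show ?thesis
    proof (cases "n = 0")
      case True
      then show ?thesis using disc d' n cc by simp
    next
      case False
      then have "c (att e a) (spoke (e, a, b) \<tau>) = c (att e' a') (spoke (e', a', b') \<tau>')" using n(2) cc(1) by simp
      from spoke_eq_imp[OF f disc(2) d'(2) this]
      show ?thesis using disc d' n pt_sides(1)[of n 0] pt_sides(2)[of n 0] by auto
    qed
  next
    case (gap \<tau>)
    from z(2) obtain \<tau>' where d': "\<tau>' \<in> {1<..2}" "z' = pt0 1 \<tau>'"
      by (cases rule: triangle_cases) (use reg gap region_gap[OF f(1)] region_disc[OF f(2)] region_band[OF f(2)] region_face(1)[OF f(2)] in auto)
    have "gapX e a b (\<tau> - 1) = gapX e' a' b' (\<tau>' - 1)" using eq tri_gap[OF f(1) gap(1)] tri_gap[OF f(2) d'(1)] gap(2) d'(2) by simp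
    then have "\<tau> - 1 = \<tau>' - 1" "(e, a, b) = (e', a', b') \<or> \<tau> - 1 = 1" "gapX e a b (\<tau> - 1) = gapX e' a' b' (\<tau>' - 1)"
      using gapX_eq_imp[OF f, of "\<tau> - 1" "\<tau>' - 1"] gap d' by auto
    then show ?thesis using gap d' pt_sides(2)[of 1 0] by auto
  next
    case (band \<alpha> \<beta>)
    from z(2) obtain \<alpha>' \<beta>' where d': "\<alpha>' \<in> {0..1}" "\<beta>' \<in> {0..1}" "z' = pt1 \<alpha>' \<beta>'"
      by (cases rule: triangle_cases) (use reg band region_band[OF f(1)] region_disc[OF f(2)] region_gap[OF f(2)] region_face(1)[OF f(2)] in auto)
    have "(a * \<alpha>, b * \<beta>) \<in> square" "(a' * \<alpha>', b' * \<beta>') \<in> square" using fD fD' band d' by (auto simp: square_def)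
    moreover have "q e (a * \<alpha>, b * \<beta>) = q e' (a' * \<alpha>', b' * \<beta>')" using eq tri_pt1[OF f(1) band(1,2)] tri_pt1[OF f(2) d'(1,2)] band(3) d'(3) by simp
    ultimately have qq: "e = e'" "a * \<alpha> = a' * \<alpha>'" "b * \<beta> = b' * \<beta>'" using q_eq_imp[OF fD(1) fD'(1)] by blast+
    have "\<alpha> = \<alpha>'" "a = a' \<or> \<alpha> = 0" using qq(2) fD(2) fD'(2) band d' by auto
    moreover have "\<beta> = \<beta>'" "b = b' \<or> \<beta> = 0" using qq(3) fD(3) fD'(3) band d' by auto
    ultimately show ?thesis using qq(1) band d' pt_sides(3)[of 0 \<alpha>] pt_sides(4)[of 0 \<beta>] by auto
  next
    case (face n \<tau>)
    from z(2) obtain n' \<tau>' where d': "n' \<in> {0..<1}" "\<tau>' \<in> {0..2}" "z' = pt2 n' \<tau>'"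
      by (cases rule: triangle_cases) (use reg face region_face(1)[OF f(1)] region_gap[OF f(2)] region_band[OF f(2)] region_disc[OF f(2)] in auto)
    have nn: "norm (rim_lift (e, a, b) \<tau>) = 1" "norm (rim_lift (e', a', b') \<tau>') = 1" using rim_lift_norm f face d' by blast+
    have bb: "boundary_of (e, a, b) = boundary_of (e', a', b')"
      using fd_disjoint[OF boundary_of[OF f(1)] boundary_of[OF f(2)]] region_face(2)[OF f(1) face(1,2)] region_face(2)[OF f(2) d'(1,2)]
        eq face(3) d'(3) by auto
    have "face_disc (boundary_of (e, a, b)) (n *\<^sub>R rim_lift (e, a, b) \<tau>) = face_disc (boundary_of (e, a, b)) (n' *\<^sub>R rim_lift (e', a', b') \<tau>')"
      using eq face d' tri_pt2[OF f(1), of n \<tau>] tri_pt2[OF f(2), of n' \<tau>'] bb by simp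
    moreover have "n *\<^sub>R rim_lift (e, a, b) \<tau> \<in> cball 0 1" "n' *\<^sub>R rim_lift (e', a', b') \<tau>' \<in> cball 0 1" using nn face d' by simp_all
    ultimately have cc: "n *\<^sub>R rim_lift (e, a, b) \<tau> = n' *\<^sub>R rim_lift (e', a', b') \<tau>'"
      using inj_onD[OF fd_inj_on[OF boundary_of[OF f(1)]]] by blast
    have n: "n = n'" "n = 0 \<or> rim_lift (e, a, b) \<tau> = rim_lift (e', a', b') \<tau>'"
    proof -
      have "0 \<le> n" "0 \<le> n'" using face d' by simp_all
      from scaleR_sphere_eq[OF cc nn this] show "n = n'" "n = 0 \<or> rim_lift (e, a, b) \<tau> = rim_lift (e', a', b') \<tau>'" by blast+
    qed
    show ?thesis
    proof (cases "n = 0")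
      case True
      then show ?thesis using face d' n bb by simp
    next
      case False
      then have "rim (e, a, b) \<tau> = rim (e', a', b') \<tau>'"
        using n(2) bb rim_lift(3)[OF f(1) face(2)] rim_lift(3)[OF f(2) d'(2)] by simp
      from rim_eq_imp[OF f face(2) d'(2) this]
      show ?thesis using face d' n pt_sides(5)[of n 0] pt_sides(6)[of n 0] by auto
    qed
  qed
qed

lemma tri_red:
  assumes f: "(e, a, b) \<in> flags" "(e, a, b') \<in> flags" and z: "z \<in> side Red"
  shows "tri (e, a, b) z = tri (e, a, b') z"
proof -
  have zz: "0 \<le> Re z" "Re z \<le> 1" "Im z = 0" using z by (auto simp: side_eq)
  show ?thesis
  proof (cases "Re z \<le> 2/3")
    case True
    have "z = pt0 (3/2 * Re z) 0" using zz by (simp add: pt0_def complex_eq_iff)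
    moreover have "3/2 * Re z \<in> {0..1}" using zz True by auto
    moreover have "spoke (e, a, b) 0 = spoke (e, a, b') 0" by (simp add: spoke_def)
    ultimately show ?thesis using tri_pt0[of "3/2 * Re z" 0] by (metis atLeastAtMost_iff fst_conv le_numeral_extra(3) snd_conv zero_le_numeral)
  next
    case False
    have "z = pt1 (3 * (1 - Re z)) 0" using zz by (simp add: pt1_def complex_eq_iff field_simps)
    moreover have "3 * (1 - Re z) \<in> {0..1}" using zz False by auto
    ultimately show ?thesis using tri_pt1[OF f(1), of "3 * (1 - Re z)" 0] tri_pt1[OF f(2), of "3 * (1 - Re z)" 0] by simp
  qed
qed

lemma boundary_of_rim_eq:
  assumes "\<phi> \<in> flags" "\<psi> \<in> flags" "\<tau> \<in> {0..2}" "rim \<phi> \<tau> = rim \<psi> \<tau>"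
  shows "boundary_of \<phi> = boundary_of \<psi>" "rim_lift \<phi> \<tau> = rim_lift \<psi> \<tau>"
proof -
  show b: "boundary_of \<phi> = boundary_of \<psi>"
    by (rule boundary_of_eqI[OF assms(1) boundary_of[OF assms(2)] assms(3)])
      (use rim_in_boundary[OF assms(2,3)] assms(4) in simp)
  have "rim_lift \<phi> \<tau> \<in> cball 0 1" "rim_lift \<psi> \<tau> \<in> cball 0 1" using rim_lift_norm assms(1-3) by simp_all
  then show "rim_lift \<phi> \<tau> = rim_lift \<psi> \<tau>"
    using inj_onD[OF fd_inj_on[OF boundary_of[OF assms(1)]]] rim_lift(3)[OF assms(1,3)] rim_lift(3)[OF assms(2,3)] b assms(4) by simp
qed

lemma tri_blue:
  assumes f: "(e, a, b) \<in> flags" "(e, a', b) \<in> flags" and z: "z \<in> side Blue"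
  shows "tri (e, a, b) z = tri (e, a', b) z"
proof -
  have zz: "0 \<le> Re z" "0 \<le> Im z" "Re z + Im z = 1" using z by (auto simp: side_eq)
  show ?thesis
  proof (cases "Im z \<le> 1/3")
    case True
    have "z = pt1 0 (3 * Im z)" using zz by (simp add: pt1_def complex_eq_iff)
    moreover have "3 * Im z \<in> {0..1}" using zz True by auto
    ultimately show ?thesis using tri_pt1[OF f(1), of 0 "3 * Im z"] tri_pt1[OF f(2), of 0 "3 * Im z"] by simp
  next
    case False
    have "z = pt2 (3/2 * (1 - Im z)) 0" using zz by (simp add: pt2_def complex_eq_iff field_simps)
    moreover have n: "3/2 * (1 - Im z) \<in> {0..1}" using zz False by auto
    moreover have "rim (e, a, b) 0 = rim (e, a', b) 0" by (simp add: rim_def)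
    moreover have "(0::real) \<in> {0..2}" by simp
    ultimately show ?thesis
      using tri_pt2[OF f(1) n, of 0] tri_pt2[OF f(2) n, of 0] boundary_of_rim_eq[OF f, of 0] by simp
  qed
qed

lemma mid_eq_imp:
  assumes f: "(e, a, b) \<in> flags" "(e', a', b') \<in> flags" and m: "mid (e, a, b) = mid (e', a', b')"
  shows "att e a = att e' a'" "spoke (e, a, b) 2 = spoke (e', a', b') 2"
    "boundary_of (e, a, b) = boundary_of (e', a', b')" "rim_lift (e, a, b) 2 = rim_lift (e', a', b') 2"
proof -
  have v: "att e a \<in> vertices G" "att e' a' \<in> vertices G" using att_flag[OF f(1)] att_flag[OF f(2)] by simp_all
  have "spoke (e, a, b) 2 \<in> cball 0 1" "spoke (e', a', b') 2 \<in> cball 0 1" using spoke_norm f by simp_all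
  moreover have "c (att e a) (spoke (e, a, b) 2) = c (att e' a') (spoke (e', a', b') 2)"
    using m by (simp add: spoke_def gapX_def)
  ultimately show "att e a = att e' a'" "spoke (e, a, b) 2 = spoke (e', a', b') 2" using c_eq_imp[OF v] by blast+
  have "rim (e, a, b) 2 = rim (e', a', b') 2" using m by (simp add: rim_def)
  then show "boundary_of (e, a, b) = boundary_of (e', a', b')" "rim_lift (e, a, b) 2 = rim_lift (e', a', b') 2"
    using boundary_of_rim_eq[OF f, of 2] by simp_all
qed

lemma tri_yellow:
  assumes f: "(e, a, b) \<in> flags" "(e', a', b') \<in> flags" and m: "mid (e, a, b) = mid (e', a', b')" and z: "z \<in> side Yellow"
  shows "tri (e, a, b) z = tri (e', a', b') z"
proof -
  have zz: "Re z = 0" "0 \<le> Im z" "Im z \<le> 1" using z by (auto simp: side_eq)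
  note me = mid_eq_imp[OF f m]
  show ?thesis
  proof (cases "Im z \<le> 2/3")
    case True
    have "z = pt0 (3/2 * Im z) 2" using zz by (simp add: pt0_def complex_eq_iff)
    moreover have "3/2 * Im z \<in> {0..1}" "(2::real) \<in> {0..2}" using zz True by auto
    ultimately show ?thesis using tri_pt0[of "3/2 * Im z" 2 "(e, a, b)"] tri_pt0[of "3/2 * Im z" 2 "(e', a', b')"] me(1,2) by simp
  next
    case False
    have "z = pt2 (3 * (1 - Im z)) 2" using zz by (simp add: pt2_def complex_eq_iff field_simps)
    moreover have "3 * (1 - Im z) \<in> {0..1}" "(2::real) \<in> {0..2}" using zz False by auto
    ultimately show ?thesis using tri_pt2[OF f(1), of "3 * (1 - Im z)" 2] tri_pt2[OF f(2), of "3 * (1 - Im z)" 2] me(3,4) by simp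
  qed
qed

text \<open>The combinatorial gem on flags. Yellow is tested by the midpoint of the gap, where the
  walks from its two ends meet; the diagonal is included.\<close>

definition same_side :: "colour \<Rightarrow> 'e \<times> real \<times> real \<Rightarrow> 'e \<times> real \<times> real \<Rightarrow> bool" where
  "same_side k = (\<lambda>(e, a, b) (e', a', b'). case k of
      Red \<Rightarrow> e = e' \<and> a = a' | Blue \<Rightarrow> e = e' \<and> b = b' | Yellow \<Rightarrow> mid (e, a, b) = mid (e', a', b'))"

lemma tri_side_eq:
  assumes f: "\<phi> \<in> flags" "\<psi> \<in> flags" and s: "same_side k \<phi> \<psi>" and z: "z \<in> side k"
  shows "tri \<phi> z = tri \<psi> z"
proof -
  obtain e a b where p: "\<phi> = (e, a, b)" by (metis prod_cases3)
  obtain e' a' b' where p': "\<psi> = (e', a', b')" by (metis prod_cases3)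
  show ?thesis
  proof (cases k)
    case Red
    then have "e' = e" "a' = a" and zR: "z \<in> side Red" using s z p p' by (simp_all add: same_side_def)
    then have p'': "\<psi> = (e, a, b')" using p' by simp
    show ?thesis unfolding p p'' by (rule tri_red[OF f[unfolded p p''] zR])
  next
    case Yellow
    then have "mid (e, a, b) = mid (e', a', b')" "z \<in> side Yellow" using s z p p' by (simp_all add: same_side_def)
    then show ?thesis using tri_yellow[of e a b e' a' b' z] f p p' by simp
  next
    case Blue
    then have "e' = e" "b' = b" and zB: "z \<in> side Blue" using s z p p' by (simp_all add: same_side_def)
    then have p'': "\<psi> = (e, a', b)" using p' by simp
    show ?thesis unfolding p p'' by (rule tri_blue[OF f[unfolded p p''] zB])
  qed
qed

lemma tri_meet:
  assumes f: "\<phi> \<in> flags" "\<psi> \<in> flags" and z: "z \<in> std_triangle" "z' \<in> std_triangle" and eq: "tri \<phi> z = tri \<psi> z'"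
  shows "z = z'" and "\<phi> = \<psi> \<or> (\<exists>k. z \<in> side k \<and> same_side k \<phi> \<psi>) \<or> (z = 0 \<and> att' \<phi> = att' \<psi>) \<or> (z = 1 \<and> fst \<phi> = fst \<psi>)
    \<or> (z = \<i> \<and> boundary_of \<phi> = boundary_of \<psi>)"
proof -
  obtain e a b where p: "\<phi> = (e, a, b)" by (metis prod_cases3)
  obtain e' a' b' where p': "\<psi> = (e', a', b')" by (metis prod_cases3)
  note t = tri_eq_imp[of e a b e' a' b', OF f[unfolded p p'] z eq[unfolded p p']]
  show "z = z'" using t by blast
  have s: "same_side Red \<phi> \<psi> \<longleftrightarrow> e = e' \<and> a = a'" "same_side Blue \<phi> \<psi> \<longleftrightarrow> e = e' \<and> b = b'"
    "same_side Yellow \<phi> \<psi> \<longleftrightarrow> mid (e, a, b) = mid (e', a', b')" by (simp_all add: same_side_def p p')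
  show "\<phi> = \<psi> \<or> (\<exists>k. z \<in> side k \<and> same_side k \<phi> \<psi>) \<or> (z = 0 \<and> att' \<phi> = att' \<psi>) \<or> (z = 1 \<and> fst \<phi> = fst \<psi>)
    \<or> (z = \<i> \<and> boundary_of \<phi> = boundary_of \<psi>)"
    using conjunct2[OF t]
  proof (elim disjE)
    assume "(e, a, b) = (e', a', b')" then show ?thesis using p p' by simp
  next
    assume "z \<in> side Red \<and> e = e' \<and> a = a'" then show ?thesis using s(1) by blast
  next
    assume "z \<in> side Blue \<and> e = e' \<and> b = b'" then show ?thesis using s(2) by blast
  next
    assume "z \<in> side Yellow \<and> mid (e, a, b) = mid (e', a', b')" then show ?thesis using s(3) by blast
  qed (simp_all add: p p')
qed

lemma same_side_refl: "same_side k \<phi> \<phi>"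
  by (cases k) (auto simp: same_side_def split: prod.splits)

lemma side_image_eq_iff:
  assumes f: "\<phi> \<in> flags" "\<psi> \<in> flags"
  shows "tri \<phi> ` side k = tri \<psi> ` side k \<longleftrightarrow> same_side k \<phi> \<psi>"
proof
  assume "same_side k \<phi> \<psi>"
  then show "tri \<phi> ` side k = tri \<psi> ` side k" using tri_side_eq[OF f] by (intro image_cong) auto
next
  assume eq: "tri \<phi> ` side k = tri \<psi> ` side k"
  \<comment> \<open>The midpoint of the side lies on no other side and is no corner, so a contact
    there can only be due to this side.\<close>
  define z where "z = (case k of Red \<Rightarrow> Complex (1/2) 0 | Yellow \<Rightarrow> Complex 0 (1/2) | Blue \<Rightarrow> Complex (1/2) (1/2))"
  have z: "z \<in> side l \<longleftrightarrow> l = k" for l by (cases k; cases l) (auto simp: z_def side_eq)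
  have zn: "z \<noteq> 0" "z \<noteq> 1" "z \<noteq> \<i>" by (cases k; auto simp: z_def complex_eq_iff)+
  have "tri \<phi> z \<in> tri \<psi> ` side k" using z eq by blast
  then obtain z' where z': "z' \<in> side k" "tri \<phi> z = tri \<psi> z'" by blast
  have "z \<in> std_triangle" "z' \<in> std_triangle" using z z'(1) side_subset by blast+
  from tri_meet(2)[OF f this z'(2)] have "\<phi> = \<psi> \<or> (\<exists>l. z \<in> side l \<and> same_side l \<phi> \<psi>)" using zn by blast
  then show "same_side k \<phi> \<psi>"
  proof (elim disjE exE conjE)
    show "\<phi> = \<psi> \<Longrightarrow> same_side k \<phi> \<psi>" using same_side_refl[of k \<phi>] by simp
    show "z \<in> side l \<Longrightarrow> same_side l \<phi> \<psi> \<Longrightarrow> same_side k \<phi> \<psi>" for l using z[of l] by simp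
  qed
qed

lemma tri_inj_on: "inj_on tri flags"
proof (rule inj_onI)
  fix \<phi> \<psi> assume f: "\<phi> \<in> flags" "\<psi> \<in> flags" and eq: "tri \<phi> = tri \<psi>"
  \<comment> \<open>A point off all three sides determines the flag.\<close>
  let ?z = "Complex (1/4) (1/4)"
  have z: "?z \<in> std_triangle" by (simp add: std_triangle_eq)
  have "?z \<notin> side k" for k by (cases k) (auto simp: side_eq)
  moreover have "?z \<noteq> 0" "?z \<noteq> 1" "?z \<noteq> \<i>" by (auto simp: complex_eq_iff)
  ultimately show "\<phi> = \<psi>" using tri_meet(2)[OF f z z] eq by auto
qed

lemma tri_embedding:
  assumes f: "\<phi> \<in> flags" shows "embedding_map (top_of_set std_triangle) X (tri \<phi>)"
proof (rule injective_closed_imp_embedding_map)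
  show "continuous_map (top_of_set std_triangle) X (tri \<phi>)" using tri_continuous[OF f] .
  have "compact_space (top_of_set std_triangle)" using compact_std_triangle by (simp add: compact_space_subtopology)
  then show "closed_map (top_of_set std_triangle) X (tri \<phi>)"
    using continuous_imp_closed_map_gen tri_continuous[OF f] hausdorff Hausdorff_imp_kc_space by blast
  show "inj_on (tri \<phi>) (topspace (top_of_set std_triangle))" using tri_meet(1)[OF f f] by (auto intro!: inj_onI)
qed

lemma tri_corners:
  assumes f: "(e, a, b) \<in> flags"
  shows "tri (e, a, b) 0 = att e a" "tri (e, a, b) 1 = q e (0, 0)" "tri (e, a, b) \<i> = face_disc (boundary_of (e, a, b)) 0"
proof -
  have v: "att e a \<in> vertices G" using att_flag[OF f] by simp
  show "tri (e, a, b) 0 = att e a" using tri_pt0[of 0 0 "(e, a, b)"] c_zero[OF v] by simp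
  show "tri (e, a, b) 1 = q e (0, 0)" using tri_pt1[OF f, of 0 0] by simp
  show "tri (e, a, b) \<i> = face_disc (boundary_of (e, a, b)) 0" using tri_pt2[OF f, of 0 0] by simp
qed

lemma finite_flags: "finite flags"
  unfolding flags_def using finite_edges by simp

lemma sgn_decompose:
  fixes x :: real assumes "x \<in> {-1..1}"
  obtains a where "a \<in> {-1, 1}" "x = a * \<bar>x\<bar>" "\<bar>x\<bar> \<in> {0..1}"
  using that[of 1] that[of "-1"] assms by (cases "x \<ge> 0") auto

lemma outline_rim:
  assumes x: "x \<in> outline (edges G)"
  obtains \<phi> \<tau> where "\<phi> \<in> flags" "\<tau> \<in> {0..2}" "x = rim \<phi> \<tau>"
proof -
  define H where "H = (\<Union>e\<in>edges G. \<Union>b\<in>{-1,1}. hside e b)"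
  define B where "B = (\<Union>e\<in>edges G. \<Union>a\<in>{-1,1}. q e ` ({a} \<times> {-1<..<1}))"
  have xHB: "x \<in> (\<Union>v\<in>vertices G. circle v) - B \<union> H" using x unfolding outline_def H_def B_def .
  show thesis
  proof (cases "x \<in> H")
    case True
    then obtain e b y where h: "e \<in> edges G" "b \<in> {-1, 1}" "y \<in> {-1..1}" "x = q e (y, b)" unfolding H_def by blast
    obtain a where a: "a \<in> {-1, 1}" "y = a * \<bar>y\<bar>" "\<bar>y\<bar> \<in> {0..1}" using sgn_decompose[OF h(3)] .
    show ?thesis by (rule that[of "(e, a, b)" "\<bar>y\<bar>"]) (use h a in \<open>auto simp: flags_def rim_def\<close>)
  next
    case False
    then obtain v where v: "v \<in> vertices G" "x \<in> circle v" and xB: "x \<notin> B" using xHB by blast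
    from v show ?thesis
    proof (cases rule: circle_cover)
      case (1 e a y)
      have "y \<notin> {-1<..<1}"
      proof
        assume "y \<in> {-1<..<1}"
        then have "x \<in> q e ` ({a} \<times> {-1<..<1})" using 1(5) by auto
        then have "x \<in> B" unfolding B_def by (rule UN_I[OF 1(1) UN_I[OF 1(2)]])
        then show False using xB by simp
      qed
      then have "y \<in> {-1, 1}" using 1(3) by auto
      \<comment> \<open>Of an attaching arc only the corners belong to the outline; they are reached
        at time 1.\<close>
      then show ?thesis by (intro that[of "(e, a, y)" 1]) (use 1 in \<open>auto simp: flags_def rim_def\<close>)
    next
      case (2 e a b \<tau>)
      show ?thesis by (rule that[of "(e, a, b)" "1 + \<tau>"]) (use 2 in \<open>auto simp: rim_def\<close>)
    qed
  qed
qed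

lemma circle_spoke:
  assumes v: "v \<in> vertices G" and x: "x \<in> circle v"
  obtains \<phi> \<tau> where "\<phi> \<in> flags" "\<tau> \<in> {0..2}" "att' \<phi> = v" "x = c v (spoke \<phi> \<tau>)"
  using v x
proof (cases rule: circle_cover)
  case (1 e a y)
  obtain b where b: "b \<in> {-1, 1}" "y = b * \<bar>y\<bar>" "\<bar>y\<bar> \<in> {0..1}" using sgn_decompose[OF 1(3)] .
  have f: "(e, a, b) \<in> flags" using 1 b by (auto simp: flags_def)
  have t: "\<bar>y\<bar> \<in> {0..2}" using b by auto
  show ?thesis by (rule that[OF f t]) (use 1 b spoke_image[OF f t] in auto)
next
  case (2 e a b \<tau>)
  have t: "1 + \<tau> \<in> {0..2}" using 2 by auto
  show ?thesis by (rule that[OF 2(1) t]) (use 2 spoke_image[OF 2(1) t] in auto)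
qed

text \<open>Polar coordinates in 0-bands and face discs, absolute values in 1-bands. That every
  direction belongs to some flag rests on the gaps and attaching arcs filling each circle.\<close>

lemma tri_cover: "(\<Union>\<phi>\<in>flags. tri \<phi> ` std_triangle) = topspace X"
proof
  have "tri \<phi> ` std_triangle \<subseteq> topspace X" if "\<phi> \<in> flags" for \<phi>
    using continuous_map_image_subset_topspace[OF tri_continuous[OF that]] by simp
  then show "(\<Union>\<phi>\<in>flags. tri \<phi> ` std_triangle) \<subseteq> topspace X" by blast
  show "topspace X \<subseteq> (\<Union>\<phi>\<in>flags. tri \<phi> ` std_triangle)"
  proof
    fix x assume "x \<in> topspace X"
    then consider v where "v \<in> vertices G" "x \<in> c v ` cball 0 1" | e where "e \<in> edges G" "x \<in> band e"
      | C where "C \<in> boundaries" "x \<in> face_disc C ` cball 0 1"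
      unfolding fd_cover band_union_def by blast
    then obtain \<phi> z where "\<phi> \<in> flags" "z \<in> kite0 \<union> kite1 \<union> kite2" "x = tri \<phi> z"
    proof cases
      case 1
      obtain y where y: "y \<in> cball 0 1" "x = c v y" using 1(2) by (rule imageE)
      \<comment> \<open>At the centre every direction fits; \<open>1\<close> is a default.\<close>
      define w where "w = (if y = 0 then 1 else sgn y)"
      have w: "w \<in> sphere 0 1" "y = norm y *\<^sub>R w" by (auto simp: w_def norm_sgn sgn_div_norm)
      obtain \<phi> \<tau> where p: "\<phi> \<in> flags" "\<tau> \<in> {0..2}" "att' \<phi> = v" "c v w = c v (spoke \<phi> \<tau>)"
        using circle_spoke[OF 1(1), of "c v w"] w(1) by blast
      have "w \<in> cball 0 1" "spoke \<phi> \<tau> \<in> cball 0 1" using w spoke_norm[OF p(1,2)] by simp_all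
      then have "w = spoke \<phi> \<tau>" using c_eq_imp[OF 1(1) 1(1)] p(4) by blast
      moreover have n: "norm y \<in> {0..1}" using y(1) by simp
      ultimately have "x = tri \<phi> (pt0 (norm y) \<tau>)" using tri_pt0[OF n p(2), of \<phi>] p(3) w(2) y(2) by simp
      then show ?thesis using that[OF p(1)] pt0_kite0(1)[OF n p(2)] by blast
    next
      case 2
      then obtain y1 y2 where y: "y1 \<in> {-1..1}" "y2 \<in> {-1..1}" "x = q e (y1, y2)" by (auto simp: square_def)
      obtain a where a: "a \<in> {-1, 1}" "y1 = a * \<bar>y1\<bar>" "\<bar>y1\<bar> \<in> {0..1}" using sgn_decompose[OF y(1)] .
      obtain b where b: "b \<in> {-1, 1}" "y2 = b * \<bar>y2\<bar>" "\<bar>y2\<bar> \<in> {0..1}" using sgn_decompose[OF y(2)] .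
      have f: "(e, a, b) \<in> flags" using 2 a b by (auto simp: flags_def)
      have "x = tri (e, a, b) (pt1 \<bar>y1\<bar> \<bar>y2\<bar>)" using tri_pt1[OF f a(3) b(3)] a(2) b(2) y(3) by simp
      then show ?thesis using that[OF f] pt1_kite1[OF a(3) b(3)] by blast
    next
      case 3
      obtain y where y: "y \<in> cball 0 1" "x = face_disc C y" using 3(2) by (rule imageE)
      define w where "w = (if y = 0 then 1 else sgn y)"
      have w: "w \<in> sphere 0 1" "y = norm y *\<^sub>R w" by (auto simp: w_def norm_sgn sgn_div_norm)
      have wC: "face_disc C w \<in> C" using fd_sphere[OF 3(1)] w(1) by blast
      have "C \<subseteq> outline (edges G)" using connected_components_of_subset[OF 3(1)[unfolded boundaries_eq]] by auto
      then obtain \<phi> \<tau> where p: "\<phi> \<in> flags" "\<tau> \<in> {0..2}" "face_disc C w = rim \<phi> \<tau>" using wC outline_rim by blast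
      have bC: "boundary_of \<phi> = C" using boundary_of_eqI[OF p(1) 3(1) p(2)] p(3) wC by simp
      have "w \<in> cball 0 1" "rim_lift \<phi> \<tau> \<in> cball 0 1" using w rim_lift_norm[OF p(1,2)] by simp_all
      then have "w = rim_lift \<phi> \<tau>"
        using inj_onD[OF fd_inj_on[OF 3(1)]] rim_lift(3)[OF p(1,2)] bC p(3) by simp
      moreover have n: "norm y \<in> {0..1}" using y(1) by simp
      moreover obtain e a b where e: "\<phi> = (e, a, b)" by (metis prod_cases3)
      ultimately have "x = tri \<phi> (pt2 (norm y) \<tau>)" using tri_pt2[of e a b "norm y" \<tau>] p(1,2) bC w(2) y(2) by simp
      then show ?thesis using that[OF p(1)] pt2_kite2(1)[OF n p(2)] by blast
    qed
    moreover have "kite0 \<union> kite1 \<union> kite2 \<subseteq> std_triangle" by (auto simp: kite0_def kite1_def kite2_def)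
    ultimately show "x \<in> (\<Union>\<phi>\<in>flags. tri \<phi> ` std_triangle)" by blast
  qed
qed

end

text \<open>The ribbon representation describes an edge only as a set, so its halves have to be
  identified with parameter intervals. Each open half of the curve is connected and off the common
  points, hence lies in one of \<open>A\<close> and \<open>B\<close>. The witnesses \<open>w\<close>
  and \<open>w'\<close> keep both halves from lying in the same set, and closedness adds the
  ends.\<close>

lemma arc_split:
  fixes \<gamma> :: "real \<Rightarrow> 'a"
  assumes \<gamma>: "pathin X \<gamma>" and inj: "inj_on \<gamma> {0<..<1}" and s: "0 < s" "s < 1"
    and AB: "closedin X A" "closedin X B" "A \<union> B = \<gamma> ` {0..1}" "A \<inter> B \<subseteq> insert (\<gamma> s) V"
    and V: "\<gamma> ` {0<..<1} \<inter> V = {}" "\<gamma> 0 \<in> V" "\<gamma> 1 \<in> V" "A \<inter> V \<subseteq> {x}" "B \<inter> V \<subseteq> {y}"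
    and ne: "w \<in> A" "w \<notin> insert (\<gamma> s) V" "w' \<in> B" "w' \<notin> insert (\<gamma> s) V"
  shows "(A = \<gamma> ` {0..s} \<and> B = \<gamma> ` {s..1}) \<or> (A = \<gamma> ` {s..1} \<and> B = \<gamma> ` {0..s})"
proof -
  have cm: "continuous_map (top_of_set {0..1}) X \<gamma>" using \<gamma> unfolding pathin_def .
  have out: "\<gamma> r \<notin> insert (\<gamma> s) V" if r: "r \<in> {0<..<1}" "r \<noteq> s" for r
  proof -
    have "\<gamma> r \<in> \<gamma> ` {0<..<1}" using r(1) by (rule imageI)
    then have "\<gamma> r \<notin> V" using V(1) by blast
    then show ?thesis using inj_onD[OF inj, of r s] r s by auto
  qed
  have extend: "\<gamma> ` {a..b} \<subseteq> F" if F: "closedin X F" "\<gamma> ` {a<..<b} \<subseteq> F" and ab: "0 \<le> a" "a < b" "b \<le> 1" for F a b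
  proof -
    have "closedin (top_of_set {0..1}) {r \<in> {0..1}. \<gamma> r \<in> F}"
      using closedin_continuous_map_preimage[OF cm F(1)] by simp
    then have "closed {r \<in> {0..1}. \<gamma> r \<in> F}" using closedin_closed_trans closed_atLeastAtMost by blast
    moreover have "{a<..<b} \<subseteq> {r \<in> {0..1}. \<gamma> r \<in> F}" using F(2) ab by auto
    ultimately have "closure {a<..<b} \<subseteq> {r \<in> {0..1}. \<gamma> r \<in> F}" by (rule closure_minimal[rotated])
    then show ?thesis using ab(2) by auto
  qed
  have main: "A' = \<gamma> ` {0..s} \<and> B' = \<gamma> ` {s..1}"
    if cl: "closedin X A'" "closedin X B'" and un: "A' \<union> B' = \<gamma> ` {0..1}" and int: "A' \<inter> B' \<subseteq> insert (\<gamma> s) V"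
      and vx: "A' \<inter> V \<subseteq> {x'}" "B' \<inter> V \<subseteq> {y'}" and sub: "\<gamma> ` {0<..<s} \<subseteq> A'" "\<gamma> ` {s<..<1} \<subseteq> B'" for A' B' x' y'
  proof -
    have 1: "\<gamma> ` {0..s} \<subseteq> A'" "\<gamma> ` {s..1} \<subseteq> B'" using extend[OF cl(1) sub(1)] extend[OF cl(2) sub(2)] s by auto
    have g: "\<gamma> 0 \<in> A'" "\<gamma> 1 \<in> B'" using 1 s by auto
    have "A' \<subseteq> \<gamma> ` {0..s}"
    proof
      fix z assume z: "z \<in> A'"
      then obtain r where r: "r \<in> {0..1}" "z = \<gamma> r" using un by blast
      consider "r \<in> {0..s}" | "r \<in> {s<..<1}" | "r = 1" using r(1) by force
      then show "z \<in> \<gamma> ` {0..s}"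
      proof cases
        case 2
        then have "\<gamma> r \<in> A' \<inter> B'" using sub(2) z r(2) by auto
        then show ?thesis using int out[of r] 2 s by auto
      next
        case 3
        \<comment> \<open>If the other end of the curve belongs to this part as well, then the curve
          is a loop, because the part contains only one point of \<open>V\<close>.\<close>
        then have "\<gamma> 1 \<in> A' \<inter> V" "\<gamma> 0 \<in> A' \<inter> V" using z r(2) V g by auto
        then have "\<gamma> 1 = \<gamma> 0" using vx(1) by blast
        then show ?thesis using 3 r(2) s by (intro image_eqI[of _ _ 0]) auto
      qed (use r in auto)
    qed
    moreover have "B' \<subseteq> \<gamma> ` {s..1}"
    proof
      fix z assume z: "z \<in> B'"
      then obtain r where r: "r \<in> {0..1}" "z = \<gamma> r" using un by blast
      consider "r \<in> {s..1}" | "r \<in> {0<..<s}" | "r = 0" using r(1) by force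
      then show "z \<in> \<gamma> ` {s..1}"
      proof cases
        case 2
        then have "\<gamma> r \<in> A' \<inter> B'" using sub(1) z r(2) by auto
        then show ?thesis using int out[of r] 2 s by auto
      next
        case 3
        then have "\<gamma> 1 \<in> B' \<inter> V" "\<gamma> 0 \<in> B' \<inter> V" using z r(2) V g by auto
        then have "\<gamma> 0 = \<gamma> 1" using vx(2) by blast
        then show ?thesis using 3 r(2) s by (intro image_eqI[of _ _ 1]) auto
      qed (use r in auto)
    qed
    ultimately show ?thesis using 1 by blast
  qed
  have piece: "\<gamma> ` {a<..<b} \<subseteq> A \<or> \<gamma> ` {a<..<b} \<subseteq> B" if ab: "0 \<le> a" "a < b" "b \<le> 1" "s \<notin> {a<..<b}" for a b
  proof -
    have "connectedin X (\<gamma> ` {a<..<b})"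
    proof (rule connectedin_continuous_map_image[OF cm])
      show "connectedin (top_of_set {0..1}) {a<..<b}" using ab by (auto simp: connectedin_subtopology)
    qed
    moreover have "\<gamma> ` {a<..<b} \<noteq> {}" using ab(2) by auto
    moreover have "\<gamma> ` {a<..<b} \<subseteq> (\<Union>i\<in>{True, False}. if i then A else B)"
    proof -
      have "\<gamma> ` {a<..<b} \<subseteq> \<gamma> ` {0..1}" using ab by (intro image_mono) auto
      then show ?thesis using AB(3) by auto
    qed
    moreover have "A \<inter> B \<inter> \<gamma> ` {a<..<b} = {}"
    proof -
      have "\<gamma> r \<notin> insert (\<gamma> s) V" if r: "r \<in> {a<..<b}" for r
      proof -
        have "r \<in> {0<..<1}" "r \<noteq> s" using r ab by auto
        then show ?thesis using out by blast
      qed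
      then show ?thesis using AB(4) by blast
    qed
    ultimately have pre: "connectedin X (\<gamma> ` {a<..<b})" "\<gamma> ` {a<..<b} \<noteq> {}"
      "\<gamma> ` {a<..<b} \<subseteq> (\<Union>i\<in>{True, False}. if i then A else B)" "A \<inter> B \<inter> \<gamma> ` {a<..<b} = {}" by this+
    obtain i where "\<gamma> ` {a<..<b} \<subseteq> (if i then A else B)"
    proof (rule connectedin_in_one_closed[OF pre(1,2) _ _ pre(3)])
      show "closedin X (if i then A else B)" for i using AB(1,2) by simp
      show "(if i then A else B) \<inter> (if j then A else B) \<inter> \<gamma> ` {a<..<b} = {}" if "i \<noteq> j" for i j
        using that pre(4) by (cases i; cases j) (simp_all add: Int_commute)
    qed simp_all
    then show ?thesis by (cases i) auto
  qed
  have p: "\<gamma> ` {0<..<s} \<subseteq> A \<or> \<gamma> ` {0<..<s} \<subseteq> B" "\<gamma> ` {s<..<1} \<subseteq> A \<or> \<gamma> ` {s<..<1} \<subseteq> B"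
    using piece[of 0 s] piece[of s 1] s by auto
  have nb: "\<not> (\<gamma> ` {0<..<s} \<subseteq> F \<and> \<gamma> ` {s<..<1} \<subseteq> F)"
    if F: "F \<inter> F' \<subseteq> insert (\<gamma> s) V" "z \<in> F'" "F' \<subseteq> \<gamma> ` {0..1}" "z \<notin> insert (\<gamma> s) V" for F F' z
  proof
    assume sub: "\<gamma> ` {0<..<s} \<subseteq> F \<and> \<gamma> ` {s<..<1} \<subseteq> F"
    obtain r where r: "r \<in> {0..1}" "z = \<gamma> r" using F(2,3) by blast
    have "r \<noteq> 0" "r \<noteq> 1" "r \<noteq> s" using F(4) r(2) V by auto
    then have "r \<in> {0<..<s} \<or> r \<in> {s<..<1}" using r(1) by auto
    then have "z \<in> F" using sub r(2) by blast
    then show False using F by blast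
  qed
  have "\<not> (\<gamma> ` {0<..<s} \<subseteq> A \<and> \<gamma> ` {s<..<1} \<subseteq> A)" by (rule nb[of A B w']) (use AB ne in auto)
  moreover have "\<not> (\<gamma> ` {0<..<s} \<subseteq> B \<and> \<gamma> ` {s<..<1} \<subseteq> B)" by (rule nb[of B A w]) (use AB ne in auto)
  ultimately consider "\<gamma> ` {0<..<s} \<subseteq> A" "\<gamma> ` {s<..<1} \<subseteq> B" | "\<gamma> ` {0<..<s} \<subseteq> B" "\<gamma> ` {s<..<1} \<subseteq> A"
    using p by blast
  then show ?thesis
  proof cases
    case 1
    then show ?thesis using main[OF AB(1-4) V(4,5)] by blast
  next
    case 2
    have "B \<union> A = \<gamma> ` {0..1}" "B \<inter> A \<subseteq> insert (\<gamma> s) V" using AB by blast+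
    from main[OF AB(2,1) this V(5,4) 2] show ?thesis by blast
  qed
qed

context ribbon_graph
begin

section \<open>The canonical barycentric subdivision\<close>

text \<open>The sign \<open>1\<close> is a default: both values of \<open>b\<close> give the same
  set (\<open>red_side_arm\<close>).\<close>

definition arm :: "'e \<Rightarrow> real \<Rightarrow> 'a set" where
  "arm e a = tri (e, a, 1) ` side Red"

lemma arm_flag: "e \<in> edges G \<Longrightarrow> a \<in> {-1, 1} \<Longrightarrow> (e, a, 1) \<in> flags"
  by (simp add: flags_def)

lemma red_side_arm: "(e, a, b) \<in> flags \<Longrightarrow> tri (e, a, b) ` side Red = arm e a"
  unfolding arm_def by (subst side_image_eq_iff) (auto simp: flags_def same_side_def)

lemma arm_eq:
  assumes e: "e \<in> edges G" and a: "a \<in> {-1, 1}"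
  shows "arm e a = c (att e a) ` closed_segment 0 (vpath e a 0) \<union> (\<lambda>x. q e (a * x, 0)) ` {0..1}"
proof -
  note f = arm_flag[OF e a]
  have p0: "tri (e, a, 1) (pt0 n 0) = c (att e a) (n *\<^sub>R vpath e a 0)" if "n \<in> {0..1}" for n
    using tri_pt0[OF that, of 0 "(e, a, 1)"] by (simp add: spoke_def)
  have p1: "tri (e, a, 1) (pt1 x 0) = q e (a * x, 0)" if "x \<in> {0..1}" for x
    using tri_pt1[OF f that, of 0] by simp
  show ?thesis
  proof (intro equalityI subsetI)
    fix y assume "y \<in> arm e a"
    then obtain z where z: "z \<in> side Red" "y = tri (e, a, 1) z" unfolding arm_def by blast
    then have zz: "0 \<le> Re z" "Re z \<le> 1" "Im z = 0" by (auto simp: side_eq)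
    show "y \<in> c (att e a) ` closed_segment 0 (vpath e a 0) \<union> (\<lambda>x. q e (a * x, 0)) ` {0..1}"
    proof (cases "Re z \<le> 2/3")
      case True
      have "z = pt0 (3/2 * Re z) 0" using zz by (simp add: pt0_def complex_eq_iff)
      moreover have n: "3/2 * Re z \<in> {0..1}" using zz True by auto
      ultimately have "y = c (att e a) ((3/2 * Re z) *\<^sub>R vpath e a 0)" using p0[OF n] z(2) by simp
      moreover have "(3/2 * Re z) *\<^sub>R vpath e a 0 \<in> closed_segment 0 (vpath e a 0)"
        using n by (auto simp: closed_segment_def intro!: exI[of _ "3/2 * Re z"])
      ultimately show ?thesis by blast
    next
      case False
      have "z = pt1 (3 * (1 - Re z)) 0" using zz by (simp add: pt1_def complex_eq_iff field_simps)
      moreover have n: "3 * (1 - Re z) \<in> {0..1}" using zz False by auto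
      ultimately have "y = q e (a * (3 * (1 - Re z)), 0)" using p1[OF n] z(2) by simp
      then show ?thesis using n by blast
    qed
  next
    fix y assume "y \<in> c (att e a) ` closed_segment 0 (vpath e a 0) \<union> (\<lambda>x. q e (a * x, 0)) ` {0..1}"
    then consider n where "n \<in> {0..1}" "y = c (att e a) (n *\<^sub>R vpath e a 0)" | x where "x \<in> {0..1}" "y = q e (a * x, 0)"
      by (auto simp: closed_segment_def)
    then show "y \<in> arm e a"
    proof cases
      case 1
      then show ?thesis using p0[OF 1(1)] pt_sides(1)[OF 1(1) 1(1)] unfolding arm_def by (metis image_eqI)
    next
      case 2
      then show ?thesis using p1[OF 2(1)] pt_sides(3)[OF 2(1) 2(1)] unfolding arm_def by (metis image_eqI)
    qed
  qed
qed

lemma ribbon_edge_set: "\<forall>e\<in>edges G. edge_set G e = q e ` ({-1..1} \<times> {0}) \<union>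
    (\<Union>v\<in>vertices G. \<Union>z\<in>{z \<in> sphere 0 1. c v z \<in> q e ` ({-1, 1} \<times> {0})}. c v ` closed_segment 0 z)"
  using ribbon unfolding ribbon_representation_def by (elim conjE) assumption

lemma edge_set_arms:
  assumes e: "e \<in> edges G" shows "edge_set G e = arm e 1 \<union> arm e (-1)"
proof -
  have zero: "(0::real) \<in> {-1..1}" by simp
  have vp: "vpath e a 0 \<in> sphere 0 1" "c (att e a) (vpath e a 0) = q e (a, 0)" if "a \<in> {-1, 1}" for a
    using vpath(2,4)[OF e that] zero by blast+
  have core: "q e ` ({-1..1} \<times> {0}) = (\<lambda>x. q e (1 * x, 0)) ` {0..1} \<union> (\<lambda>x. q e (- 1 * x, 0)) ` {0..1}"
  proof (intro equalityI subsetI)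
    fix y assume "y \<in> q e ` ({-1..1} \<times> {0})"
    then obtain x where x: "x \<in> {-1..1}" "y = q e (x, 0)" by blast
    show "y \<in> (\<lambda>x. q e (1 * x, 0)) ` {0..1} \<union> (\<lambda>x. q e (- 1 * x, 0)) ` {0..1}"
    proof (cases "x \<ge> 0")
      case True
      then have "y \<in> (\<lambda>x. q e (1 * x, 0)) ` {0..1}" using x by (intro image_eqI[of _ _ x]) auto
      then show ?thesis by simp
    next
      case False
      then have "y \<in> (\<lambda>x. q e (- 1 * x, 0)) ` {0..1}" using x by (intro image_eqI[of _ _ "- x"]) auto
      then show ?thesis by simp
    qed
  qed auto
  have radii: "(\<Union>v\<in>vertices G. \<Union>z\<in>{z \<in> sphere 0 1. c v z \<in> q e ` ({-1, 1} \<times> {0})}. c v ` closed_segment 0 z)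
    = c (att e 1) ` closed_segment 0 (vpath e 1 0) \<union> c (att e (-1)) ` closed_segment 0 (vpath e (-1) 0)" (is "?L = ?R")
  proof
    show "?L \<subseteq> ?R"
    proof (intro UN_least)
      fix v z assume v: "v \<in> vertices G" and z: "z \<in> {z \<in> sphere 0 1. c v z \<in> q e ` ({-1, 1} \<times> {0})}"
      then obtain a where a: "a \<in> {-1, 1}" "c v z = q e (a, 0)" and zs: "z \<in> sphere 0 1" by blast
      have zc: "z \<in> cball 0 1" using zs by simp
      have "(a, 0) \<in> square" using a(1) by (auto simp: square_def)
      then have av: "att e a = v" using band_Int_cball[OF e v _ zc a(2)[symmetric]] by simp
      have "vpath e a 0 \<in> cball 0 1" using vp(1)[OF a(1)] by simp
      then have "vpath e a 0 = z" using c_eq_imp[OF v v _ zc] vp(2)[OF a(1)] av a(2) by simp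
      then have "c v ` closed_segment 0 z = c (att e a) ` closed_segment 0 (vpath e a 0)" using av by simp
      then show "c v ` closed_segment 0 z \<subseteq> ?R" using a(1) by auto
    qed
    show "?R \<subseteq> ?L"
    proof (intro Un_least)
      have "c (att e a) ` closed_segment 0 (vpath e a 0) \<subseteq> ?L" if a: "a \<in> {-1, 1}" for a
      proof -
        have "vpath e a 0 \<in> {z \<in> sphere 0 1. c (att e a) z \<in> q e ` ({-1, 1} \<times> {0})}" using vp[OF a] a by auto
        then show ?thesis using att(1)[OF e a] by (intro subsetI UN_I)
      qed
      from this[of 1] this[of "-1"] show "c (att e 1) ` closed_segment 0 (vpath e 1 0) \<subseteq> ?L"
        "c (att e (-1)) ` closed_segment 0 (vpath e (-1) 0) \<subseteq> ?L" by simp_all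
    qed
  qed
  show ?thesis unfolding bspec[OF ribbon_edge_set e] core radii arm_eq[OF e, of 1, simplified] arm_eq[OF e, of "-1", simplified] by auto
qed

lemma vertex_tri:
  assumes v: "v \<in> vertices G" obtains \<phi> where "\<phi> \<in> flags" "tri \<phi> 0 = v"
proof -
  obtain e a where ea: "e \<in> edges G" "a \<in> {-1, 1}" "vside e a \<subseteq> circle v" using no_isolated[OF v] by blast
  have "att e a = v" using att_unique[OF ea(1,2) v ea(3)] .
  then show thesis using that[OF arm_flag[OF ea(1,2)]] tri_corners(1)[OF arm_flag[OF ea(1,2)]] by simp
qed

lemma zero_std: "0 \<in> std_triangle" "1 \<in> std_triangle" "\<i> \<in> std_triangle"
  by (auto simp: std_triangle_eq)

lemma tri_in_vertices:
  assumes "\<phi> \<in> flags" "z \<in> std_triangle" "tri \<phi> z \<in> vertices G" shows "z = 0"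
proof -
  obtain \<psi> where "\<psi> \<in> flags" "tri \<psi> 0 = tri \<phi> z" using vertex_tri[OF assms(3)] .
  then show ?thesis using tri_meet(1)[OF assms(1) _ assms(2) zero_std(1)] by simp
qed

lemma tri_in_graph_iff:
  assumes f: "\<phi> \<in> flags" and z: "z \<in> std_triangle"
  shows "tri \<phi> z \<in> graph_set G \<longleftrightarrow> z \<in> side Red"
proof
  assume "tri \<phi> z \<in> graph_set G"
  then consider "tri \<phi> z \<in> vertices G" | e where "e \<in> edges G" "tri \<phi> z \<in> edge_set G e" unfolding graph_set_def by blast
  then show "z \<in> side Red"
  proof cases
    case 1
    then show ?thesis using tri_in_vertices[OF f z] by (simp add: side_eq)
  next
    case 2
    then obtain a where a: "a \<in> {-1, 1}" "tri \<phi> z \<in> arm e a" using edge_set_arms[OF 2(1)] by auto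
    then obtain z' where z': "z' \<in> side Red" "tri \<phi> z = tri (e, a, 1) z'" unfolding arm_def by blast
    have "z' \<in> std_triangle" using z'(1) side_subset by blast
    then show ?thesis using tri_meet(1)[OF f arm_flag[OF 2(1) a(1)] z _ z'(2)] z'(1) by simp
  qed
next
  assume zR: "z \<in> side Red"
  obtain e a b where p: "\<phi> = (e, a, b)" by (metis prod_cases3)
  have f': "(e, a, b) \<in> flags" using f p by simp
  have "tri \<phi> z \<in> arm e a" using red_side_arm[OF f'] zR p by blast
  then have "tri \<phi> z \<in> edge_set G e" using edge_set_arms[OF flagsD(1)[OF f']] flagsD(2)[OF f'] by auto
  then show "tri \<phi> z \<in> graph_set G" using flagsD(1)[OF f'] unfolding graph_set_def by blast
qed

text \<open>The centre of the band lies on the edge, and it is no vertex because vertices occur only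
  at the corner \<open>0\<close> of a triangle.\<close>

lemma split_exists:
  assumes e: "e \<in> edges G" shows "\<exists>s. 0 < s \<and> s < 1 \<and> curve G e s = q e (0, 0)"
proof -
  have f: "(e, 1, 1) \<in> flags" using e by (simp add: flags_def)
  have one: "1 \<in> side Red" by (simp add: side_eq)
  have "q e (0, 0) \<in> arm e 1" using tri_corners(2)[OF f] one unfolding arm_def by (metis image_eqI)
  then have "q e (0, 0) \<in> edge_set G e" using edge_set_arms[OF e] by blast
  then obtain s where s: "s \<in> {0..1}" "q e (0, 0) = curve G e s" unfolding edge_set_def by blast
  have "q e (0, 0) \<notin> vertices G" using tri_in_vertices[OF f zero_std(2)] tri_corners(2)[OF f] by auto
  moreover have "curve G e 0 \<in> vertices G" "curve G e 1 \<in> vertices G"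
    using embedding e by (simp_all add: graph_embedding_def)
  ultimately have "s \<noteq> 0" "s \<noteq> 1" using s(2) by auto
  then show ?thesis using s by (intro exI[of _ s]) auto
qed

definition split :: "'e \<Rightarrow> real" where
  "split e = (SOME s. 0 < s \<and> s < 1 \<and> curve G e s = q e (0, 0))"

lemma split: "e \<in> edges G \<Longrightarrow> 0 < split e \<and> split e < 1 \<and> curve G e (split e) = q e (0, 0)"
  unfolding split_def using someI_ex[OF split_exists] .

text \<open>Instance of \<open>arc_split\<close>: two arms of one edge can meet only at the centre
  of the band and, for a loop, at the vertex. The midpoints of the red sides serve as
  witnesses.\<close>

lemma arm_halves:
  assumes e: "e \<in> edges G" and a: "a \<in> {-1, 1}"
  shows "arm e a = curve G e ` {0..split e} \<or> arm e a = curve G e ` {split e..1}"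
proof -
  have f: "(e, 1, 1) \<in> flags" "(e, -1, 1) \<in> flags" using e by (simp_all add: flags_def)
  have R: "side Red \<subseteq> std_triangle" "compact (side Red)" using side_subset compact_side by blast+
  have cl: "closedin X (arm e a)" if "(e, a, 1) \<in> flags" for a
    unfolding arm_def using embedding_closedin[OF tri_embedding[OF that] hausdorff compact_std_triangle R(2,1)] .
  have vert: "arm e a \<inter> vertices G \<subseteq> {tri (e, a, 1) 0}" if "(e, a, 1) \<in> flags" for a
    using tri_in_vertices[OF that] R(1) unfolding arm_def by blast
  have int: "arm e 1 \<inter> arm e (-1) \<subseteq> insert (curve G e (split e)) (vertices G)"
  proof
    fix y assume "y \<in> arm e 1 \<inter> arm e (-1)"
    then obtain z z' where z: "z \<in> side Red" "z' \<in> side Red" "y = tri (e, 1, 1) z" "tri (e, 1, 1) z = tri (e, -1, 1) z'"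
      unfolding arm_def by blast
    have zt: "z \<in> std_triangle" "z' \<in> std_triangle" using z R by blast+
    from tri_eq_imp[OF f zt z(4)] have "z \<in> side Blue \<or> z \<in> side Yellow \<or> z = 0 \<or> z = 1 \<or> z = \<i>" by auto
    then have "z = 0 \<or> z = 1" using z(1) by (auto simp: side_eq complex_eq_iff)
    then show "y \<in> insert (curve G e (split e)) (vertices G)"
      using z(3) tri_corners(1,2)[OF f(1)] split[OF e] att_flag[OF f(1)] by auto
  qed
  have half: "tri (e, a, 1) (1/2) \<in> arm e a \<and> tri (e, a, 1) (1/2) \<notin> insert (curve G e (split e)) (vertices G)"
    if fa: "(e, a, 1) \<in> flags" for a
  proof -
    have h: "(1/2::complex) \<in> side Red" by (simp add: side_eq)
    have hs: "(1/2::complex) \<in> std_triangle" using h R by blast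
    have "tri (e, a, 1) (1/2) \<noteq> tri (e, a, 1) 1" using tri_meet(1)[OF fa fa hs zero_std(2)] by auto
    then show ?thesis using h tri_in_vertices[OF fa hs] tri_corners(2)[OF fa] split[OF e] unfolding arm_def by auto
  qed
  have "(arm e 1 = curve G e ` {0..split e} \<and> arm e (-1) = curve G e ` {split e..1}) \<or>
    (arm e 1 = curve G e ` {split e..1} \<and> arm e (-1) = curve G e ` {0..split e})"
  proof (rule arc_split)
    show "pathin X (curve G e)" "inj_on (curve G e) {0<..<1}" "curve G e 0 \<in> vertices G" "curve G e 1 \<in> vertices G"
      "curve G e ` {0<..<1} \<inter> vertices G = {}"
      using embedding e by (simp_all add: graph_embedding_def)
    show "0 < split e" "split e < 1" using split[OF e] by simp_all
    show "arm e 1 \<union> arm e (-1) = curve G e ` {0..1}" using edge_set_arms[OF e] unfolding edge_set_def by simp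
  qed (use cl f vert int half in blast)+
  then show ?thesis using a by auto
qed

text \<open>The centre of the face disc inside the face; independent of the chosen flag by
  \<open>apex_unique\<close>.\<close>

definition apex :: "'a set \<Rightarrow> 'a" where
  "apex f = tri (SOME \<phi>. \<phi> \<in> flags \<and> tri \<phi> \<i> \<in> f) \<i>"

abbreviation "complement_space \<equiv> subtopology X (topspace X - graph_set G)"

lemma faces_eq: "faces G = connected_components_of complement_space"
  unfolding faces_def graph_set_def ..

lemma topspace_complement: "topspace complement_space = topspace X - graph_set G"
  by auto

lemma tri_open_face:
  assumes f: "\<phi> \<in> flags" and F: "F \<in> faces G" "z \<in> std_triangle - side Red" "tri \<phi> z \<in> F"
  shows "tri \<phi> ` (std_triangle - side Red) \<subseteq> F"
proof -
  have "connected (std_triangle - side Red)"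
  proof -
    have "std_triangle - side Red = std_triangle \<inter> {z. 0 < Im z}" by (auto simp: std_triangle_eq side_eq)
    then show ?thesis by (simp add: convex_connected convex_Int convex_std_triangle convex_halfspace_Im_gt)
  qed
  then have "connectedin X (tri \<phi> ` (std_triangle - side Red))"
    using embedding_connectedin[OF tri_embedding[OF f] hausdorff compact_std_triangle] by blast
  moreover have "tri \<phi> ` (std_triangle - side Red) \<subseteq> topspace X - graph_set G"
    using tri_in_graph_iff[OF f] tri_cover f by blast
  ultimately have conn: "connectedin complement_space (tri \<phi> ` (std_triangle - side Red))"
    by (simp add: connectedin_subtopology)
  show ?thesis
    using connected_components_of_maximal[OF F(1)[unfolded faces_eq] conn] F(2,3) by (auto simp: disjnt_def)
qed

text \<open>Faces are components of the complement of the graph, while apexes come from boundary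
  components of the ribbon graph. Grouping the triangles by boundary component gives finitely many
  closed sets that are disjoint off the graph, so a face lies in one of them.\<close>

lemma apex_unique:
  assumes f: "\<phi> \<in> flags" "\<psi> \<in> flags" and F: "F \<in> faces G" "tri \<phi> \<i> \<in> F" "tri \<psi> \<i> \<in> F"
  shows "tri \<phi> \<i> = tri \<psi> \<i>"
proof -
  have Fc: "connectedin X F" and Fsub: "F \<subseteq> topspace X - graph_set G"
    using connectedin_connected_components_of[OF F(1)[unfolded faces_eq]] by (auto simp: connectedin_subtopology)
  define A where "A C = (\<Union>\<rho>\<in>{\<rho> \<in> flags. boundary_of \<rho> = C}. tri \<rho> ` std_triangle)" for C
  \<comment> \<open>A contact off the graph is along a blue side, along a yellow side or at the
    apex, and in each case the rims have a common point or the components agree outright.\<close>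
  have in_one: "boundary_of \<rho> = boundary_of \<omega>"
    if c: "\<rho> \<in> flags" "\<omega> \<in> flags" "z \<in> std_triangle" "z' \<in> std_triangle" "tri \<rho> z = tri \<omega> z'" "tri \<rho> z \<notin> graph_set G"
    for \<rho> \<omega> z z'
  proof -
    have nR: "z \<notin> side Red" using tri_in_graph_iff[OF c(1,3)] c(6) by blast
    obtain e a b where p: "\<rho> = (e, a, b)" by (metis prod_cases3)
    obtain e' a' b' where p': "\<omega> = (e', a', b')" by (metis prod_cases3)
    have n0: "z \<noteq> 0" "z \<noteq> 1" using nR by (auto simp: side_eq)
    have blue: ?thesis if "e = e'" "b = b'"
    proof -
      have "rim \<rho> 0 = rim \<omega> 0" using that by (simp add: rim_def p p')
      then show ?thesis using boundary_of_rim_eq(1)[OF c(1,2), of 0] by simp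
    qed
    from tri_eq_imp[of e a b e' a' b', OF c(1,2)[unfolded p p'] c(3,4) c(5)[unfolded p p']] nR n0
    consider "(e, a, b) = (e', a', b')" | "e = e'" "b = b'" | "mid (e, a, b) = mid (e', a', b')" | "boundary_of \<rho> = boundary_of \<omega>"
      using p p' by blast
    then show ?thesis
    proof cases
      case 3
      then show ?thesis using mid_eq_imp(3)[of e a b e' a' b'] c(1,2) p p' by simp
    qed (use blue p p' in auto)
  qed
  obtain C where C: "C \<in> boundary_of ` flags" "F \<subseteq> A C"
  proof (rule connectedin_in_one_closed[OF Fc, of "boundary_of ` flags" A])
    show "F \<noteq> {}" using F by blast
    show "finite (boundary_of ` flags)" using finite_flags by simp
    show "closedin X (A i)" for i unfolding A_def
      using finite_flags embedding_closedin[OF tri_embedding hausdorff compact_std_triangle compact_std_triangle order_refl]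
      by (auto intro!: closedin_Union)
    show "F \<subseteq> (\<Union>i\<in>boundary_of ` flags. A i)"
    proof
      fix x assume "x \<in> F"
      then have "x \<in> (\<Union>\<phi>\<in>flags. tri \<phi> ` std_triangle)" using Fsub tri_cover by blast
      then obtain \<rho> where "\<rho> \<in> flags" "x \<in> tri \<rho> ` std_triangle" by blast
      then show "x \<in> (\<Union>i\<in>boundary_of ` flags. A i)" unfolding A_def by blast
    qed
    show "A i \<inter> A j \<inter> F = {}" if "i \<noteq> j" for i j
    proof (rule ccontr)
      assume "A i \<inter> A j \<inter> F \<noteq> {}"
      then obtain x where x: "x \<in> A i" "x \<in> A j" "x \<in> F" by blast
      obtain \<rho> z where c: "\<rho> \<in> flags" "boundary_of \<rho> = i" "z \<in> std_triangle" "x = tri \<rho> z" using x(1) unfolding A_def by blast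
      obtain \<omega> z' where w: "\<omega> \<in> flags" "boundary_of \<omega> = j" "z' \<in> std_triangle" "x = tri \<omega> z'" using x(2) unfolding A_def by blast
      have "tri \<rho> z = tri \<omega> z'" "tri \<rho> z \<notin> graph_set G" using c w x(3) Fsub by auto
      from in_one[OF c(1) w(1) c(3) w(3) this] show False using c(2) w(2) that by simp
    qed
  qed blast
  have b: "boundary_of \<rho> = C" if ch: "\<rho> \<in> flags" "tri \<rho> \<i> \<in> F" for \<rho>
  proof -
    obtain \<omega> z where w: "\<omega> \<in> flags" "boundary_of \<omega> = C" "z \<in> std_triangle" "tri \<rho> \<i> = tri \<omega> z" using ch C(2) unfolding A_def by blast
    have "tri \<rho> \<i> \<notin> graph_set G" using ch Fsub by blast
    from in_one[OF ch(1) w(1) zero_std(3) w(3,4) this] show ?thesis using w(2) by simp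
  qed
  obtain e a b where p: "\<phi> = (e, a, b)" by (metis prod_cases3)
  obtain e' a' b' where p': "\<psi> = (e', a', b')" by (metis prod_cases3)
  show ?thesis using b[OF f(1) F(2)] b[OF f(2) F(3)] tri_corners(3)[of e a b] tri_corners(3)[of e' a' b'] f p p' by simp
qed

lemma face_apex:
  assumes F: "F \<in> faces G" and f: "\<phi> \<in> flags" "tri \<phi> \<i> \<in> F"
  shows "apex F = tri \<phi> \<i>"
proof -
  have "\<exists>\<phi>. \<phi> \<in> flags \<and> tri \<phi> \<i> \<in> F" using f by blast
  from someI_ex[OF this] show ?thesis unfolding apex_def using apex_unique[OF _ f(1) F _ f(2)] by blast
qed

lemma apex_not_red: "\<i> \<in> std_triangle - side Red"
  by (auto simp: std_triangle_eq side_eq)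

text \<open>Existence of the reference subdivision. Common points have equal coordinates in both
  triangles, so every contact is in a common side or a common corner.\<close>

lemma tri_barycentric: "barycentric_subdivision G split apex (tri ` flags)"
  unfolding barycentric_subdivision_def
proof (intro conjI ballI impI)
  fix e assume "e \<in> edges G" then show "0 < split e" "split e < 1" using split by blast+
next
  fix F assume F: "F \<in> faces G"
  have "F \<noteq> {}" "F \<subseteq> topspace X - graph_set G"
    using nonempty_connected_components_of[OF F[unfolded faces_eq]] connected_components_of_subset[OF F[unfolded faces_eq]] by auto
  then obtain x where x: "x \<in> F" "x \<in> topspace X" "x \<notin> graph_set G" by blast
  then have "x \<in> (\<Union>\<phi>\<in>flags. tri \<phi> ` std_triangle)" using tri_cover by simp
  then obtain \<phi> z where p: "\<phi> \<in> flags" "z \<in> std_triangle" "x = tri \<phi> z" by blast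
  then have "z \<in> std_triangle - side Red" using tri_in_graph_iff[OF p(1,2)] x(3) by blast
  from tri_open_face[OF p(1) F this] p(3) x(1) have "tri \<phi> ` (std_triangle - side Red) \<subseteq> F" by simp
  then have "tri \<phi> \<i> \<in> F" using apex_not_red by blast
  then show "apex F \<in> F" using face_apex[OF F p(1)] by simp
next
  show "finite (tri ` flags)" using finite_flags by simp
next
  fix t assume "t \<in> tri ` flags"
  then obtain \<phi> where p: "\<phi> \<in> flags" "t = tri \<phi>" by blast
  obtain e a b where e: "\<phi> = (e, a, b)" by (metis prod_cases3)
  have f: "(e, a, b) \<in> flags" using p e by simp
  note fD = flagsD[OF f]
  show "embedding_map (top_of_set std_triangle) X t" using tri_embedding p by simp
  show "t 0 \<in> vertices G" using tri_corners(1)[OF f] att_flag[OF f] p e by simp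
  have "t 1 = curve G e (split e)" using tri_corners(2)[OF f] split[OF fD(1)] p e by simp
  moreover have "t ` side Red = curve G e ` {0..split e} \<or> t ` side Red = curve G e ` {split e..1}"
    using red_side_arm[OF f] arm_halves[OF fD(1,2)] p e by simp
  ultimately show "\<exists>e\<in>edges G. t 1 = curve G e (split e) \<and>
      (t ` side Red = curve G e ` {0..split e} \<or> t ` side Red = curve G e ` {split e..1})" using fD(1) by blast
  have "tri \<phi> \<i> \<in> topspace complement_space"
    using tri_in_graph_iff[OF p(1) zero_std(3)] apex_not_red tri_cover p(1) zero_std(3) unfolding topspace_complement by blast
  then have "tri \<phi> \<i> \<in> \<Union> (connected_components_of complement_space)" by (simp only: Union_connected_components_of)
  then obtain F where F: "F \<in> faces G" "tri \<phi> \<i> \<in> F" unfolding faces_eq by (rule UnionE)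
  have "t ` (std_triangle - side Red) \<subseteq> F" using tri_open_face[OF p(1) F(1) apex_not_red F(2)] p(2) by simp
  moreover have "t \<i> = apex F" using face_apex[OF F(1) p(1) F(2)] p(2) by simp
  ultimately show "\<exists>f\<in>faces G. t \<i> = apex f \<and> t ` (std_triangle - side Red) \<subseteq> f" using F(1) by blast
next
  fix t u z w
  assume t: "t \<in> tri ` flags" and u: "u \<in> tri ` flags" and tu: "t \<noteq> u" and z: "z \<in> std_triangle" "w \<in> std_triangle" "t z = u w"
  obtain \<phi> where p: "\<phi> \<in> flags" "t = tri \<phi>" using t by blast
  obtain \<psi> where p': "\<psi> \<in> flags" "u = tri \<psi>" using u by blast
  have eq: "tri \<phi> z = tri \<psi> w" using z(3) p p' by simp
  note m = tri_meet[OF p(1) p'(1) z(1,2) eq]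
  have "\<phi> \<noteq> \<psi>" using tu p p' by blast
  then consider k where "z \<in> side k" "same_side k \<phi> \<psi>" | "z = 0 \<or> z = 1 \<or> z = \<i>" using m(2) by blast
  then show "\<exists>K. K face_of std_triangle \<and> K \<noteq> std_triangle \<and> z \<in> K \<and> w \<in> K \<and> t ` K = u ` K"
  proof cases
    case 1
    have "t ` side k = u ` side k" using side_image_eq_iff[OF p(1) p'(1)] 1(2) p(2) p'(2) by simp
    then show ?thesis using side_face[of k] 1(1) m(1) by blast
  next
    case 2
    then have "{z} face_of std_triangle" using corner_face(1)[of z] by blast
    moreover have "t ` {z} = u ` {z}" using z(3) m(1) by simp
    ultimately show ?thesis using corner_face(2)[of z] m(1) by blast
  qed
next
  show "(\<Union>t\<in>tri ` flags. t ` std_triangle) = topspace X" using tri_cover by simp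
qed

lemma tri_edge_iff:
  assumes "\<phi> \<in> flags" "e \<in> edges G" shows "tri \<phi> 1 = curve G e (split e) \<longleftrightarrow> fst \<phi> = e"
proof -
  obtain e' a b where p: "\<phi> = (e', a, b)" by (metis prod_cases3)
  have f: "(e', a, b) \<in> flags" using assms(1) p by simp
  have "(0, 0) \<in> square" by (simp add: square_def)
  then show ?thesis using tri_corners(2)[OF f] split[OF assms(2)] q_eq_imp[OF flagsD(1)[OF f] assms(2)] p by auto
qed

end

section \<open>Coloured graphs given by relations\<close>

text \<open>Lets colours be compared as relations on nodes; reflexive relations do no harm, since
  the diagonal is excluded.\<close>

definition rel_graph :: "'n set \<Rightarrow> (colour \<Rightarrow> 'n \<Rightarrow> 'n \<Rightarrow> bool) \<Rightarrow> 'n coloured_graph" where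
  "rel_graph N R = \<lparr>nodes = N, links = (\<lambda>k. {{x, y} | x y. x \<in> N \<and> y \<in> N \<and> x \<noteq> y \<and> R k x y})\<rparr>"

lemma dual_coloured_graph_eq: "dual_coloured_graph T = rel_graph T (\<lambda>k t u. t ` side k = u ` side k)"
  by (simp add: dual_coloured_graph_def rel_graph_def)

lemma rel_graph_iso:
  assumes f: "bij_betw f N N'" and R: "\<And>k x y. x \<in> N \<Longrightarrow> y \<in> N \<Longrightarrow> R k x y \<longleftrightarrow> R' k (f x) (f y)"
  shows "coloured_iso f (rel_graph N R) (rel_graph N' R')"
  unfolding coloured_iso_def
proof (intro conjI allI)
  show "bij_betw f (nodes (rel_graph N R)) (nodes (rel_graph N' R'))" using f by (simp add: rel_graph_def)
  fix k
  have inj: "inj_on f N" and im: "f ` N = N'" using f by (simp_all add: bij_betw_def)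
  show "links (rel_graph N' R') k = (\<lambda>d. f ` d) ` links (rel_graph N R) k"
  proof (intro equalityI subsetI)
    fix d assume "d \<in> links (rel_graph N' R') k"
    then obtain x' y' where d: "d = {x', y'}" "x' \<in> N'" "y' \<in> N'" "x' \<noteq> y'" "R' k x' y'" by (auto simp: rel_graph_def)
    obtain x y where xy: "x \<in> N" "y \<in> N" "x' = f x" "y' = f y" using d(2,3) im by blast
    have "x \<noteq> y" "R k x y" using xy d R by auto
    then have "{x, y} \<in> links (rel_graph N R) k" using xy(1,2) unfolding rel_graph_def by auto
    then show "d \<in> (\<lambda>d. f ` d) ` links (rel_graph N R) k" using d(1) xy by (intro image_eqI[of _ _ "{x, y}"]) auto
  next
    fix d assume "d \<in> (\<lambda>d. f ` d) ` links (rel_graph N R) k"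
    then obtain x y where d: "d = f ` {x, y}" "x \<in> N" "y \<in> N" "x \<noteq> y" "R k x y" by (auto simp: rel_graph_def)
    have "f x \<noteq> f y" using inj_onD[OF inj _ d(2,3)] d(4) by blast
    moreover have "f x \<in> N'" "f y \<in> N'" "R' k (f x) (f y)" using d R im by auto
    ultimately show "d \<in> links (rel_graph N' R') k" using d(1) by (auto simp: rel_graph_def)
  qed
qed

lemma coloured_iso_comp:
  assumes f: "coloured_iso f A B" and g: "coloured_iso g B C" shows "coloured_iso (g \<circ> f) A C"
  unfolding coloured_iso_def
proof (intro conjI allI)
  show "bij_betw (g \<circ> f) (nodes A) (nodes C)"
    using bij_betw_trans[of f "nodes A" "nodes B" g "nodes C"] f g by (simp add: coloured_iso_def)
  show "links C k = (\<lambda>d. (g \<circ> f) ` d) ` links A k" for k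
    using f g unfolding coloured_iso_def by (simp add: image_image image_comp[symmetric])
qed

text \<open>The label \<open>l\<close> names the bigon of a node. Both ends of a red or blue link
  carry the same label, so the swap on links becomes a pointwise choice of the relation according to
  \<open>l x\<close>.\<close>

lemma swap_red_blue_iso:
  assumes g: "coloured_iso g (rel_graph N R) M" and \<beta>: "\<And>e. e \<in> D \<Longrightarrow> \<beta> e = g ` {x \<in> N. l x = e}"
    and l: "\<And>k x y. x \<in> N \<Longrightarrow> y \<in> N \<Longrightarrow> k \<noteq> Yellow \<Longrightarrow> R k x y \<Longrightarrow> l x = l y"
    and R': "\<And>x y. R' Yellow x y \<longleftrightarrow> R Yellow x y" "\<And>x y. R' Red x y \<longleftrightarrow> R (if l x \<in> D then Blue else Red) x y"
       "\<And>x y. R' Blue x y \<longleftrightarrow> R (if l x \<in> D then Red else Blue) x y"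
  shows "coloured_iso g (rel_graph N R') (swap_red_blue M (\<beta> ` D))"
proof -
  have bij: "bij_betw g N (nodes M)" and links: "\<And>k. links M k = (\<lambda>d. g ` d) ` links (rel_graph N R) k"
    using g unfolding coloured_iso_def by (simp_all add: rel_graph_def)
  have inj: "inj_on g N" using bij by (simp add: bij_betw_def)
  define on where "on d \<longleftrightarrow> (\<exists>B\<in>\<beta> ` D. d \<subseteq> B)" for d
  have on: "on (g ` {x, y}) \<longleftrightarrow> l x \<in> D \<and> l x = l y" if "x \<in> N" "y \<in> N" for x y
  proof
    assume "on (g ` {x, y})"
    then obtain e where e: "e \<in> D" "g ` {x, y} \<subseteq> \<beta> e" unfolding on_def by blast
    have "w \<in> {x \<in> N. l x = e}" if "w \<in> {x, y}" for w
    proof -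
      have "g w \<in> g ` {x \<in> N. l x = e}" using e(2) \<beta>[OF e(1)] that by blast
      then obtain w' where w': "w' \<in> N" "l w' = e" "g w = g w'" by blast
      have "w \<in> N" using that \<open>x \<in> N\<close> \<open>y \<in> N\<close> by blast
      then show ?thesis using inj_onD[OF inj w'(3)] w' by simp
    qed
    then show "l x \<in> D \<and> l x = l y" using e(1) by auto
  next
    assume a: "l x \<in> D \<and> l x = l y"
    then have "g ` {x, y} \<subseteq> \<beta> (l x)" using \<beta>[of "l x"] that by auto
    then show "on (g ` {x, y})" using a unfolding on_def by blast
  qed
  have pair: "{d \<in> links M k. P d} = (\<lambda>d. g ` d) ` {{x, y} | x y. x \<in> N \<and> y \<in> N \<and> x \<noteq> y \<and> R k x y \<and> P (g ` {x, y})}" for k P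
  proof -
    have "{d \<in> links M k. P d} = (\<lambda>d. g ` d) ` {d \<in> links (rel_graph N R) k. P (g ` d)}" unfolding links by blast
    also have "{d \<in> links (rel_graph N R) k. P (g ` d)} =
        {{x, y} | x y. x \<in> N \<and> y \<in> N \<and> x \<noteq> y \<and> R k x y \<and> P (g ` {x, y})}"
      by (simp only: rel_graph_def coloured_graph.simps) blast
    finally show ?thesis .
  qed
  have two: "{d \<in> links M k. \<not> on d} \<union> {d \<in> links M k'. on d} = (\<lambda>d. g ` d) ` links (rel_graph N R') j"
    if k: "k \<noteq> Yellow" "k' \<noteq> Yellow" and j: "\<And>x y. R' j x y \<longleftrightarrow> R (if l x \<in> D then k' else k) x y" for k k' j
  proof -
    let ?A = "{{x, y} | x y. x \<in> N \<and> y \<in> N \<and> x \<noteq> y \<and> R k x y \<and> \<not> on (g ` {x, y})}"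
    let ?B = "{{x, y} | x y. x \<in> N \<and> y \<in> N \<and> x \<noteq> y \<and> R k' x y \<and> on (g ` {x, y})}"
    let ?C = "{{x, y} | x y. x \<in> N \<and> y \<in> N \<and> x \<noteq> y \<and> R' j x y}"
    have eqv: "(R k x y \<and> \<not> on (g ` {x, y}) \<or> R k' x y \<and> on (g ` {x, y})) \<longleftrightarrow> R' j x y" if "x \<in> N" "y \<in> N" for x y
      unfolding on[OF that] j using l[OF that k(1)] l[OF that k(2)] by auto
    have "?A \<union> ?B = ?C"
    proof (intro equalityI subsetI)
      fix d assume "d \<in> ?A \<union> ?B"
      then obtain x y where "d = {x, y}" "x \<in> N" "y \<in> N" "x \<noteq> y" "R k x y \<and> \<not> on (g ` {x, y}) \<or> R k' x y \<and> on (g ` {x, y})" by blast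
      then show "d \<in> ?C" using eqv by blast
    next
      fix d assume "d \<in> ?C"
      then obtain x y where d: "d = {x, y}" "x \<in> N" "y \<in> N" "x \<noteq> y" "R' j x y" by blast
      then have "R k x y \<and> \<not> on (g ` {x, y}) \<or> R k' x y \<and> on (g ` {x, y})" using eqv by blast
      then show "d \<in> ?A \<union> ?B" using d by blast
    qed
    then have "(\<lambda>d. g ` d) ` ?A \<union> (\<lambda>d. g ` d) ` ?B = (\<lambda>d. g ` d) ` ?C" by (metis image_Un)
    then show ?thesis unfolding pair by (simp add: rel_graph_def)
  qed
  have "links (swap_red_blue M (\<beta> ` D)) k = (\<lambda>d. g ` d) ` links (rel_graph N R') k" for k
  proof (cases k)
    case Red
    then show ?thesis using two[of Red Blue Red] R'(2) by (simp add: swap_red_blue_def Let_def on_def)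
  next
    case Blue
    then show ?thesis using two[of Blue Red Blue] R'(3) by (simp add: swap_red_blue_def Let_def on_def)
  next
    case Yellow
    then show ?thesis using R'(1) links[of Yellow] by (simp add: swap_red_blue_def Let_def rel_graph_def)
  qed
  then show ?thesis using bij unfolding coloured_iso_def by (simp add: rel_graph_def swap_red_blue_def Let_def)
qed

lemma coloured_iso_linkI:
  assumes "coloured_iso g (rel_graph N R) M" "x \<in> N" "y \<in> N" "x \<noteq> y" "R k x y"
  shows "{g x, g y} \<in> links M k"
proof -
  have "g ` {x, y} \<in> (\<lambda>d. g ` d) ` links (rel_graph N R) k"
    by (rule imageI) (use assms in \<open>auto simp: rel_graph_def\<close>)
  then show ?thesis using assms(1) unfolding coloured_iso_def by simp
qed

lemma coloured_iso_bigon4: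
  assumes g: "coloured_iso g (rel_graph N R) M" and N: "x1 \<in> N" "x2 \<in> N" "x3 \<in> N" "x4 \<in> N" and d: "distinct [x1, x2, x3, x4]"
    and R: "R j x1 x2" "R k x2 x3" "R j x3 x4" "R k x4 x1"
  shows "bigon M j k (g ` {x1, x2, x3, x4})"
proof -
  have bij: "bij_betw g N (nodes M)" using g unfolding coloured_iso_def by (simp add: rel_graph_def)
  let ?xs = "[g x1, g x2, g x3, g x4]"
  have l: "{g x1, g x2} \<in> links M j" "{g x2, g x3} \<in> links M k" "{g x3, g x4} \<in> links M j" "{g x4, g x1} \<in> links M k"
    using coloured_iso_linkI[OF g] N d R by auto
  have inj: "inj_on g {x1, x2, x3, x4}" by (rule inj_on_subset[of g N]) (use bij N in \<open>auto simp: bij_betw_def\<close>)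
  have "distinct (map g [x1, x2, x3, x4])" unfolding distinct_map using d inj by simp
  then have "distinct ?xs" by simp
  moreover have "set ?xs = g ` {x1, x2, x3, x4}" by simp
  moreover have "g ` {x1, x2, x3, x4} \<subseteq> nodes M" using bij N by (auto simp: bij_betw_def)
  moreover have "\<forall>i<length ?xs. {?xs ! i, ?xs ! (Suc i mod length ?xs)} \<in> links M (if even i then j else k)"
  proof (intro allI impI)
    have len: "length ?xs = 4" by simp
    have nths: "?xs ! 0 = g x1" "?xs ! 1 = g x2" "?xs ! 2 = g x3" "?xs ! 3 = g x4" by simp_all
    have md: "Suc 0 mod 4 = 1" "Suc 1 mod 4 = 2" "Suc 2 mod 4 = 3" "Suc 3 mod 4 = 0" by simp_all
    have par: "even (0::nat)" "\<not> even (1::nat)" "even (2::nat)" "\<not> even (3::nat)" by simp_all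
    fix i assume "i < length ?xs"
    then have "i < 4" by simp
    then consider "i = 0" | "i = 1" | "i = 2" | "i = 3" by linarith
    then show "{?xs ! i, ?xs ! (Suc i mod length ?xs)} \<in> links M (if even i then j else k)"
      by cases (simp_all only: len md nths par l if_True if_False)
  qed
  ultimately show ?thesis unfolding bigon_def by (intro exI[of _ ?xs]) simp
qed

section \<open>Symmetries of the square\<close>

text \<open>On a vertical side the first coordinate of \<open>g\<close> is continuous with values
  \<plusminus>1, hence constant. Invariance of domain keeps the boundary of the square on the
  boundary, so the horizontal sides are preserved too, and the second coordinate is constant on each
  of them.\<close>

lemma square_symmetry:
  fixes g :: "real \<times> real \<Rightarrow> real \<times> real"
  assumes cont: "continuous_on square g" and inj: "inj_on g square" and onto: "g ` square = square"
    and V: "g ` ({-1, 1} \<times> {-1..1}) = {-1, 1} \<times> {-1..1}"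
  shows "\<exists>s\<in>{-1, 1}. \<exists>t\<in>{-1, 1}. \<forall>a\<in>{-1, 1}. \<forall>b\<in>{-1, 1}. g (a, b) = (s * a, t * b)"
proof -
  have two: "\<exists>r\<in>{-1, 1}. \<forall>x\<in>S. f x = r"
    if "connected S" "S \<noteq> {}" "continuous_on S f" "\<And>x. x \<in> S \<Longrightarrow> f x \<in> {-1, 1}" for S :: "real set" and f :: "real \<Rightarrow> real"
  proof -
    have ne: "f ` S \<noteq> {}" using that(2) by simp
    have sub: "f ` S \<subseteq> {-1, 1}" using that(4) by blast
    then have "finite (f ` S)" using finite_subset by blast
    moreover have "connected (f ` S)" using connected_continuous_image[OF that(3,1)] .
    ultimately have "f ` S = {} \<or> (\<exists>r. f ` S = {r})" by (simp only: connected_finite_iff_sing)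
    then obtain r where "f ` S = {r}" using ne by blast
    then show ?thesis using sub by (intro bexI[of _ r]) auto
  qed
  have sq: "compact square" unfolding square_def by (intro compact_Times) auto
  have vsub: "{-1, 1} \<times> {-1..1} \<subseteq> square" by (auto simp: square_def)
  have "\<forall>a\<in>{-1, 1}. \<exists>r\<in>{-1, 1}. \<forall>y\<in>{-1..1}. fst (g (a, y)) = r"
  proof
    fix a :: real assume a: "a \<in> {-1, 1}"
    have "continuous_on {-1..1} (\<lambda>y. g (a, y))"
      by (rule continuous_on_compose2[OF cont]) (use a in \<open>auto simp: square_def intro!: continuous_intros\<close>)
    then have "continuous_on {-1..1} (\<lambda>y. fst (g (a, y)))" by (intro continuous_intros)
    moreover have "fst (g (a, y)) \<in> {-1, 1}" if y: "y \<in> {-1..1}" for y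
    proof -
      have "g (a, y) \<in> g ` ({-1, 1} \<times> {-1..1})" using a y by blast
      then have "g (a, y) \<in> {-1, 1} \<times> {-1..1}" unfolding V .
      then show ?thesis by (simp add: mem_Times_iff)
    qed
    ultimately show "\<exists>r\<in>{-1, 1}. \<forall>y\<in>{-1..1}. fst (g (a, y)) = r" using two[of "{-1..1}" "\<lambda>y. fst (g (a, y))"] by simp
  qed
  then obtain r where r: "\<And>a. a \<in> {-1, 1} \<Longrightarrow> r a \<in> {-1, 1}" "\<And>a y. a \<in> {-1, 1} \<Longrightarrow> y \<in> {-1..1} \<Longrightarrow> fst (g (a, y)) = r a" by metis
  \<comment> \<open>Otherwise one vertical side would be missed by the image.\<close>
  have "r 1 \<noteq> r (-1)"
  proof
    assume eq: "r 1 = r (-1)"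
    have "(- r 1, 0) \<in> {-1, 1} \<times> {-1..(1::real)}" using r(1)[of 1] by auto
    then have "(- r 1, 0) \<in> g ` ({-1, 1} \<times> {-1..1})" unfolding V .
    then obtain p where p: "(- r 1, 0) = g p" "p \<in> {-1, 1} \<times> {-1..1}" by (rule imageE)
    have "fst (g p) = - r 1" using p(1)[symmetric] by simp
    then have "r (fst p) = - r 1" using r(2)[of "fst p" "snd p"] p(2) by (simp add: mem_Times_iff)
    moreover have "fst p = 1 \<or> fst p = -1" using p(2) by auto
    ultimately show False using eq r(1)[of 1] by auto
  qed
  then have ra: "r a = r 1 * a" if "a \<in> {-1, 1}" for a using that r(1)[of 1] r(1)[of "-1"] by auto
  obtain k where k: "homeomorphism square square g k" using homeomorphism_compact[OF sq cont onto inj] by blast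
  have kc: "continuous_on square k" and ks: "k ` square = square" and kg: "\<And>x. x \<in> square \<Longrightarrow> k (g x) = x" and gk: "\<And>y. y \<in> square \<Longrightarrow> g (k y) = y"
    using k unfolding homeomorphism_def by auto
  \<comment> \<open>The inverse of \<open>g\<close> maps interior points to interior points;
    equivalently \<open>g\<close> sends boundary points to boundary points.\<close>
  have kint: "k y \<in> interior square" if y: "y \<in> interior square" for y
  proof -
    have sub: "interior square \<subseteq> square" by (rule interior_subset)
    have "inj_on k square" by (rule inj_on_inverseI[of _ g]) (rule gk)
    then have "inj_on k (interior square)" using sub by (rule inj_on_subset)
    then have "open (k ` interior square)"
      using invariance_of_domain_gen[OF open_interior continuous_on_subset[OF kc sub]] by simp
    moreover have "k ` interior square \<subseteq> square" using ks sub by blast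
    ultimately show ?thesis using interior_maximal y by blast
  qed
  have H: "\<bar>snd (g (x, b))\<bar> = 1" if x: "x \<in> {-1<..<1}" and b: "b \<in> {-1, 1}" for x b
  proof -
    have xb: "(x, b) \<in> square" using x b by (auto simp: square_def)
    have gs: "g (x, b) \<in> square" using onto xb by blast
    have "g (x, b) \<notin> interior square"
    proof
      assume "g (x, b) \<in> interior square"
      then have "(x, b) \<in> interior square" using kint kg[OF xb] by metis
      then show False using b unfolding square_def by (auto simp: interior_Times)
    qed
    moreover have "g (x, b) \<notin> {-1, 1} \<times> {-1..1}"
    proof
      assume "g (x, b) \<in> {-1, 1} \<times> {-1..1}"
      then have "g (x, b) \<in> g ` ({-1, 1} \<times> {-1..1})" unfolding V .
      then obtain p where p: "p \<in> {-1, 1} \<times> {-1..1}" "g (x, b) = g p" by (rule imageE)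
      have "p \<in> square" using p(1) vsub by blast
      then have "(x, b) = p" using inj_onD[OF inj p(2) xb] by simp
      then show False using p(1) x by auto
    qed
    ultimately show ?thesis using gs unfolding square_def
      by (cases "g (x, b)") (auto simp: interior_Times abs_if)
  qed
  have "\<forall>b\<in>{-1, 1}. \<exists>t\<in>{-1, 1}. \<forall>x\<in>{-1..1}. snd (g (x, b)) = t"
  proof
    fix b :: real assume b: "b \<in> {-1, 1}"
    have c: "continuous_on {-1..1} (\<lambda>x. g (x, b))"
      by (rule continuous_on_compose2[OF cont]) (use b in \<open>auto simp: square_def intro!: continuous_intros\<close>)
    \<comment> \<open>Extends the previous fact from the open side to its two corners.\<close>
    have "closed {x \<in> {-1..1}. \<bar>snd (g (x, b))\<bar> \<in> {1}}"
    proof -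
      have "continuous_on {-1..1} (\<lambda>x. \<bar>snd (g (x, b))\<bar>)" using c by (intro continuous_intros)
      then have "closed ({-1..1} \<inter> (\<lambda>x. \<bar>snd (g (x, b))\<bar>) -` {1})" by (rule continuous_closed_preimage) auto
      moreover have "{-1..1} \<inter> (\<lambda>x. \<bar>snd (g (x, b))\<bar>) -` {1} = {x \<in> {-1..1}. \<bar>snd (g (x, b))\<bar> \<in> {1}}" by blast
      ultimately show ?thesis by simp
    qed
    moreover have "{-1<..<1} \<subseteq> {x \<in> {-1..1}. \<bar>snd (g (x, b))\<bar> \<in> {1}}" using H[OF _ b] by auto
    ultimately have "closure {-1<..<1} \<subseteq> {x \<in> {-1..1}. \<bar>snd (g (x, b))\<bar> \<in> {1}}" by (rule closure_minimal[rotated])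
    then have "\<bar>snd (g (x, b))\<bar> = 1" if "x \<in> {-1..1}" for x using that by auto
    then have "snd (g (x, b)) \<in> {-1, 1}" if "x \<in> {-1..1}" for x using that by (fastforce simp: abs_if split: if_splits)
    moreover have "continuous_on {-1..1} (\<lambda>x. snd (g (x, b)))" using c by (intro continuous_intros)
    ultimately show "\<exists>t\<in>{-1, 1}. \<forall>x\<in>{-1..1}. snd (g (x, b)) = t" using two[of "{-1..1}" "\<lambda>x. snd (g (x, b))"] by simp
  qed
  then obtain t where t: "\<And>b. b \<in> {-1, 1} \<Longrightarrow> t b \<in> {-1, 1}" "\<And>b x. b \<in> {-1, 1} \<Longrightarrow> x \<in> {-1..1} \<Longrightarrow> snd (g (x, b)) = t b" by metis
  have g: "g (a, b) = (r 1 * a, t b)" if "a \<in> {-1, 1}" "b \<in> {-1, 1}" for a b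
  proof -
    have "a \<in> {-1..1}" "b \<in> {-1..1}" using that by auto
    then have "fst (g (a, b)) = r 1 * a" "snd (g (a, b)) = t b" using r(2)[OF that(1)] ra[OF that(1)] t(2)[OF that(2)] by auto
    then show ?thesis by (simp add: prod_eq_iff)
  qed
  have "t 1 \<noteq> t (-1)"
  proof
    assume "t 1 = t (-1)"
    then have "g (1, 1) = g (1, -1)" using g[of 1 1] g[of 1 "-1"] by simp
    then show False using inj_onD[OF inj, of "(1, 1)" "(1, -1)"] by (simp add: square_def)
  qed
  then have tb: "t b = t 1 * b" if "b \<in> {-1, 1}" for b using that t(1)[of 1] t(1)[of "-1"] by auto
  have "\<forall>a\<in>{-1, 1}. \<forall>b\<in>{-1, 1}. g (a, b) = (r 1 * a, t 1 * b)" using g tb by metis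
  then show ?thesis using r(1)[of 1] t(1)[of 1] by blast
qed

section \<open>Transport along the partial dual\<close>

context ribbon_graph
begin

definition gap_set :: "'a set" where
  "gap_set = (\<Union>(e, a, b)\<in>flags. gapX e a b ` {0..1})"

abbreviation "corner \<phi> \<equiv> q (fst \<phi>) (fst (snd \<phi>), snd (snd \<phi>))"

lemma without_0_bands_eq: "without_0_bands G c q = (\<Union>v\<in>vertices G. circle v) \<union> (\<Union>e\<in>edges G. band e)"
proof (intro equalityI subsetI)
  fix x assume x: "x \<in> without_0_bands G c q"
  then have nd: "x \<notin> disc v" if "v \<in> vertices G" for v using that unfolding without_0_bands_def by auto
  consider v where "v \<in> vertices G" "x \<in> c v ` cball 0 1" | e where "e \<in> edges G" "x \<in> band e"
    using x unfolding without_0_bands_def band_union_def by auto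
  then show "x \<in> (\<Union>v\<in>vertices G. circle v) \<union> (\<Union>e\<in>edges G. band e)"
  proof cases
    case 1
    then obtain z where z: "z \<in> cball 0 1" "x = c v z" by (auto elim: imageE)
    have "z \<notin> ball 0 1" using nd[OF 1(1)] z(2) by blast
    then have "z \<in> sphere 0 1" using z(1) by auto
    then show ?thesis using z(2) 1(1) by blast
  qed blast
next
  fix x assume x: "x \<in> (\<Union>v\<in>vertices G. circle v) \<union> (\<Union>e\<in>edges G. band e)"
  then consider v where "v \<in> vertices G" "x \<in> circle v" | e where "e \<in> edges G" "x \<in> band e" by blast
  then have "x \<in> ribbon_surface \<and> (\<forall>w\<in>vertices G. x \<notin> disc w)"
  proof cases
    case 1
    then show ?thesis using band_union_regions(2)[OF 1(2,1)] disc_Int_circle[OF _ 1(1)] by blast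
  next
    case 2
    then show ?thesis using band_union_regions(3)[OF 2(2,1)] disc_Int_band[OF _ 2(1)] by blast
  qed
  then show "x \<in> without_0_bands G c q" unfolding without_0_bands_def by blast
qed

lemma without_0_bands_subset: "without_0_bands G c q \<subseteq> topspace X"
  using fd_cover unfolding without_0_bands_def by blast

text \<open>The right-hand side speaks only of bands, their corners and the punctured ribbon graph,
  all of which \<open>h\<close> respects; hence \<open>h\<close> maps gaps to gaps. The corners
  restore the end points of the gaps.\<close>

lemma gap_set_eq: "gap_set = (without_0_bands G c q - (\<Union>e\<in>edges G. band e)) \<union> corner ` flags"
proof (intro equalityI subsetI)
  fix x assume "x \<in> gap_set"
  then obtain e a b \<tau> where x: "(e, a, b) \<in> flags" "\<tau> \<in> {0..1}" "x = gapX e a b \<tau>" unfolding gap_set_def by blast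
  show "x \<in> (without_0_bands G c q - (\<Union>e\<in>edges G. band e)) \<union> corner ` flags"
  proof (cases "\<tau> = 0")
    case True
    then have "x = corner (e, a, b)" using gapX_zero[OF x(1)] x(3) by simp
    then show ?thesis using x(1) by blast
  next
    case False
    then have t: "\<tau> \<in> {0<..1}" using x(2) by auto
    have "x \<notin> (\<Union>e\<in>edges G. band e)" unfolding x(3) using gapX_notin_band[OF x(1) t] by blast
    moreover have "x \<in> circle (att e a)" "att e a \<in> vertices G"
      using gapX_in_circle[OF x(1,2)] x(3) att_flag[OF x(1)] by auto
    ultimately show ?thesis unfolding without_0_bands_eq by blast
  qed
next
  fix x assume "x \<in> (without_0_bands G c q - (\<Union>e\<in>edges G. band e)) \<union> corner ` flags"
  then consider "x \<in> without_0_bands G c q" "x \<notin> (\<Union>e\<in>edges G. band e)" | \<phi> where "\<phi> \<in> flags" "x = corner \<phi>" by blast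
  then show "x \<in> gap_set"
  proof cases
    case 1
    then obtain v where v: "v \<in> vertices G" "x \<in> circle v" unfolding without_0_bands_eq by blast
    from v show ?thesis
    proof (cases rule: circle_cover)
      case (1 e a y)
      then have "(a, y) \<in> square" by (auto simp: square_def)
      then have "x \<in> (\<Union>e\<in>edges G. band e)" using 1(1,5) by blast
      then show ?thesis using \<open>x \<notin> (\<Union>e\<in>edges G. band e)\<close> by simp
    next
      case (2 e a b \<tau>)
      have "\<tau> \<in> {0..1}" using 2(2) by auto
      then have "x \<in> gapX e a b ` {0..1}" using 2(4) by blast
      then show ?thesis using 2(1) unfolding gap_set_def by blast
    qed
  next
    case 2
    obtain e a b where p: "\<phi> = (e, a, b)" by (metis prod_cases3)
    have f: "(e, a, b) \<in> flags" using 2 p by simp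
    have "x = gapX e a b 0" using gapX_zero[OF f] 2 p by simp
    then have "x \<in> gapX e a b ` {0..1}" by simp
    then show ?thesis using f unfolding gap_set_def by blast
  qed
qed

lemma gapX_connectedin: "(e, a, b) \<in> flags \<Longrightarrow> connectedin X (gapX e a b ` {0..1})"
  by (rule connectedin_continuous_map_image[OF gapX_continuous]) (auto simp: connectedin_subtopology)

lemma gapX_closedin: "(e, a, b) \<in> flags \<Longrightarrow> closedin X (gapX e a b ` {0..1})"
  by (rule compactin_imp_closedin[OF hausdorff image_compactin[OF _ gapX_continuous]]) (auto simp: compactin_subtopology)

text \<open>The boundary of \<Delta> reads off membership in \<open>D\<close>: on a band of
  \<open>D\<close> it consists of the horizontal sides, on any other band of the attaching arcs.
  This is the source of the exchange of red and blue.\<close>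

lemma outline_Int_band:
  assumes D: "D \<subseteq> edges G" and e: "e \<in> edges G"
  shows "outline D \<inter> band e = q e ` (if e \<in> D then {-1..1} \<times> {-1, 1} else {-1, 1} \<times> {-1..1})"
proof (intro equalityI subsetI)
  define H where "H = (\<Union>e\<in>D. \<Union>b\<in>{-1,1}. hside e b)"
  define B where "B = (\<Union>e\<in>D. \<Union>a\<in>{-1,1}. q e ` ({a} \<times> {-1<..<1}))"
  have oD: "outline D = (\<Union>v\<in>vertices G. circle v) - B \<union> H" unfolding outline_def H_def B_def ..
  {
    fix x assume x: "x \<in> outline D \<inter> band e"
    then obtain y where y: "y \<in> square" "x = q e y" by blast
    have ys: "fst y \<in> {-1..1}" "snd y \<in> {-1..1}" using y(1) by (auto simp: square_def)
    show "x \<in> q e ` (if e \<in> D then {-1..1} \<times> {-1, 1} else {-1, 1} \<times> {-1..1})"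
    proof (cases "x \<in> H")
      case True
      then obtain e' b w where h: "e' \<in> D" "b \<in> {-1, 1}" "w \<in> {-1..1}" "x = q e' (w, b)" unfolding H_def by blast
      have "(w, b) \<in> square" using h by (auto simp: square_def)
      then have "e = e'" "y = (w, b)" using q_eq_imp[OF e _ y(1), of e' "(w, b)"] h D y(2) by auto
      then show ?thesis using h y(2) by auto
    next
      case False
      then have nB: "x \<notin> B" and "x \<in> (\<Union>v\<in>vertices G. circle v)" using x oD by auto
      then obtain v z where v: "v \<in> vertices G" "z \<in> sphere 0 1" "x = c v z" by blast
      have "z \<in> cball 0 1" using v(2) by simp
      then have fy: "fst y \<in> {-1, 1}" using band_Int_cball[OF e v(1) y(1)] y(2) v(3) by simp
      show ?thesis
      proof (cases "e \<in> D")
        case True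
        have "snd y \<notin> {-1<..<1}"
        proof
          assume "snd y \<in> {-1<..<1}"
          then have "y \<in> {fst y} \<times> {-1<..<1}" by (simp add: mem_Times_iff)
          then have "x \<in> q e ` ({fst y} \<times> {-1<..<1})" unfolding y(2) by (rule imageI)
          then have "x \<in> B" unfolding B_def by (rule UN_I[OF True UN_I[OF fy]])
          then show False using nB by simp
        qed
        then have "snd y \<in> {-1, 1}" using ys by auto
        then have "y \<in> {-1..1} \<times> {-1, 1}" using ys by (simp add: mem_Times_iff)
        then show ?thesis using True y(2) by auto
      next
        case False
        have "y \<in> {-1, 1} \<times> {-1..1}" using fy ys by (simp add: mem_Times_iff)
        then show ?thesis using False y(2) by auto
      qed
    qed
  }
  {
    fix x assume x: "x \<in> q e ` (if e \<in> D then {-1..1} \<times> {-1, 1} else {-1, 1} \<times> {-1..1})"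
    show "x \<in> outline D \<inter> band e"
    proof (cases "e \<in> D")
      case True
      then have "x \<in> q e ` ({-1..1} \<times> {-1, 1})" using x by simp
      then obtain w b where y: "w \<in> {-1..1}" "b \<in> {-1, 1}" "x = q e (w, b)" by blast
      then have "x \<in> hside e b" by auto
      then have "x \<in> H" unfolding H_def by (rule UN_I[OF True UN_I[OF y(2)]])
      moreover have "(w, b) \<in> square" using y by (auto simp: square_def)
      ultimately show ?thesis using y(3) oD by blast
    next
      case False
      then have "x \<in> q e ` ({-1, 1} \<times> {-1..1})" using x by simp
      then obtain a w where y: "a \<in> {-1, 1}" "w \<in> {-1..1}" "x = q e (a, w)" by blast
      have sq: "(a, w) \<in> square" using y by (auto simp: square_def)
      have "x \<in> vside e a" using y by auto
      then have "x \<in> circle (att e a)" using att(2)[OF e y(1)] by blast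
      then have "x \<in> (\<Union>v\<in>vertices G. circle v)" using att(1)[OF e y(1)] by blast
      moreover have "x \<notin> B"
      proof
        assume "x \<in> B"
        then obtain e' a' w' where b: "e' \<in> D" "a' \<in> {-1, 1}" "w' \<in> {-1<..<1}" "x = q e' (a', w')" unfolding B_def by blast
        have "(a', w') \<in> square" using b by (auto simp: square_def)
        then have "e = e'" using q_eq_imp[OF e _ sq, of e' "(a', w')"] b D y(3) by auto
        then show False using False b(1) by simp
      qed
      ultimately show ?thesis using y(3) sq oD by blast
    qed
  }
qed

text \<open>A point of the outline off all bands lies in a gap; the gap is connected and stays in
  the outline, so the component reaches the corner where it starts. This guarantees bands at every
  vertex of the partial dual.\<close>

lemma boundary_component_meets_band:
  assumes D: "D \<subseteq> edges G" and C: "C \<in> boundary_components X (band_union (vertices G) D c q)"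
  shows "\<exists>e\<in>edges G. C \<inter> band e \<noteq> {}"
proof -
  have C': "C \<in> connected_components_of (subtopology X (outline D))"
    using C unfolding boundary_components_def frontier_band_union[OF D] .
  obtain x where x: "x \<in> C" using nonempty_connected_components_of[OF C'] by blast
  have xo: "x \<in> outline D" using connected_components_of_subset[OF C'] x by auto
  show ?thesis
  proof (cases "x \<in> (\<Union>e\<in>edges G. band e)")
    case False
    have "x \<notin> (\<Union>e\<in>D. \<Union>b\<in>{-1,1}. hside e b)" 
    proof
      assume "x \<in> (\<Union>e\<in>D. \<Union>b\<in>{-1,1}. hside e b)"
      then obtain e b where eb: "e \<in> D" "b \<in> {-1, 1}" "x \<in> hside e b" by (elim UN_E)
      then have "x \<in> band e" using hside_subset_band[of b e] by (elim subsetD[rotated]) auto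
      then show False using False eb(1) D by (meson UN_I subsetD)
    qed
    then have "x \<in> (\<Union>v\<in>vertices G. circle v)" using xo unfolding outline_def by simp
    then obtain v where v: "v \<in> vertices G" "x \<in> circle v" by blast
    then obtain e a b \<tau> where g: "(e, a, b) \<in> flags" "\<tau> \<in> {0<..1}" "x = gapX e a b \<tau>"
    proof (cases rule: circle_cover)
      case (1 e a y)
      then have "(a, y) \<in> square" by (auto simp: square_def)
      then show ?thesis using False 1(1,5) by blast
    next
      case (2 e a b \<tau>) then show ?thesis using that by blast
    qed
    have "gapX e a b ` {0..1} \<subseteq> outline D" using gapX_in_outline[OF g(1) _ D] by blast
    then have "connectedin (subtopology X (outline D)) (gapX e a b ` {0..1})"
      using gapX_connectedin[OF g(1)] by (simp add: connectedin_subtopology)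
    moreover have "x \<in> gapX e a b ` {0..1}" using g by auto
    ultimately have "gapX e a b ` {0..1} \<subseteq> C"
      using connected_components_of_maximal[OF C'] x by (auto simp: disjnt_def)
    then have "gapX e a b 0 \<in> C" by auto
    moreover have "gapX e a b 0 \<in> band e" using gapX_zero[OF g(1)] flagsD[OF g(1)] by (auto simp: square_def)
    ultimately show ?thesis using flagsD(1)[OF g(1)] by blast
  qed (use x in blast)
qed

end

text \<open>Requirements for one direction only, so that the locale can be instantiated with
  \<open>h\<close> and with its inverse.\<close>

locale ribbon_map = dom: ribbon_graph G c q + cod: ribbon_graph G' c' q'
  for G :: "('a, 'e) embedded_graph" and c q and G' :: "('b, 'e) embedded_graph" and c' q' +
  fixes h :: "'a \<Rightarrow> 'b" and \<theta> :: "'e \<times> real \<times> real \<Rightarrow> 'e \<times> real \<times> real"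
  assumes h_continuous: "continuous_map (subtopology (surf G) dom.gap_set) (surf G') h"
    and h_gaps: "h ` dom.gap_set \<subseteq> cod.gap_set"
    and \<theta>_flags: "\<And>\<phi>. \<phi> \<in> dom.flags \<Longrightarrow> \<theta> \<phi> \<in> cod.flags"
    and \<theta>_corner: "\<And>\<phi>. \<phi> \<in> dom.flags \<Longrightarrow> h (dom.corner \<phi>) = cod.corner (\<theta> \<phi>)"
begin

text \<open>\<open>h\<close> need not send midpoints of gaps to midpoints. Instead, two half-gaps
  with a common midpoint have a connected union, whose image lies in a single gap of the
  target.\<close>

lemma mid_transfer:
  assumes f: "\<phi> \<in> dom.flags" "\<psi> \<in> dom.flags" and m: "dom.mid \<phi> = dom.mid \<psi>"
  shows "cod.mid (\<theta> \<phi>) = cod.mid (\<theta> \<psi>)"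
proof -
  obtain e a b where p: "\<phi> = (e, a, b)" by (metis prod_cases3)
  obtain e' a' b' where p': "\<psi> = (e', a', b')" by (metis prod_cases3)
  have f1: "(e, a, b) \<in> dom.flags" "(e', a', b') \<in> dom.flags" using f p p' by simp_all
  let ?S = "dom.gapX e a b ` {0..1} \<union> dom.gapX e' a' b' ` {0..1}"
  have "dom.gapX e a b 1 \<in> dom.gapX e a b ` {0..1}" "dom.gapX e' a' b' 1 \<in> dom.gapX e' a' b' ` {0..1}" by auto
  moreover have "dom.gapX e a b 1 = dom.gapX e' a' b' 1" using m p p' by simp
  ultimately have "dom.gapX e a b ` {0..1} \<inter> dom.gapX e' a' b' ` {0..1} \<noteq> {}" by (metis IntI empty_iff)
  then have "connectedin (surf G) ?S" using dom.gapX_connectedin[OF f1(1)] dom.gapX_connectedin[OF f1(2)] connectedin_Un by blast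
  moreover have Ssub: "?S \<subseteq> dom.gap_set" using f1 unfolding dom.gap_set_def by blast
  ultimately have "connectedin (subtopology (surf G) dom.gap_set) ?S" by (simp add: connectedin_subtopology)
  then have conn: "connectedin (surf G') (h ` ?S)" by (rule connectedin_continuous_map_image[OF h_continuous])
  \<comment> \<open>The whole gap with midpoint \<open>m\<close>. These are finitely many closed
    sets, disjoint because half-gaps of different flags meet only in midpoints.\<close>
  define A where "A m = (\<Union>\<rho>\<in>{\<rho> \<in> cod.flags. cod.mid \<rho> = m}. cod.gapX (fst \<rho>) (fst (snd \<rho>)) (snd (snd \<rho>)) ` {0..1})" for m
  obtain m where m': "m \<in> cod.mid ` cod.flags" "h ` ?S \<subseteq> A m"
  proof (rule connectedin_in_one_closed[OF conn, of "cod.mid ` cod.flags" A])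
    show "h ` ?S \<noteq> {}" by simp
    show "finite (cod.mid ` cod.flags)" using cod.finite_flags by simp
    show "closedin (surf G') (A i)" for i
      unfolding A_def using cod.finite_flags cod.gapX_closedin by (intro closedin_Union) auto
    have "h ` ?S \<subseteq> cod.gap_set" using h_gaps Ssub by blast
    moreover have "cod.gap_set \<subseteq> (\<Union>i\<in>cod.mid ` cod.flags. A i)"
    proof
      fix x assume "x \<in> cod.gap_set"
      then obtain e'' a'' b'' \<tau> where x: "(e'', a'', b'') \<in> cod.flags" "\<tau> \<in> {0..1}" "x = cod.gapX e'' a'' b'' \<tau>"
        unfolding cod.gap_set_def by blast
      define \<rho> where "\<rho> = (e'', a'', b'')"
      have "\<rho> \<in> cod.flags" "x \<in> cod.gapX (fst \<rho>) (fst (snd \<rho>)) (snd (snd \<rho>)) ` {0..1}" using x by (simp_all add: \<rho>_def)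
      then have "x \<in> A (cod.mid \<rho>)" unfolding A_def by blast
      then show "x \<in> (\<Union>i\<in>cod.mid ` cod.flags. A i)" using \<open>\<rho> \<in> cod.flags\<close> by blast
    qed
    ultimately show "h ` ?S \<subseteq> (\<Union>i\<in>cod.mid ` cod.flags. A i)" by blast
    show "A i \<inter> A j \<inter> h ` ?S = {}" if ij: "i \<noteq> j" for i j
    proof (rule ccontr)
      assume "A i \<inter> A j \<inter> h ` ?S \<noteq> {}"
      then obtain x where x: "x \<in> A i" "x \<in> A j" by blast
      obtain \<rho> \<tau> where r: "\<rho> \<in> cod.flags" "cod.mid \<rho> = i" "\<tau> \<in> {0..1}" "x = cod.gapX (fst \<rho>) (fst (snd \<rho>)) (snd (snd \<rho>)) \<tau>"
        using x(1) unfolding A_def by blast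
      obtain \<omega> \<tau>' where w: "\<omega> \<in> cod.flags" "cod.mid \<omega> = j" "\<tau>' \<in> {0..1}" "x = cod.gapX (fst \<omega>) (fst (snd \<omega>)) (snd (snd \<omega>)) \<tau>'"
        using x(2) unfolding A_def by blast
      have fl: "(fst \<rho>, fst (snd \<rho>), snd (snd \<rho>)) \<in> cod.flags" "(fst \<omega>, fst (snd \<omega>), snd (snd \<omega>)) \<in> cod.flags"
        using r(1) w(1) by simp_all
      from cod.gapX_eq_imp[OF fl r(3) w(3)] r(4) w(4)
      have "\<tau> = \<tau>'" "\<rho> = \<omega> \<or> \<tau> = 1" by (auto simp: prod_eq_iff)
      then show False using r w ij by auto
    qed
  qed blast
  \<comment> \<open>A corner is the start of a half-gap and belongs to that of its own flag only, so
    the gap that contains it determines the midpoint.\<close>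
  have transfer: "cod.mid (\<theta> \<rho>) = m" if r: "\<rho> \<in> dom.flags" "dom.gapX (fst \<rho>) (fst (snd \<rho>)) (snd (snd \<rho>)) 0 \<in> ?S" for \<rho>
  proof -
    have f\<rho>: "(fst \<rho>, fst (snd \<rho>), snd (snd \<rho>)) \<in> dom.flags" using r(1) by simp
    have "h (dom.corner \<rho>) \<in> A m" using m'(2) r(2) dom.gapX_zero[OF f\<rho>] by auto
    then have "cod.corner (\<theta> \<rho>) \<in> A m" using \<theta>_corner[OF r(1)] by simp
    then obtain \<omega> \<tau> where w: "\<omega> \<in> cod.flags" "cod.mid \<omega> = m" "\<tau> \<in> {0..1}"
      "cod.corner (\<theta> \<rho>) = cod.gapX (fst \<omega>) (fst (snd \<omega>)) (snd (snd \<omega>)) \<tau>" unfolding A_def by blast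
    have fl: "(fst (\<theta> \<rho>), fst (snd (\<theta> \<rho>)), snd (snd (\<theta> \<rho>))) \<in> cod.flags" "(fst \<omega>, fst (snd \<omega>), snd (snd \<omega>)) \<in> cod.flags"
      using \<theta>_flags[OF r(1)] w(1) by simp_all
    have "(0::real) \<in> {0..1}" by simp
    from cod.gapX_eq_imp[OF fl this w(3)] cod.gapX_zero[OF fl(1)] w(4)
    have "\<theta> \<rho> = \<omega>" by (auto simp: prod_eq_iff)
    then show ?thesis using w(2) by simp
  qed
  have "cod.mid (\<theta> \<phi>) = m" by (rule transfer[OF f(1)]) (use p in \<open>auto intro!: image_eqI[of _ _ 0]\<close>)
  moreover have "cod.mid (\<theta> \<psi>) = m" by (rule transfer[OF f(2)]) (use p' in \<open>auto intro!: image_eqI[of _ _ 0]\<close>)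
  ultimately show ?thesis by simp
qed

end

locale partial_dual_ribbons = dom: ribbon_graph G c q + cod: ribbon_graph G' c' q'
  for G :: "('a, 'e) embedded_graph" and c q and G' :: "('b, 'e) embedded_graph" and c' q' +
  fixes h :: "'a \<Rightarrow> 'b" and D :: "'e set"
  assumes edges_eq: "edges G' = edges G" and D: "D \<subseteq> edges G"
    and hom: "homeomorphic_map (subtopology (surf G) (without_0_bands G c q)) (subtopology (surf G') (without_0_bands G' c' q')) h"
    and bands: "\<And>e. e \<in> edges G \<Longrightarrow> h ` q e ` square = q' e ` square"
    and circles: "h ` dom.outline D = (\<Union>v\<in>vertices G'. c' v ` sphere 0 1)"
begin

abbreviation "W \<equiv> without_0_bands G c q"
abbreviation "W' \<equiv> without_0_bands G' c' q'"

lemma top_W: "topspace (subtopology (surf G) W) = W" "topspace (subtopology (surf G') W') = W'"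
  using dom.without_0_bands_subset cod.without_0_bands_subset by auto

lemma h_continuous: "continuous_map (subtopology (surf G) W) (surf G') h"
  using homeomorphic_imp_continuous_map[OF hom] by (simp add: continuous_map_in_subtopology)

lemma h_inj: "inj_on h W"
  using homeomorphic_imp_injective_map[OF hom] top_W by simp

lemma h_image: "h ` W = W'"
  using homeomorphic_imp_surjective_map[OF hom] top_W by simp

lemma band_subset: "e \<in> edges G \<Longrightarrow> q e ` square \<subseteq> W"
  unfolding dom.without_0_bands_eq by blast

text \<open>Read in the two parametrisations of the band, \<open>h\<close> is a homeomorphism of the
  square. It takes the sides on the boundary of \<Delta>, horizontal for \<open>e \<in> D\<close>
  and vertical otherwise, to the attaching arcs of the new band; \<open>square_symmetry\<close> then
  fixes the corners up to signs.\<close>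

lemma corner_signs:
  assumes e: "e \<in> edges G"
  shows "\<exists>s\<in>{-1, 1}. \<exists>t\<in>{-1, 1}. \<forall>a\<in>{-1, 1}. \<forall>b\<in>{-1, 1}.
    h (q e (a, b)) = q' e (if e \<in> D then (s * b, t * a) else (s * a, t * b))"
proof -
  have e': "e \<in> edges G'" using e edges_eq by simp
  have "continuous_map (top_of_set square) (subtopology (surf G) W) (q e)"
    using dom.q_continuous[OF e] band_subset[OF e] by (simp add: continuous_map_in_subtopology image_subset_iff_funcset)
  then have cm: "continuous_map (top_of_set square) (surf G') (h \<circ> q e)" using h_continuous by (rule continuous_map_compose)
  have "(h \<circ> q e) ` square \<subseteq> q' e ` square" unfolding image_comp[symmetric] using bands[OF e] by simp
  then obtain g where g: "continuous_on square g" "g ` square \<subseteq> square" "\<And>x. x \<in> square \<Longrightarrow> q' e (g x) = (h \<circ> q e) x"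
    using embedding_lift_path[OF cod.q_embedding[OF e'] cm] by metis
  have inj: "inj_on g square"
  proof (rule inj_onI)
    fix x y assume xy: "x \<in> square" "y \<in> square" "g x = g y"
    then have "h (q e x) = h (q e y)" using g(3)[OF xy(1)] g(3)[OF xy(2)] by simp
    then have "q e x = q e y" using inj_onD[OF h_inj, of "q e x" "q e y"] band_subset[OF e] xy by blast
    then show "x = y" using dom.q_eq_imp[OF e e xy(1,2)] by simp
  qed
  have img: "q' e ` g ` S = h ` q e ` S" if "S \<subseteq> square" for S
    unfolding image_image by (rule image_cong) (use g(3) that in auto)
  have inj': "inj_on (q' e) square" using cod.q_inj_on[OF e'] .
  have onto: "g ` square = square"
    using img[OF order_refl] bands[OF e] inj_on_image_eq_iff[OF inj' g(2) order_refl] by simp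
  let ?P = "if e \<in> D then {-1..1} \<times> {-1, 1::real} else {-1, 1::real} \<times> {-1..1}"
  have P: "?P \<subseteq> square" and V: "{-1, 1} \<times> {-1..1} \<subseteq> square" by (auto simp: square_def)
  have "dom.outline D \<subseteq> W"
  proof -
    have "(\<Union>e\<in>D. \<Union>b\<in>{-1,1}. dom.hside e b) \<subseteq> W"
    proof (intro UN_least)
      fix e b assume "e \<in> D" and b: "b \<in> {-1, 1::real}"
      then show "dom.hside e b \<subseteq> W" using band_subset[of e] D dom.hside_subset_band[OF b, of e] by blast
    qed
    moreover have "(\<Union>v\<in>vertices G. c v ` sphere 0 1) \<subseteq> W" unfolding dom.without_0_bands_eq by (rule Un_upper1)
    ultimately show ?thesis unfolding dom.outline_def by (intro Un_least order_trans[OF Diff_subset])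
  qed
  then have "h ` (dom.outline D \<inter> q e ` square) = h ` dom.outline D \<inter> h ` q e ` square"
    by (rule inj_on_image_Int[OF h_inj _ band_subset[OF e]])
  \<comment> \<open>With no edges the outline is the union of all circles, so
    \<open>outline_Int_band\<close> applies to the new ribbon graph too.\<close>
  also have "\<dots> = cod.outline {} \<inter> q' e ` square" using bands[OF e] circles by (simp add: cod.outline_def)
  also have "\<dots> = q' e ` ({-1, 1} \<times> {-1..1})" using cod.outline_Int_band[OF _ e', of "{}"] by simp
  finally have "q' e ` g ` ?P = q' e ` ({-1, 1} \<times> {-1..1})" using dom.outline_Int_band[OF D e] img[OF P] by simp
  moreover have "g ` ?P \<subseteq> square" using P g(2) by blast
  ultimately have gP: "g ` ?P = {-1, 1} \<times> {-1..1}" using inj_on_image_eq_iff[OF inj' _ V] by blast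
  have hq: "h (q e (a, b)) = q' e (g (a, b))" if "a \<in> {-1, 1}" "b \<in> {-1, 1}" for a b
    using g(3)[of "(a, b)"] that by (auto simp: square_def)
  show ?thesis
  proof (cases "e \<in> D")
    case True
    \<comment> \<open>Exchanging the coordinates first makes vertical sides go to vertical
      sides.\<close>
    let ?g = "g \<circ> prod.swap"
    have sw: "prod.swap ` square = square" unfolding square_def by (rule product_swap)
    have "continuous_on square ?g"
      by (rule continuous_on_compose) (use g(1) sw in \<open>auto intro!: continuous_on_swap\<close>)
    moreover have "inj_on ?g square" using inj sw by (intro comp_inj_on) (auto simp: inj_on_def)
    moreover have "?g ` square = square" unfolding image_comp[symmetric] sw by (rule onto)
    moreover have "?g ` ({-1, 1} \<times> {-1..1}) = {-1, 1} \<times> {-1..1}"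
      unfolding image_comp[symmetric] product_swap using gP True by simp
    ultimately have "\<exists>s\<in>{-1, 1}. \<exists>t\<in>{-1, 1}. \<forall>a\<in>{-1, 1}. \<forall>b\<in>{-1, 1}. ?g (a, b) = (s * a, t * b)"
      by (rule square_symmetry)
    then obtain s t where st: "s \<in> {-1, 1}" "t \<in> {-1, 1}" "\<forall>a\<in>{-1, 1}. \<forall>b\<in>{-1, 1}. ?g (a, b) = (s * a, t * b)"
      by (elim bexE)
    have "g (a, b) = (s * b, t * a)" if "a \<in> {-1, 1}" "b \<in> {-1, 1}" for a b using st(3) that by fastforce
    then show ?thesis using st(1,2) hq True by (intro bexI[of _ s] bexI[of _ t]) simp_all
  next
    case False
    then have "g ` ({-1, 1} \<times> {-1..1}) = {-1, 1} \<times> {-1..1}" using gP by simp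
    then have "\<exists>s\<in>{-1, 1}. \<exists>t\<in>{-1, 1}. \<forall>a\<in>{-1, 1}. \<forall>b\<in>{-1, 1}. g (a, b) = (s * a, t * b)"
      by (rule square_symmetry[OF g(1) inj onto])
    then obtain s t where st: "s \<in> {-1, 1}" "t \<in> {-1, 1}" "\<forall>a\<in>{-1, 1}. \<forall>b\<in>{-1, 1}. g (a, b) = (s * a, t * b)"
      by (elim bexE)
    then show ?thesis using hq False by (intro bexI[of _ s] bexI[of _ t]) simp_all
  qed
qed

definition swapped :: "colour \<Rightarrow> 'e \<times> real \<times> real \<Rightarrow> 'e \<times> real \<times> real \<Rightarrow> bool" where
  "swapped k \<phi> \<psi> = dom.same_side (if fst \<phi> \<in> D then (case k of Red \<Rightarrow> Blue | Blue \<Rightarrow> Red | Yellow \<Rightarrow> Yellow) else k) \<phi> \<psi>"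

text \<open>On the flags of one edge \<theta> acts by signs, preceded by an exchange of the
  coordinates for edges in \<open>D\<close>. Red and blue adjacency fix one coordinate each and are
  therefore exchanged there; yellow is transported by \<open>mid_transfer\<close> in both
  directions.\<close>

lemma flag_bijection:
  obtains \<theta> where "bij_betw \<theta> dom.flags cod.flags" "\<And>\<phi>. fst (\<theta> \<phi>) = fst \<phi>"
    "\<And>k \<phi> \<psi>. \<phi> \<in> dom.flags \<Longrightarrow> \<psi> \<in> dom.flags \<Longrightarrow> cod.same_side k (\<theta> \<phi>) (\<theta> \<psi>) \<longleftrightarrow> swapped k \<phi> \<psi>"
proof -
  have "\<exists>s t. s \<in> {-1, 1} \<and> t \<in> {-1, 1} \<and> (\<forall>a\<in>{-1, 1}. \<forall>b\<in>{-1, 1}.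
    h (q e (a, b)) = q' e (if e \<in> D then (s * b, t * a) else (s * a, t * b)))" if "e \<in> edges G" for e
    using corner_signs[OF that] by blast
  then obtain S T where ST: "\<And>e. e \<in> edges G \<Longrightarrow> S e \<in> {-1, 1} \<and> T e \<in> {-1, 1} \<and> (\<forall>a\<in>{-1, 1}. \<forall>b\<in>{-1, 1}.
    h (q e (a, b)) = q' e (if e \<in> D then (S e * b, T e * a) else (S e * a, T e * b)))" by metis
  define \<theta> :: "'e \<times> real \<times> real \<Rightarrow> 'e \<times> real \<times> real" where
    "\<theta> = (\<lambda>(e, a, b). (e, if e \<in> D then (S e * b, T e * a) else (S e * a, T e * b)))"
  have flags_eq: "cod.flags = dom.flags" unfolding dom.flags_def cod.flags_def edges_eq ..
  have fst\<theta>: "fst (\<theta> \<phi>) = fst \<phi>" for \<phi> by (simp add: \<theta>_def split: prod.splits)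
  have \<theta>f: "\<theta> \<phi> \<in> cod.flags" if f: "\<phi> \<in> dom.flags" for \<phi>
  proof -
    obtain e a b where p: "\<phi> = (e, a, b)" by (metis prod_cases3)
    then have fD: "e \<in> edges G" "a \<in> {-1, 1}" "b \<in> {-1, 1}" using f by (auto simp: dom.flags_def)
    have "S e \<in> {-1, 1}" "T e \<in> {-1, 1}" using ST[OF fD(1)] by blast+
    then have "S e * a \<in> {-1, 1}" "S e * b \<in> {-1, 1}" "T e * a \<in> {-1, 1}" "T e * b \<in> {-1, 1}" using fD(2,3) by auto
    then show ?thesis using fD(1) unfolding flags_eq p by (auto simp: \<theta>_def dom.flags_def)
  qed
  have \<theta>c: "h (dom.corner \<phi>) = cod.corner (\<theta> \<phi>)" if f: "\<phi> \<in> dom.flags" for \<phi>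
  proof -
    obtain e a b where p: "\<phi> = (e, a, b)" by (metis prod_cases3)
    then have fD: "e \<in> edges G" "a \<in> {-1, 1}" "b \<in> {-1, 1}" using f by (auto simp: dom.flags_def)
    have "h (q e (a, b)) = q' e (if e \<in> D then (S e * b, T e * a) else (S e * a, T e * b))" using ST[OF fD(1)] fD(2,3) by blast
    then show ?thesis by (simp add: p \<theta>_def)
  qed
  have inj: "inj_on \<theta> dom.flags"
  proof (rule inj_onI)
    fix \<phi> \<psi> assume f: "\<phi> \<in> dom.flags" "\<psi> \<in> dom.flags" and eq: "\<theta> \<phi> = \<theta> \<psi>"
    obtain e a b where p: "\<phi> = (e, a, b)" by (metis prod_cases3)
    obtain e' a' b' where p': "\<psi> = (e', a', b')" by (metis prod_cases3)
    have ee: "e' = e" using fst\<theta>[of \<phi>] fst\<theta>[of \<psi>] eq p p' by simp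
    have "e \<in> edges G" using f p by (simp add: dom.flags_def)
    then have "S e \<noteq> 0" "T e \<noteq> 0" using ST by force+
    then show "\<phi> = \<psi>" using eq unfolding p p' ee \<theta>_def by (auto split: if_splits)
  qed
  \<comment> \<open>Both ribbon graphs have the same flags, so injectivity on this finite set
    suffices.\<close>
  have bij: "bij_betw \<theta> dom.flags cod.flags"
    using endo_inj_surj[OF dom.finite_flags _ inj] \<theta>f inj unfolding flags_eq bij_betw_def by blast
  then have onto: "\<theta> ` dom.flags = cod.flags" by (simp add: bij_betw_def)
  have gW: "dom.gap_set \<subseteq> W"
  proof -
    have "dom.corner \<phi> \<in> W" if f: "\<phi> \<in> dom.flags" for \<phi>
    proof -
      obtain e a b where p: "\<phi> = (e, a, b)" by (metis prod_cases3)
      then have fD: "e \<in> edges G" "a \<in> {-1, 1}" "b \<in> {-1, 1}" using f by (auto simp: dom.flags_def)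
      then have "(a, b) \<in> square" by (auto simp: square_def)
      then show ?thesis using band_subset[OF fD(1)] p by auto
    qed
    then show ?thesis unfolding dom.gap_set_eq by blast
  qed
  have Bsub: "(\<Union>e\<in>edges G. q e ` square) \<subseteq> W" using band_subset by blast
  have "h ` (\<Union>e\<in>edges G. q e ` square) = (\<Union>e\<in>edges G'. q' e ` square)"
    unfolding image_UN edges_eq using bands by (intro SUP_cong) auto
  then have "h ` (W - (\<Union>e\<in>edges G. q e ` square)) = W' - (\<Union>e\<in>edges G'. q' e ` square)"
    using inj_on_image_set_diff[OF h_inj Diff_subset Bsub] h_image by simp
  moreover have "h ` dom.corner ` dom.flags = cod.corner ` cod.flags"
  proof -
    have "h ` dom.corner ` dom.flags = (\<lambda>\<phi>. cod.corner (\<theta> \<phi>)) ` dom.flags"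
      unfolding image_image by (rule image_cong[OF refl \<theta>c])
    then show ?thesis unfolding onto[symmetric] image_image .
  qed
  ultimately have hgap: "h ` dom.gap_set = cod.gap_set" unfolding dom.gap_set_eq cod.gap_set_eq image_Un by simp
  obtain k where k: "homeomorphic_maps (subtopology (surf G) W) (subtopology (surf G') W') h k"
    using hom homeomorphic_map_maps by blast
  have kc: "continuous_map (subtopology (surf G') W') (surf G) k"
    using k unfolding homeomorphic_maps_def by (simp add: continuous_map_in_subtopology)
  have kh: "k (h x) = x" if "x \<in> W" for x using k that top_W unfolding homeomorphic_maps_def by auto
  have gW': "cod.gap_set \<subseteq> W'" using hgap gW h_image by blast
  interpret fwd: ribbon_map G c q G' c' q' h \<theta>
  proof
    show "continuous_map (subtopology (surf G) dom.gap_set) (surf G') h"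
      using continuous_map_from_subtopology_mono[OF h_continuous gW] .
  qed (use hgap \<theta>f \<theta>c in auto)
  define \<theta>' where "\<theta>' = inv_into dom.flags \<theta>"
  have \<theta>'\<theta>: "\<theta>' (\<theta> \<phi>) = \<phi>" if "\<phi> \<in> dom.flags" for \<phi> unfolding \<theta>'_def using inv_into_f_f[OF inj that] .
  interpret bwd: ribbon_map G' c' q' G c q k \<theta>'
  proof
    show "continuous_map (subtopology (surf G') cod.gap_set) (surf G) k"
      using continuous_map_from_subtopology_mono[OF kc gW'] .
    have "k ` h ` dom.gap_set \<subseteq> dom.gap_set" using kh gW by (auto simp: subset_iff)
    then show "k ` cod.gap_set \<subseteq> dom.gap_set" using hgap by simp
    fix \<phi> assume "\<phi> \<in> cod.flags"
    then obtain \<psi> where \<psi>: "\<psi> \<in> dom.flags" "\<phi> = \<theta> \<psi>" using onto by blast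
    show "\<theta>' \<phi> \<in> dom.flags" using \<psi> \<theta>'\<theta> by simp
    have "dom.corner \<psi> \<in> dom.gap_set" using \<psi>(1) unfolding dom.gap_set_eq by blast
    then have "k (h (dom.corner \<psi>)) = dom.corner \<psi>" using kh gW by blast
    then show "k (cod.corner \<phi>) = dom.corner (\<theta>' \<phi>)" using \<theta>c[OF \<psi>(1)] \<psi> \<theta>'\<theta> by simp
  qed
  have mid: "cod.mid (\<theta> \<phi>) = cod.mid (\<theta> \<psi>) \<longleftrightarrow> dom.mid \<phi> = dom.mid \<psi>"
    if f: "\<phi> \<in> dom.flags" "\<psi> \<in> dom.flags" for \<phi> \<psi>
    using fwd.mid_transfer[OF f] bwd.mid_transfer[OF \<theta>f[OF f(1)] \<theta>f[OF f(2)]] \<theta>'\<theta>[OF f(1)] \<theta>'\<theta>[OF f(2)] by metis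
  have "cod.same_side j (\<theta> \<phi>) (\<theta> \<psi>) \<longleftrightarrow> swapped j \<phi> \<psi>"
    if f: "\<phi> \<in> dom.flags" "\<psi> \<in> dom.flags" for j \<phi> \<psi>
  proof -
    obtain e a b where p: "\<phi> = (e, a, b)" by (metis prod_cases3)
    obtain e' a' b' where p': "\<psi> = (e', a', b')" by (metis prod_cases3)
    have "e \<in> edges G" using f p by (simp add: dom.flags_def)
    then have nz: "S e \<noteq> 0" "T e \<noteq> 0" using ST by force+
    show ?thesis
    proof (cases j)
      case Red
      show ?thesis unfolding swapped_def Red dom.same_side_def cod.same_side_def p p' using nz by (auto simp: \<theta>_def)
    next
      case Blue
      show ?thesis unfolding swapped_def Blue dom.same_side_def cod.same_side_def p p' using nz by (auto simp: \<theta>_def)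
    next
      case Yellow
      have "cod.same_side Yellow (\<theta> \<phi>) (\<theta> \<psi>) \<longleftrightarrow> cod.mid (\<theta> \<phi>) = cod.mid (\<theta> \<psi>)"
        by (simp add: cod.same_side_def split: prod.splits)
      moreover have "swapped Yellow \<phi> \<psi> \<longleftrightarrow> dom.mid \<phi> = dom.mid \<psi>"
        by (simp add: swapped_def dom.same_side_def split: prod.splits)
      ultimately show ?thesis using mid[OF f] Yellow by simp
    qed
  qed
  then show thesis using that[OF bij fst\<theta>] by blast
qed

end

section \<open>Comparison with the canonical subdivision and conclusion\<close>

context ribbon_graph
begin

text \<open>Red fixes \<open>(e, a)\<close> and blue fixes \<open>(e, b)\<close>, so together they
  fix the flag; the partner of \<open>(e, a, b)\<close> is \<open>(e, - a, b)\<close>.\<close>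

lemma canonical_pair:
  assumes "barycentric_subdivision G s p T"
  shows "subdivision_pair G s p T split apex (tri ` flags)"
proof
  show "graph_embedding G" by (rule embedding)
  show "barycentric_subdivision G s p T" by fact
  show "barycentric_subdivision G split apex (tri ` flags)" by (rule tri_barycentric)
  fix t assume t: "t \<in> tri ` flags"
  then obtain e a b where p: "(e, a, b) \<in> flags" "t = tri (e, a, b)" by (metis imageE prod_cases3)
  {
    fix u assume u: "u \<in> tri ` flags" and r: "t ` side Red = u ` side Red" and bl: "t ` side Blue = u ` side Blue"
    obtain e' a' b' where p': "(e', a', b') \<in> flags" "u = tri (e', a', b')" using u by (metis imageE prod_cases3)
    have "same_side Red (e, a, b) (e', a', b')" "same_side Blue (e, a, b) (e', a', b')"
      using side_image_eq_iff[OF p(1) p'(1)] r bl p(2) p'(2) by simp_all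
    then show "t = u" using p p' by (simp add: same_side_def)
  }
  have f: "(e, - a, b) \<in> flags" using flagsD[OF p(1)] by (auto simp: flags_def)
  have "tri (e, - a, b) ` side Blue = t ` side Blue" "tri (e, - a, b) ` side Red \<noteq> t ` side Red"
    using side_image_eq_iff[OF f p(1)] flagsD(2)[OF p(1)] p(2) by (auto simp: same_side_def)
  then show "\<exists>u\<in>tri ` flags. u ` side Blue = t ` side Blue \<and> u ` side Red \<noteq> t ` side Red" using f by blast
qed

end

text \<open>By connectedness each vertex lies on an edge, that is, on the core of a band or on a
  radius. The centre of a 0-band is on no 1-band, so it lies on a radius of its own disc, and that
  radius leads to the end of an attached band.\<close>

lemma ribbon_no_isolated:
  assumes emb: "graph_embedding G" and conn: "connected_graph G" and ne: "edges G \<noteq> {}"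
    and rib: "ribbon_representation G c q" and v: "v \<in> vertices G"
  shows "\<exists>e\<in>edges G. \<exists>a\<in>{-1, 1}. q e ` ({a} \<times> {-1..1}) \<subseteq> c v ` sphere 0 1"
proof -
  let ?R = "\<Union>e\<in>edges G. {(curve G e 0, curve G e 1), (curve G e 1, curve G e 0)}"
  have ends: "curve G e 0 \<in> vertices G" if "e \<in> edges G" for e
    using emb that by (simp add: graph_embedding_def)
  obtain e0 where e0: "e0 \<in> edges G" using ne by blast
  have "(v, curve G e0 0) \<in> ?R\<^sup>*" using conn v ends[OF e0] unfolding connected_graph_def by blast
  then have "\<exists>e\<in>edges G. v \<in> edge_set G e"
  proof (cases rule: converse_rtranclE)
    case base
    then show ?thesis using e0 unfolding edge_set_def by (intro bexI[of _ e0] image_eqI[of _ _ 0]) auto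
  next
    case (step w)
    then obtain e where "e \<in> edges G" "v = curve G e 0 \<or> v = curve G e 1" by blast
    then show ?thesis unfolding edge_set_def by (intro bexI[of _ e]) auto
  qed
  then obtain e where e: "e \<in> edges G" "v \<in> edge_set G e" by blast
  have att: "\<forall>e\<in>edges G. \<forall>a\<in>{-1, 1}. \<exists>v\<in>vertices G. q e ` ({a} \<times> {-1..1}) \<subseteq> c v ` sphere 0 1"
    and meet: "\<forall>e\<in>edges G. \<forall>v\<in>vertices G. q e ` square \<inter> c v ` cball 0 1 \<subseteq> q e ` ({-1, 1} \<times> {-1..1})"
    and es: "\<forall>e\<in>edges G. edge_set G e = q e ` ({-1..1} \<times> {0}) \<union>
      (\<Union>v\<in>vertices G. \<Union>z\<in>{z \<in> sphere 0 1. c v z \<in> q e ` ({-1, 1} \<times> {0})}. c v ` closed_segment 0 z)"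
    and dj: "disjoint_family_on (\<lambda>v. c v ` cball 0 1) (vertices G)"
    using rib unfolding ribbon_representation_def by - (elim conjE, assumption)+
  have c0: "c v 0 = v" and cinj: "inj_on (c v) (cball 0 1)"
  proof -
    have "embedding_map (top_of_set (cball 0 1)) (surf G) (c v)" "c v 0 = v"
      using rib v by (simp_all add: ribbon_representation_def)
    moreover have "Hausdorff_space (surf G)" using emb by (simp add: graph_embedding_def surface_def)
    ultimately show "c v 0 = v" "inj_on (c v) (cball 0 1)" using embedding_inj_on[OF _ _ compact_cball] by blast+
  qed
  have same: "w = v" if "w \<in> vertices G" "x \<in> cball 0 1" "y \<in> cball 0 1" "c w x = c v y" for w x y
    using dj that v unfolding disjoint_family_on_def by blast
  have sc: "z \<in> cball 0 1" if "z \<in> sphere 0 1" for z :: complex using that by simp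
  have "v \<in> q e ` ({-1..1} \<times> {0}) \<union>
      (\<Union>v\<in>vertices G. \<Union>z\<in>{z \<in> sphere 0 1. c v z \<in> q e ` ({-1, 1} \<times> {0})}. c v ` closed_segment 0 z)"
    using e(2) bspec[OF es e(1)] by simp
  then consider "v \<in> q e ` ({-1..1} \<times> {0})"
    | w z where "w \<in> vertices G" "z \<in> sphere 0 1" "c w z \<in> q e ` ({-1, 1} \<times> {0})" "v \<in> c w ` closed_segment 0 z" by blast
  then show ?thesis
  proof cases
    case 1
    then have "v \<in> q e ` square" by (auto simp: square_def)
    moreover have "v \<in> c v ` cball 0 1" using c0 by (intro image_eqI[of _ _ 0]) auto
    ultimately have "v \<in> q e ` ({-1, 1} \<times> {-1..1})" using meet e(1) v by blast
    then obtain a where a: "a \<in> {-1, 1}" "v \<in> q e ` ({a} \<times> {-1..1})" by blast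
    then obtain w where w: "w \<in> vertices G" "v \<in> c w ` sphere 0 1" using att e(1) by blast
    then obtain z where z: "z \<in> sphere 0 1" "v = c w z" by blast
    have "w = v" using same[OF w(1) sc[OF z(1)], of 0] z(2) c0 by simp
    then have "z = 0" using inj_onD[OF cinj, of z 0] z sc c0 by simp
    then show ?thesis using z(1) by simp
  next
    case 2
    obtain y where y: "y \<in> closed_segment 0 z" "v = c w y" using 2(4) by blast
    have "closed_segment 0 z \<subseteq> cball 0 1" using sc[OF 2(2)] by (intro closed_segment_subset) auto
    then have "w = v" using same[OF 2(1), of y 0] y c0 by auto
    then obtain a where a: "a \<in> {-1, 1}" "c v z = q e (a, 0)" using 2(3) by blast
    obtain w' where w': "w' \<in> vertices G" "q e ` ({a} \<times> {-1..1}) \<subseteq> c w' ` sphere 0 1" using att e(1) a(1) by blast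
    then have "c v z \<in> c w' ` sphere 0 1" using a(2) by auto
    then obtain z' where z': "z' \<in> sphere 0 1" "c w' z' = c v z" by (metis imageE)
    have "w' = v" using same[OF w'(1) sc[OF z'(1)] sc[OF 2(2)] z'(2)] .
    then show ?thesis using e(1) a(1) w'(2) by blast
  qed
qed

text \<open>Both gems are expressed on the flags of \<open>G\<close>: the given one through the
  matching with the canonical subdivision, the new one through the canonical subdivision of
  \<open>G'\<close> and the flag bijection.\<close>

theorem proposition2p3:
  fixes G :: "('a, 'e) embedded_graph" and G' :: "('b, 'e) embedded_graph"
    and M :: "'m coloured_graph" and \<beta> :: "'e \<Rightarrow> 'm set" and D :: "'e set"
  assumes "two_cell_embedding G" and "connected_graph G" and "edges G \<noteq> {}"
    and "is_gem G M \<beta>"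
    and "D \<subseteq> edges G"
    and "is_partial_dual G D G'"
  shows "is_gem G' (swap_red_blue M (\<beta> ` D)) \<beta>"
proof -
  have emb: "graph_embedding G" "graph_embedding G'"
    using assms(1,6) by (simp_all add: two_cell_embedding_def is_partial_dual_def)
  have edges: "edges G' = edges G" using assms(6) by (simp add: is_partial_dual_def)
  obtain c q c' q' h where rib: "ribbon_representation G c q" and rib': "ribbon_representation G' c' q'"
    and hom: "homeomorphic_map (subtopology (surf G) (without_0_bands G c q)) (subtopology (surf G') (without_0_bands G' c' q')) h"
    and bands: "\<forall>e\<in>edges G. h ` q e ` square = q' e ` square"
    and comps: "(\<lambda>C. h ` C) ` boundary_components (surf G) (band_union (vertices G) D c q) = (\<lambda>v. c' v ` sphere 0 1) ` vertices G'"
    using assms(6) unfolding is_partial_dual_def Let_def by (elim conjE exE) (rule that; assumption)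
  interpret dom: ribbon_graph G c q
    by (rule ribbon_graph.intro[OF emb(1) rib ribbon_no_isolated[OF emb(1) assms(2,3) rib]])
  have att': "\<forall>e\<in>edges G'. \<forall>a\<in>{-1, 1}. \<exists>v\<in>vertices G'. q' e ` ({a} \<times> {-1..1}) \<subseteq> c' v ` sphere 0 1"
    and meet': "\<forall>e\<in>edges G'. \<forall>v\<in>vertices G'. q' e ` square \<inter> c' v ` cball 0 1 \<subseteq> q' e ` ({-1, 1} \<times> {-1..1})"
    and dj': "disjoint_family_on (\<lambda>v. c' v ` cball 0 1) (vertices G')"
    using rib' unfolding ribbon_representation_def by - (elim conjE, assumption)+
  \<comment> \<open>The circle of a new vertex is the image of a boundary component of \<Delta>.
    That component touches a band, and its image can meet the new band only in an attaching
    arc.\<close>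
  have no_iso: "\<exists>e\<in>edges G'. \<exists>a\<in>{-1, 1}. q' e ` ({a} \<times> {-1..1}) \<subseteq> c' v ` sphere 0 1" if v: "v \<in> vertices G'" for v
  proof -
    obtain C where C: "C \<in> boundary_components (surf G) (band_union (vertices G) D c q)" "h ` C = c' v ` sphere 0 1"
      using comps v by (metis (no_types, lifting) imageE imageI)
    obtain e y where e: "e \<in> edges G" "y \<in> C" "y \<in> q e ` square"
      using dom.boundary_component_meets_band[OF assms(5) C(1)] by blast
    have hy: "h y \<in> c' v ` sphere 0 1" "h y \<in> q' e ` square" using e C(2) bands by blast+
    have cb: "c' w ` sphere 0 1 \<subseteq> c' w ` cball 0 1" for w by (intro image_mono sphere_cball)
    have e': "e \<in> edges G'" using e(1) edges by simp
    have "h y \<in> q' e ` ({-1, 1} \<times> {-1..1})" using meet' e' v hy cb[of v] by blast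
    then obtain a where a: "a \<in> {-1, 1}" "h y \<in> q' e ` ({a} \<times> {-1..1})" by blast
    obtain w where w: "w \<in> vertices G'" "q' e ` ({a} \<times> {-1..1}) \<subseteq> c' w ` sphere 0 1" using att' e' a(1) by blast
    have "h y \<in> c' w ` cball 0 1 \<inter> c' v ` cball 0 1" using hy(1) a(2) w(2) cb[of v] cb[of w] by blast
    then have "w = v" using dj' w(1) v unfolding disjoint_family_on_def by blast
    then show ?thesis using e' a(1) w(2) by blast
  qed
  interpret P: partial_dual_ribbons G c q G' c' q' h D
  proof unfold_locales
    have "\<Union> (boundary_components (surf G) (band_union (vertices G) D c q)) = dom.outline D"
      unfolding boundary_components_def dom.frontier_band_union[OF assms(5)] Union_connected_components_of
      using dom.outline_subset_topspace[OF assms(5)] by auto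
    moreover have "h ` (\<Union> (boundary_components (surf G) (band_union (vertices G) D c q))) = (\<Union>v\<in>vertices G'. c' v ` sphere 0 1)"
      unfolding image_Union comps ..
    ultimately show "h ` dom.outline D = (\<Union>v\<in>vertices G'. c' v ` sphere 0 1)" by simp
  qed (use emb rib' no_iso edges assms(5) hom bands in auto)
  obtain s p T g where bary: "barycentric_subdivision G s p T" and g: "coloured_iso g (dual_coloured_graph T) M"
    and bigons: "\<forall>e\<in>edges G. bigon M Red Blue (\<beta> e) \<and> \<beta> e = g ` {t \<in> T. t 1 = curve G e (s e)}"
    using assms(4) unfolding is_gem_def by blast
  interpret U: subdivision_pair G s p T dom.split dom.apex "dom.tri ` dom.flags" by (rule dom.canonical_pair[OF bary])
  \<comment> \<open>From flags to the given triangles, by way of the canonical ones.\<close>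
  define F where "F = inv_into T U.match \<circ> dom.tri"
  have tri_bij: "bij_betw dom.tri dom.flags (dom.tri ` dom.flags)" using dom.tri_inj_on by (simp add: bij_betw_def)
  have F_bij: "bij_betw F dom.flags T"
    unfolding F_def by (rule bij_betw_trans[OF tri_bij bij_betw_inv_into[OF U.match_iso(1)]])
  have F: "F \<phi> \<in> T" "U.match (F \<phi>) = dom.tri \<phi>" if "\<phi> \<in> dom.flags" for \<phi>
  proof -
    show "F \<phi> \<in> T" using F_bij that by (auto simp: bij_betw_def)
    have "dom.tri \<phi> \<in> U.match ` T" using U.match_iso(1) that by (simp add: bij_betw_def)
    then show "U.match (F \<phi>) = dom.tri \<phi>" unfolding F_def comp_def by (rule f_inv_into_f)
  qed
  have F_side: "dom.same_side k \<phi> \<psi> \<longleftrightarrow> F \<phi> ` side k = F \<psi> ` side k" if f: "\<phi> \<in> dom.flags" "\<psi> \<in> dom.flags" for k \<phi> \<psi>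
    using U.match_iso(2)[OF F(1)[OF f(1)] F(1)[OF f(2)], of k] F(2)[OF f(1)] F(2)[OF f(2)] dom.side_image_eq_iff[OF f, of k] by simp
  have F_edge: "F \<phi> 1 = curve G e (s e) \<longleftrightarrow> fst \<phi> = e" if f: "\<phi> \<in> dom.flags" "e \<in> edges G" for \<phi> e
    using U.match_iso(3)[OF F(1)[OF f(1)] f(2)] F(2)[OF f(1)] dom.tri_edge_iff[OF f] by simp
  define g0 where "g0 = g \<circ> F"
  have g0: "coloured_iso g0 (rel_graph dom.flags dom.same_side) M"
  proof -
    have "coloured_iso F (rel_graph dom.flags dom.same_side) (dual_coloured_graph T)"
      unfolding dual_coloured_graph_eq by (rule rel_graph_iso[OF F_bij]) (rule F_side)
    then show ?thesis unfolding g0_def using g by (rule coloured_iso_comp)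
  qed
  have \<beta>: "\<beta> e = g0 ` {\<phi> \<in> dom.flags. fst \<phi> = e}" if e: "e \<in> edges G" for e
  proof -
    have "{t \<in> T. t 1 = curve G e (s e)} = F ` {\<phi> \<in> dom.flags. fst \<phi> = e}"
      using F_bij F_edge[OF _ e] by (auto simp: bij_betw_def)
    then show ?thesis using bigons e unfolding g0_def by (simp add: image_comp)
  qed
  have g1: "coloured_iso g0 (rel_graph dom.flags P.swapped) (swap_red_blue M (\<beta> ` D))"
  proof (rule swap_red_blue_iso[OF g0, where l = fst])
    show "\<beta> e = g0 ` {\<phi> \<in> dom.flags. fst \<phi> = e}" if "e \<in> D" for e using \<beta> that assms(5) by blast
    show "fst \<phi> = fst \<psi>" if "k \<noteq> Yellow" "dom.same_side k \<phi> \<psi>" for k and \<phi> \<psi> :: "'e \<times> real \<times> real"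
      using that by (cases k) (auto simp: dom.same_side_def split: prod.splits)
  qed (auto simp: P.swapped_def)
  obtain \<theta> where \<theta>: "bij_betw \<theta> dom.flags P.cod.flags" "\<And>\<phi>. fst (\<theta> \<phi>) = fst \<phi>"
    "\<And>k \<phi> \<psi>. \<phi> \<in> dom.flags \<Longrightarrow> \<psi> \<in> dom.flags \<Longrightarrow> P.cod.same_side k (\<theta> \<phi>) (\<theta> \<psi>) \<longleftrightarrow> P.swapped k \<phi> \<psi>"
    using P.flag_bijection by blast
  define F' where "F' = P.cod.tri \<circ> \<theta>"
  let ?T' = "P.cod.tri ` P.cod.flags"
  have F'_bij: "bij_betw F' dom.flags ?T'"
    unfolding F'_def by (rule bij_betw_trans[OF \<theta>(1)]) (use P.cod.tri_inj_on in \<open>simp add: bij_betw_def\<close>)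
  have \<theta>_flags: "\<theta> \<phi> \<in> P.cod.flags" if "\<phi> \<in> dom.flags" for \<phi> using \<theta>(1) that by (auto simp: bij_betw_def)
  have F'_img: "F' ` dom.flags = ?T'" by (rule bij_betw_imp_surj_on[OF F'_bij])
  \<comment> \<open>The node set of the gem is unchanged; only its identification with triangles now
    goes through the subdivision of \<open>G'\<close>.\<close>
  define g' where "g' = g0 \<circ> inv_into dom.flags F'"
  have inv: "inv_into dom.flags F' (F' \<phi>) = \<phi>" if "\<phi> \<in> dom.flags" for \<phi>
    by (rule inv_into_f_f[OF bij_betw_imp_inj_on[OF F'_bij] that])
  have "coloured_iso (inv_into dom.flags F') (rel_graph ?T' (\<lambda>k t u. t ` side k = u ` side k)) (rel_graph dom.flags P.swapped)"
  proof (rule rel_graph_iso[OF bij_betw_inv_into[OF F'_bij]])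
    fix k t u assume "t \<in> ?T'" "u \<in> ?T'"
    then obtain \<phi> \<psi> where f: "\<phi> \<in> dom.flags" "\<psi> \<in> dom.flags" "t = F' \<phi>" "u = F' \<psi>"
      unfolding F'_img[symmetric] by blast
    have "t ` side k = u ` side k \<longleftrightarrow> P.cod.same_side k (\<theta> \<phi>) (\<theta> \<psi>)"
      using P.cod.side_image_eq_iff[OF \<theta>_flags[OF f(1)] \<theta>_flags[OF f(2)]] f(3,4) unfolding F'_def by simp
    then show "t ` side k = u ` side k \<longleftrightarrow> P.swapped k (inv_into dom.flags F' t) (inv_into dom.flags F' u)"
      using \<theta>(3)[OF f(1,2)] inv f by simp
  qed
  then have g': "coloured_iso g' (dual_coloured_graph ?T') (swap_red_blue M (\<beta> ` D))"
    unfolding g'_def dual_coloured_graph_eq by (rule coloured_iso_comp[OF _ g1])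
  have "bigon (swap_red_blue M (\<beta> ` D)) Red Blue (\<beta> e) \<and> \<beta> e = g' ` {t \<in> ?T'. t 1 = curve G' e (P.cod.split e)}"
    if e: "e \<in> edges G'" for e
  proof
    have eG: "e \<in> edges G" using e edges by simp
    \<comment> \<open>Two orders around the bigon of \<open>e\<close>: starting with a change of
      \<open>b\<close>, which is red for \<open>e \<notin> D\<close>, or with a change of
      \<open>a\<close>, which is red after the swap. The bigon keeps its nodes.\<close>
    have fl: "{\<phi> \<in> dom.flags. fst \<phi> = e} = {(e, 1, 1), (e, 1, -1), (e, -1, -1), (e, -1, 1)}"
      "{\<phi> \<in> dom.flags. fst \<phi> = e} = {(e, 1, 1), (e, -1, 1), (e, -1, -1), (e, 1, -1)}"
      using eG by (auto simp: dom.flags_def)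
    show "bigon (swap_red_blue M (\<beta> ` D)) Red Blue (\<beta> e)"
    proof (cases "e \<in> D")
      case True
      show ?thesis unfolding \<beta>[OF eG] fl(2)
        by (rule coloured_iso_bigon4[OF g1]) (use eG True in \<open>auto simp: dom.flags_def P.swapped_def dom.same_side_def\<close>)
    next
      case False
      show ?thesis unfolding \<beta>[OF eG] fl(1)
        by (rule coloured_iso_bigon4[OF g1]) (use eG False in \<open>auto simp: dom.flags_def P.swapped_def dom.same_side_def\<close>)
    qed
    have "{t \<in> ?T'. t 1 = curve G' e (P.cod.split e)} = F' ` {\<phi> \<in> dom.flags. fst \<phi> = e}"
    proof -
      have "F' \<phi> 1 = curve G' e (P.cod.split e) \<longleftrightarrow> fst \<phi> = e" if "\<phi> \<in> dom.flags" for \<phi>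
        using P.cod.tri_edge_iff[OF \<theta>_flags[OF that] e] \<theta>(2) unfolding F'_def by simp
      then show ?thesis unfolding F'_img[symmetric] by blast
    qed
    moreover have "inv_into dom.flags F' ` F' ` {\<phi> \<in> dom.flags. fst \<phi> = e} = {\<phi> \<in> dom.flags. fst \<phi> = e}"
      by (rule inv_into_image_cancel[OF bij_betw_imp_inj_on[OF F'_bij]]) blast
    ultimately show "\<beta> e = g' ` {t \<in> ?T'. t 1 = curve G' e (P.cod.split e)}"
      unfolding g'_def image_comp[symmetric] by (simp only: \<beta>[OF eG])
  qed
  then show ?thesis unfolding is_gem_def
    by (intro exI[of _ P.cod.split] exI[of _ P.cod.apex] exI[of _ ?T'] exI[of _ g'] conjI ballI P.cod.tri_barycentric g') blast+
qed

end
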